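(* For probabilistic CMIP: (a) the greedy $\Delta$-approximation algorithm can be implemented to run in $O(N\hat\Delta\log\Delta)$ time, where $\hat\Delta$ is the maximum number of constraints in which any variable appears and $N=\sum_{S\in\mathcal C}|\mathrm{vars}(S)|$ is the input size; (b) when all activation probabilities equal $1$, it can be implemented to run in time $O(N\log\Delta)$.
   Context: Monotone covering: minimize a non-decreasing submodular cost over vectors lying in every set of a collection of monotone (closed upwards) subsets of $\mathbb R_+^n$; $\mathrm{vars}(S)$ is the set of coordinates constraint $S$ depends on, $\Delta=\max_S|\mathrm{vars}(S)|$. The greedy algorithm starts at $\mathbf 0$ and repeatedly picks a violated constraint $S$, chooses a step size $\beta$ at most the minimum cost increase needed to bring the current point into $S$, and raises every variable of $S$ simultaneously as far as possible so that raising it alone would increase the cost by at most $\beta$; the result is a $\Delta$-approximation (cost at most $\Delta$ times optimum). A CMIP instance $\min\{c\cdot x:x\ge0,Ax\ge b,x\le u,x_j\in\mathbb Z\ (j\in I)\}$ (non-negative data) gives monotone constraints $S$, one per row $i$: $\sum_{j\in I}A_{ij}\lfloor\min(x_j,u_j)\rfloor+\sum_{j\notin I}A_{ij}\min(x_j,u_j)\ge b_i$. Probabilistic CMIP: given such a CMIP with constraint collection $\mathcal C$, an activation probability $p_S\in[0,1]$ for each $S\in\mathcal C$, and a non-negative linear first-stage objective $W$ with weights $w^S_j$, one chooses for each $S\in\mathcal C$ a vector $x^S\in S$ (forming $X=(x^S)_{S\in\mathcal C}$); each constraint $S$ is then independently active with probability $p_S$, and $\hat x_j=\max\{x^S_j: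 S\text{ active}\}$ (0 if none). The objective is $C(X)=\sum_{S,j}w^S_jx^S_j+\mathbb E[c\cdot\hat x]$, to be minimized subject to $x^S\in S$ for all $S$; this is a monotone covering instance in the variables $X$ with constraint $S$ depending on the variables $x^S_j$, $j\in\mathrm{vars}(S)$. *)

theory Defs
  imports "HOL-Probability.Probability" "HOL-Probability.Product_PMF"
begin

section \<open>Monotone covering and the greedy algorithm\<close>

text \<open>
  \<open>'s\<close> indexes the constraints and \<open>'v\<close> the variables.  Membership of a point in \<open>region M s\<close>
  depends only on the coordinates in \<open>scope M s\<close> (the set vars(S) of the constraint).
\<close>

record ('s, 'v) covering =
  cost :: "('v \<Rightarrow> real) \<Rightarrow> real"
  constrs :: "'s set"
  region :: "'s \<Rightarrow> ('v \<Rightarrow> real) set"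
  scope :: "'s \<Rightarrow> 'v set"

definition feasible_point :: "('s, 'v) covering \<Rightarrow> ('v \<Rightarrow> real) \<Rightarrow> bool" where
  "feasible_point M x \<longleftrightarrow> (\<forall>s\<in>constrs M. x \<in> region M s)"

definition max_scope :: "('s, 'v) covering \<Rightarrow> nat" where
  "max_scope M = Max (insert 0 ((\<lambda>s. card (scope M s)) ` constrs M))"

definition approx_solution :: "('s, 'v) covering \<Rightarrow> real \<Rightarrow> ('v \<Rightarrow> real) \<Rightarrow> bool" where
  "approx_solution M \<rho> x \<longleftrightarrow>
     feasible_point M x \<and> (\<forall>y. feasible_point M y \<longrightarrow> cost M x \<le> \<rho> * cost M y)"

definition min_increase :: "('s, 'v) covering \<Rightarrow> ('v \<Rightarrow> real) \<Rightarrow> 's \<Rightarrow> real" where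
  "min_increase M x s = Inf {cost M y - cost M x | y. x \<le> y \<and> y \<in> region M s}"

definition affordable :: "('s, 'v) covering \<Rightarrow> ('v \<Rightarrow> real) \<Rightarrow> 'v \<Rightarrow> real \<Rightarrow> real set" where
  "affordable M x v \<beta> = {t. x v \<le> t \<and> cost M (x(v := t)) - cost M x \<le> \<beta>}"

text \<open>From value \<open>t\<close> on, raising \<open>v\<close> further is irrelevant to constraint \<open>s\<close>.\<close>

definition saturated :: "('s, 'v) covering \<Rightarrow> 's \<Rightarrow> 'v \<Rightarrow> real \<Rightarrow> bool" where
  "saturated M s v t \<longleftrightarrow>
     (\<forall>t'\<ge>t. \<forall>y. y(v := t') \<in> region M s \<longleftrightarrow> y(v := t) \<in> region M s)"

text \<open>
  \<open>t\<close> is the value of \<open>v\<close> after it has been raised as far as possible at cost at most \<open>\<beta>\<close>.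
  A variable of zero marginal cost can be raised for ever, so that no largest affordable real value
  exists.  Such a variable may get any affordable value beyond which it no longer
  matters to the constraint.
\<close>

definition raised :: "('s, 'v) covering \<Rightarrow> 's \<Rightarrow> ('v \<Rightarrow> real) \<Rightarrow> 'v \<Rightarrow> real \<Rightarrow> real \<Rightarrow> bool" where
  "raised M s x v \<beta> t \<longleftrightarrow>
     t \<in> affordable M x v \<beta> \<and>
     (if bdd_above (affordable M x v \<beta>) then \<forall>t'\<in>affordable M x v \<beta>. t' \<le> t
      else saturated M s v t)"

definition greedy_step :: "('s, 'v) covering \<Rightarrow> ('v \<Rightarrow> real) \<Rightarrow> ('v \<Rightarrow> real) \<Rightarrow> bool" where
  "greedy_step M x x' \<longleftrightarrow>
     (\<exists>s\<in>constrs M. \<exists>\<beta>. x \<notin> region M s \<and> 0 \<le> \<beta> \<and> \<beta> \<le> min_increase M x s \<and>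
        (\<forall>v\<in>scope M s. raised M s x v \<beta> (x' v)) \<and>
        (\<forall>v. v \<notin> scope M s \<longrightarrow> x' v = x v))"

definition greedy_result :: "('s, 'v) covering \<Rightarrow> ('v \<Rightarrow> real) \<Rightarrow> bool" where
  "greedy_result M x \<longleftrightarrow> (greedy_step M)\<^sup>*\<^sup>* (\<lambda>_. 0) x \<and> feasible_point M x"


section \<open>Probabilistic CMIP\<close>

text \<open>
  Constraints (rows) are \<open>0, \<dots>, nrows - 1\<close>, variables (columns) are \<open>0, \<dots>, ncols - 1\<close>.
  \<open>wt P i j\<close> is the first-stage weight of the variable \<open>j\<close> of the vector chosen for row \<open>i\<close>.
\<close>

record pcmip =
  nrows :: nat
  ncols :: nat
  ints :: "nat set"
  mat :: "nat \<Rightarrow> nat \<Rightarrow> real"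
  rhs :: "nat \<Rightarrow> real"
  ub :: "nat \<Rightarrow> real"
  price :: "nat \<Rightarrow> real"
  act_prob :: "nat \<Rightarrow> real"
  wt :: "nat \<Rightarrow> nat \<Rightarrow> real"

definition row_vars :: "pcmip \<Rightarrow> nat \<Rightarrow> nat set" where
  "row_vars P i = {j. j < ncols P \<and> mat P i j \<noteq> 0}"

definition row_constraint :: "pcmip \<Rightarrow> nat \<Rightarrow> (nat \<Rightarrow> real) set" where
  "row_constraint P i =
     {x. (\<forall>j<ncols P. 0 \<le> x j) \<and>
         (\<Sum>j\<in>{..<ncols P} \<inter> ints P. mat P i j * of_int \<lfloor>min (x j) (ub P j)\<rfloor>) +
         (\<Sum>j\<in>{..<ncols P} - ints P. mat P i j * min (x j) (ub P j)) \<ge> rhs P i}"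

definition pcmip_instance :: "pcmip \<Rightarrow> bool" where
  "pcmip_instance P \<longleftrightarrow>
     (\<forall>i<nrows P. 0 \<le> rhs P i \<and> act_prob P i \<in> {0..1}) \<and>
     (\<forall>j<ncols P. 0 \<le> ub P j \<and> 0 \<le> price P j) \<and>
     (\<forall>i<nrows P. \<forall>j<ncols P. 0 \<le> mat P i j \<and> 0 \<le> wt P i j) \<and>
     (\<forall>i<nrows P. row_constraint P i \<noteq> {})"

text \<open>
  A point is a function \<open>X\<close> on pairs: \<open>X (i, j)\<close> is the \<open>j\<close>-th coordinate of the vector chosen for
  row \<open>i\<close>.
\<close>

definition xhat :: "pcmip \<Rightarrow> (nat \<times> nat \<Rightarrow> real) \<Rightarrow> (nat \<Rightarrow> bool) \<Rightarrow> nat \<Rightarrow> real" where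
  "xhat P X active j = Max (insert 0 ((\<lambda>i. X (i, j)) ` {i. i < nrows P \<and> active i}))"

definition activation :: "pcmip \<Rightarrow> (nat \<Rightarrow> bool) pmf" where
  "activation P = Pi_pmf {..<nrows P} False (\<lambda>i. bernoulli_pmf (act_prob P i))"

definition pcmip_cost :: "pcmip \<Rightarrow> (nat \<times> nat \<Rightarrow> real) \<Rightarrow> real" where
  "pcmip_cost P X =
     (\<Sum>i<nrows P. \<Sum>j<ncols P. wt P i j * X (i, j)) +
     measure_pmf.expectation (activation P)
       (\<lambda>active. \<Sum>j<ncols P. price P j * xhat P X active j)"

definition pcmip_covering :: "pcmip \<Rightarrow> (nat, nat \<times> nat) covering" where
  "pcmip_covering P =
     \<lparr>cost = pcmip_cost P,
      constrs = {..<nrows P},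
      region = (\<lambda>i. {X. (\<lambda>j. X (i, j)) \<in> row_constraint P i}),
      scope = (\<lambda>i. {i} \<times> row_vars P i)\<rparr>"

definition Delta :: "pcmip \<Rightarrow> nat" where
  "Delta P = max_scope (pcmip_covering P)"

definition Delta_hat :: "pcmip \<Rightarrow> nat" where
  "Delta_hat P = Max (insert 0 ((\<lambda>j. card {i. i < nrows P \<and> j \<in> row_vars P i}) ` {..<ncols P}))"

definition input_size :: "pcmip \<Rightarrow> nat" where
  "input_size P = (\<Sum>i<nrows P. card (row_vars P i))"

text \<open>The factor \<open>log \<Delta>\<close> of a running time bound is read as 1 when it is smaller (\<open>\<Delta> = 1\<close>).\<close>

definition log_Delta :: "pcmip \<Rightarrow> real" where
  "log_Delta P = max 1 (log 2 (real (Delta P)))"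


section \<open>A unit-cost real random access machine\<close>

text \<open>
  The memory consists of arrays of natural numbers (indices) and arrays of real numbers.  A program
  names only finitely many of them, so they can be interleaved in a single memory.
  Program constants are natural and rational numbers, and reals cannot be
  converted to naturals.  Scalars are kept at index 0 of an array.
\<close>

record memory =
  nmem :: "string \<Rightarrow> nat \<Rightarrow> nat"
  rmem :: "string \<Rightarrow> nat \<Rightarrow> real"

datatype nexp =
    NConst nat
  | NGet string nexp
  | NAdd nexp nexp
  | NSub nexp nexp
  | NHalf nexp

datatype rexp =
    RConst rat
  | RGet string nexp
  | RAdd rexp rexp
  | RSub rexp rexp
  | RMul rexp rexp
  | RDiv rexp rexp
  | RFloor rexp

datatype bexp =
    NLess nexp nexp
  | RLess rexp rexp
  | BNot bexp
  | BAnd bexp bexp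

datatype com =
    Skip
  | NPut string nexp nexp
  | RPut string nexp rexp
  | Seq com com
  | Cond bexp com com
  | While bexp com

primrec nval :: "nexp \<Rightarrow> memory \<Rightarrow> nat" where
  "nval (NConst k) \<sigma> = k"
| "nval (NGet a e) \<sigma> = nmem \<sigma> a (nval e \<sigma>)"
| "nval (NAdd e f) \<sigma> = nval e \<sigma> + nval f \<sigma>"
| "nval (NSub e f) \<sigma> = nval e \<sigma> - nval f \<sigma>"
| "nval (NHalf e) \<sigma> = nval e \<sigma> div 2"

primrec rval :: "rexp \<Rightarrow> memory \<Rightarrow> real" where
  "rval (RConst q) \<sigma> = of_rat q"
| "rval (RGet a e) \<sigma> = rmem \<sigma> a (nval e \<sigma>)"
| "rval (RAdd e f) \<sigma> = rval e \<sigma> + rval f \<sigma>"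
| "rval (RSub e f) \<sigma> = rval e \<sigma> - rval f \<sigma>"
| "rval (RMul e f) \<sigma> = rval e \<sigma> * rval f \<sigma>"
| "rval (RDiv e f) \<sigma> = rval e \<sigma> / rval f \<sigma>"
| "rval (RFloor e) \<sigma> = of_int \<lfloor>rval e \<sigma>\<rfloor>"

primrec bval :: "bexp \<Rightarrow> memory \<Rightarrow> bool" where
  "bval (NLess e f) \<sigma> \<longleftrightarrow> nval e \<sigma> < nval f \<sigma>"
| "bval (RLess e f) \<sigma> \<longleftrightarrow> rval e \<sigma> < rval f \<sigma>"
| "bval (BNot b) \<sigma> \<longleftrightarrow> \<not> bval b \<sigma>"
| "bval (BAnd b d) \<sigma> \<longleftrightarrow> bval b \<sigma> \<and> bval d \<sigma>"

definition nput :: "string \<Rightarrow> nat \<Rightarrow> nat \<Rightarrow> memory \<Rightarrow> memory" where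
  "nput a k v \<sigma> = \<sigma>\<lparr>nmem := (nmem \<sigma>)(a := (nmem \<sigma> a)(k := v))\<rparr>"

definition rput :: "string \<Rightarrow> nat \<Rightarrow> real \<Rightarrow> memory \<Rightarrow> memory" where
  "rput a k v \<sigma> = \<sigma>\<lparr>rmem := (rmem \<sigma>)(a := (rmem \<sigma> a)(k := v))\<rparr>"

text \<open>
  \<open>exec c \<sigma> t \<tau>\<close>: started in \<open>\<sigma>\<close>, the program \<open>c\<close> halts in \<open>\<tau>\<close> after time \<open>t\<close>.  Each assignment
  and each test counts 1.  The expressions occurring in a program have constant size, so counting
  the single operations would change running times by a constant factor only.
\<close>

inductive exec :: "com \<Rightarrow> memory \<Rightarrow> nat \<Rightarrow> memory \<Rightarrow> bool" where
  Skip: "exec Skip \<sigma> 1 \<sigma>"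
| NPut: "exec (NPut a e f) \<sigma> 1 (nput a (nval e \<sigma>) (nval f \<sigma>) \<sigma>)"
| RPut: "exec (RPut a e f) \<sigma> 1 (rput a (nval e \<sigma>) (rval f \<sigma>) \<sigma>)"
| Seq: "exec c \<sigma> t \<sigma>' \<Longrightarrow> exec d \<sigma>' t' \<tau> \<Longrightarrow> exec (Seq c d) \<sigma> (t + t') \<tau>"
| CondTrue: "bval b \<sigma> \<Longrightarrow> exec c \<sigma> t \<tau> \<Longrightarrow> exec (Cond b c d) \<sigma> (1 + t) \<tau>"
| CondFalse: "\<not> bval b \<sigma> \<Longrightarrow> exec d \<sigma> t \<tau> \<Longrightarrow> exec (Cond b c d) \<sigma> (1 + t) \<tau>"
| WhileFalse: "\<not> bval b \<sigma> \<Longrightarrow> exec (While b c) \<sigma> 1 \<sigma>"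
| WhileTrue: "bval b \<sigma> \<Longrightarrow> exec c \<sigma> t \<sigma>' \<Longrightarrow> exec (While b c) \<sigma>' t' \<tau> \<Longrightarrow>
    exec (While b c) \<sigma> (1 + t + t') \<tau>"


section \<open>Input, output and running time\<close>

text \<open>
  The matrix is given in sparse form, as a list \<open>es\<close> of the positions of its nonzero entries,
  row by row and in any order within a row.
\<close>

definition sparse_form :: "pcmip \<Rightarrow> (nat \<times> nat) list \<Rightarrow> bool" where
  "sparse_form P es \<longleftrightarrow>
     distinct es \<and> sorted (map fst es) \<and> set es = (SIGMA i:{..<nrows P}. row_vars P i)"

definition entries :: "nat \<Rightarrow> (nat \<Rightarrow> 'a::zero) \<Rightarrow> nat \<Rightarrow> 'a" where
  "entries n f k = (if k < n then f k else 0)"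

definition input_memory :: "pcmip \<Rightarrow> (nat \<times> nat) list \<Rightarrow> memory" where
  "input_memory P es =
     \<lparr>nmem = (\<lambda>_ _. 0)
        (''nrows'' := entries 1 (\<lambda>_. nrows P),
         ''ncols'' := entries 1 (\<lambda>_. ncols P),
         ''len'' := entries 1 (\<lambda>_. length es),
         ''row'' := entries (length es) (\<lambda>k. fst (es ! k)),
         ''col'' := entries (length es) (\<lambda>k. snd (es ! k)),
         ''int'' := entries (ncols P) (\<lambda>j. if j \<in> ints P then 1 else 0)),
      rmem = (\<lambda>_ _. 0)
        (''mat'' := entries (length es) (\<lambda>k. mat P (fst (es ! k)) (snd (es ! k))),
         ''wt'' := entries (length es) (\<lambda>k. wt P (fst (es ! k)) (snd (es ! k))),
         ''rhs'' := entries (nrows P) (rhs P),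
         ''prob'' := entries (nrows P) (act_prob P),
         ''price'' := entries (ncols P) (price P),
         ''ub'' := entries (ncols P) (ub P))\<rparr>"

text \<open>
  On every presentation of \<open>P\<close>, the program halts within time \<open>T\<close> and leaves in the real array
  \<open>''x''\<close> the values \<open>X (i, j)\<close>, \<open>j \<in> row_vars P i\<close>, of a point \<open>X\<close> that the greedy algorithm
  can return (it is 0 elsewhere).
\<close>

definition runs_greedy :: "com \<Rightarrow> pcmip \<Rightarrow> real \<Rightarrow> bool" where
  "runs_greedy prog P T \<longleftrightarrow>
     (\<forall>es. sparse_form P es \<longrightarrow>
        (\<exists>t \<tau> X. exec prog (input_memory P es) t \<tau> \<and> real t \<le> T \<and>
           greedy_result (pcmip_covering P) X \<and>
           approx_solution (pcmip_covering P) (real (Delta P)) X \<and>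
           (\<forall>k<length es. rmem \<tau> ''x'' k = X (es ! k))))"

end

theory Submission
  imports Defs
begin

text \<open>
  Rows are processed in the order of the input, each in a single greedy step.  Let \<open>cst j t\<close> be the
  cost of raising the variable \<open>(i, j)\<close> of the current row \<open>i\<close> from 0 to \<open>t\<close>.  The costs of the
  variables of one row add up, and \<open>cst j\<close> is convex and piecewise linear, since it is
  \<open>w t + c p E[(t - M)\<^sup>+]\<close> for the maximum \<open>M\<close> of the active values already chosen in column \<open>j\<close>.  Its
  breakpoints are these values, at most \<open>D\<close> of them, where \<open>D\<close> is the maximum column size.
  If some rows are active with probability 1, all values below the largest one of those rows
  can be discarded, so that \<open>D = 1\<close> suffices when all probabilities are 1.

  The step size \<open>B\<close> must be large enough to satisfy the row if all its variables are raised at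
  cost \<open>B\<close>, and at most the cost of every solution of the row.  If raising at cost \<open>V\<close> does not satisfy
  the row, then a solution either costs \<open>2 V\<close>, or raises a single variable above cost \<open>V\<close>, and this
  variable alone has to cover what is missing at \<open>V\<close>.  So \<open>B\<close> is known as soon as some insufficient \<open>V\<close>
  with sufficient \<open>2 V\<close> is.  To find \<open>V\<close>, sort the costs of all breakpoints, of the first integers
  above them, and of the upper bounds, and find by binary search two consecutive ones between
  which sufficiency begins.  At the smaller one, the least cost of a single variable covering what
  is missing (or the larger one, if smaller) exceeds the least sufficient cost by a factor of at
  most \<open>m\<close>, the number of variables of the row.  Halving it at most \<open>log m\<close> times gives \<open>2 V\<close>.

  For the time bound, the keys of one entry are sorted from the start, so that merging
  takes \<open>log m\<close> rounds of time \<open>m D\<close>, and an evaluation of the row takes time \<open>m log D\<close> by binary search in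
  the breakpoints.  As \<open>(log D)\<^sup>2 = O(D)\<close>, a row takes time \<open>O(m D log m)\<close>.

  The approximation factor follows from submodularity: if \<open>y\<close> is feasible and \<open>X \<squnion> y\<close> is the pointwise
  maximum, then no step increases \<open>cost X + \<Delta> (cost (X \<squnion> y) - cost X)\<close>.
\<close>

subsection \<open>Expected cost\<close>

text \<open>The least sufficient level would itself be a legal step size, since a solution of cost C
  raises no variable above level C. The obstacle is to compute it in time independent of the
  magnitude of the data: between two consecutive keys the amount covered contains floors of affine
  functions of the level, so the threshold is not the root of one linear equation. Hence halving
  only fixes the level up to a factor of 2, and the exact comparison is left to the single variable
  that exceeds V. The first integers above the breakpoints become keys for the sake of rounding. If
  a variable gains units between two keys, such an integer does not exceed its current value, so all
  units gained lie on one linear piece of its cost and cost at most the level reached. This is what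
  makes the factor m hold for integer variables too.\<close>

abbreviation expect :: "pcmip \<Rightarrow> ((nat \<Rightarrow> bool) \<Rightarrow> real) \<Rightarrow> real" where
  "expect P g \<equiv> measure_pmf.expectation (activation P) g"

lemma finite_set_activation: "finite (set_pmf (activation P))"
proof (rule finite_subset)
  show "set_pmf (activation P) \<subseteq> PiE_dflt {..<nrows P} False (\<lambda>_. UNIV)"
    unfolding activation_def by (rule order_trans[OF set_Pi_pmf_subset']) (auto simp: PiE_dflt_def)
  show "finite (PiE_dflt {..<nrows P} False (\<lambda>_. UNIV :: bool set))"
    by (rule finite_PiE_dflt) auto
qed

text \<open>Only finitely many activation patterns have positive probability, so integrability is
  never an issue below.\<close>

lemma integrable_activation [simp]: "integrable (measure_pmf (activation P)) (g :: _ \<Rightarrow> real)"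
  by (rule integrable_measure_pmf_finite[OF finite_set_activation])

lemma expect_mono: "(\<And>a. g a \<le> h a) \<Longrightarrow> expect P g \<le> expect P h"
  by (rule integral_mono) auto

lemma expect_sum: "expect P (\<lambda>a. \<Sum>j\<in>J. c j * g j a) = (\<Sum>j\<in>J. c j * expect P (g j))"
  by simp

text \<open>Conditioning on row \<open>i\<close>: the product distribution is a Bernoulli choice for
  \<open>i\<close> and an independent choice for the other rows, and neither \<open>g\<close> nor
  \<open>h\<close> reads coordinate \<open>i\<close>.\<close>

lemma expect_split:
  assumes i: "i < nrows P" and p: "act_prob P i \<in> {0..1}"
    and g: "\<And>a v. g (a(i := v)) = g a" and h: "\<And>a v. h (a(i := v)) = h a"
  shows "expect P (\<lambda>a. if a i then g a else h a) =
    act_prob P i * expect P g + (1 - act_prob P i) * expect P h"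
proof -
  define R where "R = Pi_pmf ({..<nrows P} - {i}) False (\<lambda>i. bernoulli_pmf (act_prob P i))"
  have fR: "finite (set_pmf R)"
  proof (rule finite_subset)
    show "set_pmf R \<subseteq> PiE_dflt ({..<nrows P} - {i}) False (\<lambda>_. UNIV)"
      unfolding R_def by (rule order_trans[OF set_Pi_pmf_subset']) (auto simp: PiE_dflt_def)
    show "finite (PiE_dflt ({..<nrows P} - {i}) False (\<lambda>_. UNIV :: bool set))"
      by (rule finite_PiE_dflt) auto
  qed
  have ins: "insert i ({..<nrows P} - {i}) = {..<nrows P}" using i by auto
  have act: "activation P = bernoulli_pmf (act_prob P i) \<bind> (\<lambda>y. map_pmf (\<lambda>f. f(i := y)) R)"
    using Pi_pmf_insert'[of "{..<nrows P} - {i}" i False "\<lambda>i. bernoulli_pmf (act_prob P i)"]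
    unfolding ins by (simp add: activation_def R_def map_pmf_def)
  have E: "expect P k = act_prob P i * measure_pmf.expectation R (\<lambda>f. k (f(i := True)))
     + (1 - act_prob P i) * measure_pmf.expectation R (\<lambda>f. k (f(i := False)))"
    for k :: "(nat \<Rightarrow> bool) \<Rightarrow> real"
    unfolding act
    by (subst pmf_expectation_bind[of UNIV]) (use p in \<open>auto simp: fR UNIV_bool\<close>)
  show ?thesis by (subst (1 2 3) E) (simp add: g h algebra_simps)
qed

lemma xhat_nonneg: "0 \<le> xhat P X a j"
  unfolding xhat_def by (rule Max_ge) auto

lemma xhat_ge: "i < nrows P \<Longrightarrow> a i \<Longrightarrow> X (i, j) \<le> xhat P X a j"
  unfolding xhat_def by (rule Max_ge) auto

lemma xhat_le_iff: "xhat P X a j \<le> t \<longleftrightarrow> 0 \<le> t \<and> (\<forall>i<nrows P. a i \<longrightarrow> X (i, j) \<le> t)"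
  unfolding xhat_def by (subst Max_le_iff) auto

lemma xhat_mono: "(\<And>i. i < nrows P \<Longrightarrow> X (i, j) \<le> Y (i, j)) \<Longrightarrow> xhat P X a j \<le> xhat P Y a j"
  unfolding xhat_le_iff by (auto simp: xhat_nonneg intro: order_trans[OF _ xhat_ge])

text \<open>The pointwise maximum leads to at most the larger of the two values of
  \<open>xhat\<close>, and the pointwise minimum to at most the smaller; these bounds add up to the
  right-hand side.\<close>

lemma xhat_submodular:
  "xhat P (\<lambda>v. max (X v) (Y v)) a j + xhat P (\<lambda>v. min (X v) (Y v)) a j
    \<le> xhat P X a j + xhat P Y a j"
proof -
  have "xhat P (\<lambda>v. max (X v) (Y v)) a j \<le> max (xhat P X a j) (xhat P Y a j)"
    unfolding xhat_le_iff using xhat_ge[of _ P a X j] xhat_ge[of _ P a Y j]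
    by (auto simp: xhat_nonneg le_max_iff_disj intro: order_trans) (meson linear order_trans)
  moreover have "xhat P (\<lambda>v. min (X v) (Y v)) a j \<le> xhat P X a j"
    "xhat P (\<lambda>v. min (X v) (Y v)) a j \<le> xhat P Y a j"
    by (auto intro: xhat_mono)
  ultimately show ?thesis by linarith
qed

lemma pcmip_cost_alt: "pcmip_cost P X = (\<Sum>i<nrows P. \<Sum>j<ncols P. wt P i j * X (i, j)) +
  (\<Sum>j<ncols P. price P j * expect P (\<lambda>a. xhat P X a j))"
  unfolding pcmip_cost_def by (simp add: expect_sum)

lemma pcmip_instanceD:
  assumes "pcmip_instance P"
  shows "i < nrows P \<Longrightarrow> 0 \<le> rhs P i" "i < nrows P \<Longrightarrow> act_prob P i \<in> {0..1}"
    "j < ncols P \<Longrightarrow> 0 \<le> ub P j" "j < ncols P \<Longrightarrow> 0 \<le> price P j"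
    "i < nrows P \<Longrightarrow> j < ncols P \<Longrightarrow> 0 \<le> mat P i j" "i < nrows P \<Longrightarrow> j < ncols P \<Longrightarrow> 0 \<le> wt P i j"
    "i < nrows P \<Longrightarrow> row_constraint P i \<noteq> {}"
  using assms unfolding pcmip_instance_def by auto

lemma pcmip_cost_mono:
  assumes "pcmip_instance P" and "\<And>i j. i < nrows P \<Longrightarrow> j < ncols P \<Longrightarrow> X (i, j) \<le> Y (i, j)"
  shows "pcmip_cost P X \<le> pcmip_cost P Y"
  unfolding pcmip_cost_alt
  using assms(2) pcmip_instanceD[OF assms(1)]
  by (intro add_mono sum_mono mult_left_mono expect_mono xhat_mono) auto

lemma pcmip_cost_submodular:
  assumes "pcmip_instance P"
  shows "pcmip_cost P (\<lambda>v. max (X v) (Y v)) + pcmip_cost P (\<lambda>v. min (X v) (Y v))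
    \<le> pcmip_cost P X + pcmip_cost P Y"
proof -
  have lin: "w * max a b + w * min a b = w * a + w * b" for w a b :: real
    by (simp add: max_def min_def)
  have "expect P (\<lambda>a. xhat P (\<lambda>v. max (X v) (Y v)) a j) + expect P (\<lambda>a. xhat P (\<lambda>v. min (X v) (Y v)) a j)
    \<le> expect P (\<lambda>a. xhat P X a j) + expect P (\<lambda>a. xhat P Y a j)" for j
    using expect_mono[where P = P, OF xhat_submodular[of P X Y _ j]] by simp
  then have "(\<Sum>j<ncols P. price P j * (expect P (\<lambda>a. xhat P (\<lambda>v. max (X v) (Y v)) a j) + expect P (\<lambda>a. xhat P (\<lambda>v. min (X v) (Y v)) a j)))
    \<le> (\<Sum>j<ncols P. price P j * (expect P (\<lambda>a. xhat P X a j) + expect P (\<lambda>a. xhat P Y a j)))"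
    using pcmip_instanceD(4)[OF assms] by (intro sum_mono mult_left_mono) auto
  moreover have "(\<Sum>i<nrows P. \<Sum>j<ncols P. wt P i j * max (X (i, j)) (Y (i, j))) +
     (\<Sum>i<nrows P. \<Sum>j<ncols P. wt P i j * min (X (i, j)) (Y (i, j))) =
     (\<Sum>i<nrows P. \<Sum>j<ncols P. wt P i j * X (i, j)) + (\<Sum>i<nrows P. \<Sum>j<ncols P. wt P i j * Y (i, j))"
    by (simp add: sum.distrib[symmetric] lin)
  ultimately show ?thesis
    unfolding pcmip_cost_alt by (simp add: distrib_left sum.distrib)
qed

text \<open>A Lipschitz estimate in one coordinate, which does the work of continuity in
  \<open>affordable_max_cost\<close>. Raising one value by \<open>e\<close> raises every
  \<open>xhat\<close> by at most \<open>e\<close>.\<close>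

lemma pcmip_cost_increase:
  assumes P: "pcmip_instance P" and e: "0 \<le> e"
  shows "pcmip_cost P (X(v := X v + e)) \<le> pcmip_cost P X +
    ((\<Sum>i<nrows P. \<Sum>j<ncols P. wt P i j) + (\<Sum>j<ncols P. price P j)) * e"
proof -
  have le: "(X(v := X v + e)) (i, j) \<le> X (i, j) + e" for i j using e by auto
  have "xhat P (X(v := X v + e)) a j \<le> xhat P X a j + e" for a j
    unfolding xhat_le_iff using e xhat_nonneg[of P X a j] xhat_ge[of _ P a X j]
    by (auto intro: order_trans[OF le]) (metis add.right_neutral add_mono)
  then have "expect P (\<lambda>a. xhat P (X(v := X v + e)) a j) \<le> expect P (\<lambda>a. xhat P X a j + e)" for j
    by (rule expect_mono)
  then have E: "expect P (\<lambda>a. xhat P (X(v := X v + e)) a j) \<le> expect P (\<lambda>a. xhat P X a j) + e" for j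
    by simp
  have "pcmip_cost P (X(v := X v + e)) \<le> (\<Sum>i<nrows P. \<Sum>j<ncols P. wt P i j * (X (i, j) + e)) +
    (\<Sum>j<ncols P. price P j * (expect P (\<lambda>a. xhat P X a j) + e))"
    unfolding pcmip_cost_alt using pcmip_instanceD[OF P]
    by (intro add_mono sum_mono mult_left_mono le E) auto
  also have "\<dots> = pcmip_cost P X +
    ((\<Sum>i<nrows P. \<Sum>j<ncols P. wt P i j) + (\<Sum>j<ncols P. price P j)) * e"
    unfolding pcmip_cost_alt by (simp add: algebra_simps sum.distrib sum_distrib_right sum_distrib_left)
  finally show ?thesis .
qed

text \<open>If the largest affordable value cost less than \<beta>, the Lipschitz estimate would
  leave room to go a little further.\<close>

lemma affordable_max_cost:
  assumes P: "pcmip_instance P"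
    and max: "\<forall>t'\<in>affordable (pcmip_covering P) X v \<beta>. t' \<le> t" and t: "X v \<le> t"
  shows "\<beta> \<le> pcmip_cost P (X(v := t)) - pcmip_cost P X"
proof (rule ccontr)
  define C where "C = (\<Sum>i<nrows P. \<Sum>j<ncols P. wt P i j) + (\<Sum>j<ncols P. price P j)"
  define d where "d = \<beta> - (pcmip_cost P (X(v := t)) - pcmip_cost P X)"
  assume "\<not> ?thesis"
  then have d: "d > 0" by (simp add: d_def)
  have C: "0 \<le> C" unfolding C_def using pcmip_instanceD[OF P] by (intro add_nonneg_nonneg sum_nonneg) auto
  \<comment> \<open>The added 1 keeps the denominator positive when all weights and prices
    vanish.\<close>
  define e where "e = d / (C + 1)"
  have e: "e > 0" using d C by (simp add: e_def)
  have "C * e \<le> d" using d C by (simp add: e_def field_simps)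
  moreover have "pcmip_cost P (X(v := t + e)) \<le> pcmip_cost P (X(v := t)) + C * e"
    using pcmip_cost_increase[OF P, of e "X(v := t)" v] e by (simp add: C_def)
  ultimately have "t + e \<in> affordable (pcmip_covering P) X v \<beta>"
    unfolding affordable_def using t e by (simp add: pcmip_covering_def d_def)
  then show False using max e by fastforce
qed

subsection \<open>The greedy algorithm is a \<open>\<Delta>\<close>-approximation\<close>

text \<open>One formula for integer and continuous variables, so that the two sums of a row become a
  single sum over \<open>row_vars\<close>.\<close>

definition contrib :: "pcmip \<Rightarrow> nat \<Rightarrow> nat \<Rightarrow> real \<Rightarrow> real" where
  "contrib P i j t = mat P i j *
    (if j \<in> ints P then of_int \<lfloor>min t (ub P j)\<rfloor> else min t (ub P j))"

lemma row_constraint_alt: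
  "row_constraint P i = {x. (\<forall>j<ncols P. 0 \<le> x j) \<and> rhs P i \<le> (\<Sum>j\<in>row_vars P i. contrib P i j (x j))}"
proof -
  have "(\<Sum>j\<in>{..<ncols P} \<inter> ints P. mat P i j * of_int \<lfloor>min (x j) (ub P j)\<rfloor>) +
         (\<Sum>j\<in>{..<ncols P} - ints P. mat P i j * min (x j) (ub P j)) = (\<Sum>j\<in>row_vars P i. contrib P i j (x j))"
    for x :: "nat \<Rightarrow> real"
  proof -
    have "(\<Sum>j\<in>row_vars P i. contrib P i j (x j)) = (\<Sum>j<ncols P. contrib P i j (x j))"
      by (rule sum.mono_neutral_left) (auto simp: row_vars_def contrib_def)
    also have "\<dots> = (\<Sum>j\<in>{..<ncols P} \<inter> ints P. contrib P i j (x j)) + (\<Sum>j\<in>{..<ncols P} - ints P. contrib P i j (x j))"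
      by (subst sum.union_disjoint[symmetric]) (auto intro!: sum.cong)
    finally show ?thesis by (simp add: contrib_def)
  qed
  then show ?thesis unfolding row_constraint_def by simp
qed

lemma finite_row_vars [simp]: "finite (row_vars P i)"
  by (simp add: row_vars_def)

lemma contrib_mono: "0 \<le> mat P i j \<Longrightarrow> s \<le> t \<Longrightarrow> contrib P i j s \<le> contrib P i j t"
  unfolding contrib_def by (auto intro!: mult_left_mono floor_mono min.mono)

lemma contrib_above: "ub P j \<le> s \<Longrightarrow> ub P j \<le> t \<Longrightarrow> contrib P i j s = contrib P i j t"
  unfolding contrib_def by (simp add: min_def)

lemma row_constraint_mono:
  assumes P: "pcmip_instance P" and i: "i < nrows P" and x: "x \<in> row_constraint P i"
    and le: "\<And>j. j < ncols P \<Longrightarrow> x j \<le> y j"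
  shows "y \<in> row_constraint P i"
proof -
  have "(\<Sum>j\<in>row_vars P i. contrib P i j (x j)) \<le> (\<Sum>j\<in>row_vars P i. contrib P i j (y j))"
    using pcmip_instanceD[OF P] i le by (intro sum_mono contrib_mono) (auto simp: row_vars_def)
  then show ?thesis using x le unfolding row_constraint_alt by (force intro: order_trans)
qed

text \<open>\<open>saturated\<close> speaks of one variable. Lowering the coordinates in
  \<open>F\<close> to their saturation values one after another never leaves the region.\<close>

lemma saturated_upd_set:
  assumes "finite F" and "\<And>v. v \<in> F \<Longrightarrow> saturated M s v (t v) \<and> t v \<le> Z v" and "Z \<in> region M s"
  shows "(\<lambda>v. if v \<in> F then t v else Z v) \<in> region M s"
  using assms
proof (induction F rule: finite_induct)
  case (insert v F)
  define Y where "Y = (\<lambda>v. if v \<in> F then t v else Z v)"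
  have "Y \<in> region M s" using insert by (simp add: Y_def)
  moreover have "Y(v := Z v) = Y" using insert(2) by (auto simp: Y_def)
  ultimately have "Y(v := t v) \<in> region M s"
    using insert(4)[of v] unfolding saturated_def by (metis insertI1)
  moreover have "Y(v := t v) = (\<lambda>w. if w \<in> insert v F then t w else Z w)"
    using insert(2) by (auto simp: Y_def)
  ultimately show ?case by simp
qed simp

text \<open>The first cost bound is subadditivity of the single raises, the second says that the gap
  to any feasible \<open>y\<close> shrinks by \<beta>. For the second, \<open>W\<close> lies between
  \<open>X\<close> and the join \<open>J\<close> of \<open>X\<close> and \<open>y\<close>;
  submodularity for \<open>X'\<close> and \<open>J\<close> leaves only the claim that passing from
  \<open>X\<close> to \<open>W\<close> costs at least \<beta>.\<close>

lemma greedy_step_potential: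
  assumes P: "pcmip_instance P" and step: "greedy_step (pcmip_covering P) X X'"
    and X: "\<And>v. 0 \<le> X v" and y: "feasible_point (pcmip_covering P) y"
  obtains \<beta> where "0 \<le> \<beta>" "\<And>v. X v \<le> X' v"
    "pcmip_cost P X' - pcmip_cost P X \<le> real (Delta P) * \<beta>"
    "pcmip_cost P (\<lambda>v. max (X' v) (y v)) - pcmip_cost P X' \<le>
       pcmip_cost P (\<lambda>v. max (X v) (y v)) - pcmip_cost P X - \<beta>"
proof -
  let ?M = "pcmip_covering P" and ?c = "pcmip_cost P"
  have M: "cost ?M = ?c" "constrs ?M = {..<nrows P}"
    "region ?M = (\<lambda>i. {X. (\<lambda>j. X (i, j)) \<in> row_constraint P i})"
    "scope ?M = (\<lambda>i. {i} \<times> row_vars P i)"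
    by (simp_all add: pcmip_covering_def)
  obtain s \<beta> where s: "s < nrows P" "X \<notin> region ?M s" and \<beta>: "0 \<le> \<beta>" "\<beta> \<le> min_increase ?M X s"
    and r: "\<And>v. v \<in> scope ?M s \<Longrightarrow> raised ?M s X v \<beta> (X' v)"
    and off: "\<And>v. v \<notin> scope ?M s \<Longrightarrow> X' v = X v"
    using step unfolding greedy_step_def M by blast
  have ge: "X v \<le> X' v" for v
    using r[of v] off[of v] by (cases "v \<in> scope ?M s") (auto simp: raised_def affordable_def)
  have "?c X' - ?c X \<le> real (card (scope ?M s)) * \<beta>"
  proof -
    \<comment> \<open>The point raised on \<open>F\<close> and the raise of one further variable
      have the meet \<open>X\<close>, so submodularity bounds the increase of their join by the sum
      of the two increases.\<close>
    have "?c (\<lambda>v. if v \<in> F then X' v else X v) - ?c X \<le> real (card F) * \<beta>"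
      if "finite F" "F \<subseteq> scope ?M s" for F
      using that
    proof (induction F rule: finite_induct)
      case empty
      then show ?case by simp
    next
      case (insert v F)
      let ?Z = "\<lambda>v. if v \<in> F then X' v else X v"
      have "?c (\<lambda>w. max (?Z w) ((X(v := X' v)) w)) + ?c (\<lambda>w. min (?Z w) ((X(v := X' v)) w))
         \<le> ?c ?Z + ?c (X(v := X' v))"
        by (rule pcmip_cost_submodular[OF P])
      moreover have "(\<lambda>w. max (?Z w) ((X(v := X' v)) w)) = (\<lambda>w. if w \<in> insert v F then X' w else X w)"
        using ge by (intro ext) (auto simp: max_def intro: antisym)
      moreover have "(\<lambda>w. min (?Z w) ((X(v := X' v)) w)) = X"
      proof
        show "min (?Z w) ((X(v := X' v)) w) = X w" for w
          using ge[of w] insert(2) by (auto simp: min_def)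
      qed
      moreover have "?c (X(v := X' v)) - ?c X \<le> \<beta>"
        using r[of v] insert(4) by (auto simp: raised_def affordable_def M)
      ultimately show ?case using insert by (simp add: algebra_simps)
    qed
    from this[of "scope ?M s"] have "?c (\<lambda>v. if v \<in> scope ?M s then X' v else X v) - ?c X \<le> real (card (scope ?M s)) * \<beta>"
      by (simp add: M)
    moreover have "(\<lambda>v. if v \<in> scope ?M s then X' v else X v) = X'" using off by auto
    ultimately show ?thesis by simp
  qed
  moreover have "card (scope ?M s) \<le> Delta P"
    unfolding Delta_def max_scope_def using s by (intro Max_ge) (auto simp: M)
  ultimately have 1: "?c X' - ?c X \<le> real (Delta P) * \<beta>"
    using \<beta>(1) by (meson mult_right_mono of_nat_le_iff order_trans)
  define J where "J = (\<lambda>v. max (X v) (y v))"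
  define W where "W = (\<lambda>v. min (X' v) (J v))"
  have XW: "X v \<le> W v" for v using ge by (simp add: W_def J_def)
  have "?c (\<lambda>v. max (X' v) (J v)) + ?c W \<le> ?c X' + ?c J"
    unfolding W_def by (rule pcmip_cost_submodular[OF P])
  moreover have "(\<lambda>v. max (X' v) (J v)) = (\<lambda>v. max (X' v) (y v))"
    using ge by (auto simp: J_def fun_eq_iff max_def intro: order_trans antisym)
  moreover have "\<beta> \<le> ?c W - ?c X"
  \<comment> \<open>Either one variable of the row attains its largest affordable value inside
    \<open>W\<close>, which alone costs \<beta>, or \<open>W\<close> satisfies the row, and then
    \<open>min_increase\<close> applies.\<close>
  proof (cases "\<exists>v\<in>scope ?M s. bdd_above (affordable ?M X v \<beta>) \<and> X' v \<le> J v")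
    case True
    then obtain v where v: "v \<in> scope ?M s" "bdd_above (affordable ?M X v \<beta>)" "X' v \<le> J v" by blast
    have "\<beta> \<le> ?c (X(v := X' v)) - ?c X"
      using r[OF v(1)] v(2) ge by (intro affordable_max_cost[OF P]) (auto simp: raised_def)
    also have "?c (X(v := X' v)) \<le> ?c W"
      using v(3) XW by (intro pcmip_cost_mono[OF P]) (auto simp: W_def)
    finally show ?thesis by simp
  next
    case False
    \<comment> \<open>Outside the first case, a variable raised less than in \<open>J\<close> is
      saturated, so lowering \<open>J\<close> to \<open>X'\<close> there keeps the row satisfied. On
      the row the result is \<open>W\<close>.\<close>
    define F where "F = {v \<in> scope ?M s. X' v < J v}"
    have Jreg: "J \<in> region ?M s"
    proof -
      have "(\<lambda>j. y (s, j)) \<in> row_constraint P s" using y s unfolding feasible_point_def M by auto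
      then have "(\<lambda>j. J (s, j)) \<in> row_constraint P s"
        by (rule row_constraint_mono[OF P s(1)]) (auto simp: J_def)
      then show ?thesis by (simp add: M)
    qed
    have "(\<lambda>v. if v \<in> F then X' v else J v) \<in> region ?M s"
    proof (rule saturated_upd_set[OF _ _ Jreg])
      show "finite F" unfolding F_def M by simp
      show "saturated ?M s v (X' v) \<and> X' v \<le> J v" if "v \<in> F" for v
        using that False r[of v] by (auto simp: F_def raised_def not_le)
    qed
    then have reg: "(\<lambda>j. if (s, j) \<in> F then X' (s, j) else J (s, j)) \<in> row_constraint P s" by (simp add: M)
    have "(\<lambda>j. W (s, j)) \<in> row_constraint P s"
      unfolding row_constraint_alt
    proof (rule CollectI, rule conjI)
      show "\<forall>j<ncols P. 0 \<le> W (s, j)" using X XW order_trans by blast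
      have "(\<Sum>j\<in>row_vars P s. contrib P s j (W (s, j))) =
        (\<Sum>j\<in>row_vars P s. contrib P s j (if (s, j) \<in> F then X' (s, j) else J (s, j)))"
        by (rule sum.cong) (auto simp: W_def F_def M min_def)
      then show "rhs P s \<le> (\<Sum>j\<in>row_vars P s. contrib P s j (W (s, j)))"
        using reg unfolding row_constraint_alt by simp
    qed
    then have "W \<in> region ?M s" by (simp add: M)
    then have "?c W - ?c X \<in> {?c z - ?c X | z. X \<le> z \<and> z \<in> region ?M s}"
      using XW by (auto simp: le_fun_def)
    moreover have "bdd_below {?c z - ?c X | z. X \<le> z \<and> z \<in> region ?M s}"
      using pcmip_cost_mono[OF P] by (intro bdd_belowI[of _ 0]) (auto simp: le_fun_def)
    ultimately have "min_increase ?M X s \<le> ?c W - ?c X"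
      unfolding min_increase_def M(1) by (rule cInf_lower)
    then show ?thesis using \<beta>(2) by simp
  qed
  ultimately have 2: "?c (\<lambda>v. max (X' v) (y v)) - ?c X' \<le> ?c J - ?c X - \<beta>" by simp
  show thesis using that[OF \<beta>(1) ge 1] 2 by (simp add: J_def)
qed

theorem greedy_result_approx:
  assumes P: "pcmip_instance P" and g: "greedy_result (pcmip_covering P) X"
  shows "approx_solution (pcmip_covering P) (real (Delta P)) X"
proof -
  let ?c = "pcmip_cost P"
  have "?c X \<le> real (Delta P) * ?c y" if y: "feasible_point (pcmip_covering P) y" for y
  proof -
    have "(\<forall>v. 0 \<le> X v) \<and> ?c X + real (Delta P) * (?c (\<lambda>v. max (X v) (y v)) - ?c X) \<le> real (Delta P) * ?c y"
      using g[unfolded greedy_result_def, THEN conjunct1]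
    proof (induction rule: rtranclp_induct)
      case base
      \<comment> \<open>The join of the starting point with \<open>y\<close> is the positive part of
        \<open>y\<close>. Feasibility makes \<open>y\<close> non-negative at the indices that the
        cost reads, so this join costs no more than \<open>y\<close>.\<close>
      have "0 \<le> y (i, j)" if "i < nrows P" "j < ncols P" for i j
        using y that unfolding feasible_point_def pcmip_covering_def row_constraint_def by auto
      then have "?c (\<lambda>v. max 0 (y v)) \<le> ?c y" by (intro pcmip_cost_mono[OF P]) simp
      moreover have "?c (\<lambda>_. 0) = 0"
      proof -
        have "xhat P (\<lambda>_. 0) a j = 0" for a j
          by (rule antisym[OF _ xhat_nonneg]) (simp add: xhat_le_iff)
        then show ?thesis by (simp add: pcmip_cost_alt)
      qed
      ultimately show ?case by (simp add: mult_left_mono)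
    next
      case (step X X')
      then have X: "\<And>v. 0 \<le> X v" by blast
      obtain \<beta> where \<beta>: "0 \<le> \<beta>" "\<And>v. X v \<le> X' v" "?c X' - ?c X \<le> real (Delta P) * \<beta>"
        "?c (\<lambda>v. max (X' v) (y v)) - ?c X' \<le> ?c (\<lambda>v. max (X v) (y v)) - ?c X - \<beta>"
        using greedy_step_potential[OF P step(2) X y] by blast
      have "real (Delta P) * (?c (\<lambda>v. max (X' v) (y v)) - ?c X') \<le>
        real (Delta P) * (?c (\<lambda>v. max (X v) (y v)) - ?c X - \<beta>)"
        by (intro mult_left_mono \<beta>) simp
      with step(3) \<beta>(3) have "?c X' + real (Delta P) * (?c (\<lambda>v. max (X' v) (y v)) - ?c X') \<le> real (Delta P) * ?c y"
        by (simp add: algebra_simps)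
      then show ?case using X \<beta>(2) order_trans by blast
    qed
    moreover have "?c X \<le> ?c (\<lambda>v. max (X v) (y v))" by (intro pcmip_cost_mono[OF P]) simp
    ultimately show ?thesis by (smt (verit) mult_nonneg_nonneg of_nat_0_le_iff)
  qed
  then show ?thesis using g unfolding approx_solution_def greedy_result_def by (simp add: pcmip_covering_def)
qed

subsection \<open>Cost of raising the variables of one row\<close>

text \<open>The expected growth of \<open>xhat\<close> in column \<open>j\<close> when one more
  active row takes the value \<open>t\<close> there.\<close>

definition excess :: "pcmip \<Rightarrow> (nat \<times> nat \<Rightarrow> real) \<Rightarrow> nat \<Rightarrow> real \<Rightarrow> real" where
  "excess P X j t = expect P (\<lambda>a. max (t - xhat P X a j) 0)"

definition raise_cost :: "pcmip \<Rightarrow> (nat \<times> nat \<Rightarrow> real) \<Rightarrow> nat \<Rightarrow> nat \<Rightarrow> real \<Rightarrow> real" where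
  "raise_cost P X i j t = wt P i j * t + price P j * act_prob P i * excess P X j t"

lemma excess_nonneg: "0 \<le> excess P X j t"
  unfolding excess_def by (rule Bochner_Integration.integral_nonneg) simp

lemma xhat_upd:
  assumes "i < nrows P" "X (i, j) = 0" "0 \<le> Y (i, j)" "\<And>i'. i' \<noteq> i \<Longrightarrow> Y (i', j) = X (i', j)"
  shows "xhat P Y a j = (if a i then max (Y (i, j)) (xhat P X a j) else xhat P X a j)"
proof (rule antisym)
  have "xhat P X a j \<le> xhat P Y a j"
    by (rule xhat_mono) (metis assms(2-4) order_refl)
  then show "(if a i then max (Y (i, j)) (xhat P X a j) else xhat P X a j) \<le> xhat P Y a j"
    using xhat_ge[of i P a Y j] assms(1) by auto
  show "xhat P Y a j \<le> (if a i then max (Y (i, j)) (xhat P X a j) else xhat P X a j)"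
    unfolding xhat_le_iff
  proof (intro conjI allI impI)
    show "0 \<le> (if a i then max (Y (i, j)) (xhat P X a j) else xhat P X a j)"
      by (simp add: xhat_nonneg le_max_iff_disj)
    fix i' assume i': "i' < nrows P" "a i'"
    then show "Y (i', j) \<le> (if a i then max (Y (i, j)) (xhat P X a j) else xhat P X a j)"
      using xhat_ge[of i' P a X j] assms(4)[of i'] by (cases "i' = i") (auto simp: le_max_iff_disj)
  qed
qed

text \<open>A row whose value is 0 never decides the maximum. This provides the independence that
  \<open>expect_split\<close> asks for.\<close>

lemma xhat_indep:
  assumes "X (i, j) = 0"
  shows "xhat P X (a(i := v)) j = xhat P X a j"
proof -
  have "xhat P X b j \<le> xhat P X c j" if "\<And>i'. i' \<noteq> i \<Longrightarrow> b i' = c i'" for b c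
    unfolding xhat_le_iff using assms that xhat_ge[of _ P c X j] xhat_nonneg[of P X c j] by metis
  then show ?thesis by (intro antisym) auto
qed

lemma expect_xhat_upd:
  assumes P: "pcmip_instance P" and i: "i < nrows P" and X: "X (i, j) = 0"
    and Y: "0 \<le> Y (i, j)" "\<And>i'. i' \<noteq> i \<Longrightarrow> Y (i', j) = X (i', j)"
  shows "expect P (\<lambda>a. xhat P Y a j) = expect P (\<lambda>a. xhat P X a j) + act_prob P i * excess P X j (Y (i, j))"
proof -
  have "expect P (\<lambda>a. xhat P Y a j) = expect P (\<lambda>a. if a i then xhat P X a j + max (Y (i, j) - xhat P X a j) 0 else xhat P X a j)"
    by (rule Bochner_Integration.integral_cong) (auto simp: xhat_upd[of i P X j Y, OF i X Y])
  also have "\<dots> = act_prob P i * expect P (\<lambda>a. xhat P X a j + max (Y (i, j) - xhat P X a j) 0) +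
    (1 - act_prob P i) * expect P (\<lambda>a. xhat P X a j)"
    by (rule expect_split[OF i pcmip_instanceD(2)[OF P i]]) (simp_all add: xhat_indep[of X, OF X])
  also have "expect P (\<lambda>a. xhat P X a j + max (Y (i, j) - xhat P X a j) 0) =
    expect P (\<lambda>a. xhat P X a j) + excess P X j (Y (i, j))"
    by (simp add: excess_def)
  finally show ?thesis by (simp add: algebra_simps)
qed

text \<open>For the old maximum M and the new value y, the positive part of
  \<open>t - max y M\<close> is that of \<open>t - M\<close> minus that of
  \<open>min t y - M\<close>. Taking expectations gives the recurrence that the lists of breakpoints
  follow.\<close>

lemma excess_upd:
  assumes P: "pcmip_instance P" and i: "i < nrows P" and X: "X (i, j) = 0"
    and Y: "0 \<le> Y (i, j)" "\<And>i'. i' \<noteq> i \<Longrightarrow> Y (i', j) = X (i', j)"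
  shows "excess P Y j t = excess P X j t - act_prob P i * excess P X j (min t (Y (i, j)))"
proof -
  have "excess P Y j t = expect P (\<lambda>a. if a i then max (t - xhat P X a j) 0 - max (min t (Y (i, j)) - xhat P X a j) 0
    else max (t - xhat P X a j) 0)"
    unfolding excess_def
    by (rule Bochner_Integration.integral_cong) (auto simp: xhat_upd[of i P X j Y, OF i X Y] max_def min_def)
  also have "\<dots> = act_prob P i * expect P (\<lambda>a. max (t - xhat P X a j) 0 - max (min t (Y (i, j)) - xhat P X a j) 0) +
    (1 - act_prob P i) * expect P (\<lambda>a. max (t - xhat P X a j) 0)"
    by (rule expect_split[OF i pcmip_instanceD(2)[OF P i]]) (simp_all add: xhat_indep[of X, OF X])
  finally show ?thesis by (simp add: excess_def algebra_simps)
qed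

lemma excess_le_0: "t \<le> 0 \<Longrightarrow> excess P X j t = 0"
proof -
  assume "t \<le> 0"
  then have "max (t - xhat P X a j) 0 = 0" for a using xhat_nonneg[of P X a j] by (simp add: max_def)
  then show ?thesis by (simp add: excess_def)
qed

lemma excess_zero_point: "0 \<le> t \<Longrightarrow> excess P (\<lambda>_. 0) j t = t"
proof -
  assume t: "0 \<le> t"
  have "xhat P (\<lambda>_. 0) a j = 0" for a
    by (rule antisym[OF _ xhat_nonneg]) (simp add: xhat_le_iff)
  then show ?thesis using t by (simp add: excess_def)
qed

lemma raise_cost_nonneg:
  "pcmip_instance P \<Longrightarrow> i < nrows P \<Longrightarrow> j < ncols P \<Longrightarrow> 0 \<le> t \<Longrightarrow> 0 \<le> raise_cost P X i j t"
  unfolding raise_cost_def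
  by (intro add_nonneg_nonneg mult_nonneg_nonneg excess_nonneg) (auto dest: pcmip_instanceD)

lemma raise_cost_0: "raise_cost P X i j 0 = 0"
  by (simp add: raise_cost_def excess_le_0)

text \<open>The variables of one row lie in different columns and the cost is a sum over columns, so
  raises within the row do not interact.\<close>

lemma pcmip_cost_raise_row:
  assumes P: "pcmip_instance P" and i: "i < nrows P" and X: "\<And>j. j < ncols P \<Longrightarrow> X (i, j) = 0"
    and Y: "\<And>j. j < ncols P \<Longrightarrow> 0 \<le> Y (i, j)" "\<And>i' j. i' \<noteq> i \<Longrightarrow> j < ncols P \<Longrightarrow> Y (i', j) = X (i', j)"
  shows "pcmip_cost P Y - pcmip_cost P X = (\<Sum>j<ncols P. raise_cost P X i j (Y (i, j)))"
proof -
  have "(\<Sum>i'<nrows P. \<Sum>j<ncols P. wt P i' j * Y (i', j)) - (\<Sum>i'<nrows P. \<Sum>j<ncols P. wt P i' j * X (i', j)) =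
    (\<Sum>i'<nrows P. if i' = i then \<Sum>j<ncols P. wt P i j * Y (i, j) else 0)"
    unfolding sum_subtractf[symmetric]
    by (rule sum.cong) (auto simp: X Y sum_subtractf[symmetric] intro!: sum.neutral)
  also have "\<dots> = (\<Sum>j<ncols P. wt P i j * Y (i, j))" using i by simp
  finally have w: "(\<Sum>i'<nrows P. \<Sum>j<ncols P. wt P i' j * Y (i', j)) - (\<Sum>i'<nrows P. \<Sum>j<ncols P. wt P i' j * X (i', j)) =
    (\<Sum>j<ncols P. wt P i j * Y (i, j))" .
  have "(\<Sum>j<ncols P. price P j * expect P (\<lambda>a. xhat P Y a j)) - (\<Sum>j<ncols P. price P j * expect P (\<lambda>a. xhat P X a j)) =
    (\<Sum>j<ncols P. price P j * act_prob P i * excess P X j (Y (i, j)))"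
    unfolding sum_subtractf[symmetric]
    by (rule sum.cong) (auto simp: expect_xhat_upd[of P i X _ Y, OF P i X Y] algebra_simps)
  with w show ?thesis
    unfolding pcmip_cost_alt raise_cost_def by (simp add: sum.distrib)
qed

text \<open>
  The hypotheses on \<open>x\<close> say that \<open>x j\<close> is the largest value of cost at most \<open>B\<close>; a variable that
  can be raised for ever may stop at its upper bound.
\<close>

lemma greedy_step_row:
  assumes P: "pcmip_instance P" and i: "i < nrows P" and rhs: "0 < rhs P i"
    and X: "\<And>j. j < ncols P \<Longrightarrow> X (i, j) = 0" and B: "0 \<le> B"
    and opt: "\<And>y. (\<And>j. 0 \<le> y j) \<Longrightarrow> rhs P i \<le> (\<Sum>j\<in>row_vars P i. contrib P i j (y j)) \<Longrightarrow>
        B \<le> (\<Sum>j\<in>row_vars P i. raise_cost P X i j (y j))"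
    and x: "\<And>j. j \<in> row_vars P i \<Longrightarrow> 0 \<le> x j"
      "\<And>j. j \<in> row_vars P i \<Longrightarrow> (\<forall>t\<ge>0. raise_cost P X i j t \<le> B \<longleftrightarrow> t \<le> x j) \<or>
         (\<forall>t\<ge>0. raise_cost P X i j t \<le> B) \<and> ub P j \<le> x j"
  shows "greedy_step (pcmip_covering P) X (\<lambda>v. if v \<in> {i} \<times> row_vars P i then x (snd v) else X v)"
proof -
  let ?M = "pcmip_covering P" and ?c = "pcmip_cost P"
  have M: "cost ?M = ?c" "constrs ?M = {..<nrows P}"
    "region ?M = (\<lambda>i. {X. (\<lambda>j. X (i, j)) \<in> row_constraint P i})"
    "scope ?M = (\<lambda>i. {i} \<times> row_vars P i)"
    by (simp_all add: pcmip_covering_def)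
  have "(\<Sum>j\<in>row_vars P i. contrib P i j (X (i, j))) \<le> 0"
    using X pcmip_instanceD[OF P] by (intro sum_nonpos) (auto simp: row_vars_def contrib_def min_def)
  then have viol: "X \<notin> region ?M i" using rhs by (auto simp: M row_constraint_alt)
  have "B \<le> ?c y - ?c X" if y: "X \<le> y" "y \<in> region ?M i" for y
  proof -
    \<comment> \<open>\<open>z\<close> takes over the changes of \<open>y\<close> in row
      \<open>i\<close> only, which cannot cost more; \<open>r\<close> makes the values non-negative
      in all columns, as \<open>opt\<close> expects.\<close>
    define z where "z = (\<lambda>v. if fst v = i then y v else X v)"
    define r where "r = (\<lambda>j. max 0 (y (i, j)))"
    have ypos: "0 \<le> y (i, j)" if "j < ncols P" for j
      using y(2) that by (auto simp: M row_constraint_alt)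
    have "(\<Sum>j\<in>row_vars P i. contrib P i j (r j)) = (\<Sum>j\<in>row_vars P i. contrib P i j (y (i, j)))"
      by (rule sum.cong) (auto simp: r_def row_vars_def ypos)
    then have "B \<le> (\<Sum>j\<in>row_vars P i. raise_cost P X i j (r j))"
      using y(2) by (intro opt) (auto simp: M row_constraint_alt r_def)
    also have "\<dots> \<le> (\<Sum>j<ncols P. raise_cost P X i j (r j))"
      by (rule sum_mono2) (auto simp: row_vars_def r_def raise_cost_nonneg[OF P i])
    also have "\<dots> = (\<Sum>j<ncols P. raise_cost P X i j (z (i, j)))"
      by (rule sum.cong) (auto simp: r_def z_def ypos)
    also have "\<dots> = ?c z - ?c X"
      by (rule pcmip_cost_raise_row[of P i X z, OF P i X, symmetric]) (auto simp: z_def ypos)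
    also have "\<dots> \<le> ?c y - ?c X"
      using pcmip_cost_mono[OF P, of z y] y(1) by (auto simp: z_def le_fun_def)
    finally show ?thesis .
  qed
  \<comment> \<open>A lower bound passes to the infimum in \<open>min_increase\<close> only if the
    set is nonempty.\<close>
  moreover have "\<exists>y. X \<le> y \<and> y \<in> region ?M i"
  proof -
    obtain z where z: "z \<in> row_constraint P i" using pcmip_instanceD(7)[OF P i] by blast
    have "(\<lambda>j. max (X (i, j)) (z j)) \<in> row_constraint P i"
      by (rule row_constraint_mono[OF P i z]) simp
    then show ?thesis
      by (intro exI[of _ "\<lambda>v. max (X v) (z (snd v))"]) (simp add: M le_fun_def)
  qed
  ultimately have min: "B \<le> min_increase ?M X i"
    unfolding min_increase_def M by (intro cInf_greatest) auto
  have "raised ?M i X (i, j) B (x j)" if j: "j \<in> row_vars P i" for j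
  proof -
    have j': "j < ncols P" using j by (simp add: row_vars_def)
    have cost: "?c (X((i, j) := t)) - ?c X = raise_cost P X i j t" if "0 \<le> t" for t
    proof -
      have "?c (X((i, j) := t)) - ?c X = (\<Sum>j'<ncols P. raise_cost P X i j' ((X((i, j) := t)) (i, j')))"
        using that X by (intro pcmip_cost_raise_row[of P i X "X((i, j) := t)", OF P i X]) auto
      also have "\<dots> = (\<Sum>j'<ncols P. if j' = j then raise_cost P X i j t else 0)"
        by (rule sum.cong) (auto simp: X raise_cost_0)
      finally show ?thesis using j' by simp
    qed
    have aff: "affordable ?M X (i, j) B = {t. 0 \<le> t \<and> raise_cost P X i j t \<le> B}"
      unfolding affordable_def using X[OF j'] cost by (auto simp: M)
    from x(2)[OF j] show ?thesis
    proof
      assume h: "\<forall>t\<ge>0. raise_cost P X i j t \<le> B \<longleftrightarrow> t \<le> x j"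
      then have "affordable ?M X (i, j) B = {0..x j}" using aff by auto
      then show ?thesis using x(1)[OF j] unfolding raised_def by auto
    next
      assume h: "(\<forall>t\<ge>0. raise_cost P X i j t \<le> B) \<and> ub P j \<le> x j"
      then have a: "affordable ?M X (i, j) B = {0..}" using aff by auto
      have "\<not> bdd_above {0::real..}"
      proof
        assume "bdd_above {0::real..}"
        then obtain m where "\<And>x. 0 \<le> x \<Longrightarrow> x \<le> (m::real)" unfolding bdd_above_def by auto
        from this[of "max 0 m + 1"] show False by auto
      qed
      moreover have "saturated ?M i (i, j) (x j)"
        unfolding saturated_def
      proof (intro allI impI)
        fix t' y assume t': "x j \<le> t'"
        have "(\<Sum>j'\<in>row_vars P i. contrib P i j' ((y((i, j) := t')) (i, j'))) =
          (\<Sum>j'\<in>row_vars P i. contrib P i j' ((y((i, j) := x j)) (i, j')))"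
          by (rule sum.cong) (use h t' in \<open>auto intro: contrib_above\<close>)
        moreover have "(\<forall>j'<ncols P. 0 \<le> (y((i, j) := t')) (i, j')) \<longleftrightarrow> (\<forall>j'<ncols P. 0 \<le> (y((i, j) := x j)) (i, j'))"
          using x(1)[OF j] t' by auto
        ultimately show "(y((i, j) := t') \<in> region ?M i) = (y((i, j) := x j) \<in> region ?M i)"
          unfolding M row_constraint_alt by auto
      qed
      ultimately show ?thesis using x(1)[OF j] unfolding raised_def a by auto
    qed
  qed
  then show ?thesis
    unfolding greedy_step_def using i viol B min
    by (intro bexI[of _ i] exI[of _ B]) (auto simp: M)
qed

subsection \<open>Sorted lists of breakpoints\<close>

text \<open>
  \<open>excess_list [(v\<^sub>1, p\<^sub>1), \<dots>, (v\<^sub>n, p\<^sub>n)] t\<close> is the expectation of \<open>(t - M)\<^sup>+\<close> for the maximum \<open>M\<close> of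
  independently active values \<open>v\<^sub>1 \<ge> \<dots> \<ge> v\<^sub>n\<close> and 0.
\<close>

fun excess_list :: "(real \<times> real) list \<Rightarrow> real \<Rightarrow> real" where
  "excess_list [] t = max t 0"
| "excess_list ((v, p) # vs) t = (1 - p) * excess_list vs t + p * max (t - v) 0"

text \<open>An entry of probability 1 makes everything behind it irrelevant, so the tail is cut when
  such an entry arrives. In a list built this way it can only be the last entry, hence looking at
  the last element of \<open>a\<close> detects one above \<open>v\<close>.\<close>

definition insert_pos :: "real \<Rightarrow> real \<Rightarrow> (real \<times> real) list \<Rightarrow> (real \<times> real) list" where
  "insert_pos v p vs = (let a = takeWhile (\<lambda>w. v < fst w) vs; b = dropWhile (\<lambda>w. v < fst w) vs in
     if a \<noteq> [] \<and> snd (last a) = 1 then vs else a @ (v, p) # (if p = 1 then [] else b))"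

lemma excess_list_above:
  "\<forall>w\<in>set vs. fst w \<le> s \<Longrightarrow> 0 \<le> s \<Longrightarrow> s \<le> t \<Longrightarrow> excess_list vs t = excess_list vs s + (t - s)"
proof (induction vs t rule: excess_list.induct)
  case (2 v p vs t)
  have e: "excess_list vs t = excess_list vs s + (t - s)" using 2 by simp
  have m: "max (t - v) 0 = max (s - v) 0 + (t - s)" using 2 by auto
  show ?case unfolding excess_list.simps e m by (simp add: algebra_simps)
qed simp

text \<open>The last element of \<open>a\<close> is active with certainty and at least
  \<open>s\<close>, so the maximum surely reaches \<open>s\<close>.\<close>

lemma excess_list_dead:
  "\<forall>w\<in>set a. s \<le> fst w \<Longrightarrow> a \<noteq> [] \<Longrightarrow> snd (last a) = 1 \<Longrightarrow> excess_list (a @ b) s = 0"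
proof (induction a)
  case (Cons w a)
  then show ?case by (cases w; cases "a = []") (auto simp: max_def)
qed simp

text \<open>The recurrence of \<open>excess_upd\<close>, for lists.\<close>

lemma excess_list_insert:
  assumes "sorted_wrt (\<lambda>x y. fst y \<le> fst x) vs" "0 \<le> v" "0 \<le> t"
  shows "excess_list (insert_pos v p vs) t = excess_list vs t - p * excess_list vs (min t v)"
proof -
  define a where "a = takeWhile (\<lambda>w. v < fst w) vs"
  define b where "b = dropWhile (\<lambda>w. v < fst w) vs"
  have vs: "vs = a @ b" by (simp add: a_def b_def)
  have a: "\<forall>w\<in>set a. v < fst w" unfolding a_def by (meson set_takeWhileD)
  have b: "\<forall>w\<in>set b. fst w \<le> v"
  proof (cases b)
    case (Cons w bs)
    then have "fst w \<le> v" using hd_dropWhile[of "\<lambda>w. v < fst w" vs] unfolding b_def by (metis list.discI list.sel(1) not_le)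
    moreover have "sorted_wrt (\<lambda>x y. fst y \<le> fst x) (w # bs)"
      using assms(1) unfolding vs Cons by (auto simp: sorted_wrt_append)
    ultimately show ?thesis unfolding Cons by auto
  qed simp
  show ?thesis
  proof (cases "a \<noteq> [] \<and> snd (last a) = 1")
    case True
    have "excess_list (a @ b) (min t v) = 0"
      by (rule excess_list_dead) (use True a in \<open>auto simp: min_def intro: less_imp_le order_trans\<close>)
    then show ?thesis using True unfolding insert_pos_def a_def[symmetric] b_def[symmetric] vs[symmetric] by simp
  next
    case False
    \<comment> \<open>All values in \<open>b\<close> are at most \<open>v\<close>, and above them
      \<open>excess_list b\<close> has slope 1. If \<open>p = 1\<close>, the factor
      \<open>1 - p\<close> of the tail vanishes, so the cut is harmless.\<close>
    have base: "excess_list ((v, p) # (if p = 1 then [] else b)) t = excess_list b t - p * excess_list b (min t v)"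
    proof -
      have "excess_list b t - excess_list b (min t v) = max (t - v) 0"
        using excess_list_above[OF b assms(2), of t] by (auto simp: min_def max_def)
      then have e: "excess_list b (min t v) = excess_list b t - max (t - v) 0" by simp
      show ?thesis unfolding e by (simp add: algebra_simps)
    qed
    have "excess_list (a @ (v, p) # (if p = 1 then [] else b)) t = excess_list (a @ b) t - p * excess_list (a @ b) (min t v)"
      using a
    proof (induction a)
      case Nil
      show ?case using base by simp
    next
      case (Cons w a)
      obtain v1 p1 where w: "w = (v1, p1)" by fastforce
      \<comment> \<open>Values in front exceed \<open>v\<close>, so they contribute nothing at
        \<open>min t v\<close> and the recurrence passes through them linearly.\<close>
      have m: "max (min t v - v1) 0 = 0" using Cons(2) w by auto
      have e: "excess_list (a @ (v, p) # (if p = 1 then [] else b)) t = excess_list (a @ b) t - p * excess_list (a @ b) (min t v)"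
        using Cons by simp
      show ?case unfolding append_Cons w excess_list.simps e m by (simp add: algebra_simps)
    qed
    then show ?thesis using False unfolding insert_pos_def a_def[symmetric] b_def[symmetric] vs[symmetric] by (auto simp: Let_def)
  qed
qed

text \<open>The slope of \<open>excess_list\<close> at \<open>t\<close> is the probability that no value above \<open>t\<close> is active.\<close>

definition list_slope :: "(real \<times> real) list \<Rightarrow> real" where
  "list_slope vs = (\<Prod>w\<leftarrow>vs. 1 - snd w)"

lemma excess_list_piece:
  assumes "\<forall>w\<in>set a. t \<le> fst w" "\<forall>w\<in>set b. fst w \<le> s" "0 \<le> s" "s \<le> t"
  shows "excess_list (a @ b) t = excess_list (a @ b) s + list_slope a * (t - s)"
  using assms
proof (induction a)
  case Nil
  then show ?case by (simp add: list_slope_def excess_list_above[of b s t])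
next
  case (Cons w a)
  obtain v p where w: "w = (v, p)" by fastforce
  have m: "max (t - v) 0 = 0" "max (s - v) 0 = 0" using Cons.prems w by auto
  have e: "excess_list (a @ b) t = excess_list (a @ b) s + list_slope a * (t - s)" using Cons by simp
  have sl: "list_slope (w # a) = (1 - p) * list_slope a" by (simp add: list_slope_def w)
  show ?case unfolding sl by (simp add: w m e algebra_simps)
qed

lemma excess_list_0: "\<forall>w\<in>set vs. 0 \<le> fst w \<Longrightarrow> t \<le> 0 \<Longrightarrow> excess_list vs t = 0"
  by (induction vs t rule: excess_list.induct) (auto simp: max_def)

subsection \<open>Choosing the cost increase for one row\<close>

lemma chain_le:
  fixes f :: "nat \<Rightarrow> real"
  assumes "d \<le> e" "\<And>i. d \<le> i \<Longrightarrow> i < e \<Longrightarrow> f i \<le> f (Suc i)"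
  shows "f d \<le> f e"
  using assms by (induction e rule: dec_induct) (auto intro: order_trans)

text \<open>
  Variable \<open>k \<in> K\<close> of the row has the convex piecewise linear cost \<open>cst k\<close>, with slope \<open>sl k d\<close> from
  the breakpoint \<open>bp k d\<close> on, at which the cost is \<open>lev k d\<close>.
\<close>

locale row_levels =
  fixes K :: "nat set" and L :: nat and bp lev sl :: "nat \<Rightarrow> nat \<Rightarrow> real"
    and A u :: "nat \<Rightarrow> real" and isint :: "nat \<Rightarrow> bool" and b :: real
  assumes finK: "finite K" and L: "0 < L"
    and bp0: "k \<in> K \<Longrightarrow> bp k 0 = 0" and lev0: "k \<in> K \<Longrightarrow> lev k 0 = 0"
    and bp_mono: "k \<in> K \<Longrightarrow> Suc d < L \<Longrightarrow> bp k d \<le> bp k (Suc d)"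
    and sl_mono: "k \<in> K \<Longrightarrow> Suc d < L \<Longrightarrow> sl k d \<le> sl k (Suc d)"
    and sl_nonneg: "k \<in> K \<Longrightarrow> 0 \<le> sl k 0"
    and lev_Suc: "k \<in> K \<Longrightarrow> Suc d < L \<Longrightarrow> lev k (Suc d) = lev k d + sl k d * (bp k (Suc d) - bp k d)"
    and A: "k \<in> K \<Longrightarrow> 0 < A k" and u: "k \<in> K \<Longrightarrow> 0 \<le> u k" and b: "0 < b"
    and feas: "b \<le> (\<Sum>k\<in>K. A k * (if isint k then of_int \<lfloor>u k\<rfloor> else u k))"
begin

definition tang :: "nat \<Rightarrow> nat \<Rightarrow> real \<Rightarrow> real" where
  "tang k d t = lev k d + sl k d * (t - bp k d)"

text \<open>A convex piecewise linear function is the maximum of its extended pieces. In this form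
  it can be evaluated without locating a piece, and at negative arguments too.\<close>

definition cst :: "nat \<Rightarrow> real \<Rightarrow> real" where
  "cst k t = Max ((\<lambda>d. tang k d t) ` {..<L})"

text \<open>The slopes are non-negative and increasing, so a zero last slope means cost 0
  everywhere: these are the variables that can be raised for ever.\<close>

definition free :: "nat \<Rightarrow> bool" where
  "free k \<longleftrightarrow> sl k (L - 1) = 0"

text \<open>For a free variable the set under \<open>Sup\<close> is unbounded; \<open>raised\<close>
  then admits the upper bound, from which on the constraint no longer reacts.\<close>

definition lvl :: "nat \<Rightarrow> real \<Rightarrow> real" where
  "lvl k B = (if free k then u k else Sup {t. cst k t \<le> B})"

definition units :: "nat \<Rightarrow> real \<Rightarrow> real" where
  "units k t = (if isint k then of_int \<lfloor>min t (u k)\<rfloor> else min t (u k))"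

definition covered :: "real \<Rightarrow> real" where
  "covered B = (\<Sum>k\<in>K. A k * units k (lvl k B))"

text \<open>The value at which variable \<open>k\<close> supplies alone what the row lacks at level
  \<open>V\<close>. It is counted from the units already obtained, not from \<open>lvl k V\<close>,
  so that rounding up the missing units yields an integer.\<close>

definition target :: "nat \<Rightarrow> real \<Rightarrow> real" where
  "target k V = units k (lvl k V) +
     (if isint k then of_int \<lceil>(b - covered V) / A k\<rceil> else (b - covered V) / A k)"

section \<open>Tangents, costs and levels of one variable\<close>

lemma bp_le: "k \<in> K \<Longrightarrow> d \<le> e \<Longrightarrow> e < L \<Longrightarrow> bp k d \<le> bp k e"
  by (rule chain_le[of d e "bp k"]) (auto intro: bp_mono)

lemma sl_le: "k \<in> K \<Longrightarrow> d \<le> e \<Longrightarrow> e < L \<Longrightarrow> sl k d \<le> sl k e"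
  by (rule chain_le[of d e "sl k"]) (auto intro: sl_mono)

lemma sl_ge0: "k \<in> K \<Longrightarrow> d < L \<Longrightarrow> 0 \<le> sl k d"
  using sl_le[of k 0 d] sl_nonneg[of k] by simp

lemma bp_ge0: "k \<in> K \<Longrightarrow> d < L \<Longrightarrow> 0 \<le> bp k d"
  using bp_le[of k 0 d] bp0[of k] by simp

lemma lev_Suc_le: "k \<in> K \<Longrightarrow> Suc d < L \<Longrightarrow> lev k d \<le> lev k (Suc d)"
  using bp_mono[of k d] sl_ge0[of k d] by (simp add: lev_Suc)

lemma lev_le: "k \<in> K \<Longrightarrow> d \<le> e \<Longrightarrow> e < L \<Longrightarrow> lev k d \<le> lev k e"
  by (rule chain_le[of d e "lev k"]) (auto intro: lev_Suc_le)

lemma lev_ge0: "k \<in> K \<Longrightarrow> d < L \<Longrightarrow> 0 \<le> lev k d"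
  using lev_le[of k 0 d] lev0[of k] by simp

text \<open>Consecutive pieces cross at the later breakpoint, and the later one is at least as
  steep; \<open>tang_up\<close> and \<open>tang_down\<close> iterate this.\<close>

lemma tang_Suc: "k \<in> K \<Longrightarrow> Suc d < L \<Longrightarrow>
  tang k (Suc d) t = tang k d t + (sl k (Suc d) - sl k d) * (t - bp k (Suc d))"
  unfolding tang_def by (simp add: lev_Suc algebra_simps)

lemma tang_up:
  assumes "k \<in> K" "d \<le> e" "e < L" "bp k e \<le> t"
  shows "tang k d t \<le> tang k e t"
proof (rule chain_le[of d e "\<lambda>d. tang k d t"])
  fix i assume i: "d \<le> i" "i < e"
  then have "bp k (Suc i) \<le> t" using bp_le[of k "Suc i" e] assms by simp
  then show "tang k i t \<le> tang k (Suc i) t"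
    using i assms sl_mono[of k i] by (simp add: tang_Suc)
qed (rule assms)

lemma tang_down:
  assumes "k \<in> K" "d \<le> e" "e < L" "d < e \<Longrightarrow> t \<le> bp k (Suc d)"
  shows "tang k e t \<le> tang k d t"
proof -
  have "- tang k d t \<le> - tang k e t"
  proof (rule chain_le[of d e "\<lambda>d. - tang k d t"])
    fix i assume i: "d \<le> i" "i < e"
    then have "t \<le> bp k (Suc i)" using bp_le[of k "Suc d" "Suc i"] assms by simp
    then show "- tang k i t \<le> - tang k (Suc i) t"
      using i assms sl_mono[of k i] by (simp add: tang_Suc mult_nonneg_nonpos)
  qed (rule assms)
  then show ?thesis by simp
qed

lemma tang_le_cst: "d < L \<Longrightarrow> tang k d t \<le> cst k t"
  unfolding cst_def by (rule Max_ge) auto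

lemma cst_le_iff: "cst k t \<le> B \<longleftrightarrow> (\<forall>d<L. tang k d t \<le> B)"
  unfolding cst_def using L by (subst Max_le_iff) auto

lemma cst_piece:
  assumes "k \<in> K" "q < L" "bp k q \<le> t" "Suc q < L \<Longrightarrow> t \<le> bp k (Suc q)"
  shows "cst k t = tang k q t"
proof (rule antisym)
  have "tang k d t \<le> tang k q t" if "d < L" for d
    using tang_up[of k d q t] tang_down[of k q d t] assms that by (cases "d \<le> q") auto
  then show "cst k t \<le> tang k q t" by (simp add: cst_le_iff)
qed (use assms tang_le_cst in auto)

lemma cst_mono: "k \<in> K \<Longrightarrow> s \<le> t \<Longrightarrow> cst k s \<le> cst k t"
proof -
  assume k: "k \<in> K" and st: "s \<le> t"
  have "tang k d s \<le> cst k t" if "d < L" for d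
  proof -
    have "tang k d s \<le> tang k d t"
      unfolding tang_def using st sl_ge0[OF k that] by (simp add: mult_left_mono)
    then show ?thesis using tang_le_cst[OF that, of k t] by simp
  qed
  then show ?thesis by (simp add: cst_le_iff)
qed

lemma cst_0: "k \<in> K \<Longrightarrow> cst k 0 = 0"
  using cst_piece[of k 0 0] L bp_ge0[of k 1] by (simp add: bp0 lev0 tang_def)

lemma cst_nonneg: "k \<in> K \<Longrightarrow> 0 \<le> t \<Longrightarrow> 0 \<le> cst k t"
  using cst_mono[of k 0 t] by (simp add: cst_0)

lemma free_lev: "k \<in> K \<Longrightarrow> free k \<Longrightarrow> d < L \<Longrightarrow> lev k d = 0 \<and> sl k d = 0"
proof (induction d)
  case 0
  then show ?case using sl_le[of k 0 "L - 1"] sl_nonneg[of k] by (simp add: lev0 free_def)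
next
  case (Suc d)
  then show ?case using sl_le[of k "Suc d" "L - 1"] sl_ge0[of k "Suc d"] by (simp add: lev_Suc free_def)
qed

lemma cst_free: "k \<in> K \<Longrightarrow> free k \<Longrightarrow> cst k t = 0"
  using L free_lev[of k] by (intro antisym) (auto simp: cst_le_iff tang_def intro: order_trans[OF _ tang_le_cst[of 0]])

lemma level_piece_exists:
  assumes "k \<in> K" "0 \<le> B"
  obtains q where "q < L" "lev k q \<le> B" "Suc q < L \<Longrightarrow> B < lev k (Suc q)"
proof -
  let ?S = "{d. d < L \<and> lev k d \<le> B}"
  have S: "finite ?S" "?S \<noteq> {}" using L assms lev0[of k] by auto
  have "Max ?S \<in> ?S" by (rule Max_in[OF S])
  moreover have "Suc (Max ?S) \<notin> ?S" using Max_ge[OF S(1)] Suc_n_not_le_n by blast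
  ultimately show thesis using that[of "Max ?S"] by auto
qed

text \<open>Zero slope on the last piece of level at most \<open>B\<close> would give the next piece
  the same level, so there is no next piece. A program can thus recognise a free variable from the
  piece it has found.\<close>

lemma piece_not_free:
  assumes "k \<in> K" "q < L" "Suc q < L \<Longrightarrow> B < lev k (Suc q)" "lev k q \<le> B"
  shows "free k \<longleftrightarrow> \<not> 0 < sl k q"
proof
  assume "\<not> 0 < sl k q"
  then have 0: "sl k q = 0" using sl_ge0[OF assms(1,2)] by simp
  then have "\<not> Suc q < L" using assms lev_Suc[OF assms(1), of q] by auto
  then have "q = L - 1" using assms(2) by simp
  then show "free k" using 0 by (simp add: free_def)
qed (use free_lev assms in auto)

lemma cst_le_piece_iff:
  assumes k: "k \<in> K" and q: "q < L" "lev k q \<le> B" "Suc q < L \<Longrightarrow> B < lev k (Suc q)" and s: "0 < sl k q"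
  shows "cst k t \<le> B \<longleftrightarrow> t \<le> bp k q + (B - lev k q) / sl k q"
    and "cst k (bp k q + (B - lev k q) / sl k q) = B"
    and "Suc q < L \<Longrightarrow> bp k q + (B - lev k q) / sl k q < bp k (Suc q)"
proof -
  let ?x = "bp k q + (B - lev k q) / sl k q"
  have x: "tang k q ?x = B" using s by (simp add: tang_def)
  show lt: "?x < bp k (Suc q)" if "Suc q < L"
    using q(3)[OF that] s unfolding lev_Suc[OF k that] by (simp add: field_simps)
  show c: "cst k ?x = B"
    using cst_piece[OF k q(1), of ?x] lt q s x by (simp add: less_imp_le)
  show "cst k t \<le> B \<longleftrightarrow> t \<le> ?x"
  proof
    assume "cst k t \<le> B"
    then have "tang k q t \<le> tang k q ?x" using tang_le_cst[OF q(1), of k t] x by simp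
    then show "t \<le> ?x" using s unfolding tang_def by (simp add: field_simps)
  qed (use cst_mono[OF k, of t ?x] c in simp)
qed

lemma lvl_piece:
  assumes k: "k \<in> K" and q: "q < L" "lev k q \<le> B" "Suc q < L \<Longrightarrow> B < lev k (Suc q)"
  shows "lvl k B = (if 0 < sl k q then bp k q + (B - lev k q) / sl k q else u k)"
proof (cases "0 < sl k q")
  case True
  have "{t. cst k t \<le> B} = {..bp k q + (B - lev k q) / sl k q}"
    using cst_le_piece_iff(1)[OF k q True] by auto
  then show ?thesis using True piece_not_free[OF k q(1,3,2)] by (simp add: lvl_def)
next
  case False
  then show ?thesis using piece_not_free[OF k q(1,3,2)] by (simp add: lvl_def)
qed

lemma lvl_iff:
  assumes k: "k \<in> K" and B: "0 \<le> B" and f: "\<not> free k"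
  shows "cst k t \<le> B \<longleftrightarrow> t \<le> lvl k B"
proof -
  obtain q where q: "q < L" "lev k q \<le> B" "Suc q < L \<Longrightarrow> B < lev k (Suc q)"
    using level_piece_exists[OF k B] by blast
  then have "0 < sl k q" using f piece_not_free[OF k q(1,3,2)] by simp
  then show ?thesis using lvl_piece[OF k q] cst_le_piece_iff(1)[OF k q] by simp
qed

lemma cst_lvl_le: "k \<in> K \<Longrightarrow> 0 \<le> B \<Longrightarrow> cst k (lvl k B) \<le> B"
  using lvl_iff[of k B "lvl k B"] by (cases "free k") (auto simp: cst_free)

lemma lvl_nonneg: "k \<in> K \<Longrightarrow> 0 \<le> B \<Longrightarrow> 0 \<le> lvl k B"
  using lvl_iff[of k B 0] u[of k] by (cases "free k") (auto simp: cst_0 lvl_def)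

lemma lvl_mono: "k \<in> K \<Longrightarrow> 0 \<le> B \<Longrightarrow> B \<le> C \<Longrightarrow> lvl k B \<le> lvl k C"
  using lvl_iff[of k C "lvl k B"] cst_lvl_le[of k B] by (cases "free k") (auto simp: lvl_def)

section \<open>Coverage of the row and the single variable that completes it\<close>

lemma units_mono: "s \<le> t \<Longrightarrow> units k s \<le> units k t"
  unfolding units_def by (auto intro!: floor_mono min.mono)

lemma units_above: "u k \<le> t \<Longrightarrow> units k t = units k (u k)"
  by (simp add: units_def min_def)

lemma covered_mono: "0 \<le> B \<Longrightarrow> B \<le> C \<Longrightarrow> covered B \<le> covered C"
  unfolding covered_def by (intro sum_mono mult_left_mono units_mono lvl_mono) (auto dest: A)

text \<open>All variables reach their upper bounds, where the row is satisfied by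
  \<open>feas\<close>. This makes the largest key a sufficient level.\<close>

lemma covered_saturated:
  assumes "0 \<le> B" "\<And>k. k \<in> K \<Longrightarrow> cst k (u k) \<le> B"
  shows "b \<le> covered B"
proof -
  have "u k \<le> lvl k B" if "k \<in> K" for k
    using lvl_iff[OF that assms(1), of "u k"] assms(2)[OF that] by (cases "free k") (auto simp: lvl_def)
  then have "covered B = (\<Sum>k\<in>K. A k * units k (u k))"
    unfolding covered_def by (intro sum.cong refl) (metis units_above)
  moreover have "units k (u k) = (if isint k then of_int \<lfloor>u k\<rfloor> else u k)" for k
    by (auto simp: units_def)
  ultimately show ?thesis using feas by simp
qed

text \<open>The last claim is minimality: a variable that supplies the missing \<open>r\<close>
  alone has to reach its target, since for integer variables a difference of units that is at least
  \<open>r / A k\<close> is at least its ceiling.\<close>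

lemma units_step:
  assumes "0 < r" "k \<in> K" "b - covered V = r"
  shows "units k (lvl k V) < target k V" "A k * target k V \<ge> A k * units k (lvl k V) + r"
    "target k V \<le> u k \<Longrightarrow> units k (target k V) = target k V"
    "units k t > units k (lvl k V) \<Longrightarrow> A k * units k t \<ge> A k * units k (lvl k V) + r \<Longrightarrow> target k V \<le> min t (u k)"
proof -
  have ra: "0 < r / A k" using assms A by simp
  define n :: real where "n = (if isint k then of_int \<lceil>r / A k\<rceil> else r / A k)"
  have t: "target k V = units k (lvl k V) + n" by (simp add: target_def n_def assms)
  have n: "r / A k \<le> n" by (simp add: n_def)
  show "units k (lvl k V) < target k V" using n ra by (simp add: t)
  show "A k * target k V \<ge> A k * units k (lvl k V) + r"
    using n A[OF assms(2)] by (simp add: t field_simps)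
  show "target k V \<le> u k \<Longrightarrow> units k (target k V) = target k V"
  proof -
    assume "target k V \<le> u k"
    then have m: "min (target k V) (u k) = target k V" by simp
    show ?thesis
    proof (cases "isint k")
      case True
      have "target k V = of_int (\<lfloor>min (lvl k V) (u k)\<rfloor> + \<lceil>(b - covered V) / A k\<rceil>)"
        using True by (simp add: target_def units_def)
      then have "of_int \<lfloor>target k V\<rfloor> = target k V" by (simp only: floor_of_int)
      then show ?thesis using True by (simp add: units_def m)
    next
      case False
      then show ?thesis by (simp add: units_def m)
    qed
  qed
  assume "A k * units k t \<ge> A k * units k (lvl k V) + r"
  then have "r / A k \<le> units k t - units k (lvl k V)" using A[OF assms(2)] by (simp add: field_simps)
  then have "n \<le> units k t - units k (lvl k V)"
    unfolding n_def units_def by (auto simp: ceiling_le_iff simp flip: of_int_diff)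
  then have "target k V \<le> units k t" by (simp add: t)
  also have "\<dots> \<le> min t (u k)"
    unfolding units_def using of_int_floor_le[of "min t (u k)"] by simp
  finally show "target k V \<le> min t (u k)" .
qed

text \<open>At the cost of its target, variable \<open>k\<close> covers the missing amount while no
  other variable falls below its value at level \<open>V\<close>. So the cost of a target within its
  upper bound is a sufficient level.\<close>

lemma target_above:
  assumes V: "0 \<le> V" "covered V < b" and k: "k \<in> K" and t: "target k V \<le> u k"
  shows "\<not> free k" "V < cst k (target k V)" "b \<le> covered (cst k (target k V))"
proof -
  let ?t = "target k V"
  have r: "0 < b - covered V" using V by simp
  note st = units_step[OF r k refl]
  have lt: "lvl k V < ?t"
  proof (rule ccontr)
    assume "\<not> ?thesis"
    then have "units k ?t \<le> units k (lvl k V)" by (intro units_mono) simp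
    then show False using st(1,3) t by simp
  qed
  show f: "\<not> free k" using lt t by (auto simp: lvl_def)
  show V': "V < cst k ?t" using lvl_iff[OF k V(1) f, of ?t] lt by simp
  let ?B = "cst k ?t"
  have le: "?t \<le> lvl k ?B" using lvl_iff[OF k _ f, of ?B ?t] V V' by simp
  have "covered V + (b - covered V) \<le> covered ?B"
  proof -
    have "covered V + (b - covered V) =
      (\<Sum>j\<in>K - {k}. A j * units j (lvl j V)) + (A k * units k (lvl k V) + (b - covered V))"
      unfolding covered_def using k finK by (simp add: sum.remove)
    also have "\<dots> \<le> (\<Sum>j\<in>K - {k}. A j * units j (lvl j ?B)) + A k * units k (lvl k ?B)"
    proof (rule add_mono)
      show "(\<Sum>j\<in>K - {k}. A j * units j (lvl j V)) \<le> (\<Sum>j\<in>K - {k}. A j * units j (lvl j ?B))"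
        using V V' by (intro sum_mono mult_left_mono units_mono lvl_mono) (auto dest: A)
      have "A k * units k (lvl k V) + (b - covered V) \<le> A k * ?t" by (rule st(2))
      also have "\<dots> \<le> A k * units k (lvl k ?B)"
        using units_mono[OF le, of k] st(3)[OF t] A[OF k] by simp
      finally show "A k * units k (lvl k V) + (b - covered V) \<le> A k * units k (lvl k ?B)" .
    qed
    also have "\<dots> = covered ?B" unfolding covered_def using k finK by (simp add: sum.remove)
    finally show ?thesis .
  qed
  then show "b \<le> covered ?B" by simp
qed

text \<open>
  A solution cheaper than \<open>2 V\<close> exceeds level \<open>V\<close> in one variable only, which therefore has to
  cover alone what is missing at level \<open>V\<close>.
\<close>

lemma solution_cost:
  assumes V: "0 \<le> V" "covered V < b" and y: "\<And>k. k \<in> K \<Longrightarrow> 0 \<le> y k"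
    and sol: "b \<le> (\<Sum>k\<in>K. A k * units k (y k))"
  shows "2 * V \<le> (\<Sum>k\<in>K. cst k (y k)) \<or>
    (\<exists>k\<in>K. target k V \<le> u k \<and> cst k (target k V) \<le> (\<Sum>k\<in>K. cst k (y k)))"
proof (cases "2 * V \<le> (\<Sum>k\<in>K. cst k (y k))")
  case False
  then have cheap: "\<not> 2 * V \<le> (\<Sum>k\<in>K. cst k (y k))" by simp
  have "\<exists>k\<in>K. units k (lvl k V) < units k (y k)"
  proof (rule ccontr)
    assume "\<not> ?thesis"
    then have "(\<Sum>k\<in>K. A k * units k (y k)) \<le> covered V"
      unfolding covered_def by (intro sum_mono mult_left_mono) (auto simp: not_less dest: A)
    then show False using V sol by simp
  qed
  then obtain k where k: "k \<in> K" and lt: "units k (lvl k V) < units k (y k)" by blast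
  have f: "\<not> free k"
  proof
    assume "free k"
    then have "units k (y k) \<le> units k (lvl k V)" unfolding units_def lvl_def by (auto intro: floor_mono)
    then show False using lt by simp
  qed
  have "lvl k V < y k" using lt units_mono[of "y k" "lvl k V" k] by force
  then have kV: "V < cst k (y k)" using lvl_iff[OF k V(1) f, of "y k"] by simp
  have sum: "(\<Sum>k\<in>K. cst k (y k)) = cst k (y k) + (\<Sum>j\<in>K - {k}. cst j (y j))"
    using k finK by (simp add: sum.remove)
  have others: "units j (y j) \<le> units j (lvl j V)" if j: "j \<in> K - {k}" for j
  proof (cases "free j")
    case True
    then show ?thesis unfolding units_def lvl_def by (auto intro: floor_mono)
  next
    case False
    have "cst j (y j) \<le> (\<Sum>j\<in>K - {k}. cst j (y j))"
      using j finK y by (intro member_le_sum) (auto intro: cst_nonneg)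
    then have "cst j (y j) \<le> V" using sum kV cheap by simp
    then show ?thesis using lvl_iff[of j V "y j"] j V(1) False by (intro units_mono) auto
  qed
  have "b \<le> A k * units k (y k) + (\<Sum>j\<in>K - {k}. A j * units j (y j))"
    using sol k finK by (simp add: sum.remove)
  also have "(\<Sum>j\<in>K - {k}. A j * units j (y j)) \<le> (\<Sum>j\<in>K - {k}. A j * units j (lvl j V))"
    using others by (intro sum_mono mult_left_mono) (auto dest: A)
  also have "\<dots> = covered V - A k * units k (lvl k V)"
    unfolding covered_def using k finK by (simp add: sum.remove)
  finally have "A k * units k (y k) \<ge> A k * units k (lvl k V) + (b - covered V)" by simp
  then have t: "target k V \<le> min (y k) (u k)"
    using units_step(4)[of "b - covered V" k V "y k"] lt V k by simp
  have "cst k (target k V) \<le> cst k (y k)" using t by (intro cst_mono[OF k]) simp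
  also have "\<dots> \<le> (\<Sum>k\<in>K. cst k (y k))"
    unfolding sum using y by (auto intro!: sum_nonneg cst_nonneg)
  finally show ?thesis using t k by (intro disjI2 bexI[of _ k]) auto
qed simp

text \<open>The cost of the first integer strictly above the breakpoint, read off the tangent of
  piece \<open>d\<close>. No search is required even when this integer lies beyond the
  piece.\<close>

definition next_unit :: "nat \<Rightarrow> nat \<Rightarrow> real" where
  "next_unit k d = lev k d + sl k d * (of_int \<lfloor>bp k d\<rfloor> + 1 - bp k d)"

lemma next_unit_Suc_le:
  assumes step: "k \<in> K" "Suc d < L"
  shows "next_unit k d \<le> next_unit k (Suc d)"
proof -
  let ?n = "of_int \<lfloor>bp k d\<rfloor> + 1 :: real" and ?m = "of_int \<lfloor>bp k (Suc d)\<rfloor> + 1 :: real"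
  have nm: "?n \<le> ?m" using bp_mono[of k d] step by (simp add: floor_mono)
  have "tang k d ?n \<le> tang k (Suc d) ?m"
  \<comment> \<open>If the integer does not pass the next breakpoint, the two values are compared
    through that breakpoint, where the pieces agree; otherwise the later piece is already the larger
    one.\<close>
  proof (cases "?n \<le> bp k (Suc d)")
    case True
    have "tang k d ?n \<le> tang k d (bp k (Suc d))"
      unfolding tang_def using True sl_ge0[of k d] step by (simp add: mult_left_mono)
    also have "\<dots> = tang k (Suc d) (bp k (Suc d))" using step by (simp add: tang_Suc)
    also have "\<dots> \<le> tang k (Suc d) ?m"
      unfolding tang_def using real_of_int_floor_add_one_ge[of "bp k (Suc d)"]
      by (intro add_left_mono mult_left_mono diff_right_mono sl_ge0 step) auto
    finally show ?thesis .
  next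
    case False
    have "tang k d ?n \<le> tang k (Suc d) ?n" using tang_up[of k d "Suc d" ?n] step False by simp
    also have "\<dots> \<le> tang k (Suc d) ?m"
      unfolding tang_def using sl_ge0[of k "Suc d"] nm step by (simp add: mult_left_mono)
    finally show ?thesis .
  qed
  then show ?thesis by (simp add: next_unit_def tang_def)
qed

lemma next_unit_le: "k \<in> K \<Longrightarrow> d \<le> e \<Longrightarrow> e < L \<Longrightarrow> next_unit k d \<le> next_unit k e"
  by (rule chain_le[of d e "next_unit k"]) (auto intro: next_unit_Suc_le)

lemma next_unit_nonneg: "k \<in> K \<Longrightarrow> d < L \<Longrightarrow> 0 \<le> next_unit k d"
  unfolding next_unit_def using real_of_int_floor_add_one_ge[of "bp k d"]
  by (intro add_nonneg_nonneg mult_nonneg_nonneg lev_ge0 sl_ge0) auto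

text \<open>The row gains at least \<open>r\<close> from level \<open>s\<close> to the sufficient
  level \<open>B\<close>, so one of the m variables gains at least \<open>r / m\<close>. If
  \<open>B < s'\<close>, no key lies strictly between \<open>s\<close> and \<open>B\<close>, hence
  this variable moves along a single piece below its upper bound, and what it needs to reach its
  target there is at most m times its gain.\<close>

lemma estimate_factor:
  assumes s: "0 \<le> s" "covered s < b"
    and gap: "\<And>k d. k \<in> K \<Longrightarrow> d < L \<Longrightarrow> lev k d \<le> s \<or> s' \<le> lev k d"
      "\<And>k d. k \<in> K \<Longrightarrow> d < L \<Longrightarrow> next_unit k d \<le> s \<or> s' \<le> next_unit k d"
      "\<And>k. k \<in> K \<Longrightarrow> cst k (u k) \<le> s \<or> s' \<le> cst k (u k)"
    and T: "T \<le> s'" "\<And>k. k \<in> K \<Longrightarrow> target k s \<le> u k \<Longrightarrow> T \<le> cst k (target k s)"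
    and B: "0 \<le> B" "b \<le> covered B"
  shows "T \<le> real (card K) * B"
proof -
  define m where "m = real (card K)"
  define r where "r = b - covered s"
  have r: "0 < r" using s by (simp add: r_def)
  have sB: "s < B" using covered_mono[of B s] B s by (rule_tac ccontr) simp
  have "\<exists>k\<in>K. r / m \<le> A k * units k (lvl k B) - A k * units k (lvl k s)"
  proof (rule ccontr)
    assume n: "\<not> ?thesis"
    have K: "K \<noteq> {}" using b feas by auto
    have "covered B - covered s = (\<Sum>k\<in>K. A k * units k (lvl k B) - A k * units k (lvl k s))"
      unfolding covered_def by (simp add: sum_subtractf)
    also have "\<dots> < (\<Sum>k\<in>K. r / m)"
      by (rule sum_strict_mono[OF finK K]) (use n in auto)
    also have "\<dots> = r" using K finK by (simp add: m_def)
    finally show False using B by (simp add: r_def)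
  qed
  then obtain k where k: "k \<in> K" and gain: "r / m \<le> A k * units k (lvl k B) - A k * units k (lvl k s)" by blast
  have "1 \<le> card K" using k finK card_gt_0_iff[of K] by auto
  then have m: "1 \<le> m" by (simp add: m_def)
  show ?thesis
  proof (cases "s' \<le> B")
    case True
    have "B \<le> m * B" using m B(1) mult_right_mono[of 1 m B] by simp
    then show ?thesis using T(1) True by (simp add: m_def)
  next
    case False
    then have Bs': "B < s'" by simp
    have lt: "units k (lvl k s) < units k (lvl k B)"
    proof -
      have "0 < r / m" using r m by simp
      then have "A k * units k (lvl k s) < A k * units k (lvl k B)" using gain by simp
      then show ?thesis using A[OF k] by simp
    qed
    have f: "\<not> free k" using lt by (auto simp: lvl_def)
    \<comment> \<open>Had the variable reached its upper bound at level \<open>s\<close>, it could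
      not have gained units.\<close>
    have unsat: "s' \<le> cst k (u k)"
    proof (rule ccontr)
      assume "\<not> ?thesis"
      then have "u k \<le> lvl k s" using gap(3)[OF k] lvl_iff[OF k s(1) f] by auto
      moreover have "lvl k s \<le> lvl k B" using sB s k by (intro lvl_mono) auto
      ultimately have "units k (lvl k s) = units k (lvl k B)" by (metis units_above order_trans)
      then show False using lt by simp
    qed
    have xu: "lvl k B < u k" using unsat Bs' lvl_iff[OF k B(1) f, of "u k"] by simp
    obtain q where q: "q < L" "lev k q \<le> s" "Suc q < L \<Longrightarrow> s < lev k (Suc q)"
      using level_piece_exists[OF k s(1)] by blast
    have q': "s' \<le> lev k (Suc q)" if "Suc q < L" using gap(1)[OF k that] q(3)[OF that] by simp
    have sl: "0 < sl k q" using f piece_not_free[OF k q(1,3,2)] by simp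
    have piece: "lvl k C = bp k q + (C - lev k q) / sl k q" "tang k q (lvl k C) = C" "cst k (lvl k C) = C"
      if "s \<le> C" "C < s'" for C
    proof -
      have c: "lev k q \<le> C" "Suc q < L \<Longrightarrow> C < lev k (Suc q)" using q q' that by auto
      show e: "lvl k C = bp k q + (C - lev k q) / sl k q" using lvl_piece[OF k q(1) c] sl by simp
      show "tang k q (lvl k C) = C" unfolding e tang_def using sl by simp
      show "cst k (lvl k C) = C" unfolding e using cst_le_piece_iff(2)[OF k q(1) c sl] by simp
    qed
    define x where "x = lvl k s"
    define x' where "x' = lvl k B"
    define t where "t = target k s"
    have ss': "s < s'" using sB Bs' by simp
    have x: "tang k q x = s" and x': "tang k q x' = B" using piece(2)[of s] piece(2)[of B] ss' sB Bs' by (auto simp: x_def x'_def)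
    have bx: "bp k q \<le> x" using piece(1)[of s] ss' q(2) sl by (simp add: x_def)
    have xx': "x \<le> x'" unfolding x_def x'_def using sB s k by (intro lvl_mono) auto
    have tmono: "tang k q v \<le> tang k q w \<longleftrightarrow> v \<le> w" for v w using sl by (simp add: tang_def)
    have tdiff: "tang k q w = tang k q v + sl k q * (w - v)" for v w by (simp add: tang_def algebra_simps)
    \<comment> \<open>The cost of the target if the piece went on for ever. Below \<open>s'\<close>
      it is the true cost; otherwise \<open>T \<le> s'\<close> suffices.\<close>
    define T1 where "T1 = tang k q t"
    have xu': "x < u k" "x' < u k" using xx' xu by (auto simp: x'_def)
    have ux: "units k x = (if isint k then of_int \<lfloor>x\<rfloor> else x)" "units k x' = (if isint k then of_int \<lfloor>x'\<rfloor> else x')"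
      using xu' by (auto simp: units_def min_def)
    have t: "t = units k x + (if isint k then of_int \<lceil>r / A k\<rceil> else r / A k)"
      by (simp add: t_def target_def x_def r_def)
    have ra: "0 < r / A k" using r A[OF k] by simp
    have xt: "x \<le> t"
    proof (cases "isint k")
      case True
      have "1 \<le> \<lceil>r / A k\<rceil>" using ra by linarith
      then show ?thesis unfolding t using True ux by (simp, linarith)
    qed (use t ux ra in simp)
    have TT1: "T \<le> T1"
    proof (cases "T1 < s'")
      case True
      have "s \<le> T1" using xt x tmono[of x t] by (simp add: T1_def)
      then have p: "lvl k T1 = bp k q + (T1 - lev k q) / sl k q" "cst k (lvl k T1) = T1" "0 \<le> T1"
        using piece(1,3)[of T1] True s by auto
      have "lvl k T1 = t" using p(1) sl by (simp add: T1_def tang_def)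
      then have "cst k t = T1" "\<not> u k \<le> t" using p lvl_iff[OF k p(3) f, of "u k"] unsat True by auto
      then show ?thesis using T(2)[OF k] by (simp add: t_def)
    qed (use T in simp)
    have g: "r / m \<le> A k * (units k x' - units k x)" using gain by (simp add: x_def x'_def algebra_simps)
    then have g': "r / A k \<le> m * (units k x' - units k x)"
      using A[OF k] m by (simp add: field_simps)
    have "T1 \<le> m * B"
    proof (cases "isint k")
      case False
      have "T1 = s + sl k q * (r / A k)" using tdiff[of t x] x t ux False by (simp add: T1_def)
      also have "sl k q * (r / A k) \<le> sl k q * (m * (x' - x))"
        using g' ux False sl by (intro mult_left_mono) auto
      also have "\<dots> = m * (sl k q * (x' - x))" by simp
      also have "sl k q * (x' - x) = B - s" using tdiff[of x' x] x x' by simp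
      also have "s + m * (B - s) = m * B - (m - 1) * s" by (simp add: algebra_simps)
      also have "\<dots> \<le> m * B" using m s by simp
      finally show ?thesis by simp
    next
      case True
      \<comment> \<open>The first integer above the breakpoint. Its key is at most \<open>B\<close>,
        hence at most \<open>s\<close>, so it does not exceed \<open>x\<close>: all \<open>d\<close>
        units gained lie on piece \<open>q\<close>.\<close>
      define n0 :: real where "n0 = of_int \<lfloor>bp k q\<rfloor> + 1"
      define d where "d = units k x' - units k x"
      have d: "d = of_int (\<lfloor>x'\<rfloor> - \<lfloor>x\<rfloor>)" using ux True by (simp add: d_def)
      have "0 < d" using lt by (simp add: d_def x_def x'_def)
      then have d1: "1 \<le> \<lfloor>x'\<rfloor> - \<lfloor>x\<rfloor>" using d by simp
      have fl: "\<lfloor>bp k q\<rfloor> \<le> \<lfloor>x\<rfloor>" using bx by (rule floor_mono)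
      have nu: "next_unit k q = tang k q n0" by (simp add: next_unit_def tang_def n0_def)
      have fx': "tang k q (of_int \<lfloor>x'\<rfloor>) \<le> B" using tmono[of "of_int \<lfloor>x'\<rfloor>" x'] x' by simp
      have "n0 \<le> of_int \<lfloor>x'\<rfloor>" using d1 fl by (simp add: n0_def)
      then have "next_unit k q \<le> B" unfolding nu using tmono[of n0 "of_int \<lfloor>x'\<rfloor>"] fx' by linarith
      then have "next_unit k q \<le> s" using gap(2)[OF k q(1)] Bs' by auto
      then have "n0 \<le> x" unfolding nu using tmono[of n0 x] x by simp
      then have "\<lfloor>bp k q\<rfloor> + 1 \<le> \<lfloor>x\<rfloor>" by (simp add: n0_def le_floor_iff)
      then have n0: "n0 \<le> of_int \<lfloor>x\<rfloor>" unfolding n0_def by linarith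
      \<comment> \<open>The bound \<open>m * d\<close> is an integer, so it also dominates the
        rounded amount.\<close>
      have "real_of_int \<lceil>r / A k\<rceil> \<le> m * d"
      proof -
        have "r / A k \<le> of_int (int (card K) * (\<lfloor>x'\<rfloor> - \<lfloor>x\<rfloor>))" using g' d by (simp add: d_def m_def)
        then have "\<lceil>r / A k\<rceil> \<le> int (card K) * (\<lfloor>x'\<rfloor> - \<lfloor>x\<rfloor>)" by (simp only: ceiling_le_iff)
        then have "real_of_int \<lceil>r / A k\<rceil> \<le> of_int (int (card K) * (\<lfloor>x'\<rfloor> - \<lfloor>x\<rfloor>))" by (simp only: of_int_le_iff)
        then show ?thesis unfolding d m_def by simp
      qed
      moreover have "t - of_int \<lfloor>x'\<rfloor> = real_of_int \<lceil>r / A k\<rceil> - d" using t ux True d by simp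
      moreover have "(m - 1) * d = m * d - d" by (simp add: left_diff_distrib)
      ultimately have "t - of_int \<lfloor>x'\<rfloor> \<le> (m - 1) * d" by linarith
      then have "sl k q * (t - of_int \<lfloor>x'\<rfloor>) \<le> sl k q * ((m - 1) * d)" using sl by simp
      \<comment> \<open>The \<open>d\<close> units fit between \<open>n0\<close> and the integer
        reached at level \<open>B\<close>, so on this piece they cost at most \<open>B\<close>. From
        that integer to the target there are at most \<open>m - 1\<close> further such
        amounts.\<close>
      moreover have "sl k q * d \<le> B"
      proof -
        have "sl k q * d \<le> sl k q * (of_int \<lfloor>x'\<rfloor> - n0)" using n0 d sl by simp
        also have "\<dots> \<le> tang k q (of_int \<lfloor>x'\<rfloor>)"
          using tdiff[of "of_int \<lfloor>x'\<rfloor>" n0] next_unit_nonneg[OF k q(1)] by (simp add: nu)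
        finally show ?thesis using fx' by simp
      qed
      then have "(m - 1) * (sl k q * d) \<le> (m - 1) * B" using m by (intro mult_left_mono) auto
      ultimately have "T1 \<le> B + (m - 1) * B"
        using tdiff[of t "of_int \<lfloor>x'\<rfloor>"] fx' by (simp add: T1_def algebra_simps)
      then show ?thesis by (simp add: algebra_simps)
    qed
    then show ?thesis using TT1 by (simp add: m_def)
  qed
qed

text \<open>Bounds the number of successful halvings. Level 0 is insufficient, so \<open>T\<close>
  is positive and can be cancelled from \<open>T \<le> card K * T / 2 ^ n\<close>.\<close>

lemma covered_halving_bound:
  assumes "0 \<le> s" "covered s < b"
    and "\<And>B. 0 \<le> B \<Longrightarrow> b \<le> covered B \<Longrightarrow> T \<le> real (card K) * B"
    and "b \<le> covered (T / 2 ^ n)" "0 \<le> T" "card K < 2 ^ n"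
  shows False
proof -
  have "T \<le> real (card K) * (T / 2 ^ n)" using assms by (intro assms(3)) auto
  moreover have "T \<noteq> 0" using assms covered_mono[of 0 s] by auto
  ultimately have "2 ^ n \<le> real (card K)" using assms(5) by (simp add: field_simps)
  then show False using assms(6) by (metis leD of_nat_le_iff of_nat_numeral of_nat_power)
qed

end

subsection \<open>Timed reasoning about programs\<close>

text \<open>A bound in place of the exact time allows the same value for both branches of a
  test.\<close>

definition reach :: "com \<Rightarrow> memory \<Rightarrow> nat \<Rightarrow> (memory \<Rightarrow> bool) \<Rightarrow> bool" where
  "reach c \<sigma> T Q \<longleftrightarrow> (\<exists>t \<tau>. exec c \<sigma> t \<tau> \<and> t \<le> T \<and> Q \<tau>)"

lemma reach_conseq: "reach c \<sigma> T Q \<Longrightarrow> T \<le> T' \<Longrightarrow> (\<And>\<tau>. Q \<tau> \<Longrightarrow> Q' \<tau>) \<Longrightarrow> reach c \<sigma> T' Q'"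
  unfolding reach_def by (meson order_trans)

lemma reach_Seq: "reach c \<sigma> T (\<lambda>\<tau>. reach d \<tau> U Q) \<Longrightarrow> reach (Seq c d) \<sigma> (T + U) Q"
  unfolding reach_def by (meson Seq add_mono)

lemma reach_Cond:
  assumes "bval b \<sigma> \<Longrightarrow> reach c \<sigma> T Q" "\<not> bval b \<sigma> \<Longrightarrow> reach d \<sigma> T Q"
  shows "reach (Cond b c d) \<sigma> (1 + T) Q"
  using assms unfolding reach_def by (cases "bval b \<sigma>") (meson CondTrue CondFalse add_le_mono1 add_left_mono)+

section \<open>Frame conditions\<close>

primrec nwrites :: "com \<Rightarrow> string set" where
  "nwrites Skip = {}"
| "nwrites (NPut a e f) = {a}"
| "nwrites (RPut a e f) = {}"
| "nwrites (Seq c d) = nwrites c \<union> nwrites d"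
| "nwrites (Cond b c d) = nwrites c \<union> nwrites d"
| "nwrites (While b c) = nwrites c"

primrec rwrites :: "com \<Rightarrow> string set" where
  "rwrites Skip = {}"
| "rwrites (NPut a e f) = {}"
| "rwrites (RPut a e f) = {a}"
| "rwrites (Seq c d) = rwrites c \<union> rwrites d"
| "rwrites (Cond b c d) = rwrites c \<union> rwrites d"
| "rwrites (While b c) = rwrites c"

text \<open>Frames are given by array names because these can be read off a program. Specifications
  then mention only what changes.\<close>

definition same :: "string set \<Rightarrow> string set \<Rightarrow> memory \<Rightarrow> memory \<Rightarrow> bool" where
  "same A B \<sigma> \<tau> \<longleftrightarrow> (\<forall>a. a \<notin> A \<longrightarrow> nmem \<tau> a = nmem \<sigma> a) \<and> (\<forall>a. a \<notin> B \<longrightarrow> rmem \<tau> a = rmem \<sigma> a)"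

lemma same_nmem: "same A B \<sigma> \<tau> \<Longrightarrow> a \<notin> A \<Longrightarrow> nmem \<tau> a = nmem \<sigma> a"
  and same_rmem: "same A B \<sigma> \<tau> \<Longrightarrow> a \<notin> B \<Longrightarrow> rmem \<tau> a = rmem \<sigma> a"
  by (auto simp: same_def)

lemma same_refl: "same A B \<sigma> \<sigma>"
  by (simp add: same_def)

lemma same_trans: "same A B \<sigma> \<sigma>' \<Longrightarrow> same A B \<sigma>' \<tau> \<Longrightarrow> same A B \<sigma> \<tau>"
  by (simp add: same_def)

lemma same_mono: "same A B \<sigma> \<tau> \<Longrightarrow> A \<subseteq> A' \<Longrightarrow> B \<subseteq> B' \<Longrightarrow> same A' B' \<sigma> \<tau>"
  by (auto simp: same_def)

lemma nmem_nput [simp]: "nmem (nput a k v \<sigma>) = (nmem \<sigma>)(a := (nmem \<sigma> a)(k := v))"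
  and rmem_nput [simp]: "rmem (nput a k v \<sigma>) = rmem \<sigma>"
  and nmem_rput [simp]: "nmem (rput a k w \<sigma>) = nmem \<sigma>"
  and rmem_rput [simp]: "rmem (rput a k w \<sigma>) = (rmem \<sigma>)(a := (rmem \<sigma> a)(k := w))"
  by (simp_all add: nput_def rput_def)

lemma exec_same: "exec c \<sigma> t \<tau> \<Longrightarrow> same (nwrites c) (rwrites c) \<sigma> \<tau>"
  by (induction rule: exec.induct) (auto simp: same_def)

lemma reach_same:
  "reach c \<sigma> T Q \<Longrightarrow> reach c \<sigma> T (\<lambda>\<tau>. same (nwrites c) (rwrites c) \<sigma> \<tau> \<and> Q \<tau>)"
  unfolding reach_def using exec_same by blast

text \<open>The index of the invariant is the time still available, from which each iteration pays.
  Iterations may thus differ in length, as rows do.\<close>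

lemma reach_While_budget:
  assumes "I n \<sigma>"
    and step: "\<And>k \<tau>. I k \<tau> \<Longrightarrow> same (nwrites c) (rwrites c) \<sigma> \<tau> \<Longrightarrow> bval b \<tau> \<Longrightarrow>
        \<exists>T k'. 1 + T + k' \<le> k \<and> reach c \<tau> T (I k')"
    and stop: "\<And>k \<tau>. I k \<tau> \<Longrightarrow> same (nwrites c) (rwrites c) \<sigma> \<tau> \<Longrightarrow> \<not> bval b \<tau> \<Longrightarrow> Q \<tau>"
  shows "reach (While b c) \<sigma> (1 + n) Q"
proof -
  have "reach (While b c) \<tau> (1 + k) Q"
    if "I k \<tau>" "same (nwrites c) (rwrites c) \<sigma> \<tau>" for k \<tau>
    using that
  proof (induction k arbitrary: \<tau> rule: less_induct)
    case (less k)
    show ?case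
    proof (cases "bval b \<tau>")
      case True
      obtain T k' where k: "1 + T + k' \<le> k" and "reach c \<tau> T (I k')"
        using step[OF less(2,3) True] by blast
      then obtain t \<tau>' where 1: "exec c \<tau> t \<tau>'" "t \<le> T" "I k' \<tau>'" unfolding reach_def by blast
      have "same (nwrites c) (rwrites c) \<sigma> \<tau>'" using less(3) exec_same[OF 1(1)] same_trans by blast
      then obtain t' \<tau>'' where 2: "exec (While b c) \<tau>' t' \<tau>''" "t' \<le> 1 + k'" "Q \<tau>''"
        using less(1)[OF _ 1(3)] k unfolding reach_def by auto
      have "1 + t + t' \<le> 1 + k" using 1(2) 2(2) k by simp
      then show ?thesis unfolding reach_def using WhileTrue[OF True 1(1) 2(1)] 2(3) by blast
    next
      case False
      then show ?thesis
        unfolding reach_def using stop[OF less(2,3) False] WhileFalse[OF False] by (meson le_add1)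
    qed
  qed
  then show ?thesis using assms(1) same_refl by blast
qed

lemma reach_While:
  assumes "I n \<sigma>"
    and step: "\<And>k \<tau>. I k \<tau> \<Longrightarrow> same (nwrites c) (rwrites c) \<sigma> \<tau> \<Longrightarrow> bval b \<tau> \<Longrightarrow>
        0 < k \<and> reach c \<tau> T (I (k - 1))"
    and stop: "\<And>k \<tau>. I k \<tau> \<Longrightarrow> same (nwrites c) (rwrites c) \<sigma> \<tau> \<Longrightarrow> \<not> bval b \<tau> \<Longrightarrow> Q \<tau>"
  shows "reach (While b c) \<sigma> (1 + n * (1 + T)) Q"
proof (rule reach_While_budget[where I = "\<lambda>k \<tau>. \<exists>j. k = j * (1 + T) \<and> I j \<tau>"])
  fix k \<tau> assume I: "\<exists>j. k = j * (1 + T) \<and> I j \<tau>"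
    and s: "same (nwrites c) (rwrites c) \<sigma> \<tau>" and b: "bval b \<tau>"
  then obtain j where j: "k = j * (1 + T)" "I j \<tau>" by blast
  note st = step[OF j(2) s b]
  have "j * (1 + T) = 1 + T + (j - 1) * (1 + T)" using st by (cases j) auto
  then have "1 + T + (j - 1) * (1 + T) \<le> k" using j by simp
  moreover have "reach c \<tau> T (\<lambda>\<tau>. \<exists>j'. (j - 1) * (1 + T) = j' * (1 + T) \<and> I j' \<tau>)"
    by (rule reach_conseq[OF conjunct2[OF st]]) auto
  ultimately show "\<exists>T' k'. 1 + T' + k' \<le> k \<and> reach c \<tau> T' (\<lambda>\<tau>. \<exists>j. k' = j * (1 + T) \<and> I j \<tau>)" by blast
qed (use assms in auto)

section \<open>Loop-free code and counting loops\<close>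

primrec loopfree :: "com \<Rightarrow> bool" where
  "loopfree Skip = True"
| "loopfree (NPut a e f) = True"
| "loopfree (RPut a e f) = True"
| "loopfree (Seq c d) = (loopfree c \<and> loopfree d)"
| "loopfree (Cond b c d) = (loopfree c \<and> loopfree d)"
| "loopfree (While b c) = False"

text \<open>On loop-free programs the result is a function of the memory, so \<open>simp\<close> can
  execute them symbolically. The value at \<open>While\<close> is a default, excluded by
  \<open>loopfree\<close>.\<close>

primrec run :: "com \<Rightarrow> memory \<Rightarrow> memory" where
  "run Skip \<sigma> = \<sigma>"
| "run (NPut a e f) \<sigma> = nput a (nval e \<sigma>) (nval f \<sigma>) \<sigma>"
| "run (RPut a e f) \<sigma> = rput a (nval e \<sigma>) (rval f \<sigma>) \<sigma>"
| "run (Seq c d) \<sigma> = run d (run c \<sigma>)"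
| "run (Cond b c d) \<sigma> = (if bval b \<sigma> then run c \<sigma> else run d \<sigma>)"
| "run (While b c) \<sigma> = \<sigma>"

primrec tmax :: "com \<Rightarrow> nat" where
  "tmax Skip = 1"
| "tmax (NPut a e f) = 1"
| "tmax (RPut a e f) = 1"
| "tmax (Seq c d) = tmax c + tmax d"
| "tmax (Cond b c d) = 1 + max (tmax c) (tmax d)"
| "tmax (While b c) = 0"

lemma exec_loopfree: "loopfree c \<Longrightarrow> \<exists>t\<le>tmax c. exec c \<sigma> t (run c \<sigma>)"
proof (induction c arbitrary: \<sigma>)
  case (Seq c d)
  then show ?case by (metis add_mono exec.Seq loopfree.simps(4) run.simps(4) tmax.simps(4))
next
  case (Cond b c d)
  obtain t t' where "t \<le> tmax c" "exec c \<sigma> t (run c \<sigma>)" "t' \<le> tmax d" "exec d \<sigma> t' (run d \<sigma>)"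
    using Cond by fastforce
  then show ?case
    using exec.CondTrue[of b \<sigma> c t "run c \<sigma>" d] exec.CondFalse[of b \<sigma> d t' "run d \<sigma>" c]
    by (cases "bval b \<sigma>") (force intro: exI[of _ "1 + t"] exI[of _ "1 + t'"])+
qed (simp_all, (metis exec.Skip exec.NPut exec.RPut One_nat_def order_refl)+)

lemma reach_run: "loopfree c \<Longrightarrow> tmax c \<le> T \<Longrightarrow> Q (run c \<sigma>) \<Longrightarrow> reach c \<sigma> T Q"
  unfolding reach_def using exec_loopfree order_trans by blast

lemma reach_Seq_run:
  "loopfree c \<Longrightarrow> tmax c + U \<le> T \<Longrightarrow> reach d (run c \<sigma>) U Q \<Longrightarrow> reach (Seq c d) \<sigma> T Q"
  by (rule reach_conseq[OF reach_Seq[of _ _ "tmax c"]], rule reach_run) auto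

definition For :: "string \<Rightarrow> nexp \<Rightarrow> nexp \<Rightarrow> com \<Rightarrow> com" where
  "For v e f c = Seq (NPut v (NConst 0) e)
     (While (NLess (NGet v (NConst 0)) f) (Seq c (NPut v (NConst 0) (NAdd (NGet v (NConst 0)) (NConst 1)))))"

lemma nwrites_For [simp]: "nwrites (For v e f c) = insert v (nwrites c)"
  and rwrites_For [simp]: "rwrites (For v e f c) = rwrites c"
  by (auto simp: For_def)

text \<open>The step has to establish the invariant after the increment of the counter, with the
  frame of the body at hand. The limit \<open>f\<close> is evaluated anew at each test, hence the
  assumption that it is constant on the frame.\<close>

lemma reach_For:
  assumes v: "v \<notin> nwrites c" and e: "nval e \<sigma> = m" "m \<le> n"
    and f: "\<And>\<tau>. same (insert v (nwrites c)) (rwrites c) \<sigma> \<tau> \<Longrightarrow> nval f \<tau> = n"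
    and init: "I m (nput v 0 m \<sigma>)"
    and step: "\<And>k \<tau>. m \<le> k \<Longrightarrow> k < n \<Longrightarrow> nmem \<tau> v 0 = k \<Longrightarrow> same (insert v (nwrites c)) (rwrites c) \<sigma> \<tau> \<Longrightarrow>
        I k \<tau> \<Longrightarrow> reach c \<tau> T (\<lambda>\<tau>'. same (nwrites c) (rwrites c) \<tau> \<tau>' \<longrightarrow> I (Suc k) (nput v 0 (Suc k) \<tau>'))"
    and stop: "\<And>\<tau>. nmem \<tau> v 0 = n \<Longrightarrow> same (insert v (nwrites c)) (rwrites c) \<sigma> \<tau> \<Longrightarrow> I n \<tau> \<Longrightarrow> Q \<tau>"
  shows "reach (For v e f c) \<sigma> (2 + (n - m) * (2 + T)) Q"
proof -
  let ?W = "While (NLess (NGet v (NConst 0)) f) (Seq c (NPut v (NConst 0) (NAdd (NGet v (NConst 0)) (NConst 1))))"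
  let ?s = "same (insert v (nwrites c)) (rwrites c)"
  let ?J = "\<lambda>k \<tau>. k \<le> n - m \<and> nmem \<tau> v 0 = n - k \<and> ?s \<sigma> \<tau> \<and> I (n - k) \<tau>"
  have s0: "?s \<sigma> (nput v 0 m \<sigma>)" by (auto simp: same_def)
  have "reach ?W (nput v 0 m \<sigma>) (1 + (n - m) * (1 + (T + 1))) Q"
  proof (rule reach_While[where I = ?J])
    show "?J (n - m) (nput v 0 m \<sigma>)" using init s0 e(2) by simp
  next
    fix k \<tau> assume J: "?J k \<tau>" and b: "bval (NLess (NGet v (NConst 0)) f) \<tau>"
    then have k: "0 < k" "n - k < n" "m \<le> n - k" using f[of \<tau>] by auto
    have "reach c \<tau> T (\<lambda>\<tau>'. same (nwrites c) (rwrites c) \<tau> \<tau>' \<and>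
       (same (nwrites c) (rwrites c) \<tau> \<tau>' \<longrightarrow> I (Suc (n - k)) (nput v 0 (Suc (n - k)) \<tau>')))"
      by (rule reach_same, rule step) (use J k in auto)
    then have "reach c \<tau> T (\<lambda>\<tau>'. reach (NPut v (NConst 0) (NAdd (NGet v (NConst 0)) (NConst 1))) \<tau>' 1 (?J (k - 1)))"
    proof (rule reach_conseq)
      fix \<tau>' assume h: "same (nwrites c) (rwrites c) \<tau> \<tau>' \<and>
       (same (nwrites c) (rwrites c) \<tau> \<tau>' \<longrightarrow> I (Suc (n - k)) (nput v 0 (Suc (n - k)) \<tau>'))"
      then have v': "nmem \<tau>' v = nmem \<tau> v" using v by (simp add: same_def)
      have "?s \<tau> (nput v 0 (Suc (n - k)) \<tau>')" using h by (auto simp: same_def)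
      then have "?s \<sigma> (nput v 0 (Suc (n - k)) \<tau>')" using J same_trans by blast
      then show "reach (NPut v (NConst 0) (NAdd (NGet v (NConst 0)) (NConst 1))) \<tau>' 1 (?J (k - 1))"
        using h J k by (intro reach_run) (auto simp: v' Suc_diff_le)
    qed simp
    then show "0 < k \<and> reach (Seq c (NPut v (NConst 0) (NAdd (NGet v (NConst 0)) (NConst 1)))) \<tau> (T + 1) (?J (k - 1))"
      using k reach_Seq by blast
  next
    fix k \<tau> assume J: "?J k \<tau>" and b: "\<not> bval (NLess (NGet v (NConst 0)) f) \<tau>"
    then have "\<not> n - k < n" using f[of \<tau>] by simp
    then have "n - k = n" using J by linarith
    then show "Q \<tau>" using J stop[of \<tau>] by simp
  qed
  then have "reach ?W (nput v 0 m \<sigma>) (1 + (n - m) * (2 + T)) Q"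
    by (simp add: numeral_2_eq_2)
  then have "reach (NPut v (NConst 0) e) \<sigma> 1 (\<lambda>\<tau>. reach ?W \<tau> (1 + (n - m) * (2 + T)) Q)"
    by (rule_tac reach_run) (simp_all add: e(1))
  then have "reach (For v e f c) \<sigma> (1 + (1 + (n - m) * (2 + T))) Q" unfolding For_def by (rule reach_Seq)
  then show ?thesis by simp
qed

subsection \<open>Solving one row\<close>

abbreviation nv :: "string \<Rightarrow> nexp" where "nv a \<equiv> NGet a (NConst 0)"
abbreviation rv :: "string \<Rightarrow> rexp" where "rv a \<equiv> RGet a (NConst 0)"
abbreviation ns :: "string \<Rightarrow> nexp \<Rightarrow> com" where "ns a \<equiv> NPut a (NConst 0)"
abbreviation rs :: "string \<Rightarrow> rexp \<Rightarrow> com" where "rs a \<equiv> RPut a (NConst 0)"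
notation Seq (infixr ";;" 60)

text \<open>
  The pieces of entry \<open>k\<close> of the current row, \<open>s \<le> k < e\<close>, are stored from index \<open>(k - s) * L\<close> on;
  \<open>''o''\<close> holds this index.
\<close>

definition find_piece :: com where
  "find_piece = (ns ''a'' (NConst 0) ;; ns ''c'' (nv ''L'')) ;;
    While (NLess (NAdd (nv ''a'') (NConst 1)) (nv ''c''))
     (ns ''d'' (NHalf (NAdd (nv ''a'') (nv ''c''))) ;;
      Cond (RLess (rv ''lv'') (RGet ''lev'' (NAdd (nv ''o'') (nv ''d''))))
        (ns ''c'' (nv ''d'')) (ns ''a'' (nv ''d'')))"

definition eval_entry :: com where
  "eval_entry = find_piece ;;
    Cond (RLess (RConst 0) (RGet ''sl'' (NAdd (nv ''o'') (nv ''a''))))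
      (RPut ''x'' (nv ''k'') (RAdd (RGet ''bp'' (NAdd (nv ''o'') (nv ''a'')))
        (RDiv (RSub (rv ''lv'') (RGet ''lev'' (NAdd (nv ''o'') (nv ''a'')))) (RGet ''sl'' (NAdd (nv ''o'') (nv ''a''))))))
      (RPut ''x'' (nv ''k'') (RGet ''ub'' (NGet ''col'' (nv ''k'')))) ;;
    Cond (RLess (RGet ''ub'' (NGet ''col'' (nv ''k''))) (RGet ''x'' (nv ''k'')))
      (RPut ''z'' (nv ''k'') (RGet ''ub'' (NGet ''col'' (nv ''k''))))
      (RPut ''z'' (nv ''k'') (RGet ''x'' (nv ''k''))) ;;
    Cond (NLess (NConst 0) (NGet ''int'' (NGet ''col'' (nv ''k''))))
      (RPut ''z'' (nv ''k'') (RFloor (RGet ''z'' (nv ''k'')))) Skip ;;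
    rs ''r'' (RSub (rv ''r'') (RMul (RGet ''mat'' (nv ''k'')) (RGet ''z'' (nv ''k'')))) ;;
    ns ''o'' (NAdd (nv ''o'') (nv ''L''))"

definition eval_row :: com where
  "eval_row = (rs ''r'' (RGet ''rhs'' (nv ''i'')) ;; ns ''o'' (NConst 0)) ;;
    For ''k'' (nv ''s'') (nv ''e'') eval_entry"

definition max_tangent :: com where
  "max_tangent = rs ''m'' (RConst 0) ;; For ''d'' (NConst 0) (nv ''L'')
    (rs ''v'' (RAdd (RGet ''lev'' (NAdd (nv ''o'') (nv ''d'')))
      (RMul (RGet ''sl'' (NAdd (nv ''o'') (nv ''d''))) (RSub (rv ''t'') (RGet ''bp'' (NAdd (nv ''o'') (nv ''d'')))))) ;;
     Cond (RLess (rv ''m'') (rv ''v'')) (rs ''m'' (rv ''v'')) Skip)"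

text \<open>The machine only has a floor, so the ceiling is the negated floor of the negation.
  \<open>top\<close> holds the least cost found so far.\<close>

definition finish_entry :: com where
  "finish_entry = (rs ''t'' (RDiv (rv ''r'') (RGet ''mat'' (nv ''k''))) ;;
    Cond (NLess (NConst 0) (NGet ''int'' (NGet ''col'' (nv ''k''))))
      (rs ''t'' (RSub (RConst 0) (RFloor (RSub (RConst 0) (rv ''t''))))) Skip ;;
    rs ''t'' (RAdd (RGet ''z'' (nv ''k'')) (rv ''t''))) ;;
    max_tangent ;;
    Cond (BAnd (BNot (RLess (RGet ''ub'' (NGet ''col'' (nv ''k''))) (rv ''t''))) (RLess (rv ''m'') (rv ''top'')))
      (rs ''top'' (rv ''m'')) Skip ;;
    ns ''o'' (NAdd (nv ''o'') (nv ''L''))"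

definition finish :: com where
  "finish = ns ''o'' (NConst 0) ;; For ''k'' (nv ''s'') (nv ''e'') finish_entry"

lemma offset_Suc: "s \<le> k \<Longrightarrow> (Suc k - s) * L = (k - s) * L + (L :: nat)"
  by (simp add: Suc_diff_le)

text \<open>\<open>h\<close> bounds the number of bisections in \<open>find_piece\<close>.\<close>

locale row_machine = row_levels "{s..<e}" L bp lev sl A u isint b
  for s e L :: nat and bp lev sl :: "nat \<Rightarrow> nat \<Rightarrow> real"
    and A u :: "nat \<Rightarrow> real" and isint :: "nat \<Rightarrow> bool" and b :: real +
  fixes i h :: nat
  assumes se: "s < e" and h: "L \<le> 2 ^ h"
begin

text \<open>The solver of a row sees the instance only through these values, so its correctness is
  proved without reference to \<open>P\<close>.\<close>

definition row_ok :: "memory \<Rightarrow> bool" where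
  "row_ok \<sigma> \<longleftrightarrow> nmem \<sigma> ''s'' 0 = s \<and> nmem \<sigma> ''e'' 0 = e \<and> nmem \<sigma> ''i'' 0 = i \<and> nmem \<sigma> ''L'' 0 = L \<and>
    (\<forall>k\<in>{s..<e}. \<forall>d<L. rmem \<sigma> ''bp'' ((k - s) * L + d) = bp k d \<and>
       rmem \<sigma> ''lev'' ((k - s) * L + d) = lev k d \<and> rmem \<sigma> ''sl'' ((k - s) * L + d) = sl k d) \<and>
    (\<forall>k\<in>{s..<e}. rmem \<sigma> ''mat'' k = A k \<and> rmem \<sigma> ''ub'' (nmem \<sigma> ''col'' k) = u k \<and>
       (0 < nmem \<sigma> ''int'' (nmem \<sigma> ''col'' k) \<longleftrightarrow> isint k)) \<and> rmem \<sigma> ''rhs'' i = b"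

lemma row_okD:
  assumes "row_ok \<sigma>"
  shows "nmem \<sigma> ''s'' 0 = s" "nmem \<sigma> ''e'' 0 = e" "nmem \<sigma> ''i'' 0 = i" "nmem \<sigma> ''L'' 0 = L"
    "k \<in> {s..<e} \<Longrightarrow> d < L \<Longrightarrow> rmem \<sigma> ''bp'' ((k - s) * L + d) = bp k d"
    "k \<in> {s..<e} \<Longrightarrow> d < L \<Longrightarrow> rmem \<sigma> ''lev'' ((k - s) * L + d) = lev k d"
    "k \<in> {s..<e} \<Longrightarrow> d < L \<Longrightarrow> rmem \<sigma> ''sl'' ((k - s) * L + d) = sl k d"
    "k \<in> {s..<e} \<Longrightarrow> rmem \<sigma> ''mat'' k = A k" "k \<in> {s..<e} \<Longrightarrow> rmem \<sigma> ''ub'' (nmem \<sigma> ''col'' k) = u k"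
    "k \<in> {s..<e} \<Longrightarrow> 0 < nmem \<sigma> ''int'' (nmem \<sigma> ''col'' k) \<longleftrightarrow> isint k" "rmem \<sigma> ''rhs'' i = b"
  using assms unfolding row_ok_def by simp_all

lemma row_ok_same:
  assumes "row_ok \<sigma>" "same N R \<sigma> \<tau>"
    "N \<inter> {''s'', ''e'', ''i'', ''L'', ''col'', ''int''} = {}" "R \<inter> {''bp'', ''lev'', ''sl'', ''mat'', ''ub'', ''rhs''} = {}"
  shows "row_ok \<tau>"
proof -
  have n: "a \<notin> N" if "a \<in> {''s'', ''e'', ''i'', ''L'', ''col'', ''int''}" for a
    using assms(3) that by blast
  have r: "a \<notin> R" if "a \<in> {''bp'', ''lev'', ''sl'', ''mat'', ''ub'', ''rhs''}" for a
    using assms(4) that by blast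
  show ?thesis using assms(1) unfolding row_ok_def
    by (simp add: same_nmem[OF assms(2)] same_rmem[OF assms(2)] n r)
qed

lemma reach_find_piece:
  assumes ok: "row_ok \<sigma>" and k: "k \<in> {s..<e}" and o: "nmem \<sigma> ''o'' 0 = (k - s) * L"
    and lv: "rmem \<sigma> ''lv'' 0 = B" "0 \<le> B"
  shows "reach find_piece \<sigma> (3 + h * 4) (\<lambda>\<tau>. nmem \<tau> ''a'' 0 < L \<and> lev k (nmem \<tau> ''a'' 0) \<le> B \<and>
     (Suc (nmem \<tau> ''a'' 0) < L \<longrightarrow> B < lev k (Suc (nmem \<tau> ''a'' 0))))"
proof -
  let ?c = "ns ''d'' (NHalf (NAdd (nv ''a'') (nv ''c''))) ;;
      Cond (RLess (rv ''lv'') (RGet ''lev'' (NAdd (nv ''o'') (nv ''d''))))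
        (ns ''c'' (nv ''d'')) (ns ''a'' (nv ''d''))"
  let ?b = "NLess (NAdd (nv ''a'') (NConst 1)) (nv ''c'')"
  let ?Q = "\<lambda>\<tau>. nmem \<tau> ''a'' 0 < L \<and> lev k (nmem \<tau> ''a'' 0) \<le> B \<and>
     (Suc (nmem \<tau> ''a'' 0) < L \<longrightarrow> B < lev k (Suc (nmem \<tau> ''a'' 0)))"
  let ?\<sigma> = "nput ''c'' 0 L (nput ''a'' 0 0 \<sigma>)"
  \<comment> \<open>Bisection with \<open>lev k a \<le> B < lev k c\<close>, where
    \<open>c = L\<close> stands for an infinite level.\<close>
  let ?I = "\<lambda>n \<tau>. nmem \<tau> ''a'' 0 < nmem \<tau> ''c'' 0 \<and> nmem \<tau> ''c'' 0 \<le> L \<and> lev k (nmem \<tau> ''a'' 0) \<le> B \<and>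
     (nmem \<tau> ''c'' 0 < L \<longrightarrow> B < lev k (nmem \<tau> ''c'' 0)) \<and> nmem \<tau> ''c'' 0 - nmem \<tau> ''a'' 0 \<le> 2 ^ n"
  have loop: "reach (While ?b ?c) ?\<sigma> (1 + h * (1 + 3)) ?Q"
  proof (rule reach_While[where I = ?I])
    show "?I h ?\<sigma>" using L lv lev0[OF k] h by simp
  next
    fix n \<tau> assume I: "?I n \<tau>" and sm: "same (nwrites ?c) (rwrites ?c) ?\<sigma> \<tau>" and b: "bval ?b \<tau>"
    have sm': "same {''a'', ''c'', ''d''} {} \<sigma> \<tau>" using sm by (auto simp: same_def)
    note S = same_nmem[OF sm'] same_rmem[OF sm']
    define a c where "a = nmem \<tau> ''a'' 0" and "c = nmem \<tau> ''c'' 0"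
    note I = I[folded a_def c_def]
    have ac: "a + 1 < c" using b by (simp add: a_def c_def)
    have n: "0 < n"
    proof (rule ccontr)
      assume "\<not> 0 < n"
      then have "c - a \<le> 1" using I by simp
      then show False using ac by arith
    qed
    then obtain n' where n': "n = Suc n'" by (cases n) auto
    let ?d = "(a + c) div 2"
    have d: "a < ?d" "?d < c" "?d < L" "c - ?d \<le> 2 ^ n'" "?d - a \<le> 2 ^ n'"
      using ac I unfolding n' by auto
    have lev: "rmem \<sigma> ''lev'' ((k - s) * L + ?d) = lev k ?d" using row_okD(6)[OF ok k d(3)] .
    have "reach ?c \<tau> 3 (?I (n - 1))"
    proof (rule reach_run)
      show "?I (n - 1) (run ?c \<tau>)"
      proof (cases "B < lev k ?d")
        case True
        then have "run ?c \<tau> = nput ''c'' 0 ?d (nput ''d'' 0 ?d \<tau>)"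
          by (simp add: S o lv a_def[symmetric] c_def[symmetric] lev)
        then show ?thesis using True d I by (simp add: n' a_def[symmetric])
      next
        case False
        then have "run ?c \<tau> = nput ''a'' 0 ?d (nput ''d'' 0 ?d \<tau>)"
          by (simp add: S o lv a_def[symmetric] c_def[symmetric] lev)
        then show ?thesis using False d I by (simp add: n' c_def[symmetric])
      qed
    qed simp_all
    then show "0 < n \<and> reach ?c \<tau> 3 (?I (n - 1))" using n by simp
  next
    fix n \<tau> assume I: "?I n \<tau>" and b: "\<not> bval ?b \<tau>"
    then have "nmem \<tau> ''c'' 0 = Suc (nmem \<tau> ''a'' 0)" by simp
    then show "?Q \<tau>" using I by simp
  qed
  show ?thesis unfolding find_piece_def
    by (rule reach_Seq_run[where U = "1 + h * (1 + 3)"]) (use loop row_okD(4)[OF ok] in simp_all)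
qed

lemma nwrites_find_piece [simp]: "nwrites find_piece = {''a'', ''c'', ''d''}" "rwrites find_piece = {}"
  by (auto simp: find_piece_def)

lemma reach_eval_entry:
  assumes ok: "row_ok \<sigma>" and k: "k \<in> {s..<e}" "nmem \<sigma> ''k'' 0 = k" and o: "nmem \<sigma> ''o'' 0 = (k - s) * L"
    and lv: "rmem \<sigma> ''lv'' 0 = B" "0 \<le> B"
  shows "reach eval_entry \<sigma> (11 + h * 4) (\<lambda>\<tau>. rmem \<tau> ''x'' = (rmem \<sigma> ''x'')(k := lvl k B) \<and>
     rmem \<tau> ''z'' = (rmem \<sigma> ''z'')(k := units k (lvl k B)) \<and>
     rmem \<tau> ''r'' 0 = rmem \<sigma> ''r'' 0 - A k * units k (lvl k B) \<and> nmem \<tau> ''o'' 0 = (Suc k - s) * L)"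
  unfolding eval_entry_def
proof (rule reach_conseq[OF reach_Seq])
  let ?P = "\<lambda>\<tau>. same {''a'', ''c'', ''d''} {} \<sigma> \<tau> \<and> nmem \<tau> ''a'' 0 < L \<and> lev k (nmem \<tau> ''a'' 0) \<le> B \<and>
     (Suc (nmem \<tau> ''a'' 0) < L \<longrightarrow> B < lev k (Suc (nmem \<tau> ''a'' 0)))"
  let ?rest = "Cond (RLess (RConst 0) (RGet ''sl'' (NAdd (nv ''o'') (nv ''a''))))
      (RPut ''x'' (nv ''k'') (RAdd (RGet ''bp'' (NAdd (nv ''o'') (nv ''a'')))
        (RDiv (RSub (rv ''lv'') (RGet ''lev'' (NAdd (nv ''o'') (nv ''a'')))) (RGet ''sl'' (NAdd (nv ''o'') (nv ''a''))))))
      (RPut ''x'' (nv ''k'') (RGet ''ub'' (NGet ''col'' (nv ''k'')))) ;;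
    Cond (RLess (RGet ''ub'' (NGet ''col'' (nv ''k''))) (RGet ''x'' (nv ''k'')))
      (RPut ''z'' (nv ''k'') (RGet ''ub'' (NGet ''col'' (nv ''k''))))
      (RPut ''z'' (nv ''k'') (RGet ''x'' (nv ''k''))) ;;
    Cond (NLess (NConst 0) (NGet ''int'' (NGet ''col'' (nv ''k''))))
      (RPut ''z'' (nv ''k'') (RFloor (RGet ''z'' (nv ''k'')))) Skip ;;
    rs ''r'' (RSub (rv ''r'') (RMul (RGet ''mat'' (nv ''k'')) (RGet ''z'' (nv ''k'')))) ;;
    ns ''o'' (NAdd (nv ''o'') (nv ''L''))"
  let ?Q = "\<lambda>\<tau>. rmem \<tau> ''x'' = (rmem \<sigma> ''x'')(k := lvl k B) \<and>
     rmem \<tau> ''z'' = (rmem \<sigma> ''z'')(k := units k (lvl k B)) \<and>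
     rmem \<tau> ''r'' 0 = rmem \<sigma> ''r'' 0 - A k * units k (lvl k B) \<and> nmem \<tau> ''o'' 0 = (Suc k - s) * L"
  have "reach find_piece \<sigma> (3 + h * 4) ?P"
    by (rule reach_conseq[OF reach_same[OF reach_find_piece[OF ok k(1) o lv]]]) auto
  then show "reach find_piece \<sigma> (3 + h * 4) (\<lambda>\<tau>. reach ?rest \<tau> 8 ?Q)"
  proof (rule reach_conseq)
    fix \<tau> assume P: "?P \<tau>"
    define q where "q = nmem \<tau> ''a'' 0"
    have q: "q < L" "lev k q \<le> B" "Suc q < L \<Longrightarrow> B < lev k (Suc q)" using P by (auto simp: q_def)
    have sm: "same {''a'', ''c'', ''d''} {} \<sigma> \<tau>" using P by blast
    note S = same_nmem[OF sm] same_rmem[OF sm]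
    have isn: "nmem \<sigma> ''int'' (nmem \<sigma> ''col'' k) = 0 \<longleftrightarrow> \<not> isint k" using row_okD(10)[OF ok k(1)] by auto
    have off: "(Suc k - s) * L = (k - s) * L + L" by (rule offset_Suc) (use k in simp)
    show "reach ?rest \<tau> 8 ?Q"
      by (rule reach_run)
        (simp_all add: S o lv(1) k(2) row_okD(4)[OF ok] row_okD(5-7)[OF ok k(1) q(1)] row_okD(8-10)[OF ok k(1)] isn
          q_def[symmetric] off units_def min_def lvl_piece[OF k(1) q])
  qed simp
qed auto

lemma nwrites_eval_entry [simp]: "nwrites eval_entry = {''a'', ''c'', ''d'', ''o''}" "rwrites eval_entry = {''x'', ''z'', ''r''}"
  by (auto simp: eval_entry_def)

lemma nwrites_eval_row [simp]: "nwrites eval_row = {''k'', ''a'', ''c'', ''d'', ''o''}" "rwrites eval_row = {''x'', ''z'', ''r''}"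
  by (auto simp: eval_row_def)

lemma reach_eval_row:
  assumes ok: "row_ok \<sigma>" and lv: "rmem \<sigma> ''lv'' 0 = B" "0 \<le> B"
  shows "reach eval_row \<sigma> (4 + (e - s) * (13 + h * 4)) (\<lambda>\<tau>.
     same {''k'', ''a'', ''c'', ''d'', ''o''} {''x'', ''z'', ''r''} \<sigma> \<tau> \<and>
     (\<forall>k. rmem \<tau> ''x'' k = (if k \<in> {s..<e} then lvl k B else rmem \<sigma> ''x'' k)) \<and>
     (\<forall>k\<in>{s..<e}. rmem \<tau> ''z'' k = units k (lvl k B)) \<and> rmem \<tau> ''r'' 0 = b - covered B)"
proof -
  let ?I = "\<lambda>k \<tau>. nmem \<tau> ''o'' 0 = (k - s) * L \<and>
     (\<forall>k'. rmem \<tau> ''x'' k' = (if k' \<in> {s..<k} then lvl k' B else rmem \<sigma> ''x'' k')) \<and>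
     (\<forall>k'\<in>{s..<k}. rmem \<tau> ''z'' k' = units k' (lvl k' B)) \<and>
     rmem \<tau> ''r'' 0 = b - (\<Sum>k'\<in>{s..<k}. A k' * units k' (lvl k' B))"
  let ?Q = "\<lambda>\<tau>. (\<forall>k. rmem \<tau> ''x'' k = (if k \<in> {s..<e} then lvl k B else rmem \<sigma> ''x'' k)) \<and>
     (\<forall>k\<in>{s..<e}. rmem \<tau> ''z'' k = units k (lvl k B)) \<and> rmem \<tau> ''r'' 0 = b - covered B"
  let ?\<sigma> = "nput ''o'' 0 0 (rput ''r'' 0 b \<sigma>)"
  have loop: "reach (For ''k'' (nv ''s'') (nv ''e'') eval_entry) ?\<sigma> (2 + (e - s) * (2 + (11 + h * 4))) ?Q"
  proof (rule reach_For[where I = ?I])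
    show "nval (nv ''e'') \<tau> = e" if "same (insert ''k'' (nwrites eval_entry)) (rwrites eval_entry) ?\<sigma> \<tau>" for \<tau>
      using row_okD(2)[OF ok] that by (simp add: same_def)
  next
    fix k \<tau> assume k: "s \<le> k" "k < e" "nmem \<tau> ''k'' 0 = k"
      and sm: "same (insert ''k'' (nwrites eval_entry)) (rwrites eval_entry) ?\<sigma> \<tau>" and I: "?I k \<tau>"
    have sm': "same {''k'', ''a'', ''c'', ''d'', ''o''} {''x'', ''z'', ''r''} \<sigma> \<tau>"
      using sm by (auto simp: same_def)
    have ok': "row_ok \<tau>" by (rule row_ok_same[OF ok sm']) auto
    have k': "k \<in> {s..<e}" using k by simp
    have lv': "rmem \<tau> ''lv'' 0 = B" using sm' lv by (simp add: same_def)
    have fr: "{s..<Suc k} = insert k {s..<k}" using k by auto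
    show "reach eval_entry \<tau> (11 + h * 4) (\<lambda>\<tau>'. same (nwrites eval_entry) (rwrites eval_entry) \<tau> \<tau>' \<longrightarrow> ?I (Suc k) (nput ''k'' 0 (Suc k) \<tau>'))"
      by (rule reach_conseq[OF reach_eval_entry[OF ok' k' k(3) _ lv' lv(2)]]) (use I in \<open>simp_all add: fr\<close>)
  next
    show "nval (nv ''s'') ?\<sigma> = s" "s \<le> e" using row_okD(1)[OF ok] se by simp_all
    show "?Q \<tau>" if "?I e \<tau>" for \<tau> using that by (simp add: covered_def)
  qed simp_all
  have "reach eval_row \<sigma> (2 + (2 + (e - s) * (2 + (11 + h * 4)))) ?Q"
    unfolding eval_row_def
    by (rule reach_Seq_run[where U = "2 + (e - s) * (2 + (11 + h * 4))"]) (use loop row_okD(3,11)[OF ok] in simp_all)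
  from reach_same[OF this] show ?thesis by (rule reach_conseq) auto
qed

lemma nwrites_max_tangent [simp]: "nwrites max_tangent = {''d''}" "rwrites max_tangent = {''m'', ''v''}"
  by (auto simp: max_tangent_def)

text \<open>The running maximum may start at 0 because \<open>cst k\<close> is non-negative at
  non-negative arguments.\<close>

lemma reach_max_tangent:
  assumes ok: "row_ok \<sigma>" and k: "k \<in> {s..<e}" and o: "nmem \<sigma> ''o'' 0 = (k - s) * L"
    and t: "0 \<le> rmem \<sigma> ''t'' 0"
  shows "reach max_tangent \<sigma> (3 + L * 5) (\<lambda>\<tau>. same {''d''} {''m'', ''v''} \<sigma> \<tau> \<and> rmem \<tau> ''m'' 0 = cst k (rmem \<sigma> ''t'' 0))"
proof -
  define t where "t = rmem \<sigma> ''t'' 0"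
  let ?c = "rs ''v'' (RAdd (RGet ''lev'' (NAdd (nv ''o'') (nv ''d'')))
      (RMul (RGet ''sl'' (NAdd (nv ''o'') (nv ''d''))) (RSub (rv ''t'') (RGet ''bp'' (NAdd (nv ''o'') (nv ''d'')))))) ;;
     Cond (RLess (rv ''m'') (rv ''v'')) (rs ''m'' (rv ''v'')) Skip"
  let ?I = "\<lambda>d \<tau>. 0 \<le> rmem \<tau> ''m'' 0 \<and> (\<forall>d'<d. tang k d' t \<le> rmem \<tau> ''m'' 0) \<and>
    (rmem \<tau> ''m'' 0 = 0 \<or> (\<exists>d'<d. rmem \<tau> ''m'' 0 = tang k d' t))"
  have fin: "rmem \<tau> ''m'' 0 = cst k t" if "?I L \<tau>" for \<tau>
  proof (rule antisym)
    show "rmem \<tau> ''m'' 0 \<le> cst k t"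
      using that cst_nonneg[OF k, of t] assms(4) tang_le_cst[of _ k t] by (auto simp: t_def)
    show "cst k t \<le> rmem \<tau> ''m'' 0"
      using that unfolding cst_le_iff by blast
  qed
  have loop: "reach (For ''d'' (NConst 0) (nv ''L'') ?c) (rput ''m'' 0 0 \<sigma>) (2 + (L - 0) * (2 + 3)) (\<lambda>\<tau>. rmem \<tau> ''m'' 0 = cst k t)"
  proof (rule reach_For[where I = ?I])
    fix d \<tau> assume d: "d < L" "nmem \<tau> ''d'' 0 = d"
      and sm: "same (insert ''d'' (nwrites ?c)) (rwrites ?c) (rput ''m'' 0 0 \<sigma>) \<tau>" and I: "?I d \<tau>"
    have sm': "same {''d''} {''m'', ''v''} \<sigma> \<tau>" using sm by (auto simp: same_def)
    note S = same_nmem[OF sm'] same_rmem[OF sm']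
    define v where "v = tang k d t"
    have v: "lev k d + sl k d * (t - bp k d) = v" by (simp add: v_def tang_def)
    have I': "0 \<le> max (rmem \<tau> ''m'' 0) v" "\<forall>d'<Suc d. tang k d' t \<le> max (rmem \<tau> ''m'' 0) v"
      "max (rmem \<tau> ''m'' 0) v = 0 \<or> (\<exists>d'<Suc d. max (rmem \<tau> ''m'' 0) v = tang k d' t)"
      using I by (auto simp: v_def less_Suc_eq max_def)
    have r: "rmem (run ?c \<tau>) ''m'' 0 = max (rmem \<tau> ''m'' 0) v"
      by (simp add: S o d row_okD(5-7)[OF ok k d(1)] t_def[symmetric] v)
    show "reach ?c \<tau> 3 (\<lambda>\<tau>'. same (nwrites ?c) (rwrites ?c) \<tau> \<tau>' \<longrightarrow> ?I (Suc d) (nput ''d'' 0 (Suc d) \<tau>'))"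
      by (rule reach_run) (use I' in \<open>simp_all only: rmem_nput r nmem_nput\<close>, simp_all)
  next
    show "\<And>\<tau>. same (insert ''d'' (nwrites ?c)) (rwrites ?c) (rput ''m'' 0 0 \<sigma>) \<tau> \<Longrightarrow> nval (nv ''L'') \<tau> = L"
      using row_okD(4)[OF ok] by (simp add: same_def)
    show "rmem \<tau> ''m'' 0 = cst k t" if "?I L \<tau>" for \<tau>
      using fin that by blast
  qed simp_all
  have "reach max_tangent \<sigma> (1 + (2 + (L - 0) * (2 + 3))) (\<lambda>\<tau>. rmem \<tau> ''m'' 0 = cst k t)"
    unfolding max_tangent_def by (rule reach_Seq_run[where U = "2 + (L - 0) * (2 + 3)"]) (use loop in simp_all)
  from reach_same[OF this] show ?thesis by (rule reach_conseq) (auto simp: t_def)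
qed

lemma nwrites_finish [simp]: "nwrites finish_entry = {''d'', ''o''}" "rwrites finish_entry = {''t'', ''m'', ''v'', ''top''}"
  "nwrites finish = {''d'', ''o'', ''k''}" "rwrites finish = {''t'', ''m'', ''v'', ''top''}"
  by (auto simp: finish_entry_def finish_def)

end

subsection \<open>Merge sort\<close>

text \<open>\<open>x div w\<close> numbers the aligned blocks of length \<open>w\<close>, the last
  of which may be incomplete. One condition thus covers the sorted runs before and after every round
  of merging.\<close>

definition bsorted :: "nat \<Rightarrow> nat \<Rightarrow> (nat \<Rightarrow> real) \<Rightarrow> bool" where
  "bsorted w n f \<longleftrightarrow> (\<forall>x y. x \<le> y \<longrightarrow> y < n \<longrightarrow> x div w = y div w \<longrightarrow> f x \<le> f y)"

text \<open>With truncated subtraction, \<open>y - (y - x)\<close> is the minimum of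
  \<open>x\<close> and \<open>y\<close>. A new pair of blocks is opened only when \<open>k\<close>
  has reached the end of the previous pair, so a single loop over the positions suffices.\<close>

definition merge_setup :: com where
  "merge_setup = Cond (NLess (nv ''k'') (nv ''en'')) Skip
     (ns ''b'' (nv ''k'') ;;
      ns ''mid'' (NSub (nv ''y'') (NSub (nv ''y'') (NAdd (nv ''k'') (nv ''w'')))) ;;
      ns ''en'' (NSub (nv ''y'') (NSub (nv ''y'') (NAdd (nv ''k'') (NAdd (nv ''w'') (nv ''w''))))) ;;
      ns ''p'' (nv ''k'') ;; ns ''q'' (nv ''mid''))"

definition merge_pick :: com where
  "merge_pick = Cond (BAnd (NLess (nv ''p'') (nv ''mid'')) (BNot (BAnd (NLess (nv ''q'') (nv ''en''))
        (RLess (RGet ''key'' (nv ''q'')) (RGet ''key'' (nv ''p''))))))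
      (RPut ''tmp'' (nv ''k'') (RGet ''key'' (nv ''p'')) ;; ns ''p'' (NAdd (nv ''p'') (NConst 1)))
      (RPut ''tmp'' (nv ''k'') (RGet ''key'' (nv ''q'')) ;; ns ''q'' (NAdd (nv ''q'') (NConst 1)))"

definition merge_step :: com where
  "merge_step = merge_setup ;; merge_pick"

definition merge_pass :: com where
  "merge_pass = ns ''en'' (NConst 0) ;; For ''k'' (NConst 0) (nv ''y'') merge_step ;;
    For ''k'' (NConst 0) (nv ''y'') (RPut ''key'' (nv ''k'') (RGet ''tmp'' (nv ''k''))) ;;
    ns ''w'' (NAdd (nv ''w'') (nv ''w''))"

definition merge_sort :: com where
  "merge_sort = ns ''w'' (nv ''L'') ;; While (NLess (nv ''w'') (nv ''y'')) merge_pass"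

context
  fixes key :: "nat \<Rightarrow> real" and w n :: nat
  assumes w: "0 < w" and key: "bsorted w n key"
begin

text \<open>The state between two pairs of blocks. Keys are compared as sets, not as multisets,
  because the search only asks which values occur.\<close>

definition merged :: "nat \<Rightarrow> (nat \<Rightarrow> real) \<Rightarrow> bool" where
  "merged k tmp \<longleftrightarrow> k \<le> n \<and> (k = n \<or> 2 * w dvd k) \<and> tmp ` {..<k} = key ` {..<k} \<and> bsorted (2 * w) k tmp"

text \<open>The state inside a pair of blocks. The last conjunct keeps what has been written below
  what is left, so that the smaller head can be appended without breaking the order.\<close>

definition merging :: "nat \<Rightarrow> nat \<Rightarrow> nat \<Rightarrow> nat \<Rightarrow> nat \<Rightarrow> nat \<Rightarrow> (nat \<Rightarrow> real) \<Rightarrow> bool" where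
  "merging k b mid en p q tmp \<longleftrightarrow> 2 * w dvd b \<and> mid = min n (b + w) \<and> en = min n (b + 2 * w) \<and>
     b \<le> p \<and> p \<le> mid \<and> mid \<le> q \<and> q \<le> en \<and> (p - b) + (q - mid) + b = k \<and>
     tmp ` {..<k} = key ` ({..<p} \<union> {mid..<q}) \<and> bsorted (2 * w) b tmp \<and>
     (\<forall>x y. b \<le> x \<longrightarrow> x \<le> y \<longrightarrow> y < k \<longrightarrow> tmp x \<le> tmp y) \<and>
     (\<forall>x y. b \<le> x \<longrightarrow> x < k \<longrightarrow> y \<in> {p..<mid} \<union> {q..<en} \<longrightarrow> tmp x \<le> key y)"

lemma mergingD:
  assumes "merging k b mid en p q tmp"
  shows "2 * w dvd b" "mid = min n (b + w)" "en = min n (b + 2 * w)"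
    "b \<le> p" "p \<le> mid" "mid \<le> q" "q \<le> en" "(p - b) + (q - mid) + b = k"
    "tmp ` {..<k} = key ` ({..<p} \<union> {mid..<q})" "bsorted (2 * w) b tmp"
    "\<forall>x y. b \<le> x \<longrightarrow> x \<le> y \<longrightarrow> y < k \<longrightarrow> tmp x \<le> tmp y"
    "\<forall>x y. b \<le> x \<longrightarrow> x < k \<longrightarrow> y \<in> {p..<mid} \<union> {q..<en} \<longrightarrow> tmp x \<le> key y"
  by (insert assms[unfolded merging_def], elim conjE, assumption)+

lemma merging_init:
  assumes "merged k tmp" "k < n"
  shows "merging k k (min n (k + w)) (min n (k + 2 * w)) k (min n (k + w)) tmp"
  using assms w unfolding merged_def merging_def by auto

lemma div_block: "2 * w dvd b \<Longrightarrow> b \<le> x \<Longrightarrow> x < b + w \<Longrightarrow> x div w = b div w"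
  "2 * w dvd b \<Longrightarrow> b + w \<le> x \<Longrightarrow> x < b + 2 * w \<Longrightarrow> x div w = b div w + 1"
  "2 * w dvd b \<Longrightarrow> b \<le> x \<Longrightarrow> x < b + 2 * w \<Longrightarrow> x div (2 * w) = b div (2 * w)"
proof -
  assume b: "2 * w dvd b"
  then obtain t where t: "b = 2 * w * t" by blast
  have bw: "b div w = 2 * t" "b div (2 * w) = t" using w by (auto simp: t)
  show "b \<le> x \<Longrightarrow> x < b + w \<Longrightarrow> x div w = b div w"
    unfolding bw by (rule div_nat_eqI) (auto simp: t algebra_simps)
  show "b + w \<le> x \<Longrightarrow> x < b + 2 * w \<Longrightarrow> x div w = b div w + 1"
    unfolding bw by (rule div_nat_eqI) (auto simp: t algebra_simps)
  show "b \<le> x \<Longrightarrow> x < b + 2 * w \<Longrightarrow> x div (2 * w) = b div (2 * w)"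
    unfolding bw by (rule div_nat_eqI) (auto simp: t algebra_simps)
qed

lemma merging_sorted:
  assumes "merging k b mid en p q tmp"
  shows "p \<le> x \<Longrightarrow> x \<le> y \<Longrightarrow> y < mid \<Longrightarrow> key x \<le> key y" "q \<le> x \<Longrightarrow> x \<le> y \<Longrightarrow> y < en \<Longrightarrow> key x \<le> key y"
proof -
  have b: "2 * w dvd b" "mid = min n (b + w)" "en = min n (b + 2 * w)" "b \<le> p" "mid \<le> q"
    using mergingD[OF assms] by blast+
  show "p \<le> x \<Longrightarrow> x \<le> y \<Longrightarrow> y < mid \<Longrightarrow> key x \<le> key y"
    using key[unfolded bsorted_def, rule_format, of x y] div_block(1)[OF b(1), of x] div_block(1)[OF b(1), of y] b by auto
  show "q \<le> x \<Longrightarrow> x \<le> y \<Longrightarrow> y < en \<Longrightarrow> key x \<le> key y"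
    using key[unfolded bsorted_def, rule_format, of x y] div_block(2)[OF b(1), of x] div_block(2)[OF b(1), of y] b by auto
qed

lemma upd_image_lessThan: "(f(k := v)) ` {..<Suc k} = insert v (f ` {..<k :: nat})"
  by (auto simp: lessThan_Suc)

lemma merging_left:
  assumes M: "merging k b mid en p q tmp" and p: "p < mid" and le: "q < en \<Longrightarrow> key p \<le> key q"
  shows "merging (Suc k) b mid en (Suc p) q (tmp(k := key p))"
proof -
  note d = mergingD(1-10)[OF M] mergingD(11,12)[OF M, rule_format]
  \<comment> \<open>\<open>p\<close> holds the least key that is left: in its own block by order, in
    the other one by comparison with its head.\<close>
  have key': "key p \<le> key y" if "y \<in> {p..<mid} \<union> {q..<en}" for y
  proof (cases "y \<in> {p..<mid}")
    case True
    then show ?thesis using merging_sorted(1)[OF M, of p y] by simp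
  next
    case False
    then have y: "q \<le> y" "y < en" using that by auto
    then have "key p \<le> key q" using le by simp
    also have "key q \<le> key y" using merging_sorted(2)[OF M, of q y] y by simp
    finally show ?thesis .
  qed
  have bk: "b \<le> k" using d(8) by simp
  have bs: "bsorted (2 * w) b (tmp(k := key p))" using d(10) bk unfolding bsorted_def by auto
  have se: "{..<Suc p} \<union> {mid..<q} = insert p ({..<p} \<union> {mid..<q})" by auto
  have img: "(tmp(k := key p)) ` {..<Suc k} = key ` ({..<Suc p} \<union> {mid..<q})"
    unfolding upd_image_lessThan d(9) se by simp
  have cnt: "(Suc p - b) + (q - mid) + b = Suc k" using d(4-8) by arith
  have s1: "\<forall>x y. b \<le> x \<longrightarrow> x \<le> y \<longrightarrow> y < Suc k \<longrightarrow> (tmp(k := key p)) x \<le> (tmp(k := key p)) y"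
  proof (intro allI impI)
    fix x y assume "b \<le> x" "x \<le> y" "y < Suc k"
    then show "(tmp(k := key p)) x \<le> (tmp(k := key p)) y"
      using d(11)[of x y] d(12)[of x p] p by (cases "y = k"; cases "x = k") auto
  qed
  have s2: "\<forall>x y. b \<le> x \<longrightarrow> x < Suc k \<longrightarrow> y \<in> {Suc p..<mid} \<union> {q..<en} \<longrightarrow> (tmp(k := key p)) x \<le> key y"
  proof (intro allI impI)
    fix x y assume "b \<le> x" "x < Suc k" "y \<in> {Suc p..<mid} \<union> {q..<en}"
    then show "(tmp(k := key p)) x \<le> key y"
      using d(12)[of x y] key'[of y] by (cases "x = k") auto
  qed
  show ?thesis unfolding merging_def
    by (intro conjI d(1-3) img cnt bs s1 s2) (use d(4-7) p in simp_all)
qed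

lemma merging_right:
  assumes M: "merging k b mid en p q tmp" and q: "q < en" and le: "p < mid \<Longrightarrow> key q \<le> key p"
  shows "merging (Suc k) b mid en p (Suc q) (tmp(k := key q))"
proof -
  note d = mergingD(1-10)[OF M] mergingD(11,12)[OF M, rule_format]
  have key': "key q \<le> key y" if "y \<in> {p..<mid} \<union> {q..<en}" for y
  proof (cases "y \<in> {q..<en}")
    case True
    then show ?thesis using merging_sorted(2)[OF M, of q y] by simp
  next
    case False
    then have y: "p \<le> y" "y < mid" using that by auto
    then have "key q \<le> key p" using le by simp
    also have "key p \<le> key y" using merging_sorted(1)[OF M, of p y] y by simp
    finally show ?thesis .
  qed
  have bk: "b \<le> k" using d(8) by simp
  have bs: "bsorted (2 * w) b (tmp(k := key q))" using d(10) bk unfolding bsorted_def by auto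
  have se: "{..<p} \<union> {mid..<Suc q} = insert q ({..<p} \<union> {mid..<q})" using d(6) by auto
  have img: "(tmp(k := key q)) ` {..<Suc k} = key ` ({..<p} \<union> {mid..<Suc q})"
    unfolding upd_image_lessThan d(9) se by simp
  have cnt: "(p - b) + (Suc q - mid) + b = Suc k" using d(4-8) by arith
  have s1: "\<forall>x y. b \<le> x \<longrightarrow> x \<le> y \<longrightarrow> y < Suc k \<longrightarrow> (tmp(k := key q)) x \<le> (tmp(k := key q)) y"
  proof (intro allI impI)
    fix x y assume "b \<le> x" "x \<le> y" "y < Suc k"
    then show "(tmp(k := key q)) x \<le> (tmp(k := key q)) y"
      using d(11)[of x y] d(12)[of x q] q by (cases "y = k"; cases "x = k") auto
  qed
  have s2: "\<forall>x y. b \<le> x \<longrightarrow> x < Suc k \<longrightarrow> y \<in> {p..<mid} \<union> {Suc q..<en} \<longrightarrow> (tmp(k := key q)) x \<le> key y"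
  proof (intro allI impI)
    fix x y assume "b \<le> x" "x < Suc k" "y \<in> {p..<mid} \<union> {Suc q..<en}"
    then show "(tmp(k := key q)) x \<le> key y"
      using d(12)[of x y] key'[of y] by (cases "x = k") auto
  qed
  show ?thesis unfolding merging_def
    by (intro conjI d(1-3) img cnt bs s1 s2) (use d(4-7) q in simp_all)
qed

lemma merging_done:
  assumes M: "merging k b mid en p q tmp" and k: "k = en"
  shows "merged k tmp"
proof -
  note d = mergingD(1-10)[OF M] mergingD(11,12)[OF M, rule_format]
  have pq: "p = mid" "q = en" using d k by auto
  then have "{..<p} \<union> {mid..<q} = {..<k}" using d(7) d(6) k by auto
  moreover have "bsorted (2 * w) k tmp"
    unfolding bsorted_def
  proof (intro allI impI)
    fix x y assume xy: "x \<le> y" "y < k" "x div (2 * w) = y div (2 * w)"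
    show "tmp x \<le> tmp y"
    proof (cases "b \<le> x")
      case False
      \<comment> \<open>\<open>b\<close> is a multiple of the new block length, so a position before
        it shares no block with a position from \<open>b\<close> on.\<close>
      have "y < b"
      proof (rule ccontr)
        assume "\<not> y < b"
        then have "y div (2 * w) = b div (2 * w)" using div_block(3)[OF d(1), of y] xy d(3) k by simp
        moreover have "x div (2 * w) < b div (2 * w)"
          using False d(1) w by (simp add: div_less_iff_less_mult)
        ultimately show False using xy by simp
      qed
      then show ?thesis using d(10) xy unfolding bsorted_def by blast
    qed (use d(11) xy in auto)
  qed
  ultimately show ?thesis using d(1,3,9) k unfolding merged_def by (auto simp: min_def split: if_splits)
qed

end

lemma reach_merge_step:
  assumes w: "0 < w" and key: "bsorted w n key" and k: "k < n"
    and m: "nmem \<sigma> ''k'' 0 = k" "nmem \<sigma> ''y'' 0 = n" "nmem \<sigma> ''w'' 0 = w" "rmem \<sigma> ''key'' = key"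
    and I: "nmem \<sigma> ''en'' 0 \<le> k \<and> merged key w n k (rmem \<sigma> ''tmp'') \<or> k < nmem \<sigma> ''en'' 0 \<and>
      merging key w n k (nmem \<sigma> ''b'' 0) (nmem \<sigma> ''mid'' 0) (nmem \<sigma> ''en'' 0) (nmem \<sigma> ''p'' 0) (nmem \<sigma> ''q'' 0) (rmem \<sigma> ''tmp'')"
  shows "reach merge_step \<sigma> 9 (\<lambda>\<tau>. nmem \<tau> ''en'' 0 \<le> Suc k \<and> merged key w n (Suc k) (rmem \<tau> ''tmp'') \<or> Suc k < nmem \<tau> ''en'' 0 \<and>
      merging key w n (Suc k) (nmem \<tau> ''b'' 0) (nmem \<tau> ''mid'' 0) (nmem \<tau> ''en'' 0) (nmem \<tau> ''p'' 0) (nmem \<tau> ''q'' 0) (rmem \<tau> ''tmp''))"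
proof -
  define \<tau> where "\<tau> = (if k < nmem \<sigma> ''en'' 0 then \<sigma> else
    nput ''q'' 0 (min n (k + w)) (nput ''p'' 0 k (nput ''en'' 0 (min n (k + 2 * w)) (nput ''mid'' 0 (min n (k + w)) (nput ''b'' 0 k \<sigma>)))))"
  define b mid en p q tmp where "b = nmem \<tau> ''b'' 0" "mid = nmem \<tau> ''mid'' 0" "en = nmem \<tau> ''en'' 0"
    "p = nmem \<tau> ''p'' 0" "q = nmem \<tau> ''q'' 0" "tmp = rmem \<tau> ''tmp''"
  note defs = this
  have mn: "n - (n - x) = min n x" for x by auto
  have M: "merging key w n k b mid en p q tmp" and ken: "k < en"
    using I merging_init[OF w key, of k "rmem \<sigma> ''tmp''"] k w by (auto simp: defs \<tau>_def)
  define left where "left \<longleftrightarrow> p < mid \<and> \<not> (q < en \<and> key q < key p)"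
  define tmp' p' q' where "tmp' = tmp(k := if left then key p else key q)" "p' = (if left then Suc p else p)" "q' = (if left then q else Suc q)"
  note defs' = this
  have r: "run merge_step \<sigma> = (if left then nput ''p'' 0 (Suc p) (rput ''tmp'' k (key p) \<tau>) else nput ''q'' 0 (Suc q) (rput ''tmp'' k (key q) \<tau>))"
  proof -
    have "run merge_setup \<sigma> = \<tau>"
      unfolding merge_setup_def \<tau>_def by (simp add: m mn mult_2)
    moreover have "nmem \<tau> ''k'' 0 = k" "rmem \<tau> ''key'' = key" by (auto simp: \<tau>_def m)
    then have "run merge_pick \<tau> = (if left then nput ''p'' 0 (Suc p) (rput ''tmp'' k (key p) \<tau>) else nput ''q'' 0 (Suc q) (rput ''tmp'' k (key q) \<tau>))"
      unfolding merge_pick_def by (auto simp: left_def defs)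
    ultimately show ?thesis by (simp add: merge_step_def)
  qed
  have M': "merging key w n (Suc k) b mid en p' q' tmp'"
  proof (cases left)
    case True
    then show ?thesis using merging_left[OF w key M] unfolding defs' left_def by auto
  next
    case False
    have "(p - b) + (q - mid) + b = k" "b \<le> p" "p \<le> mid" "mid \<le> q" "q \<le> en"
      using mergingD(4-8)[OF w key M] by blast+
    then have "q < en" using ken False by (cases "p < mid") (auto simp: left_def)
    then show ?thesis using False merging_right[OF w key M] unfolding defs' left_def by auto
  qed
  have f: "nmem (run merge_step \<sigma>) ''en'' 0 = en" "nmem (run merge_step \<sigma>) ''mid'' 0 = mid" "nmem (run merge_step \<sigma>) ''b'' 0 = b"
    "nmem (run merge_step \<sigma>) ''p'' 0 = p'" "nmem (run merge_step \<sigma>) ''q'' 0 = q'" "rmem (run merge_step \<sigma>) ''tmp'' = tmp'"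
    unfolding r by (simp_all add: defs defs')
  show ?thesis
  proof (rule reach_run)
    show "loopfree merge_step" "tmax merge_step \<le> 9"
      by (simp_all add: merge_step_def merge_setup_def merge_pick_def)
    show "nmem (run merge_step \<sigma>) ''en'' 0 \<le> Suc k \<and> merged key w n (Suc k) (rmem (run merge_step \<sigma>) ''tmp'') \<or> Suc k < nmem (run merge_step \<sigma>) ''en'' 0 \<and>
      merging key w n (Suc k) (nmem (run merge_step \<sigma>) ''b'' 0) (nmem (run merge_step \<sigma>) ''mid'' 0) (nmem (run merge_step \<sigma>) ''en'' 0) (nmem (run merge_step \<sigma>) ''p'' 0) (nmem (run merge_step \<sigma>) ''q'' 0) (rmem (run merge_step \<sigma>) ''tmp'')"
      unfolding f using M' merging_done[OF w key M'] ken by (cases "Suc k = en") auto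
  qed
qed

lemma nwrites_merge_step [simp]: "nwrites merge_step = {''b'', ''mid'', ''en'', ''p'', ''q''}" "rwrites merge_step = {''tmp''}"
  by (auto simp: merge_step_def merge_setup_def merge_pick_def)

lemma nwrites_merge_pass [simp]: "nwrites merge_pass = {''k'', ''b'', ''mid'', ''en'', ''p'', ''q'', ''w''}" "rwrites merge_pass = {''tmp'', ''key''}"
  by (auto simp: merge_pass_def)

lemma nwrites_merge_sort [simp]: "nwrites merge_sort = {''k'', ''b'', ''mid'', ''en'', ''p'', ''q'', ''w''}" "rwrites merge_sort = {''tmp'', ''key''}"
  by (auto simp: merge_sort_def)

lemma reach_merge_pass:
  assumes w: "0 < w" and key: "bsorted w n (rmem \<sigma> ''key'')"
    and m: "nmem \<sigma> ''y'' 0 = n" "nmem \<sigma> ''w'' 0 = w"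
  shows "reach merge_pass \<sigma> (6 + n * 14) (\<lambda>\<tau>. bsorted (2 * w) n (rmem \<tau> ''key'') \<and>
    rmem \<tau> ''key'' ` {..<n} = rmem \<sigma> ''key'' ` {..<n} \<and> nmem \<tau> ''w'' 0 = 2 * w)"
proof -
  define key where "key = rmem \<sigma> ''key''"
  note key' = assms(2)[folded key_def]
  let ?Q = "\<lambda>\<tau>. bsorted (2 * w) n (rmem \<tau> ''key'') \<and> rmem \<tau> ''key'' ` {..<n} = rmem \<sigma> ''key'' ` {..<n} \<and> nmem \<tau> ''w'' 0 = 2 * w"
  let ?copy = "RPut ''key'' (nv ''k'') (RGet ''tmp'' (nv ''k''))"
  let ?I = "\<lambda>k \<tau>. nmem \<tau> ''en'' 0 \<le> k \<and> merged key w n k (rmem \<tau> ''tmp'') \<or> k < nmem \<tau> ''en'' 0 \<and>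
      merging key w n k (nmem \<tau> ''b'' 0) (nmem \<tau> ''mid'' 0) (nmem \<tau> ''en'' 0) (nmem \<tau> ''p'' 0) (nmem \<tau> ''q'' 0) (rmem \<tau> ''tmp'')"
  have copy: "reach (For ''k'' (NConst 0) (nv ''y'') ?copy ;; ns ''w'' (NAdd (nv ''w'') (nv ''w''))) \<tau> ((2 + (n - 0) * (2 + 1)) + 1) ?Q"
    if "merged key w n n (rmem \<tau> ''tmp'')" and y: "nmem \<tau> ''y'' 0 = n" "nmem \<tau> ''w'' 0 = w" for \<tau>
  proof (rule reach_Seq, rule reach_For[where I = "\<lambda>k \<tau>'. \<forall>x<k. rmem \<tau>' ''key'' x = rmem \<tau> ''tmp'' x"])
    fix k \<tau>' assume "k < n" "nmem \<tau>' ''k'' 0 = k" "same (insert ''k'' (nwrites ?copy)) (rwrites ?copy) \<tau> \<tau>'"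
      "\<forall>x<k. rmem \<tau>' ''key'' x = rmem \<tau> ''tmp'' x"
    then show "reach ?copy \<tau>' 1 (\<lambda>\<tau>''. same (nwrites ?copy) (rwrites ?copy) \<tau>' \<tau>'' \<longrightarrow> (\<forall>x<Suc k. rmem (nput ''k'' 0 (Suc k) \<tau>'') ''key'' x = rmem \<tau> ''tmp'' x))"
      by (intro reach_run) (auto simp: same_def less_Suc_eq)
  next
    fix \<tau>' assume s: "same (insert ''k'' (nwrites ?copy)) (rwrites ?copy) \<tau> \<tau>'" and c: "\<forall>x<n. rmem \<tau>' ''key'' x = rmem \<tau> ''tmp'' x"
    have w': "nmem \<tau>' ''w'' 0 = w" using s y by (simp add: same_def)
    have "rmem \<tau>' ''key'' ` {..<n} = rmem \<tau> ''tmp'' ` {..<n}" using c by (intro image_cong) auto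
    moreover have "bsorted (2 * w) n (rmem \<tau>' ''key'')"
      unfolding bsorted_def
    proof (intro allI impI)
      fix x y assume xy: "x \<le> y" "y < n" "x div (2 * w) = y div (2 * w)"
      have "bsorted (2 * w) n (rmem \<tau> ''tmp'')" using that(1) unfolding merged_def[OF w key'] by blast
      then have "rmem \<tau> ''tmp'' x \<le> rmem \<tau> ''tmp'' y" using xy unfolding bsorted_def by blast
      then show "rmem \<tau>' ''key'' x \<le> rmem \<tau>' ''key'' y" using c xy by simp
    qed
    moreover have "rmem \<tau> ''tmp'' ` {..<n} = rmem \<sigma> ''key'' ` {..<n}"
      using that(1) unfolding merged_def[OF w key'] by (simp add: key_def)
    ultimately have "?Q (nput ''w'' 0 (2 * w) \<tau>')" by simp
    then show "reach (ns ''w'' (NAdd (nv ''w'') (nv ''w''))) \<tau>' 1 ?Q"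
      by (intro reach_run) (simp_all add: w' mult_2)
  qed (use y in \<open>auto simp: same_def\<close>)
  have loop: "reach (For ''k'' (NConst 0) (nv ''y'') merge_step) (nput ''en'' 0 0 \<sigma>) (2 + (n - 0) * (2 + 9))
     (\<lambda>\<tau>. reach (For ''k'' (NConst 0) (nv ''y'') ?copy ;; ns ''w'' (NAdd (nv ''w'') (nv ''w''))) \<tau> ((2 + (n - 0) * (2 + 1)) + 1) ?Q)"
  proof (rule reach_For[where I = ?I])
    show "?I 0 (nput ''k'' 0 0 (nput ''en'' 0 0 \<sigma>))" by (simp add: merged_def[OF w key'] bsorted_def)
  next
    fix k \<tau> assume k: "k < n" "nmem \<tau> ''k'' 0 = k" and sm: "same (insert ''k'' (nwrites merge_step)) (rwrites merge_step) (nput ''en'' 0 0 \<sigma>) \<tau>"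
      and I: "?I k \<tau>"
    have m': "nmem \<tau> ''y'' 0 = n" "nmem \<tau> ''w'' 0 = w" "rmem \<tau> ''key'' = key"
      using sm m by (simp_all add: same_def key_def)
    show "reach merge_step \<tau> 9 (\<lambda>\<tau>'. same (nwrites merge_step) (rwrites merge_step) \<tau> \<tau>' \<longrightarrow> ?I (Suc k) (nput ''k'' 0 (Suc k) \<tau>'))"
      by (rule reach_conseq[OF reach_merge_step[OF w key' k m' I]]) simp_all
  next
    fix \<tau> assume sm: "same (insert ''k'' (nwrites merge_step)) (rwrites merge_step) (nput ''en'' 0 0 \<sigma>) \<tau>" and I: "?I n \<tau>"
    have "merged key w n n (rmem \<tau> ''tmp'')"
    proof -
      have False if M: "merging key w n n b mid en p q t" "n < en" for b mid en p q t
      proof -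
        have "en = min n (b + 2 * w)" using mergingD(3)[OF w key' M(1)] .
        then show False using M(2) by simp
      qed
      then show ?thesis using I by blast
    qed
    then show "reach (For ''k'' (NConst 0) (nv ''y'') ?copy ;; ns ''w'' (NAdd (nv ''w'') (nv ''w''))) \<tau> ((2 + (n - 0) * (2 + 1)) + 1) ?Q"
      using sm m by (intro copy) (simp_all add: same_def)
  qed (use m in \<open>auto simp: same_def\<close>)
  show ?thesis unfolding merge_pass_def
    by (rule reach_Seq_run[where U = "(2 + (n - 0) * (2 + 9)) + ((2 + (n - 0) * (2 + 1)) + 1)"])
      (use reach_Seq[OF loop] in simp_all)
qed

text \<open>The block length starts at \<open>L\<close> and doubles in each round, so
  \<open>c\<close> rounds suffice.\<close>

lemma reach_merge_sort:
  assumes L: "0 < L" and key: "bsorted L n (rmem \<sigma> ''key'')"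
    and m: "nmem \<sigma> ''y'' 0 = n" "nmem \<sigma> ''L'' 0 = L" and c: "n \<le> L * 2 ^ c"
  shows "reach merge_sort \<sigma> (2 + c * (7 + n * 14)) (\<lambda>\<tau>. (\<forall>x y. x \<le> y \<longrightarrow> y < n \<longrightarrow> rmem \<tau> ''key'' x \<le> rmem \<tau> ''key'' y) \<and>
    rmem \<tau> ''key'' ` {..<n} = rmem \<sigma> ''key'' ` {..<n})"
proof -
  let ?Q = "\<lambda>\<tau>. (\<forall>x y. x \<le> y \<longrightarrow> y < n \<longrightarrow> rmem \<tau> ''key'' x \<le> rmem \<tau> ''key'' y) \<and>
    rmem \<tau> ''key'' ` {..<n} = rmem \<sigma> ''key'' ` {..<n}"
  let ?I = "\<lambda>j \<tau>. 0 < nmem \<tau> ''w'' 0 \<and> bsorted (nmem \<tau> ''w'' 0) n (rmem \<tau> ''key'') \<and>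
    rmem \<tau> ''key'' ` {..<n} = rmem \<sigma> ''key'' ` {..<n} \<and> n \<le> nmem \<tau> ''w'' 0 * 2 ^ j"
  have loop: "reach (While (NLess (nv ''w'') (nv ''y'')) merge_pass) (nput ''w'' 0 L \<sigma>) (1 + c * (1 + (6 + n * 14))) ?Q"
  proof (rule reach_While[where I = ?I])
    fix j \<tau> assume I: "?I j \<tau>" and s: "same (nwrites merge_pass) (rwrites merge_pass) (nput ''w'' 0 L \<sigma>) \<tau>"
      and b: "bval (NLess (nv ''w'') (nv ''y'')) \<tau>"
    have y: "nmem \<tau> ''y'' 0 = n" using s m by (simp add: same_def)
    have j: "0 < j" using I b y by (cases j) auto
    then obtain j' where j': "j = Suc j'" by (cases j) auto
    have "reach merge_pass \<tau> (6 + n * 14) (?I (j - 1))"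
      by (rule reach_conseq[OF reach_merge_pass[of "nmem \<tau> ''w'' 0" n \<tau>]]) (use I y j' in \<open>auto simp: algebra_simps\<close>)
    with j show "0 < j \<and> reach merge_pass \<tau> (6 + n * 14) (?I (j - 1))" by simp
  next
    fix j \<tau> assume I: "?I j \<tau>" and s: "same (nwrites merge_pass) (rwrites merge_pass) (nput ''w'' 0 L \<sigma>) \<tau>"
      and b: "\<not> bval (NLess (nv ''w'') (nv ''y'')) \<tau>"
    have "n \<le> nmem \<tau> ''w'' 0" using s m b by (simp add: same_def)
    then show "?Q \<tau>" using I unfolding bsorted_def by (auto simp: div_less)
  qed (use assms in simp_all)
  show ?thesis unfolding merge_sort_def
    by (rule reach_Seq_run[where U = "1 + c * (1 + (6 + n * 14))"]) (use loop m in \<open>simp_all add: algebra_simps\<close>)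
qed

subsection \<open>Searching for the cost increase\<close>

text \<open>
  Each entry has three increasing runs of \<open>L\<close> keys: the costs of its breakpoints, the costs of
  the first integers above them, and the cost of its upper bound, repeated to get equal lengths.
\<close>

definition keys_entry :: com where
  "keys_entry = rs ''t'' (RGet ''ub'' (NGet ''col'' (nv ''k''))) ;; max_tangent ;;
    For ''d'' (NConst 0) (nv ''L'')
     (RPut ''key'' (NAdd (nv ''y'') (nv ''d'')) (RGet ''lev'' (NAdd (nv ''o'') (nv ''d''))) ;;
      RPut ''key'' (NAdd (nv ''y'') (NAdd (nv ''L'') (nv ''d''))) (RAdd (RGet ''lev'' (NAdd (nv ''o'') (nv ''d'')))
        (RMul (RGet ''sl'' (NAdd (nv ''o'') (nv ''d''))) (RSub (RAdd (RFloor (RGet ''bp'' (NAdd (nv ''o'') (nv ''d'')))) (RConst 1))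
          (RGet ''bp'' (NAdd (nv ''o'') (nv ''d'')))))) ;;
      RPut ''key'' (NAdd (nv ''y'') (NAdd (NAdd (nv ''L'') (nv ''L'')) (nv ''d''))) (rv ''m'')) ;;
    ns ''o'' (NAdd (nv ''o'') (nv ''L'')) ;;
    ns ''y'' (NAdd (nv ''y'') (NAdd (nv ''L'') (NAdd (nv ''L'') (nv ''L''))))"

definition make_keys :: com where
  "make_keys = (ns ''o'' (NConst 0) ;; ns ''y'' (NConst 0)) ;; For ''k'' (nv ''s'') (nv ''e'') keys_entry"

text \<open>The smallest key is level 0, whose insufficiency is checked beforehand, and the largest
  key is sufficient. So the initial bracket takes no evaluation.\<close>

definition search :: com where
  "search = (ns ''lo'' (NConst 0) ;; ns ''hi'' (NSub (nv ''y'') (NConst 1))) ;;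
    While (NLess (NAdd (nv ''lo'') (NConst 1)) (nv ''hi''))
     ((ns ''mid'' (NHalf (NAdd (nv ''lo'') (nv ''hi''))) ;; rs ''lv'' (RGet ''key'' (nv ''mid''))) ;;
      eval_row ;;
      Cond (RLess (RConst 0) (rv ''r'')) (ns ''lo'' (nv ''mid'')) (ns ''hi'' (nv ''mid'')))"

definition halve :: com where
  "halve = While (BNot (RLess (RConst 0) (rv ''r'')))
     ((rs ''top'' (rv ''lv'') ;; rs ''lv'' (RDiv (rv ''lv'') (RConst 2))) ;; eval_row)"

text \<open>The first \<open>finish\<close>, at the insufficient key, brings \<open>top\<close> down
  to at most m times any sufficient level. \<open>halve\<close> then leaves V in \<open>lv\<close>
  and 2 V in \<open>top\<close>, and the second \<open>finish\<close> lowers \<open>top\<close> to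
  the step size.\<close>

definition refine :: com where
  "refine = (rs ''top'' (RGet ''key'' (nv ''hi'')) ;; rs ''lv'' (RGet ''key'' (nv ''lo''))) ;;
    eval_row ;; finish ;; rs ''lv'' (RDiv (rv ''top'') (RConst 2)) ;; eval_row ;; halve ;;
    finish ;; rs ''lv'' (rv ''top'') ;; eval_row"

text \<open>Variables of zero initial slope may satisfy the row at level 0. The step size is then 0,
  and the evaluation at level 0 has already left the right values in \<open>x\<close>.\<close>

definition solve_row :: com where
  "solve_row = make_keys ;; merge_sort ;; rs ''lv'' (RConst 0) ;; eval_row ;;
    Cond (RLess (RConst 0) (rv ''r'')) (search ;; refine) Skip"

lemma reach_Seq_then:
  assumes "reach c \<sigma> T P" "\<And>\<tau>. P \<tau> \<Longrightarrow> reach d \<tau> U Q" "T + U \<le> W"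
  shows "reach (Seq c d) \<sigma> W Q"
  by (rule reach_conseq[OF reach_Seq[OF reach_conseq[OF assms(1) order_refl assms(2)]] assms(3)])

context row_machine
begin

lemma units_nonneg: "k \<in> {s..<e} \<Longrightarrow> 0 \<le> t \<Longrightarrow> 0 \<le> units k t"
  using u[of k] unfolding units_def by auto

lemma reach_finish_entry:
  assumes ok: "row_ok \<sigma>" and k: "k \<in> {s..<e}" "nmem \<sigma> ''k'' 0 = k" and o: "nmem \<sigma> ''o'' 0 = (k - s) * L"
    and V: "0 \<le> V" "covered V < b" and z: "rmem \<sigma> ''z'' k = units k (lvl k V)" "rmem \<sigma> ''r'' 0 = b - covered V"
  shows "reach finish_entry \<sigma> (10 + L * 5) (\<lambda>\<tau>. nmem \<tau> ''o'' 0 = (Suc k - s) * L \<and>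
    rmem \<tau> ''top'' 0 = (if target k V \<le> u k \<and> cst k (target k V) < rmem \<sigma> ''top'' 0 then cst k (target k V) else rmem \<sigma> ''top'' 0))"
proof -
  let ?pre = "rs ''t'' (RDiv (rv ''r'') (RGet ''mat'' (nv ''k''))) ;;
    Cond (NLess (NConst 0) (NGet ''int'' (NGet ''col'' (nv ''k''))))
      (rs ''t'' (RSub (RConst 0) (RFloor (RSub (RConst 0) (rv ''t''))))) Skip ;;
    rs ''t'' (RAdd (RGet ''z'' (nv ''k'')) (rv ''t''))"
  let ?post = "Cond (BAnd (BNot (RLess (RGet ''ub'' (NGet ''col'' (nv ''k''))) (rv ''t''))) (RLess (rv ''m'') (rv ''top'')))
      (rs ''top'' (rv ''m'')) Skip ;; ns ''o'' (NAdd (nv ''o'') (nv ''L''))"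
  let ?Q = "\<lambda>\<tau>. nmem \<tau> ''o'' 0 = (Suc k - s) * L \<and>
    rmem \<tau> ''top'' 0 = (if target k V \<le> u k \<and> cst k (target k V) < rmem \<sigma> ''top'' 0 then cst k (target k V) else rmem \<sigma> ''top'' 0)"
  have off: "(Suc k - s) * L = (k - s) * L + L" by (rule offset_Suc) (use k in simp)
  have t: "rmem (run ?pre \<sigma>) ''t'' 0 = target k V"
    using row_okD(10)[OF ok k(1)] by (simp add: k(2) z row_okD(8)[OF ok k(1)] target_def ceiling_def)
  have s1: "same {} {''t''} \<sigma> (run ?pre \<sigma>)" by (auto simp: same_def)
  have ok1: "row_ok (run ?pre \<sigma>)" by (rule row_ok_same[OF ok s1]) auto
  have r: "0 < b - covered V" using V by simp
  have tpos: "0 \<le> target k V"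
    using units_step(1)[OF r k(1) refl] units_nonneg[OF k(1) lvl_nonneg[OF k(1) V(1)]] by simp
  show ?thesis unfolding finish_entry_def
  proof (rule reach_Seq_run[where U = "(3 + L * 5) + 3"])
    show "reach (max_tangent ;; ?post) (run ?pre \<sigma>) ((3 + L * 5) + 3) ?Q"
    proof (rule reach_Seq_then[OF reach_max_tangent[OF ok1 k(1)]])
      show "nmem (run ?pre \<sigma>) ''o'' 0 = (k - s) * L" by (simp add: o)
      show "0 \<le> rmem (run ?pre \<sigma>) ''t'' 0" unfolding t by (rule tpos)
    next
      fix \<tau> assume P: "same {''d''} {''m'', ''v''} (run ?pre \<sigma>) \<tau> \<and> rmem \<tau> ''m'' 0 = cst k (rmem (run ?pre \<sigma>) ''t'' 0)"
      have sm: "same {''d''} {''m'', ''v'', ''t''} \<sigma> \<tau>" using P s1 by (auto simp: same_def)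
      have t': "rmem \<tau> ''t'' 0 = target k V" using P t by (simp add: same_def)
      have m': "rmem \<tau> ''m'' 0 = cst k (target k V)" using P t by metis
      show "reach ?post \<tau> 3 ?Q"
        by (rule reach_run) (auto simp: same_nmem[OF sm] same_rmem[OF sm] t' m' k(2) o off
          row_okD(4)[OF ok] row_okD(9)[OF ok k(1)])
    qed simp
  qed simp_all
qed

text \<open>\<open>T'\<close> is the minimum of \<open>T\<close> and the costs of the targets within
  their bounds, characterised by membership and minimality because there may be no such
  target.\<close>

definition finished :: "real \<Rightarrow> real \<Rightarrow> real \<Rightarrow> bool" where
  "finished V T T' \<longleftrightarrow> T' \<le> T \<and> (T' = T \<or> (\<exists>k\<in>{s..<e}. target k V \<le> u k \<and> T' = cst k (target k V))) \<and>
     (\<forall>k\<in>{s..<e}. target k V \<le> u k \<longrightarrow> T' \<le> cst k (target k V))"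

lemma reach_finish:
  assumes ok: "row_ok \<sigma>" and V: "0 \<le> V" "covered V < b"
    and z: "\<And>k. k \<in> {s..<e} \<Longrightarrow> rmem \<sigma> ''z'' k = units k (lvl k V)" "rmem \<sigma> ''r'' 0 = b - covered V"
  shows "reach finish \<sigma> (3 + (e - s) * (12 + L * 5)) (\<lambda>\<tau>. finished V (rmem \<sigma> ''top'' 0) (rmem \<tau> ''top'' 0))"
proof -
  define T where "T = rmem \<sigma> ''top'' 0"
  let ?I = "\<lambda>k \<tau>. nmem \<tau> ''o'' 0 = (k - s) * L \<and> rmem \<tau> ''top'' 0 \<le> T \<and>
    (rmem \<tau> ''top'' 0 = T \<or> (\<exists>k'\<in>{s..<k}. target k' V \<le> u k' \<and> rmem \<tau> ''top'' 0 = cst k' (target k' V))) \<and>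
    (\<forall>k'\<in>{s..<k}. target k' V \<le> u k' \<longrightarrow> rmem \<tau> ''top'' 0 \<le> cst k' (target k' V))"
  have loop: "reach (For ''k'' (nv ''s'') (nv ''e'') finish_entry) (nput ''o'' 0 0 \<sigma>) (2 + (e - s) * (2 + (10 + L * 5)))
    (\<lambda>\<tau>. finished V T (rmem \<tau> ''top'' 0))"
  proof (rule reach_For[where I = ?I])
    show "nval (nv ''s'') (nput ''o'' 0 0 \<sigma>) = s" "s \<le> e" using row_okD(1)[OF ok] se by simp_all
    show "nval (nv ''e'') \<tau> = e" if "same (insert ''k'' (nwrites finish_entry)) (rwrites finish_entry) (nput ''o'' 0 0 \<sigma>) \<tau>" for \<tau>
      using row_okD(2)[OF ok] that by (simp add: same_def)
  next
    fix k \<tau> assume k: "s \<le> k" "k < e" "nmem \<tau> ''k'' 0 = k"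
      and sm: "same (insert ''k'' (nwrites finish_entry)) (rwrites finish_entry) (nput ''o'' 0 0 \<sigma>) \<tau>" and I: "?I k \<tau>"
    have sm': "same {''k'', ''d'', ''o''} {''t'', ''m'', ''v'', ''top''} \<sigma> \<tau>" using sm by (auto simp: same_def)
    have ok': "row_ok \<tau>" by (rule row_ok_same[OF ok sm']) auto
    have k': "k \<in> {s..<e}" using k by simp
    have z': "rmem \<tau> ''z'' k = units k (lvl k V)" "rmem \<tau> ''r'' 0 = b - covered V"
      using z k' sm' by (simp_all add: same_def)
    have fr: "{s..<Suc k} = insert k {s..<k}" using k by auto
    show "reach finish_entry \<tau> (10 + L * 5) (\<lambda>\<tau>'. same (nwrites finish_entry) (rwrites finish_entry) \<tau> \<tau>' \<longrightarrow> ?I (Suc k) (nput ''k'' 0 (Suc k) \<tau>'))"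
    proof (rule reach_conseq[OF reach_finish_entry[OF ok' k' k(3) _ V z']], use I in blast, simp)
      fix \<tau>' :: memory assume Q: "nmem \<tau>' ''o'' 0 = (Suc k - s) * L \<and>
        rmem \<tau>' ''top'' 0 = (if target k V \<le> u k \<and> cst k (target k V) < rmem \<tau> ''top'' 0 then cst k (target k V) else rmem \<tau> ''top'' 0)"
      show "same (nwrites finish_entry) (rwrites finish_entry) \<tau> \<tau>' \<longrightarrow> ?I (Suc k) (nput ''k'' 0 (Suc k) \<tau>')"
      proof (cases "target k V \<le> u k \<and> cst k (target k V) < rmem \<tau> ''top'' 0")
        case True
        then show ?thesis using Q I unfolding fr by (auto intro: order_trans less_imp_le)
      next
        case False
        then show ?thesis using Q I unfolding fr by auto
      qed
    qed
  next
    show "finished V T (rmem \<tau> ''top'' 0)" if "?I e \<tau>" for \<tau> using that unfolding finished_def by blast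
  qed (simp_all add: T_def)
  show ?thesis unfolding finish_def
    by (rule reach_Seq_run[where U = "2 + (e - s) * (2 + (10 + L * 5))"]) (use loop in \<open>simp_all add: T_def\<close>)
qed

section \<open>Layout of the keys in memory\<close>

definition key_val :: "nat \<Rightarrow> nat \<Rightarrow> nat \<Rightarrow> real" where
  "key_val k c d = (if c = 0 then lev k d else if c = 1 then next_unit k d else cst k (u k))"

text \<open>Every run fills one aligned block of length \<open>L\<close>, so the array is
  \<open>bsorted L\<close> before the first round of merging.\<close>

definition keys_upto :: "nat \<Rightarrow> (nat \<Rightarrow> real) \<Rightarrow> bool" where
  "keys_upto k f \<longleftrightarrow> (\<forall>k'\<in>{s..<k}. \<forall>c<3. \<forall>d<L. f ((3 * (k' - s) + c) * L + d) = key_val k' c d)"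

lemma nwrites_keys [simp]: "nwrites keys_entry = {''d'', ''o'', ''y''}" "rwrites keys_entry = {''t'', ''m'', ''v'', ''key''}"
  "nwrites make_keys = {''d'', ''o'', ''y'', ''k''}" "rwrites make_keys = {''t'', ''m'', ''v'', ''key''}"
  by (auto simp: keys_entry_def make_keys_def)

lemma reach_keys_entry:
  assumes ok: "row_ok \<sigma>" and k: "k \<in> {s..<e}" "nmem \<sigma> ''k'' 0 = k" and o: "nmem \<sigma> ''o'' 0 = (k - s) * L"
    and y: "nmem \<sigma> ''y'' 0 = 3 * (k - s) * L" and prev: "keys_upto k (rmem \<sigma> ''key'')"
  shows "reach keys_entry \<sigma> (8 + L * 10) (\<lambda>\<tau>. nmem \<tau> ''o'' 0 = (Suc k - s) * L \<and> nmem \<tau> ''y'' 0 = 3 * (Suc k - s) * L \<and>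
    keys_upto (Suc k) (rmem \<tau> ''key''))"
proof -
  let ?put = "RPut ''key'' (NAdd (nv ''y'') (nv ''d'')) (RGet ''lev'' (NAdd (nv ''o'') (nv ''d''))) ;;
      RPut ''key'' (NAdd (nv ''y'') (NAdd (nv ''L'') (nv ''d''))) (RAdd (RGet ''lev'' (NAdd (nv ''o'') (nv ''d'')))
        (RMul (RGet ''sl'' (NAdd (nv ''o'') (nv ''d''))) (RSub (RAdd (RFloor (RGet ''bp'' (NAdd (nv ''o'') (nv ''d'')))) (RConst 1))
          (RGet ''bp'' (NAdd (nv ''o'') (nv ''d'')))))) ;;
      RPut ''key'' (NAdd (nv ''y'') (NAdd (NAdd (nv ''L'') (nv ''L'')) (nv ''d''))) (rv ''m'')"
  let ?post = "ns ''o'' (NAdd (nv ''o'') (nv ''L'')) ;;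
    ns ''y'' (NAdd (nv ''y'') (NAdd (nv ''L'') (NAdd (nv ''L'') (nv ''L''))))"
  let ?Q = "\<lambda>\<tau>. nmem \<tau> ''o'' 0 = (Suc k - s) * L \<and> nmem \<tau> ''y'' 0 = 3 * (Suc k - s) * L \<and>
    keys_upto (Suc k) (rmem \<tau> ''key'')"
  define Y where "Y = 3 * (k - s) * L"
  define f0 where "f0 = rmem \<sigma> ''key''"
  have off: "(Suc k - s) * L = (k - s) * L + L" by (rule offset_Suc) (use k in simp)
  have y': "3 * (Suc k - s) * L = 3 * (k - s) * L + (L + (L + L))"
    using k(1) by (simp add: Suc_diff_le distrib_right)
  have below: "(3 * (k' - s) + c) * L + d < Y" if "k' \<in> {s..<k}" "c < 3" "d < L" for k' c d :: nat
  proof -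
    have "Suc (3 * (k' - s) + c) \<le> 3 * (k - s)" using that by auto
    then have "Suc (3 * (k' - s) + c) * L \<le> 3 * (k - s) * L" by (rule mult_le_mono1)
    then show ?thesis using that(3) by (simp add: Y_def)
  qed
  let ?I = "\<lambda>d \<tau>. (\<forall>p<Y. rmem \<tau> ''key'' p = f0 p) \<and> (\<forall>d'<d. rmem \<tau> ''key'' (Y + d') = lev k d' \<and>
     rmem \<tau> ''key'' (Y + (L + d')) = next_unit k d' \<and> rmem \<tau> ''key'' (Y + (L + L + d')) = cst k (u k))"
  have fill: "reach (For ''d'' (NConst 0) (nv ''L'') ?put ;; ?post) \<tau> ((2 + (L - 0) * (2 + 3)) + 2) ?Q"
    if sm: "same {''d''} {''m'', ''v'', ''t''} \<sigma> \<tau>" and m: "rmem \<tau> ''m'' 0 = cst k (u k)" for \<tau>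
  proof (rule reach_Seq_then[OF reach_For[where I = ?I and Q = "\<lambda>\<tau>'. same {''d''} {''m'', ''v'', ''t'', ''key''} \<sigma> \<tau>' \<and> ?I L \<tau>'"]])
    show "\<And>\<tau>'. same (insert ''d'' (nwrites ?put)) (rwrites ?put) \<tau> \<tau>' \<Longrightarrow> nval (nv ''L'') \<tau>' = L"
      using row_okD(4)[OF ok] sm by (simp add: same_def)
    show "?I 0 (nput ''d'' 0 0 \<tau>)" using sm by (simp add: same_def f0_def)
  next
    fix d \<tau>' assume d: "d < L" "nmem \<tau>' ''d'' 0 = d" and sm': "same (insert ''d'' (nwrites ?put)) (rwrites ?put) \<tau> \<tau>'" and I: "?I d \<tau>'"
    have sm2: "same {''d''} {''m'', ''v'', ''t'', ''key''} \<sigma> \<tau>'" using sm sm' by (auto simp: same_def)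
    have m': "rmem \<tau>' ''m'' 0 = cst k (u k)" using sm' m by (simp add: same_def)
    note S = same_nmem[OF sm2] same_rmem[OF sm2]
    have r: "rmem (run ?put \<tau>') ''key'' = (rmem \<tau>' ''key'')(Y + d := lev k d, Y + (L + d) := next_unit k d, Y + (L + L + d) := cst k (u k))"
      by (simp add: S o y d(2) m' Y_def[symmetric] row_okD(4)[OF ok] row_okD(5-7)[OF ok k(1) d(1)] next_unit_def)
    have "?I (Suc d) (run ?put \<tau>')"
      unfolding r
    proof (intro conjI allI impI)
      fix d' assume d': "d' < Suc d"
      let ?f = "(rmem \<tau>' ''key'')(Y + d := lev k d, Y + (L + d) := next_unit k d, Y + (L + L + d) := cst k (u k))"
      have "?f (Y + d') = lev k d' \<and> ?f (Y + (L + d')) = next_unit k d' \<and> ?f (Y + (L + L + d')) = cst k (u k)"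
      proof (cases "d' = d")
        case True
        then show ?thesis using d(1) by simp
      next
        case False
        then have "d' < d" using d' by simp
        then show ?thesis using d(1) I by simp
      qed
      then show "?f (Y + d') = lev k d'" "?f (Y + (L + d')) = next_unit k d'" "?f (Y + (L + L + d')) = cst k (u k)" by blast+
    qed (use I in simp)
    then show "reach ?put \<tau>' 3 (\<lambda>\<tau>''. same (nwrites ?put) (rwrites ?put) \<tau>' \<tau>'' \<longrightarrow> ?I (Suc d) (nput ''d'' 0 (Suc d) \<tau>''))"
      by (intro reach_run) (simp_all only: nmem_nput rmem_nput, simp_all)
  next
    fix \<tau>' assume sm': "same (insert ''d'' (nwrites ?put)) (rwrites ?put) \<tau> \<tau>'" and I: "?I L \<tau>'"
    have sm2: "same {''d''} {''m'', ''v'', ''t'', ''key''} \<sigma> \<tau>'" using sm sm' by (auto simp: same_def)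
    then show "same {''d''} {''m'', ''v'', ''t'', ''key''} \<sigma> \<tau>' \<and> ?I L \<tau>'" using I by blast
  next
    fix \<tau>' assume A: "same {''d''} {''m'', ''v'', ''t'', ''key''} \<sigma> \<tau>' \<and> ?I L \<tau>'"
    then have sm2: "same {''d''} {''m'', ''v'', ''t'', ''key''} \<sigma> \<tau>'" by blast
    note S = same_nmem[OF sm2]
    have "keys_upto (Suc k) (rmem \<tau>' ''key'')"
      unfolding keys_upto_def
    proof (intro ballI allI impI)
      fix k' c d :: nat assume h: "k' \<in> {s..<Suc k}" "c < 3" "d < L"
      show "rmem \<tau>' ''key'' ((3 * (k' - s) + c) * L + d) = key_val k' c d"
      proof (cases "k' = k")
        case True
        have A': "rmem \<tau>' ''key'' (Y + d) = lev k d" "rmem \<tau>' ''key'' (Y + (L + d)) = next_unit k d"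
          "rmem \<tau>' ''key'' (Y + (L + L + d)) = cst k (u k)" using A h(3) by blast+
        consider "c = 0" | "c = 1" | "c = 2" using h(2) by linarith
        then show ?thesis
        proof cases
          case 1
          have "(3 * (k' - s) + c) * L + d = Y + d" using True 1 by (simp add: Y_def)
          then show ?thesis using A'(1) True 1 by (simp only: key_val_def) simp
        next
          case 2
          have "(3 * (k' - s) + c) * L + d = Y + (L + d)" using True 2 by (simp add: Y_def)
          then show ?thesis using A'(2) True 2 by (simp only: key_val_def) simp
        next
          case 3
          have "(3 * (k' - s) + c) * L + d = Y + (L + L + d)" using True 3 by (simp add: Y_def)
          then show ?thesis using A'(3) True 3 by (simp only: key_val_def) simp
        qed
      next
        case False
        then have k': "k' \<in> {s..<k}" using h by auto
        have "rmem \<tau>' ''key'' ((3 * (k' - s) + c) * L + d) = f0 ((3 * (k' - s) + c) * L + d)"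
          using A below[OF k' h(2,3)] by blast
        then show ?thesis using prev k' h(2,3) unfolding keys_upto_def f0_def by simp
      qed
    qed
    then show "reach ?post \<tau>' 2 ?Q"
      by (rule_tac reach_run) (simp_all add: S o y row_okD(4)[OF ok] off y')
  qed simp_all
  have t: "rmem (rput ''t'' 0 (u k) \<sigma>) ''t'' 0 = u k" by simp
  have s1: "same {} {''t''} \<sigma> (rput ''t'' 0 (u k) \<sigma>)" by (auto simp: same_def)
  have ok1: "row_ok (rput ''t'' 0 (u k) \<sigma>)" by (rule row_ok_same[OF ok s1]) auto
  have "reach (max_tangent ;; For ''d'' (NConst 0) (nv ''L'') ?put ;; ?post) (rput ''t'' 0 (u k) \<sigma>)
     ((3 + L * 5) + ((2 + (L - 0) * (2 + 3)) + 2)) ?Q"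
  proof (rule reach_Seq_then[OF reach_max_tangent[OF ok1 k(1)]])
    fix \<tau> assume P: "same {''d''} {''m'', ''v''} (rput ''t'' 0 (u k) \<sigma>) \<tau> \<and> rmem \<tau> ''m'' 0 = cst k (rmem (rput ''t'' 0 (u k) \<sigma>) ''t'' 0)"
    have "same {''d''} {''m'', ''v'', ''t''} \<sigma> \<tau>" using P s1 by (auto simp: same_def)
    moreover have "rmem \<tau> ''m'' 0 = cst k (u k)" using P t by metis
    ultimately show "reach (For ''d'' (NConst 0) (nv ''L'') ?put ;; ?post) \<tau> ((2 + (L - 0) * (2 + 3)) + 2) ?Q" by (rule fill)
  qed (use o u[OF k(1)] in simp_all)
  then show ?thesis unfolding keys_entry_def
    by (rule_tac reach_Seq_run[where U = "(3 + L * 5) + ((2 + (L - 0) * (2 + 3)) + 2)"]) (simp_all add: k(2) row_okD(9)[OF ok k(1)])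
qed

lemma reach_make_keys:
  assumes ok: "row_ok \<sigma>"
  shows "reach make_keys \<sigma> (4 + (e - s) * (10 + L * 10)) (\<lambda>\<tau>. nmem \<tau> ''y'' 0 = 3 * (e - s) * L \<and> keys_upto e (rmem \<tau> ''key''))"
proof -
  let ?\<sigma> = "nput ''y'' 0 0 (nput ''o'' 0 0 \<sigma>)"
  let ?I = "\<lambda>k \<tau>. nmem \<tau> ''o'' 0 = (k - s) * L \<and> nmem \<tau> ''y'' 0 = 3 * (k - s) * L \<and> keys_upto k (rmem \<tau> ''key'')"
  have loop: "reach (For ''k'' (nv ''s'') (nv ''e'') keys_entry) ?\<sigma> (2 + (e - s) * (2 + (8 + L * 10)))
    (\<lambda>\<tau>. nmem \<tau> ''y'' 0 = 3 * (e - s) * L \<and> keys_upto e (rmem \<tau> ''key''))"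
  proof (rule reach_For[where I = ?I])
    show "nval (nv ''s'') ?\<sigma> = s" "s \<le> e" using row_okD(1)[OF ok] se by simp_all
    show "nval (nv ''e'') \<tau> = e" if "same (insert ''k'' (nwrites keys_entry)) (rwrites keys_entry) ?\<sigma> \<tau>" for \<tau>
      using row_okD(2)[OF ok] that by (simp add: same_def)
    show "?I s (nput ''k'' 0 s ?\<sigma>)" by (simp add: keys_upto_def)
  next
    fix k \<tau> assume k: "s \<le> k" "k < e" "nmem \<tau> ''k'' 0 = k"
      and sm: "same (insert ''k'' (nwrites keys_entry)) (rwrites keys_entry) ?\<sigma> \<tau>" and I: "?I k \<tau>"
    have sm': "same {''k'', ''d'', ''o'', ''y''} {''t'', ''m'', ''v'', ''key''} \<sigma> \<tau>" using sm by (auto simp: same_def)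
    have ok': "row_ok \<tau>" by (rule row_ok_same[OF ok sm']) auto
    have k': "k \<in> {s..<e}" using k by simp
    show "reach keys_entry \<tau> (8 + L * 10) (\<lambda>\<tau>'. same (nwrites keys_entry) (rwrites keys_entry) \<tau> \<tau>' \<longrightarrow> ?I (Suc k) (nput ''k'' 0 (Suc k) \<tau>'))"
      by (rule reach_conseq[OF reach_keys_entry[OF ok' k' k(3)]]) (use I in simp_all)
  qed simp_all
  show ?thesis unfolding make_keys_def
    by (rule reach_Seq_run[where U = "2 + (e - s) * (2 + (8 + L * 10))"]) (use loop in simp_all)
qed

text \<open>The inverse of the layout: the quotient by \<open>L\<close> numbers the run, and
  dividing this number by 3 gives entry and kind.\<close>

lemma keys_index:
  assumes "p < 3 * (e - s) * L"
  obtains k c d where "k \<in> {s..<e}" "c < 3" "d < L" "p = (3 * (k - s) + c) * L + d" "p div L = 3 * (k - s) + c" "p mod L = d"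
proof -
  define q where "q = p div L"
  have "p < 3 * (e - s) * L" by (rule assms)
  then have "q < 3 * (e - s)" unfolding q_def by (rule less_mult_imp_div_less)
  then have "q < (e - s) * 3" by (simp only: mult.commute)
  then have "q div 3 < e - s" by (rule less_mult_imp_div_less)
  then have k: "s + q div 3 \<in> {s..<e}" by simp
  have eq: "3 * (s + q div 3 - s) + q mod 3 = q" by simp
  have p: "p = q * L + p mod L" by (simp add: q_def)
  show thesis
  proof (rule that[of "s + q div 3" "q mod 3" "p mod L"])
    show "p = (3 * (s + q div 3 - s) + q mod 3) * L + p mod L" "p div L = 3 * (s + q div 3 - s) + q mod 3"
      unfolding eq using p by (simp_all add: q_def)
  qed (use k L in simp_all)
qed

lemma key_val_mono: "k \<in> {s..<e} \<Longrightarrow> d \<le> d' \<Longrightarrow> d' < L \<Longrightarrow> key_val k c d \<le> key_val k c d'"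
  unfolding key_val_def using lev_le[of k d d'] next_unit_le[of k d d'] by simp

lemma keys_bsorted:
  assumes "keys_upto e f"
  shows "bsorted L (3 * (e - s) * L) f"
  unfolding bsorted_def
proof (intro allI impI)
  fix x y assume xy: "x \<le> y" "y < 3 * (e - s) * L" "x div L = y div L"
  obtain k c d where k: "k \<in> {s..<e}" "c < 3" "d < L" "y = (3 * (k - s) + c) * L + d" "y div L = 3 * (k - s) + c" "y mod L = d"
    by (rule keys_index[OF xy(2)])
  have "x = x div L * L + x mod L" by simp
  then have x: "x = (3 * (k - s) + c) * L + x mod L" using xy(3) k(5) by simp
  then have d: "x mod L \<le> d" using xy(1) k(4) by linarith
  have "f x = key_val k c (x mod L)"
    using assms k(1,2) L unfolding keys_upto_def by (subst x) auto
  moreover have "f y = key_val k c d" using assms k(1-4) unfolding keys_upto_def by auto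
  ultimately show "f x \<le> f y" using key_val_mono[OF k(1) d k(3)] by simp
qed

definition key_set :: "real set" where
  "key_set = {key_val k c d | k c d. k \<in> {s..<e} \<and> c < 3 \<and> d < L}"

lemma keys_image:
  assumes "keys_upto e f"
  shows "f ` {..<3 * (e - s) * L} = key_set"
proof
  show "f ` {..<3 * (e - s) * L} \<subseteq> key_set"
  proof
    fix v assume "v \<in> f ` {..<3 * (e - s) * L}"
    then obtain p where p: "p < 3 * (e - s) * L" "v = f p" by auto
    obtain k c d where k: "k \<in> {s..<e}" "c < 3" "d < L" "p = (3 * (k - s) + c) * L + d"
      by (rule keys_index[OF p(1)])
    then have "v = key_val k c d" using assms p(2) unfolding keys_upto_def by auto
    then show "v \<in> key_set" using k unfolding key_set_def by blast
  qed
  show "key_set \<subseteq> f ` {..<3 * (e - s) * L}"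
  proof
    fix v assume "v \<in> key_set"
    then obtain k c d where k: "k \<in> {s..<e}" "c < 3" "d < L" "v = key_val k c d" unfolding key_set_def by blast
    let ?p = "(3 * (k - s) + c) * L + d"
    have "Suc (3 * (k - s) + c) \<le> 3 * (e - s)" using k by auto
    then have "Suc (3 * (k - s) + c) * L \<le> 3 * (e - s) * L" by (rule mult_le_mono1)
    then have "?p < 3 * (e - s) * L" using k(3) by simp
    moreover have "f ?p = v" using assms k unfolding keys_upto_def by auto
    ultimately show "v \<in> f ` {..<3 * (e - s) * L}" by blast
  qed
qed

lemma key_set_nonneg: "v \<in> key_set \<Longrightarrow> 0 \<le> v"
proof -
  assume "v \<in> key_set"
  then obtain k c d where k: "k \<in> {s..<e}" "d < L" "v = key_val k c d" unfolding key_set_def by blast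
  then show "0 \<le> v"
    using lev_ge0[OF k(1,2)] next_unit_nonneg[OF k(1,2)] cst_nonneg[OF k(1) u[OF k(1)]] by (simp add: key_val_def)
qed

lemma key_setI:
  assumes "k \<in> {s..<e}" "d < L"
  shows "lev k d \<in> key_set" "next_unit k d \<in> key_set" "cst k (u k) \<in> key_set"
proof -
  have "key_val k c d \<in> key_set" if "c < 3" for c using assms that unfolding key_set_def by blast
  from this[of 0] this[of 1] this[of 2] show "lev k d \<in> key_set" "next_unit k d \<in> key_set" "cst k (u k) \<in> key_set"
    by (simp_all add: key_val_def)
qed

definition good_increase :: "real \<Rightarrow> bool" where
  "good_increase B \<longleftrightarrow> 0 \<le> B \<and> b \<le> covered B \<and>
    (\<forall>y. (\<forall>k\<in>{s..<e}. 0 \<le> y k) \<longrightarrow> b \<le> (\<Sum>k\<in>{s..<e}. A k * units k (y k)) \<longrightarrow> B \<le> (\<Sum>k\<in>{s..<e}. cst k (y k)))"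

lemma good_increase_0: "b \<le> covered 0 \<Longrightarrow> good_increase 0"
  unfolding good_increase_def by (auto intro!: sum_nonneg cst_nonneg)

lemma finished_covered:
  assumes V: "0 \<le> V" "covered V < b" and f: "finished V T T'" and T: "0 \<le> T" "b \<le> covered T"
  shows "0 \<le> T'" "b \<le> covered T'"
proof -
  have "0 \<le> T' \<and> b \<le> covered T'"
  proof (cases "T' = T")
    case False
    then obtain k where k: "k \<in> {s..<e}" "target k V \<le> u k" "T' = cst k (target k V)"
      using f unfolding finished_def by blast
    then show ?thesis using target_above(2,3)[OF V k(1,2)] V(1) by simp
  qed (use T in simp)
  then show "0 \<le> T'" "b \<le> covered T'" by auto
qed

text \<open>By \<open>solution_cost\<close>, every solution costs at least 2 V or at least as much
  as some target within its bound. \<open>T\<close> is the minimum of these amounts and is itself a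
  sufficient level.\<close>

lemma finished_good:
  assumes V: "0 \<le> V" "covered V < b" and f: "finished V (2 * V) T" and c: "b \<le> covered (2 * V)"
  shows "good_increase T"
  unfolding good_increase_def
proof (intro conjI allI impI)
  show "0 \<le> T" "b \<le> covered T" by (rule finished_covered[OF V f _ c], use V in simp)+
  fix y assume y: "\<forall>k\<in>{s..<e}. 0 \<le> y k" "b \<le> (\<Sum>k\<in>{s..<e}. A k * units k (y k))"
  have y': "\<And>k. k \<in> {s..<e} \<Longrightarrow> 0 \<le> y k" using y by blast
  from solution_cost[OF V y' y(2)] show "T \<le> (\<Sum>k\<in>{s..<e}. cst k (y k))"
  proof
    assume "2 * V \<le> (\<Sum>k\<in>{s..<e}. cst k (y k))"
    moreover have "T \<le> 2 * V" using f unfolding finished_def by blast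
    ultimately show ?thesis by simp
  next
    assume "\<exists>k\<in>{s..<e}. target k V \<le> u k \<and> cst k (target k V) \<le> (\<Sum>k\<in>{s..<e}. cst k (y k))"
    then obtain k where k: "k \<in> {s..<e}" "target k V \<le> u k" "cst k (target k V) \<le> (\<Sum>k\<in>{s..<e}. cst k (y k))" by blast
    have "T \<le> cst k (target k V)" using f k(1,2) unfolding finished_def by blast
    then show ?thesis using k(3) by simp
  qed
qed

section \<open>Memory during the search\<close>

definition at_level :: "real \<Rightarrow> memory \<Rightarrow> bool" where
  "at_level B \<tau> \<longleftrightarrow> rmem \<tau> ''lv'' 0 = B \<and> (\<forall>k\<in>{s..<e}. rmem \<tau> ''x'' k = lvl k B) \<and>
     (\<forall>k\<in>{s..<e}. rmem \<tau> ''z'' k = units k (lvl k B)) \<and> rmem \<tau> ''r'' 0 = b - covered B"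

text \<open>Evaluations overwrite \<open>x\<close> on the current row. As frames are only given by
  array names, a separate conjunct preserves the values of the other rows.\<close>

definition solving :: "memory \<Rightarrow> memory \<Rightarrow> bool" where
  "solving \<sigma> \<tau> \<longleftrightarrow> row_ok \<sigma> \<and> same {''k'', ''a'', ''c'', ''d'', ''o'', ''lo'', ''hi'', ''mid''}
      {''x'', ''z'', ''r'', ''lv'', ''top'', ''t'', ''m'', ''v''} \<sigma> \<tau> \<and>
     (\<forall>k. k \<notin> {s..<e} \<longrightarrow> rmem \<tau> ''x'' k = rmem \<sigma> ''x'' k)"

lemma solvingD:
  assumes "solving \<sigma> \<tau>"
  shows "row_ok \<sigma>" "same {''k'', ''a'', ''c'', ''d'', ''o'', ''lo'', ''hi'', ''mid''}
      {''x'', ''z'', ''r'', ''lv'', ''top'', ''t'', ''m'', ''v''} \<sigma> \<tau>"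
    "\<forall>k. k \<notin> {s..<e} \<longrightarrow> rmem \<tau> ''x'' k = rmem \<sigma> ''x'' k"
  by (insert assms[unfolded solving_def], elim conjE, assumption)+

lemma solving_ok: "solving \<sigma> \<tau> \<Longrightarrow> row_ok \<tau>"
  by (rule row_ok_same[OF solvingD(1,2)]) auto

lemma solving_same:
  assumes "solving \<sigma> \<tau>" "same {''k'', ''a'', ''c'', ''d'', ''o'', ''lo'', ''hi'', ''mid''} {''z'', ''r'', ''lv'', ''top'', ''t'', ''m'', ''v''} \<tau> \<tau>'"
  shows "solving \<sigma> \<tau>'"
proof -
  have "same {''k'', ''a'', ''c'', ''d'', ''o'', ''lo'', ''hi'', ''mid''}
      {''x'', ''z'', ''r'', ''lv'', ''top'', ''t'', ''m'', ''v''} \<tau> \<tau>'" by (rule same_mono[OF assms(2)]) auto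
  moreover have "rmem \<tau>' ''x'' = rmem \<tau> ''x''" by (rule same_rmem[OF assms(2)]) simp
  ultimately show ?thesis
    using assms(1) same_trans[OF solvingD(2)[OF assms(1)]] unfolding solving_def by simp
qed

definition eval_time :: nat where "eval_time = 4 + (e - s) * (13 + h * 4)"
definition finish_time :: nat where "finish_time = 3 + (e - s) * (12 + L * 5)"

lemma step_eval:
  assumes R: "solving \<sigma> \<tau>" and lv: "rmem \<tau> ''lv'' 0 = B" "0 \<le> B"
  shows "reach eval_row \<tau> eval_time (\<lambda>\<tau>'. solving \<sigma> \<tau>' \<and> at_level B \<tau>' \<and>
     same {''k'', ''a'', ''c'', ''d'', ''o''} {''x'', ''z'', ''r''} \<tau> \<tau>')"
  unfolding eval_time_def
proof (rule reach_conseq[OF reach_eval_row[OF solving_ok[OF R] lv] order_refl])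
  fix \<tau>' assume Q: "same {''k'', ''a'', ''c'', ''d'', ''o''} {''x'', ''z'', ''r''} \<tau> \<tau>' \<and>
     (\<forall>k. rmem \<tau>' ''x'' k = (if k \<in> {s..<e} then lvl k B else rmem \<tau> ''x'' k)) \<and>
     (\<forall>k\<in>{s..<e}. rmem \<tau>' ''z'' k = units k (lvl k B)) \<and> rmem \<tau>' ''r'' 0 = b - covered B"
  then have sm: "same {''k'', ''a'', ''c'', ''d'', ''o''} {''x'', ''z'', ''r''} \<tau> \<tau>'" by blast
  have "same {''k'', ''a'', ''c'', ''d'', ''o'', ''lo'', ''hi'', ''mid''}
      {''x'', ''z'', ''r'', ''lv'', ''top'', ''t'', ''m'', ''v''} \<tau> \<tau>'" by (rule same_mono[OF sm]) auto
  then have "same {''k'', ''a'', ''c'', ''d'', ''o'', ''lo'', ''hi'', ''mid''}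
      {''x'', ''z'', ''r'', ''lv'', ''top'', ''t'', ''m'', ''v''} \<sigma> \<tau>'"
    by (rule same_trans[OF solvingD(2)[OF R]])
  moreover have "\<forall>k. k \<notin> {s..<e} \<longrightarrow> rmem \<tau>' ''x'' k = rmem \<sigma> ''x'' k"
    using solvingD(3)[OF R] Q by simp
  ultimately have "solving \<sigma> \<tau>'" using solvingD(1)[OF R] unfolding solving_def by simp
  moreover have "at_level B \<tau>'" using Q lv same_rmem[OF sm, of "''lv''"] unfolding at_level_def by simp
  ultimately show "solving \<sigma> \<tau>' \<and> at_level B \<tau>' \<and> same {''k'', ''a'', ''c'', ''d'', ''o''} {''x'', ''z'', ''r''} \<tau> \<tau>'"
    using sm by blast
qed

lemma step_finish:
  assumes R: "solving \<sigma> \<tau>" and V: "at_level V \<tau>" "0 \<le> V" "covered V < b"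
  shows "reach finish \<tau> finish_time (\<lambda>\<tau>'. solving \<sigma> \<tau>' \<and> finished V (rmem \<tau> ''top'' 0) (rmem \<tau>' ''top'' 0))"
  unfolding finish_time_def
proof (rule reach_conseq[OF reach_same[OF reach_finish[OF solving_ok[OF R] V(2,3)]] order_refl])
  show "\<And>k. k \<in> {s..<e} \<Longrightarrow> rmem \<tau> ''z'' k = units k (lvl k V)" "rmem \<tau> ''r'' 0 = b - covered V"
    using V(1) unfolding at_level_def by auto
  fix \<tau>' assume Q: "same (nwrites finish) (rwrites finish) \<tau> \<tau>' \<and> finished V (rmem \<tau> ''top'' 0) (rmem \<tau>' ''top'' 0)"
  have "solving \<sigma> \<tau>'" by (rule solving_same[OF R same_mono[OF conjunct1[OF Q]]]) auto
  then show "solving \<sigma> \<tau>' \<and> finished V (rmem \<tau> ''top'' 0) (rmem \<tau>' ''top'' 0)" using Q by blast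
qed

end

context row_machine
begin

definition sorted_keys :: "(nat \<Rightarrow> real) \<Rightarrow> bool" where
  "sorted_keys f \<longleftrightarrow> (\<forall>x y. x \<le> y \<longrightarrow> y < 3 * (e - s) * L \<longrightarrow> f x \<le> f y) \<and> f ` {..<3 * (e - s) * L} = key_set"

lemma sorted_keysD:
  assumes "sorted_keys f" "N = 3 * (e - s) * L"
  shows "x \<le> y \<Longrightarrow> y < N \<Longrightarrow> f x \<le> f y" "p < N \<Longrightarrow> f p \<in> key_set" "v \<in> key_set \<Longrightarrow> \<exists>p<N. v = f p"
proof -
  have *: "\<forall>x y. x \<le> y \<longrightarrow> y < N \<longrightarrow> f x \<le> f y" "f ` {..<N} = key_set"
    using assms(1) unfolding sorted_keys_def assms(2) by (rule conjunct1, rule conjunct2)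
  show "x \<le> y \<Longrightarrow> y < N \<Longrightarrow> f x \<le> f y" using *(1) by blast
  show "p < N \<Longrightarrow> f p \<in> key_set" "v \<in> key_set \<Longrightarrow> \<exists>p<N. v = f p" unfolding *(2)[symmetric] by auto
qed

lemma sorted_keys_nonneg: "sorted_keys f \<Longrightarrow> p < 3 * (e - s) * L \<Longrightarrow> 0 \<le> f p"
  by (rule key_set_nonneg[OF sorted_keysD(2)[OF _ refl]])

text \<open>\<open>lev s 0 = 0\<close> is a key, and the last key dominates the costs of all upper
  bounds, so \<open>covered_saturated\<close> applies to it.\<close>

lemma sorted_keys_ends:
  assumes "sorted_keys f"
  shows "f 0 = 0" "b \<le> covered (f (3 * (e - s) * L - 1))"
proof -
  define N where "N = 3 * (e - s) * L"
  note D = sorted_keysD[OF assms N_def]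
  have N: "0 < N" unfolding N_def using se L by simp
  have f0: "0 \<le> f 0" by (rule key_set_nonneg[OF D(2)[OF N]])
  have s': "s \<in> {s..<e}" using se by simp
  obtain p where "p < N" "lev s 0 = f p" using D(3)[OF key_setI(1)[OF s' L]] by blast
  then have "f 0 \<le> 0" using D(1)[of 0 p] lev0[OF s'] by simp
  then show "f 0 = 0" using f0 by simp
  have top: "f p \<le> f (N - 1)" if "p < N" for p using that N by (intro D(1)) auto
  have "b \<le> covered (f (N - 1))"
  proof (rule covered_saturated)
    show "0 \<le> f (N - 1)" using top[OF N] f0 by simp
    fix k assume k: "k \<in> {s..<e}"
    obtain p where "p < N" "cst k (u k) = f p" using D(3)[OF key_setI(3)[OF k L]] by blast
    then show "cst k (u k) \<le> f (N - 1)" using top[of p] by simp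
  qed
  then show "b \<le> covered (f (3 * (e - s) * L - 1))" unfolding N_def .
qed

text \<open>Supplies the hypotheses \<open>gap\<close> of \<open>estimate_factor\<close> for
  neighbouring keys.\<close>

lemma sorted_keys_gap:
  assumes "sorted_keys f" "p + 1 < 3 * (e - s) * L" "v \<in> key_set"
  shows "v \<le> f p \<or> f (p + 1) \<le> v"
proof -
  define N where "N = 3 * (e - s) * L"
  note D = sorted_keysD[OF assms(1) N_def]
  have p: "p + 1 < N" using assms(2) unfolding N_def .
  obtain q where q: "q < N" "v = f q" using D(3)[OF assms(3)] by blast
  show ?thesis using D(1)[of q p] D(1)[of "p + 1" q] q p by (cases "q \<le> p") auto
qed

lemma solving_nput:
  assumes "solving \<sigma> \<tau>" "a \<in> {''lo'', ''hi'', ''mid''}"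
  shows "solving \<sigma> (nput a k v \<tau>)"
  by (rule solving_same[OF assms(1)]) (use assms(2) in \<open>auto simp: same_def\<close>)

lemma solving_rput:
  assumes "solving \<sigma> \<tau>" "a \<in> {''lv'', ''top''}"
  shows "solving \<sigma> (rput a k w \<tau>)"
  by (rule solving_same[OF assms(1)]) (use assms(2) in \<open>auto simp: same_def\<close>)

lemma nwrites_search [simp]:
  "nwrites search = {''lo'', ''hi'', ''mid'', ''k'', ''a'', ''c'', ''d'', ''o''}" "rwrites search = {''lv'', ''x'', ''z'', ''r''}"
  by (auto simp: search_def)

definition bracket :: "(nat \<Rightarrow> real) \<Rightarrow> memory \<Rightarrow> bool" where
  "bracket f \<tau> \<longleftrightarrow> nmem \<tau> ''lo'' 0 < nmem \<tau> ''hi'' 0 \<and> nmem \<tau> ''hi'' 0 < 3 * (e - s) * L \<and>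
     covered (f (nmem \<tau> ''lo'' 0)) < b \<and> b \<le> covered (f (nmem \<tau> ''hi'' 0))"

lemma reach_search:
  assumes R: "solving \<sigma> \<tau>" and f: "sorted_keys f" "rmem \<sigma> ''key'' = f" and y: "nmem \<sigma> ''y'' 0 = 3 * (e - s) * L"
    and b0: "covered 0 < b" and c: "3 * (e - s) * L \<le> 2 ^ c"
  shows "reach search \<tau> (3 + c * (5 + eval_time)) (\<lambda>\<tau>'. solving \<sigma> \<tau>' \<and> bracket f \<tau>' \<and> nmem \<tau>' ''hi'' 0 = nmem \<tau>' ''lo'' 0 + 1)"
proof -
  let ?N = "3 * (e - s) * L"
  let ?set = "ns ''mid'' (NHalf (NAdd (nv ''lo'') (nv ''hi''))) ;; rs ''lv'' (RGet ''key'' (nv ''mid''))"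
  let ?cmp = "Cond (RLess (RConst 0) (rv ''r'')) (ns ''lo'' (nv ''mid'')) (ns ''hi'' (nv ''mid''))"
  let ?b = "NLess (NAdd (nv ''lo'') (NConst 1)) (nv ''hi'')"
  let ?c = "?set ;; eval_row ;; ?cmp"
  let ?\<tau> = "nput ''hi'' 0 (?N - 1) (nput ''lo'' 0 0 \<tau>)"
  let ?I = "\<lambda>n \<tau>'. solving \<sigma> \<tau>' \<and> bracket f \<tau>' \<and> nmem \<tau>' ''hi'' 0 - nmem \<tau>' ''lo'' 0 \<le> 2 ^ n"
  let ?Q = "\<lambda>\<tau>'. solving \<sigma> \<tau>' \<and> bracket f \<tau>' \<and> nmem \<tau>' ''hi'' 0 = nmem \<tau>' ''lo'' 0 + 1"
  have N: "3 \<le> ?N"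
  proof -
    have "1 \<le> (e - s) * L" using se L by simp
    then show ?thesis by simp
  qed
  then have N2: "1 < ?N" "?N - 1 < ?N" by linarith+
  have loop: "reach (While ?b ?c) ?\<tau> (1 + c * (1 + (4 + eval_time))) ?Q"
  proof (rule reach_While[where I = ?I])
    have "solving \<sigma> ?\<tau>" by (simp add: solving_nput R)
    moreover have "bracket f ?\<tau>" unfolding bracket_def
    proof (intro conjI)
      show "nmem ?\<tau> ''lo'' 0 < nmem ?\<tau> ''hi'' 0" "nmem ?\<tau> ''hi'' 0 < ?N" using N2 by simp_all
    qed (use sorted_keys_ends[OF f(1)] b0 in simp_all)
    ultimately show "?I c ?\<tau>" using c by simp
  next
    fix n \<tau>' assume I: "?I n \<tau>'" and b: "bval ?b \<tau>'"
    define lo hi where "lo = nmem \<tau>' ''lo'' 0" and "hi = nmem \<tau>' ''hi'' 0"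
    have br: "lo < hi" "hi < ?N" "covered (f lo) < b" "b \<le> covered (f hi)" "hi - lo \<le> 2 ^ n"
      using I by (auto simp: bracket_def lo_def hi_def)
    have lh: "lo + 1 < hi" using b by (simp add: lo_def hi_def)
    have n: "0 < n"
    proof (rule ccontr)
      assume "\<not> 0 < n"
      then have "hi - lo \<le> 1" using br(5) by simp
      then show False using lh by arith
    qed
    then obtain n' where n': "n = Suc n'" by (cases n) auto
    define mid where "mid = (lo + hi) div 2"
    have mid: "lo < mid" "mid < hi" "hi - mid \<le> 2 ^ n'" "mid - lo \<le> 2 ^ n'"
      using lh br(5) unfolding n' mid_def by auto
    have Rk: "rmem \<tau>' ''key'' = f"
      using same_rmem[OF solvingD(2)[of \<sigma> \<tau>'], of "''key''"] I f(2) by simp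
    have R1: "solving \<sigma> (run ?set \<tau>')"
      by (simp add: solving_nput solving_rput conjunct1[OF I])
    have lv: "rmem (run ?set \<tau>') ''lv'' 0 = f mid" by (simp add: Rk mid_def lo_def hi_def)
    have fm: "0 \<le> f mid" using sorted_keys_nonneg[OF f(1)] mid br(2) by simp
    have "reach ?c \<tau>' (4 + eval_time) (?I n')"
    proof (rule reach_Seq_run[where U = "eval_time + 2"])
      show "reach (eval_row ;; ?cmp) (run ?set \<tau>') (eval_time + 2) (?I n')"
      proof (rule reach_Seq_then[OF step_eval[OF R1 lv fm]])
        fix \<rho> assume Q: "solving \<sigma> \<rho> \<and> at_level (f mid) \<rho> \<and> same {''k'', ''a'', ''c'', ''d'', ''o''} {''x'', ''z'', ''r''} (run ?set \<tau>') \<rho>"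
        then have sm: "same {''k'', ''a'', ''c'', ''d'', ''o''} {''x'', ''z'', ''r''} (run ?set \<tau>') \<rho>" by blast
        have v: "nmem \<rho> ''lo'' 0 = lo" "nmem \<rho> ''hi'' 0 = hi" "nmem \<rho> ''mid'' 0 = mid"
          using same_nmem[OF sm] by (simp_all add: lo_def hi_def mid_def)
        have r: "rmem \<rho> ''r'' 0 = b - covered (f mid)" using Q unfolding at_level_def by blast
        show "reach ?cmp \<rho> 2 (?I n')"
        proof (rule reach_run)
          show "?I n' (run ?cmp \<rho>)"
          proof (cases "covered (f mid) < b")
            case True
            then have e: "run ?cmp \<rho> = nput ''lo'' 0 mid \<rho>" by (simp add: r v)
            have "solving \<sigma> (nput ''lo'' 0 mid \<rho>)" by (simp add: solving_nput conjunct1[OF Q])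
            then show ?thesis unfolding e using True mid br by (simp add: bracket_def v)
          next
            case False
            then have e: "run ?cmp \<rho> = nput ''hi'' 0 mid \<rho>" by (simp add: r v)
            have "solving \<sigma> (nput ''hi'' 0 mid \<rho>)" by (simp add: solving_nput conjunct1[OF Q])
            then show ?thesis unfolding e using False mid br by (simp add: bracket_def v)
          qed
        qed simp_all
      qed simp
    qed simp_all
    then show "0 < n \<and> reach ?c \<tau>' (4 + eval_time) (?I (n - 1))" using n' by simp
  next
    fix n \<tau>' assume I: "?I n \<tau>'" and b: "\<not> bval ?b \<tau>'"
    then show "?Q \<tau>'" by (auto simp: bracket_def)
  qed
  have y': "nmem \<tau> ''y'' 0 = ?N" using same_nmem[OF solvingD(2)[OF R], of "''y''"] y by simp
  show ?thesis unfolding search_def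
    by (rule reach_Seq_run[where U = "1 + c * (1 + (4 + eval_time))"]) (use loop y' in simp_all)
qed

lemma reach_halve:
  assumes R: "solving \<sigma> \<tau>" and at: "at_level (T / 2) \<tau>" and top: "rmem \<tau> ''top'' 0 = T" and T: "0 \<le> T" "b \<le> covered T"
    and H: "\<And>j. b \<le> covered (T / 2 ^ j) \<Longrightarrow> j < m"
  shows "reach halve \<tau> (1 + m * (3 + eval_time)) (\<lambda>\<tau>'. solving \<sigma> \<tau>' \<and> (\<exists>V. 0 \<le> V \<and> covered V < b \<and> b \<le> covered (2 * V) \<and>
     at_level V \<tau>' \<and> rmem \<tau>' ''top'' 0 = 2 * V))"
proof -
  let ?set = "rs ''top'' (rv ''lv'') ;; rs ''lv'' (RDiv (rv ''lv'') (RConst 2))"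
  \<comment> \<open>After \<open>j\<close> successful halvings \<open>top\<close> is sufficient and
    its half has just been evaluated; \<open>H\<close> keeps \<open>j\<close> below
    \<open>m\<close>.\<close>
  let ?I = "\<lambda>n \<tau>'. \<exists>j. n = m - j \<and> solving \<sigma> \<tau>' \<and> at_level (T / 2 ^ Suc j) \<tau>' \<and> rmem \<tau>' ''top'' 0 = T / 2 ^ j \<and> b \<le> covered (T / 2 ^ j)"
  let ?Q = "\<lambda>\<tau>'. solving \<sigma> \<tau>' \<and> (\<exists>V. 0 \<le> V \<and> covered V < b \<and> b \<le> covered (2 * V) \<and>
     at_level V \<tau>' \<and> rmem \<tau>' ''top'' 0 = 2 * V)"
  have "reach halve \<tau> (1 + m * (1 + (2 + eval_time))) ?Q"
    unfolding halve_def
  proof (rule reach_While[where I = ?I])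
    show "?I m \<tau>" by (rule exI[of _ 0]) (use R at top T in simp)
  next
    fix n \<tau>' assume I: "?I n \<tau>'" and b: "bval (BNot (RLess (RConst 0) (rv ''r''))) \<tau>'"
    then obtain j where j: "n = m - j" "solving \<sigma> \<tau>'" "at_level (T / 2 ^ Suc j) \<tau>'" by blast
    have r: "rmem \<tau>' ''r'' 0 = b - covered (T / 2 ^ Suc j)" "rmem \<tau>' ''lv'' 0 = T / 2 ^ Suc j"
      using j(3) unfolding at_level_def by blast+
    have cov: "b \<le> covered (T / 2 ^ Suc j)" using b r by simp
    then have jm: "Suc j < m" by (rule H)
    have R1: "solving \<sigma> (run ?set \<tau>')"
      by (simp add: solving_rput j(2))
    have lv: "rmem (run ?set \<tau>') ''lv'' 0 = T / 2 ^ Suc (Suc j)" by (simp add: r)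
    have tp: "rmem (run ?set \<tau>') ''top'' 0 = T / 2 ^ Suc j" by (simp add: r)
    have "reach (?set ;; eval_row) \<tau>' (2 + eval_time) (?I (n - 1))"
    proof (rule reach_Seq_run[where U = eval_time])
      show "reach eval_row (run ?set \<tau>') eval_time (?I (n - 1))"
      proof (rule reach_conseq[OF step_eval[OF R1 lv]])
        fix \<rho> assume Q: "solving \<sigma> \<rho> \<and> at_level (T / 2 ^ Suc (Suc j)) \<rho> \<and> same {''k'', ''a'', ''c'', ''d'', ''o''} {''x'', ''z'', ''r''} (run ?set \<tau>') \<rho>"
        then have sm: "same {''k'', ''a'', ''c'', ''d'', ''o''} {''x'', ''z'', ''r''} (run ?set \<tau>') \<rho>" by blast
        have "rmem \<rho> ''top'' 0 = T / 2 ^ Suc j" using same_rmem[OF sm, of "''top''"] tp by simp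
        then show "?I (n - 1) \<rho>" using Q cov j(1) by (intro exI[of _ "Suc j"]) simp
      qed (use T in simp_all)
    qed simp_all
    then show "0 < n \<and> reach (?set ;; eval_row) \<tau>' (2 + eval_time) (?I (n - 1))" using j(1) jm by simp
  next
    fix n \<tau>' assume I: "?I n \<tau>'" and b: "\<not> bval (BNot (RLess (RConst 0) (rv ''r''))) \<tau>'"
    then obtain j where j: "solving \<sigma> \<tau>'" "at_level (T / 2 ^ Suc j) \<tau>'" "rmem \<tau>' ''top'' 0 = T / 2 ^ j" "b \<le> covered (T / 2 ^ j)" by blast
    have "rmem \<tau>' ''r'' 0 = b - covered (T / 2 ^ Suc j)" using j(2) unfolding at_level_def by blast
    then have "covered (T / 2 ^ Suc j) < b" using b by simp
    moreover have "2 * (T / 2 ^ Suc j) = T / 2 ^ j" by simp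
    ultimately show "?Q \<tau>'" using j T by (intro conjI exI[of _ "T / 2 ^ Suc j"]) simp_all
  qed
  then show ?thesis by (simp add: numeral_3_eq_3)
qed

lemma reach_refine:
  assumes R: "solving \<sigma> \<tau>" and f: "sorted_keys f" "rmem \<sigma> ''key'' = f"
    and br: "bracket f \<tau>" "nmem \<tau> ''hi'' 0 = nmem \<tau> ''lo'' 0 + 1" and m: "e - s < 2 ^ m"
  shows "reach refine \<tau> (5 + m * (3 + eval_time) + 3 * eval_time + 2 * finish_time)
     (\<lambda>\<tau>'. solving \<sigma> \<tau>' \<and> (\<exists>B. good_increase B \<and> at_level B \<tau>'))"
proof -
  let ?Q = "\<lambda>\<tau>'. solving \<sigma> \<tau>' \<and> (\<exists>B. good_increase B \<and> at_level B \<tau>')"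
  define lo where "lo = nmem \<tau> ''lo'' 0"
  have lo: "lo + 1 < 3 * (e - s) * L" "covered (f lo) < b" "b \<le> covered (f (lo + 1))"
    using br unfolding bracket_def lo_def by auto
  have key: "rmem \<tau> ''key'' = f" using same_rmem[OF solvingD(2)[OF R], of "''key''"] f(2) by simp
  have pos: "0 \<le> f lo" "0 \<le> f (lo + 1)" using sorted_keys_nonneg[OF f(1)] lo(1) by simp_all
  have last: "reach (rs ''lv'' (rv ''top'') ;; eval_row) \<rho> (1 + eval_time) ?Q"
    if "solving \<sigma> \<rho>" "good_increase (rmem \<rho> ''top'' 0)" for \<rho>
  proof (rule reach_Seq_run[where U = eval_time])
    let ?B = "rmem \<rho> ''top'' 0"
    have R1: "solving \<sigma> (rput ''lv'' 0 ?B \<rho>)" by (simp add: solving_rput that(1))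
    have B: "0 \<le> ?B" using that(2) unfolding good_increase_def by blast
    have "reach eval_row (rput ''lv'' 0 ?B \<rho>) eval_time ?Q"
      by (rule reach_conseq[OF step_eval[OF R1 _ B]]) (use that(2) in auto)
    then show "reach eval_row (run (rs ''lv'' (rv ''top'')) \<rho>) eval_time ?Q" by simp
  qed simp_all
  have second: "reach (finish ;; rs ''lv'' (rv ''top'') ;; eval_row) \<rho> (finish_time + (1 + eval_time)) ?Q"
    if h: "solving \<sigma> \<rho> \<and> (\<exists>V. 0 \<le> V \<and> covered V < b \<and> b \<le> covered (2 * V) \<and>
     at_level V \<rho> \<and> rmem \<rho> ''top'' 0 = 2 * V)" for \<rho>
  proof -
    obtain V where V: "0 \<le> V" "covered V < b" "b \<le> covered (2 * V)" "at_level V \<rho>" "rmem \<rho> ''top'' 0 = 2 * V"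
      using h by blast
    show ?thesis
    proof (rule reach_Seq_then[OF step_finish[OF conjunct1[OF h] V(4,1,2)]])
      fix \<rho>' assume Q: "solving \<sigma> \<rho>' \<and> finished V (rmem \<rho> ''top'' 0) (rmem \<rho>' ''top'' 0)"
      show "reach (rs ''lv'' (rv ''top'') ;; eval_row) \<rho>' (1 + eval_time) ?Q"
        by (rule last[OF conjunct1[OF Q] finished_good[OF V(1,2) _ V(3)]]) (use Q V(5) in simp)
    qed simp
  qed
  have halving: "reach (rs ''lv'' (RDiv (rv ''top'') (RConst 2)) ;; eval_row ;; halve ;; finish ;; rs ''lv'' (rv ''top'') ;; eval_row) \<rho>
      (1 + (eval_time + ((1 + m * (3 + eval_time)) + (finish_time + (1 + eval_time))))) ?Q"
    if h: "solving \<sigma> \<rho>" "finished (f lo) (f (lo + 1)) (rmem \<rho> ''top'' 0)" for \<rho>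
  proof (rule reach_Seq_run[where U = "eval_time + ((1 + m * (3 + eval_time)) + (finish_time + (1 + eval_time)))"])
    define T where "T = rmem \<rho> ''top'' 0"
    have T: "0 \<le> T" "b \<le> covered T"
      using finished_covered[OF pos(1) lo(2) h(2) pos(2) lo(3)] by (simp_all add: T_def)
    \<comment> \<open>The keys at \<open>lo\<close> and \<open>lo + 1\<close> play the roles of
      \<open>s\<close> and \<open>s'\<close> in \<open>estimate_factor\<close>.\<close>
    have est: "T \<le> real (card {s..<e}) * B" if "0 \<le> B" "b \<le> covered B" for B
    proof (rule estimate_factor[OF pos(1) lo(2), of "f (lo + 1)"])
      fix k d assume k: "k \<in> {s..<e}" "d < L"
      show "lev k d \<le> f lo \<or> f (lo + 1) \<le> lev k d" by (rule sorted_keys_gap[OF f(1) lo(1) key_setI(1)[OF k]])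
      show "next_unit k d \<le> f lo \<or> f (lo + 1) \<le> next_unit k d" by (rule sorted_keys_gap[OF f(1) lo(1) key_setI(2)[OF k]])
    next
      fix k assume k: "k \<in> {s..<e}"
      show "cst k (u k) \<le> f lo \<or> f (lo + 1) \<le> cst k (u k)" by (rule sorted_keys_gap[OF f(1) lo(1) key_setI(3)[OF k L]])
    next
      show "T \<le> f (lo + 1)" "\<And>k. k \<in> {s..<e} \<Longrightarrow> target k (f lo) \<le> u k \<Longrightarrow> T \<le> cst k (target k (f lo))"
        using h(2) unfolding finished_def T_def by auto
    qed (use that in auto)
    \<comment> \<open>For \<open>j \<ge> m\<close> the level \<open>T / 2 ^ m\<close>, which is no
      smaller, would be sufficient as well, against \<open>covered_halving_bound\<close>.\<close>
    have H: "j < m" if "b \<le> covered (T / 2 ^ j)" for j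
    proof (rule ccontr)
      assume "\<not> j < m"
      then have "T / 2 ^ j \<le> T / 2 ^ m" using T(1) by (intro divide_left_mono power_increasing) auto
      then have "covered (T / 2 ^ j) \<le> covered (T / 2 ^ m)" using T(1) by (intro covered_mono) auto
      then have "b \<le> covered (T / 2 ^ m)" using that by simp
      then show False using covered_halving_bound[OF pos(1) lo(2) est _ T(1)] m by simp
    qed
    let ?\<rho> = "rput ''lv'' 0 (T / 2) \<rho>"
    have R1: "solving \<sigma> ?\<rho>" by (simp add: solving_rput h(1))
    have "reach (eval_row ;; halve ;; finish ;; rs ''lv'' (rv ''top'') ;; eval_row) ?\<rho>
      (eval_time + ((1 + m * (3 + eval_time)) + (finish_time + (1 + eval_time)))) ?Q"
    proof (rule reach_Seq_then[OF step_eval[OF R1, of "T / 2"]])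
      fix \<rho>' assume Q: "solving \<sigma> \<rho>' \<and> at_level (T / 2) \<rho>' \<and> same {''k'', ''a'', ''c'', ''d'', ''o''} {''x'', ''z'', ''r''} ?\<rho> \<rho>'"
      then have sm: "same {''k'', ''a'', ''c'', ''d'', ''o''} {''x'', ''z'', ''r''} ?\<rho> \<rho>'" by blast
      have tp: "rmem \<rho>' ''top'' 0 = T" using same_rmem[OF sm, of "''top''"] by (simp add: T_def)
      show "reach (halve ;; finish ;; rs ''lv'' (rv ''top'') ;; eval_row) \<rho>' ((1 + m * (3 + eval_time)) + (finish_time + (1 + eval_time))) ?Q"
        by (rule reach_Seq_then[OF reach_halve[OF _ _ tp T H] second]) (use Q in auto)
    qed (use T in simp_all)
    then show "reach (eval_row ;; halve ;; finish ;; rs ''lv'' (rv ''top'') ;; eval_row) (run (rs ''lv'' (RDiv (rv ''top'') (RConst 2))) \<rho>)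
      (eval_time + ((1 + m * (3 + eval_time)) + (finish_time + (1 + eval_time)))) ?Q" by (simp add: T_def)
  qed simp_all
  let ?\<tau> = "rput ''lv'' 0 (f lo) (rput ''top'' 0 (f (lo + 1)) \<tau>)"
  have R1: "solving \<sigma> ?\<tau>" by (simp add: solving_rput R)
  have all: "reach (eval_row ;; finish ;; rs ''lv'' (RDiv (rv ''top'') (RConst 2)) ;; eval_row ;; halve ;; finish ;; rs ''lv'' (rv ''top'') ;; eval_row) ?\<tau>
    (eval_time + (finish_time + (1 + (eval_time + ((1 + m * (3 + eval_time)) + (finish_time + (1 + eval_time))))))) ?Q"
  proof (rule reach_Seq_then[OF step_eval[OF R1, of "f lo"]])
    fix \<rho> assume Q: "solving \<sigma> \<rho> \<and> at_level (f lo) \<rho> \<and> same {''k'', ''a'', ''c'', ''d'', ''o''} {''x'', ''z'', ''r''} ?\<tau> \<rho>"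
    then have sm: "same {''k'', ''a'', ''c'', ''d'', ''o''} {''x'', ''z'', ''r''} ?\<tau> \<rho>" by blast
    have tp: "rmem \<rho> ''top'' 0 = f (lo + 1)" using same_rmem[OF sm, of "''top''"] by simp
    show "reach (finish ;; rs ''lv'' (RDiv (rv ''top'') (RConst 2)) ;; eval_row ;; halve ;; finish ;; rs ''lv'' (rv ''top'') ;; eval_row) \<rho>
      (finish_time + (1 + (eval_time + ((1 + m * (3 + eval_time)) + (finish_time + (1 + eval_time)))))) ?Q"
    proof (rule reach_Seq_then[OF step_finish[OF _ _ pos(1) lo(2)]])
      show "solving \<sigma> \<rho>" "at_level (f lo) \<rho>" using Q by auto
    qed (use halving tp in auto)
  qed (use pos in simp_all)
  show ?thesis unfolding refine_def
  proof (rule reach_Seq_run)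
    have "run (rs ''top'' (RGet ''key'' (nv ''hi'')) ;; rs ''lv'' (RGet ''key'' (nv ''lo''))) \<tau> = ?\<tau>"
      using br(2) key by (simp add: lo_def)
    then show "reach (eval_row ;; finish ;; rs ''lv'' (RDiv (rv ''top'') (RConst 2)) ;; eval_row ;; halve ;; finish ;; rs ''lv'' (rv ''top'') ;; eval_row)
      (run (rs ''top'' (RGet ''key'' (nv ''hi'')) ;; rs ''lv'' (RGet ''key'' (nv ''lo''))) \<tau>)
      (eval_time + (finish_time + (1 + (eval_time + ((1 + m * (3 + eval_time)) + (finish_time + (1 + eval_time))))))) ?Q"
      using all by (simp only:)
  qed simp_all
qed

lemma nwrites_refine [simp]:
  "nwrites refine = {''k'', ''a'', ''c'', ''d'', ''o''}" "rwrites refine = {''lv'', ''x'', ''z'', ''r'', ''top'', ''t'', ''m'', ''v''}"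
  by (auto simp: refine_def halve_def)

lemma nwrites_solve_row [simp]:
  "nwrites solve_row = {''k'', ''a'', ''c'', ''d'', ''o'', ''y'', ''b'', ''mid'', ''en'', ''p'', ''q'', ''w'', ''lo'', ''hi''}"
  "rwrites solve_row = {''lv'', ''x'', ''z'', ''r'', ''top'', ''t'', ''m'', ''v'', ''key'', ''tmp''}"
  by (auto simp: solve_row_def)

text \<open>The bounds of the stages in program order. With \<open>e - s < 2 ^ m\<close> there are
  fewer than \<open>2 ^ (m + 2)\<close> runs of keys, hence \<open>m + 2\<close> rounds of merging
  and \<open>m + 2 + h\<close> steps of search.\<close>

definition solve_time :: "nat \<Rightarrow> nat" where
  "solve_time m = (4 + (e - s) * (10 + L * 10)) + ((2 + (m + 2) * (7 + 3 * (e - s) * L * 14)) + (1 + (eval_time +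
     (1 + ((3 + (m + 2 + h) * (5 + eval_time)) + (5 + m * (3 + eval_time) + 3 * eval_time + 2 * finish_time))))))"

lemma reach_solve_row:
  assumes ok: "row_ok \<sigma>" and m: "e - s < 2 ^ m"
  shows "reach solve_row \<sigma> (solve_time m) (\<lambda>\<tau>. \<exists>B. good_increase B \<and>
     (\<forall>k. rmem \<tau> ''x'' k = (if k \<in> {s..<e} then lvl k B else rmem \<sigma> ''x'' k)))"
proof -
  define N where "N = 3 * (e - s) * L"
  let ?Q = "\<lambda>\<tau>. \<exists>B. good_increase B \<and> (\<forall>k. rmem \<tau> ''x'' k = (if k \<in> {s..<e} then lvl k B else rmem \<sigma> ''x'' k))"
  have m3: "3 * (e - s) \<le> 2 ^ (m + 2)" using m by simp
  have NL: "N \<le> L * 2 ^ (m + 2)"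
    unfolding N_def using mult_le_mono1[OF m3, of L] by (simp only: mult.commute)
  have Nh: "N \<le> 2 ^ (m + 2 + h)"
  proof -
    have "L * 2 ^ (m + 2) \<le> 2 ^ h * 2 ^ (m + 2)" using h by (rule mult_le_mono1)
    also have "\<dots> = 2 ^ (m + 2 + h)" by (simp only: power_add mult.commute)
    finally show ?thesis using NL by simp
  qed
  have fin: "?Q \<tau>" if r: "solving \<rho> \<tau>" "good_increase B" "at_level B \<tau>" and x: "rmem \<rho> ''x'' = rmem \<sigma> ''x''" for \<rho> \<tau> B
  proof (intro exI[of _ B] conjI allI)
    fix k show "rmem \<tau> ''x'' k = (if k \<in> {s..<e} then lvl k B else rmem \<sigma> ''x'' k)"
      using solvingD(3)[OF r(1)] r(3) x unfolding at_level_def by auto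
  qed (rule r(2))
  have search: "reach (rs ''lv'' (RConst 0) ;; eval_row ;; Cond (RLess (RConst 0) (rv ''r'')) (search ;; refine) Skip) \<rho>
    (1 + (eval_time + (1 + ((3 + (m + 2 + h) * (5 + eval_time)) + (5 + m * (3 + eval_time) + 3 * eval_time + 2 * finish_time))))) ?Q"
    if ok': "row_ok \<rho>" and f: "sorted_keys (rmem \<rho> ''key'')" and y: "nmem \<rho> ''y'' 0 = N" and x: "rmem \<rho> ''x'' = rmem \<sigma> ''x''" for \<rho>
  proof (rule reach_Seq_run[where U = "eval_time + (1 + ((3 + (m + 2 + h) * (5 + eval_time)) + (5 + m * (3 + eval_time) + 3 * eval_time + 2 * finish_time)))"])
    have R: "solving \<rho> (rput ''lv'' 0 0 \<rho>)"
      by (rule solving_rput) (simp_all add: solving_def ok' same_refl)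
    have "reach (eval_row ;; Cond (RLess (RConst 0) (rv ''r'')) (search ;; refine) Skip) (rput ''lv'' 0 0 \<rho>)
      (eval_time + (1 + ((3 + (m + 2 + h) * (5 + eval_time)) + (5 + m * (3 + eval_time) + 3 * eval_time + 2 * finish_time)))) ?Q"
    proof (rule reach_Seq_then[OF step_eval[OF R, of 0]])
      fix \<tau> assume "solving \<rho> \<tau> \<and> at_level 0 \<tau> \<and> same {''k'', ''a'', ''c'', ''d'', ''o''} {''x'', ''z'', ''r''} (rput ''lv'' 0 0 \<rho>) \<tau>"
      then have Q: "solving \<rho> \<tau>" "at_level 0 \<tau>" by blast+
      have r: "rmem \<tau> ''r'' 0 = b - covered 0" using Q(2) unfolding at_level_def by blast
      show "reach (Cond (RLess (RConst 0) (rv ''r'')) (search ;; refine) Skip) \<tau>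
        (1 + ((3 + (m + 2 + h) * (5 + eval_time)) + (5 + m * (3 + eval_time) + 3 * eval_time + 2 * finish_time))) ?Q"
      proof (rule reach_Cond)
        assume "bval (RLess (RConst 0) (rv ''r'')) \<tau>"
        then have b0: "covered 0 < b" by (simp add: r)
        show "reach (search ;; refine) \<tau> ((3 + (m + 2 + h) * (5 + eval_time)) + (5 + m * (3 + eval_time) + 3 * eval_time + 2 * finish_time)) ?Q"
        proof (rule reach_Seq_then[OF reach_search[OF Q(1) f refl y[unfolded N_def] b0 Nh[unfolded N_def]]])
          fix \<tau>' assume S: "solving \<rho> \<tau>' \<and> bracket (rmem \<rho> ''key'') \<tau>' \<and> nmem \<tau>' ''hi'' 0 = nmem \<tau>' ''lo'' 0 + 1"
          then have S': "solving \<rho> \<tau>'" "bracket (rmem \<rho> ''key'') \<tau>'" "nmem \<tau>' ''hi'' 0 = nmem \<tau>' ''lo'' 0 + 1" by blast+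
          show "reach refine \<tau>' (5 + m * (3 + eval_time) + 3 * eval_time + 2 * finish_time) ?Q"
            by (rule reach_conseq[OF reach_refine[OF S'(1) f refl S'(2,3) m]]) (use fin x in blast)+
        qed simp
      next
        assume "\<not> bval (RLess (RConst 0) (rv ''r'')) \<tau>"
        then have "good_increase 0" by (intro good_increase_0) (simp add: r)
        then have "?Q \<tau>" by (rule fin[OF Q(1) _ Q(2) x])
        then show "reach Skip \<tau> ((3 + (m + 2 + h) * (5 + eval_time)) + (5 + m * (3 + eval_time) + 3 * eval_time + 2 * finish_time)) ?Q"
          by (rule_tac reach_run) simp_all
      qed
    qed simp_all
    then show "reach (eval_row ;; Cond (RLess (RConst 0) (rv ''r'')) (search ;; refine) Skip) (run (rs ''lv'' (RConst 0)) \<rho>)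
      (eval_time + (1 + ((3 + (m + 2 + h) * (5 + eval_time)) + (5 + m * (3 + eval_time) + 3 * eval_time + 2 * finish_time)))) ?Q" by simp
  qed simp_all
  show ?thesis unfolding solve_row_def solve_time_def
  proof (rule reach_Seq_then[OF reach_same[OF reach_make_keys[OF ok]]])
    fix \<tau> assume "same (nwrites make_keys) (rwrites make_keys) \<sigma> \<tau> \<and> nmem \<tau> ''y'' 0 = 3 * (e - s) * L \<and> keys_upto e (rmem \<tau> ''key'')"
    then have K: "same (nwrites make_keys) (rwrites make_keys) \<sigma> \<tau>" "nmem \<tau> ''y'' 0 = N" "keys_upto e (rmem \<tau> ''key'')"
      by (simp_all only: N_def)
    have ok1: "row_ok \<tau>" by (rule row_ok_same[OF ok K(1)]) simp_all
    have bs: "bsorted L N (rmem \<tau> ''key'')" using keys_bsorted[OF K(3)] by (simp only: N_def)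
    show "reach (merge_sort ;; rs ''lv'' (RConst 0) ;; eval_row ;; Cond (RLess (RConst 0) (rv ''r'')) (search ;; refine) Skip) \<tau>
      ((2 + (m + 2) * (7 + 3 * (e - s) * L * 14)) + (1 + (eval_time +
     (1 + ((3 + (m + 2 + h) * (5 + eval_time)) + (5 + m * (3 + eval_time) + 3 * eval_time + 2 * finish_time)))))) ?Q"
    proof (rule reach_Seq_then[OF reach_same[OF reach_merge_sort[OF L bs K(2) row_okD(4)[OF ok1] NL]]])
      fix \<rho> assume "same (nwrites merge_sort) (rwrites merge_sort) \<tau> \<rho> \<and> (\<forall>x y. x \<le> y \<longrightarrow> y < N \<longrightarrow> rmem \<rho> ''key'' x \<le> rmem \<rho> ''key'' y) \<and>
        rmem \<rho> ''key'' ` {..<N} = rmem \<tau> ''key'' ` {..<N}"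
      then have S: "same (nwrites merge_sort) (rwrites merge_sort) \<tau> \<rho>" "\<forall>x y. x \<le> y \<longrightarrow> y < N \<longrightarrow> rmem \<rho> ''key'' x \<le> rmem \<rho> ''key'' y"
        "rmem \<rho> ''key'' ` {..<N} = rmem \<tau> ''key'' ` {..<N}" by blast+
      have "sorted_keys (rmem \<rho> ''key'')"
        unfolding sorted_keys_def N_def[symmetric] using S(2,3) keys_image[OF K(3)] unfolding N_def[symmetric] by (simp only:)
      moreover have "row_ok \<rho>" by (rule row_ok_same[OF ok1 S(1)]) simp_all
      moreover have "nmem \<rho> ''y'' 0 = N" using same_nmem[OF S(1), of "''y''"] K(2) by simp
      moreover have "rmem \<rho> ''x'' = rmem \<sigma> ''x''"
        using same_rmem[OF S(1), of "''x''"] same_rmem[OF K(1), of "''x''"] by simp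
      ultimately show "reach (rs ''lv'' (RConst 0) ;; eval_row ;; Cond (RLess (RConst 0) (rv ''r'')) (search ;; refine) Skip) \<rho>
        (1 + (eval_time + (1 + ((3 + (m + 2 + h) * (5 + eval_time)) + (5 + m * (3 + eval_time) + 3 * eval_time + 2 * finish_time))))) ?Q"
        by (intro search)
    qed (simp add: N_def)
  qed simp
qed

end

subsection \<open>Linked lists of breakpoints\<close>

text \<open>
  The processed entries of column \<open>j\<close> form a list from \<open>''head''\<close> along \<open>''next''\<close>, by decreasing
  value; \<open>k + 1\<close> points to entry \<open>k\<close> and 0 ends the list.
\<close>

primrec chain :: "(nat \<Rightarrow> nat) \<Rightarrow> nat \<Rightarrow> nat list \<Rightarrow> bool" where
  "chain nx p [] \<longleftrightarrow> p = 0"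
| "chain nx p (k # ks) \<longleftrightarrow> p = Suc k \<and> chain nx (nx k) ks"

lemma chain_cong: "(\<And>k. k \<in> set ks \<Longrightarrow> nx k = nx' k) \<Longrightarrow> chain nx p ks = chain nx' p ks"
  by (induction ks arbitrary: p) auto

text \<open>Redirecting the pointer of the last cell of \<open>a\<close> exchanges the tail
  \<open>b\<close> for \<open>c\<close>. Distinctness keeps this write away from all other
  cells.\<close>

lemma chain_splice:
  "chain nx p (a @ b) \<Longrightarrow> a \<noteq> [] \<Longrightarrow> distinct a \<Longrightarrow> chain nx q c \<Longrightarrow> set a \<inter> set c = {} \<Longrightarrow>
    chain (nx(last a := q)) p (a @ c)"
proof (induction a arbitrary: p)
  case (Cons k a)
  show ?case
  proof (cases "a = []")
    case True
    have "chain (nx(k := q)) q c" using Cons.prems(4,5) by (subst chain_cong[where nx' = nx]) auto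
    then show ?thesis using True Cons.prems by (simp add: fun_upd_def)
  next
    case False
    then have "last a \<noteq> k" using Cons.prems(3) by (metis distinct.simps(2) last_in_set)
    then show ?thesis using Cons False by simp
  qed
qed simp

text \<open>The list is decreasing while breakpoints are numbered upwards, hence the reversed index.
  Positions without a value get the breakpoint 0, so every entry has exactly \<open>L\<close>
  pieces, the surplus ones of length 0.\<close>

definition list_bp :: "nat \<Rightarrow> (real \<times> real) list \<Rightarrow> nat \<Rightarrow> real" where
  "list_bp L vs d = (if L - Suc d < length vs then fst (vs ! (L - Suc d)) else 0)"

text \<open>The first \<open>L - Suc d\<close> values are those above piece \<open>d\<close>; the
  price is due only if none of them is active.\<close>

definition list_sl :: "nat \<Rightarrow> real \<Rightarrow> real \<Rightarrow> (real \<times> real) list \<Rightarrow> nat \<Rightarrow> real" where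
  "list_sl L w c vs d = w + c * list_slope (take (L - Suc d) vs)"

primrec lev_of :: "(nat \<Rightarrow> real) \<Rightarrow> (nat \<Rightarrow> real) \<Rightarrow> nat \<Rightarrow> real" where
  "lev_of bp sl 0 = 0"
| "lev_of bp sl (Suc d) = lev_of bp sl d + sl d * (bp (Suc d) - bp d)"

text \<open>Filling the pieces from the top down follows the list from its head; \<open>pr\<close>
  is the probability that none of the values passed so far is active.\<close>

definition build_pieces :: com where
  "build_pieces = (ns ''ptr'' (NGet ''head'' (NGet ''col'' (nv ''k''))) ;; rs ''pr'' (RConst 1) ;; ns ''d'' (nv ''L'')) ;;
    While (NLess (NConst 0) (nv ''d''))
     (ns ''d'' (NSub (nv ''d'') (NConst 1)) ;;
      RPut ''sl'' (NAdd (nv ''o'') (nv ''d'')) (RAdd (RGet ''wt'' (nv ''k''))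
        (RMul (RMul (RGet ''price'' (NGet ''col'' (nv ''k''))) (RGet ''prob'' (nv ''i''))) (rv ''pr''))) ;;
      Cond (NLess (NConst 0) (nv ''ptr''))
       (RPut ''bp'' (NAdd (nv ''o'') (nv ''d'')) (RGet ''x'' (NSub (nv ''ptr'') (NConst 1))) ;;
        rs ''pr'' (RMul (rv ''pr'') (RSub (RConst 1) (RGet ''prob'' (NGet ''row'' (NSub (nv ''ptr'') (NConst 1)))))) ;;
        ns ''ptr'' (NGet ''next'' (NSub (nv ''ptr'') (NConst 1))))
       (RPut ''bp'' (NAdd (nv ''o'') (nv ''d'')) (RConst 0)))"

definition build_levels :: com where
  "build_levels = RPut ''lev'' (nv ''o'') (RConst 0) ;;
    For ''d'' (NConst 1) (nv ''L'')
     (RPut ''lev'' (NAdd (nv ''o'') (nv ''d'')) (RAdd (RGet ''lev'' (NSub (NAdd (nv ''o'') (nv ''d'')) (NConst 1)))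
       (RMul (RGet ''sl'' (NSub (NAdd (nv ''o'') (nv ''d'')) (NConst 1)))
         (RSub (RGet ''bp'' (NAdd (nv ''o'') (nv ''d''))) (RGet ''bp'' (NSub (NAdd (nv ''o'') (nv ''d'')) (NConst 1)))))))"

definition build_entry :: com where
  "build_entry = build_pieces ;; build_levels ;; ns ''o'' (NAdd (nv ''o'') (nv ''L''))"

definition build_row :: com where
  "build_row = ns ''o'' (NConst 0) ;; For ''k'' (nv ''s'') (nv ''e'') build_entry"

lemma nwrites_build [simp]:
  "nwrites build_pieces = {''ptr'', ''d''}" "rwrites build_pieces = {''pr'', ''sl'', ''bp''}"
  "nwrites build_levels = {''d''}" "rwrites build_levels = {''lev''}"
  "nwrites build_entry = {''ptr'', ''d'', ''o''}" "rwrites build_entry = {''pr'', ''sl'', ''bp'', ''lev''}"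
  "nwrites build_row = {''ptr'', ''d'', ''o'', ''k''}" "rwrites build_row = {''pr'', ''sl'', ''bp'', ''lev''}"
  by (auto simp: build_pieces_def build_levels_def build_entry_def build_row_def)

lemma list_slope_Suc: "c < length vs \<Longrightarrow> list_slope (take (Suc c) vs) = list_slope (take c vs) * (1 - snd (vs ! c))"
  by (simp add: take_Suc_conv_app_nth list_slope_def)

lemma reach_build_pieces:
  assumes m: "nmem \<sigma> ''L'' 0 = L" "nmem \<sigma> ''k'' 0 = k" "nmem \<sigma> ''o'' 0 = off" "nmem \<sigma> ''i'' 0 = i"
    and ch: "chain (nmem \<sigma> ''next'') (nmem \<sigma> ''head'' (nmem \<sigma> ''col'' k)) ks"
    and len: "length ks < L"
  defines "vs \<equiv> map (\<lambda>k. (rmem \<sigma> ''x'' k, rmem \<sigma> ''prob'' (nmem \<sigma> ''row'' k))) ks"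
    and "w \<equiv> rmem \<sigma> ''wt'' k" and "c \<equiv> rmem \<sigma> ''price'' (nmem \<sigma> ''col'' k) * rmem \<sigma> ''prob'' i"
  shows "reach build_pieces \<sigma> (4 + L * 7) (\<lambda>\<tau>. (\<forall>p<off. rmem \<tau> ''bp'' p = rmem \<sigma> ''bp'' p \<and> rmem \<tau> ''sl'' p = rmem \<sigma> ''sl'' p) \<and>
    (\<forall>d<L. rmem \<tau> ''bp'' (off + d) = list_bp L vs d \<and> rmem \<tau> ''sl'' (off + d) = list_sl L w c vs d))"
proof -
  let ?b = "NLess (NConst 0) (nv ''d'')"
  let ?c = "ns ''d'' (NSub (nv ''d'') (NConst 1)) ;;
      RPut ''sl'' (NAdd (nv ''o'') (nv ''d'')) (RAdd (RGet ''wt'' (nv ''k''))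
        (RMul (RMul (RGet ''price'' (NGet ''col'' (nv ''k''))) (RGet ''prob'' (nv ''i''))) (rv ''pr''))) ;;
      Cond (NLess (NConst 0) (nv ''ptr''))
       (RPut ''bp'' (NAdd (nv ''o'') (nv ''d'')) (RGet ''x'' (NSub (nv ''ptr'') (NConst 1))) ;;
        rs ''pr'' (RMul (rv ''pr'') (RSub (RConst 1) (RGet ''prob'' (NGet ''row'' (NSub (nv ''ptr'') (NConst 1)))))) ;;
        ns ''ptr'' (NGet ''next'' (NSub (nv ''ptr'') (NConst 1))))
       (RPut ''bp'' (NAdd (nv ''o'') (nv ''d'')) (RConst 0))"
  let ?\<sigma> = "nput ''d'' 0 L (rput ''pr'' 0 1 (nput ''ptr'' 0 (nmem \<sigma> ''head'' (nmem \<sigma> ''col'' k)) \<sigma>))"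
  let ?I = "\<lambda>n \<tau>. n \<le> L \<and> nmem \<tau> ''d'' 0 = n \<and> chain (nmem \<sigma> ''next'') (nmem \<tau> ''ptr'' 0) (drop (L - n) ks) \<and>
     rmem \<tau> ''pr'' 0 = list_slope (take (L - n) vs) \<and>
     (\<forall>p<off. rmem \<tau> ''bp'' p = rmem \<sigma> ''bp'' p \<and> rmem \<tau> ''sl'' p = rmem \<sigma> ''sl'' p) \<and>
     (\<forall>d<L. n \<le> d \<longrightarrow> rmem \<tau> ''bp'' (off + d) = list_bp L vs d \<and> rmem \<tau> ''sl'' (off + d) = list_sl L w c vs d)"
  let ?Q = "\<lambda>\<tau>. (\<forall>p<off. rmem \<tau> ''bp'' p = rmem \<sigma> ''bp'' p \<and> rmem \<tau> ''sl'' p = rmem \<sigma> ''sl'' p) \<and>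
    (\<forall>d<L. rmem \<tau> ''bp'' (off + d) = list_bp L vs d \<and> rmem \<tau> ''sl'' (off + d) = list_sl L w c vs d)"
  have loop: "reach (While ?b ?c) ?\<sigma> (1 + L * (1 + 6)) ?Q"
  proof (rule reach_While[where I = ?I])
    show "?I L ?\<sigma>" using ch by (simp add: list_slope_def)
  next
    fix n \<tau> assume I: "?I n \<tau>" and sm: "same (nwrites ?c) (rwrites ?c) ?\<sigma> \<tau>" and b: "bval ?b \<tau>"
    have sm': "same {''ptr'', ''d''} {''pr'', ''sl'', ''bp''} \<sigma> \<tau>" using sm by (auto simp: same_def)
    note S = same_nmem[OF sm'] same_rmem[OF sm']
    from I b obtain d where n: "n = Suc d" by (cases n) auto
    have I1: "Suc d \<le> L" "nmem \<tau> ''d'' 0 = Suc d" "chain (nmem \<sigma> ''next'') (nmem \<tau> ''ptr'' 0) (drop (L - Suc d) ks)"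
      "rmem \<tau> ''pr'' 0 = list_slope (take (L - Suc d) vs)"
      and I2: "\<And>p. p < off \<Longrightarrow> rmem \<tau> ''bp'' p = rmem \<sigma> ''bp'' p \<and> rmem \<tau> ''sl'' p = rmem \<sigma> ''sl'' p"
      and I3: "\<And>d'. d' < L \<Longrightarrow> Suc d \<le> d' \<Longrightarrow> rmem \<tau> ''bp'' (off + d') = list_bp L vs d' \<and> rmem \<tau> ''sl'' (off + d') = list_sl L w c vs d'"
      using I unfolding n by blast+
    define \<rho> where "\<rho> = run ?c \<tau>"
    have sl: "rmem \<rho> ''sl'' = (rmem \<tau> ''sl'')(off + d := list_sl L w c vs d)"
      unfolding \<rho>_def by (simp add: S m I1 list_sl_def w_def c_def)
    have d: "nmem \<rho> ''d'' 0 = d" unfolding \<rho>_def by (simp add: I1)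
    have Ld: "L - d = Suc (L - Suc d)" using I1(1) by simp
    have rest: "rmem \<rho> ''bp'' = (rmem \<tau> ''bp'')(off + d := list_bp L vs d) \<and> chain (nmem \<sigma> ''next'') (nmem \<rho> ''ptr'' 0) (drop (L - d) ks) \<and>
       rmem \<rho> ''pr'' 0 = list_slope (take (L - d) vs)"
    proof (cases "L - Suc d < length ks")
      case True
      define q where "q = ks ! (L - Suc d)"
      have dr: "drop (L - Suc d) ks = q # drop (L - d) ks" unfolding Ld q_def using True by (rule Cons_nth_drop_Suc[symmetric])
      have p: "nmem \<tau> ''ptr'' 0 = Suc q" "chain (nmem \<sigma> ''next'') (nmem \<sigma> ''next'' q) (drop (L - d) ks)"
        using I1(3) unfolding dr by simp_all
      have v: "vs ! (L - Suc d) = (rmem \<sigma> ''x'' q, rmem \<sigma> ''prob'' (nmem \<sigma> ''row'' q))" "L - Suc d < length vs"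
        using True by (simp_all add: vs_def q_def)
      show ?thesis unfolding \<rho>_def
        by (simp add: S m I1 p list_bp_def v Ld list_slope_Suc) (use p(2) Ld in simp)
    next
      case False
      then have p: "nmem \<tau> ''ptr'' 0 = 0" "drop (L - d) ks = []" "take (L - d) vs = take (L - Suc d) vs" "\<not> L - Suc d < length vs"
        using I1(3) by (simp_all add: Ld vs_def)
      show ?thesis unfolding \<rho>_def by (simp add: S m I1 p list_bp_def)
    qed
    have "?I d \<rho>"
    proof (intro conjI allI impI)
      fix p assume p: "p < off"
      then show "rmem \<rho> ''bp'' p = rmem \<sigma> ''bp'' p" "rmem \<rho> ''sl'' p = rmem \<sigma> ''sl'' p"
        using I2[OF p] rest by (auto simp: sl)
    next
      fix d' assume d': "d' < L" "d \<le> d'"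
      show "rmem \<rho> ''bp'' (off + d') = list_bp L vs d'" "rmem \<rho> ''sl'' (off + d') = list_sl L w c vs d'"
        using I3[of d'] rest d' by (cases "d' = d"; simp add: sl)+
    qed (use I1(1) d rest in simp_all)
    then have "reach ?c \<tau> 6 (?I (n - 1))" unfolding \<rho>_def n by (rule_tac reach_run) simp_all
    then show "0 < n \<and> reach ?c \<tau> 6 (?I (n - 1))" using n by simp
  next
    fix n \<tau> assume I: "?I n \<tau>" and b: "\<not> bval ?b \<tau>"
    then have "n = 0" by simp
    then show "?Q \<tau>" using I by blast
  qed
  show ?thesis unfolding build_pieces_def
  proof (rule reach_Seq_run)
    have "run (ns ''ptr'' (NGet ''head'' (NGet ''col'' (nv ''k''))) ;; rs ''pr'' (RConst 1) ;; ns ''d'' (nv ''L'')) \<sigma> = ?\<sigma>"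
      by (simp add: m)
    then show "reach (While ?b ?c) (run (ns ''ptr'' (NGet ''head'' (NGet ''col'' (nv ''k''))) ;; rs ''pr'' (RConst 1) ;; ns ''d'' (nv ''L'')) \<sigma>)
      (1 + L * (1 + 6)) ?Q" using loop by (simp only:)
  qed simp_all
qed

lemma reach_build_levels:
  assumes m: "nmem \<sigma> ''L'' 0 = L" "nmem \<sigma> ''o'' 0 = off" and L: "0 < L"
    and a: "\<And>d. d < L \<Longrightarrow> rmem \<sigma> ''bp'' (off + d) = bp d" "\<And>d. d < L \<Longrightarrow> rmem \<sigma> ''sl'' (off + d) = sl d"
  shows "reach build_levels \<sigma> (3 + L * 3) (\<lambda>\<tau>. (\<forall>p<off. rmem \<tau> ''lev'' p = rmem \<sigma> ''lev'' p) \<and>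
    (\<forall>d<L. rmem \<tau> ''lev'' (off + d) = lev_of bp sl d))"
proof -
  let ?c = "RPut ''lev'' (NAdd (nv ''o'') (nv ''d'')) (RAdd (RGet ''lev'' (NSub (NAdd (nv ''o'') (nv ''d'')) (NConst 1)))
       (RMul (RGet ''sl'' (NSub (NAdd (nv ''o'') (nv ''d'')) (NConst 1)))
         (RSub (RGet ''bp'' (NAdd (nv ''o'') (nv ''d''))) (RGet ''bp'' (NSub (NAdd (nv ''o'') (nv ''d'')) (NConst 1))))))"
  let ?I = "\<lambda>n \<tau>. (\<forall>p<off. rmem \<tau> ''lev'' p = rmem \<sigma> ''lev'' p) \<and> (\<forall>d<n. rmem \<tau> ''lev'' (off + d) = lev_of bp sl d)"
  have loop: "reach (For ''d'' (NConst 1) (nv ''L'') ?c) (rput ''lev'' off 0 \<sigma>) (2 + (L - 1) * (2 + 1)) (?I L)"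
  proof (rule reach_For[where I = ?I])
    fix d \<tau> assume d: "1 \<le> d" "d < L" "nmem \<tau> ''d'' 0 = d" and sm: "same (insert ''d'' (nwrites ?c)) (rwrites ?c) (rput ''lev'' off 0 \<sigma>) \<tau>"
      and I: "?I d \<tau>"
    have sm': "same {''d''} {''lev''} \<sigma> \<tau>" using sm by (auto simp: same_def)
    note S = same_nmem[OF sm'] same_rmem[OF sm']
    from d obtain d' where d': "d = Suc d'" by (cases d) auto
    have "rmem \<tau> ''lev'' (off + d') = lev_of bp sl d'" using I d' by blast
    then have "rmem (run ?c \<tau>) ''lev'' = (rmem \<tau> ''lev'')(off + d := lev_of bp sl d)"
      using a[of d] a[of d'] d(2,3) unfolding d' by (simp add: S m)
    then have "?I (Suc d) (run ?c \<tau>)" using I by (simp add: less_Suc_eq)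
    then show "reach ?c \<tau> 1 (\<lambda>\<tau>'. same (nwrites ?c) (rwrites ?c) \<tau> \<tau>' \<longrightarrow> ?I (Suc d) (nput ''d'' 0 (Suc d) \<tau>'))"
      by (rule_tac reach_run) (simp_all only: rmem_nput, simp_all)
  qed (use m L in \<open>auto simp: same_def\<close>)
  show ?thesis unfolding build_levels_def
    by (rule reach_Seq_run[where U = "2 + (L - 1) * (2 + 1)"]) (use loop m L in simp_all)
qed

section \<open>Piecewise linear cost defined by a list of values\<close>

locale pieces =
  fixes L :: nat and vs :: "(real \<times> real) list" and w c :: real
  assumes len: "length vs < L" and sorted: "sorted_wrt (\<lambda>x y. fst y \<le> fst x) vs"
    and range: "\<And>v. v \<in> set vs \<Longrightarrow> 0 \<le> fst v \<and> snd v \<in> {0..1}" and wc: "0 \<le> w" "0 \<le> c"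
begin

abbreviation "pb \<equiv> list_bp L vs"
abbreviation "ps \<equiv> list_sl L w c vs"
abbreviation "pl \<equiv> lev_of pb ps"

definition pcost :: "real \<Rightarrow> real" where
  "pcost t = w * t + c * excess_list vs t"

lemma pb_0: "pb 0 = 0"
  using len by (simp add: list_bp_def)

lemma list_slope_bounds: "list_slope (take n vs) \<in> {0..1}"
proof (induction n)
  case (Suc n)
  show ?case
  proof (cases "n < length vs")
    case True
    then have "snd (vs ! n) \<in> {0..1}" using range nth_mem by blast
    then show ?thesis using Suc list_slope_Suc[OF True] by (auto intro: mult_le_one)
  qed (use Suc in simp)
qed (simp add: list_slope_def)

lemma ps_nonneg: "0 \<le> ps d"
  unfolding list_sl_def using wc list_slope_bounds by auto

lemma list_slope_antimono: "m \<le> n \<Longrightarrow> list_slope (take n vs) \<le> list_slope (take m vs)"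
proof (induction n rule: dec_induct)
  case (step n)
  have "list_slope (take (Suc n) vs) \<le> list_slope (take n vs)"
  proof (cases "n < length vs")
    case True
    then have "snd (vs ! n) \<in> {0..1}" using range nth_mem by blast
    then show ?thesis using list_slope_bounds[of n] list_slope_Suc[OF True] by (auto intro: mult_left_le)
  qed simp
  then show ?case using step by simp
qed simp

lemma ps_mono: "d \<le> e \<Longrightarrow> ps d \<le> ps e"
  unfolding list_sl_def using wc(2) list_slope_antimono[of "L - Suc e" "L - Suc d"]
  by (simp add: mult_left_mono)

lemma pb_mono: "d \<le> e \<Longrightarrow> e < L \<Longrightarrow> pb d \<le> pb e"
proof -
  assume de: "d \<le> e" "e < L"
  let ?m = "L - Suc e" and ?n = "L - Suc d"
  have mn: "?m \<le> ?n" using de by simp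
  show ?thesis
  proof (cases "?n < length vs")
    case True
    then have "fst (vs ! ?n) \<le> fst (vs ! ?m)"
      using sorted mn unfolding sorted_wrt_iff_nth_less by (cases "?m = ?n") auto
    then show ?thesis using True mn by (simp add: list_bp_def)
  next
    case False
    then show ?thesis using range nth_mem by (auto simp: list_bp_def)
  qed
qed

text \<open>Piece \<open>d\<close> splits the list at position \<open>L - Suc d\<close>: earlier
  values are at least \<open>t\<close>, later ones at most \<open>s\<close>, so
  \<open>excess_list_piece\<close> applies.\<close>

lemma pcost_piece:
  assumes d: "d < L" and st: "pb d \<le> s" "s \<le> t" "Suc d < L \<Longrightarrow> t \<le> pb (Suc d)"
  shows "pcost t = pcost s + ps d * (t - s)"
proof -
  let ?n = "L - Suc d"
  have pos: "0 \<le> s" using st(1) pb_mono[of 0 d] d pb_0 by simp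
  have "\<forall>v\<in>set (take ?n vs). t \<le> fst v"
  proof
    fix v assume "v \<in> set (take ?n vs)"
    then obtain i where i: "i < ?n" "i < length vs" "v = vs ! i" by (auto simp: in_set_conv_nth)
    have sd: "Suc d < L" using i by simp
    have "pb (Suc d) \<le> pb (L - Suc i)" using i by (intro pb_mono) auto
    also have "L - Suc (L - Suc i) = i" using i by simp
    then have "pb (L - Suc i) = fst v" using i by (simp add: list_bp_def)
    finally show "t \<le> fst v" using st(3)[OF sd] by simp
  qed
  moreover have "\<forall>v\<in>set (drop ?n vs). fst v \<le> s"
  proof
    fix v assume "v \<in> set (drop ?n vs)"
    then obtain i where "i < length (drop ?n vs)" "v = drop ?n vs ! i" by (metis in_set_conv_nth)
    then have i: "?n + i < length vs" "v = vs ! (?n + i)" by simp_all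
    have "fst (vs ! (?n + i)) \<le> fst (vs ! ?n)"
      using sorted i unfolding sorted_wrt_iff_nth_less by (cases "i = 0") auto
    also have "\<dots> = pb d" using i by (simp add: list_bp_def)
    finally show "fst v \<le> s" using st(1) i by simp
  qed
  ultimately have "excess_list (take ?n vs @ drop ?n vs) t = excess_list (take ?n vs @ drop ?n vs) s + list_slope (take ?n vs) * (t - s)"
    using pos st(2) by (intro excess_list_piece)
  then have eq: "excess_list vs t = excess_list vs s + list_slope (take ?n vs) * (t - s)" by simp
  show ?thesis unfolding pcost_def list_sl_def eq by (simp add: algebra_simps)
qed

lemma pcost_0: "pcost 0 = 0"
  unfolding pcost_def using range excess_list_0[of vs 0] by simp

lemma pl_eq: "d < L \<Longrightarrow> pl d = pcost (pb d)"
proof (induction d)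
  case 0
  then show ?case by (simp add: pb_0 pcost_0)
next
  case (Suc d)
  then show ?case using pcost_piece[of d "pb d" "pb (Suc d)"] pb_mono[of d "Suc d"] by simp
qed

end

section \<open>The instance in memory and the lists of its columns\<close>

definition scratch_n :: "string set" where
  "scratch_n = {''s'', ''e'', ''i'', ''L'', ''k'', ''a'', ''c'', ''d'', ''o'', ''y'', ''b'', ''mid'', ''en'', ''p'', ''q'', ''w'',
    ''lo'', ''hi'', ''ptr'', ''head'', ''next'', ''clen'', ''prev'', ''cnt''}"

definition scratch_r :: "string set" where
  "scratch_r = {''lv'', ''x'', ''z'', ''r'', ''top'', ''t'', ''m'', ''v'', ''key'', ''tmp'', ''pr'', ''sl'', ''bp'', ''lev''}"

locale input =
  fixes P :: pcmip and es :: "(nat \<times> nat) list"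
  assumes inst: "pcmip_instance P" and sparse: "sparse_form P es"
begin

abbreviation "rw k \<equiv> fst (es ! k)"
abbreviation "cl k \<equiv> snd (es ! k)"
abbreviation "n \<equiv> length es"

lemma entry: "k < n \<Longrightarrow> rw k < nrows P \<and> cl k \<in> row_vars P (rw k) \<and> cl k < ncols P"
proof -
  assume "k < n"
  then have "es ! k \<in> (SIGMA i:{..<nrows P}. row_vars P i)" using sparse nth_mem unfolding sparse_form_def by blast
  then show ?thesis by (cases "es ! k") (auto simp: row_vars_def)
qed

lemma entry_exists: "i < nrows P \<Longrightarrow> j \<in> row_vars P i \<Longrightarrow> \<exists>k<n. es ! k = (i, j)"
proof -
  assume "i < nrows P" "j \<in> row_vars P i"
  then have "(i, j) \<in> set es" using sparse unfolding sparse_form_def by auto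
  then show ?thesis by (simp add: in_set_conv_nth)
qed

lemma es_inj: "k < n \<Longrightarrow> k' < n \<Longrightarrow> es ! k = es ! k' \<longleftrightarrow> k = k'"
  using sparse nth_eq_iff_index_eq unfolding sparse_form_def by blast

lemma rw_mono: "k \<le> k' \<Longrightarrow> k' < n \<Longrightarrow> rw k \<le> rw k'"
  using sparse sorted_nth_mono[of "map fst es" k k'] unfolding sparse_form_def by simp

text \<open>The scratch arrays are disjoint from the input arrays, so the whole input is still
  readable.\<close>

definition static :: "memory \<Rightarrow> bool" where
  "static \<sigma> \<longleftrightarrow> same scratch_n scratch_r (input_memory P es) \<sigma>"

lemma staticD:
  assumes "static \<sigma>"
  shows "nmem \<sigma> ''len'' 0 = n" "k < n \<Longrightarrow> nmem \<sigma> ''row'' k = rw k" "k < n \<Longrightarrow> nmem \<sigma> ''col'' k = cl k"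
    "j < ncols P \<Longrightarrow> nmem \<sigma> ''int'' j = (if j \<in> ints P then 1 else 0)"
    "k < n \<Longrightarrow> rmem \<sigma> ''mat'' k = mat P (rw k) (cl k)" "k < n \<Longrightarrow> rmem \<sigma> ''wt'' k = wt P (rw k) (cl k)"
    "i < nrows P \<Longrightarrow> rmem \<sigma> ''rhs'' i = rhs P i" "i < nrows P \<Longrightarrow> rmem \<sigma> ''prob'' i = act_prob P i"
    "j < ncols P \<Longrightarrow> rmem \<sigma> ''price'' j = price P j" "j < ncols P \<Longrightarrow> rmem \<sigma> ''ub'' j = ub P j"
proof -
  have N: "nmem \<sigma> a = nmem (input_memory P es) a" if "a \<in> {''len'', ''row'', ''col'', ''int''}" for a
    using assms that unfolding static_def by (intro same_nmem) (auto simp: scratch_n_def)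
  have R: "rmem \<sigma> a = rmem (input_memory P es) a" if "a \<in> {''mat'', ''wt'', ''rhs'', ''prob'', ''price'', ''ub''}" for a
    using assms that unfolding static_def by (intro same_rmem) (auto simp: scratch_r_def)
  show "nmem \<sigma> ''len'' 0 = n" "k < n \<Longrightarrow> nmem \<sigma> ''row'' k = rw k" "k < n \<Longrightarrow> nmem \<sigma> ''col'' k = cl k"
    "j < ncols P \<Longrightarrow> nmem \<sigma> ''int'' j = (if j \<in> ints P then 1 else 0)"
    by (simp_all add: N input_memory_def entries_def)
  show "k < n \<Longrightarrow> rmem \<sigma> ''mat'' k = mat P (rw k) (cl k)" "k < n \<Longrightarrow> rmem \<sigma> ''wt'' k = wt P (rw k) (cl k)"
    "i < nrows P \<Longrightarrow> rmem \<sigma> ''rhs'' i = rhs P i" "i < nrows P \<Longrightarrow> rmem \<sigma> ''prob'' i = act_prob P i"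
    "j < ncols P \<Longrightarrow> rmem \<sigma> ''price'' j = price P j" "j < ncols P \<Longrightarrow> rmem \<sigma> ''ub'' j = ub P j"
    by (simp_all add: R input_memory_def entries_def)
qed

lemma static_same:
  assumes "static \<sigma>" "same N R \<sigma> \<tau>" "N \<subseteq> scratch_n" "R \<subseteq> scratch_r"
  shows "static \<tau>"
  using assms same_trans same_mono unfolding static_def by blast

text \<open>The positions in \<open>es\<close> are distinct, so at most one summand counts. The sum
  avoids inverting the enumeration.\<close>

definition point :: "(nat \<Rightarrow> real) \<Rightarrow> nat \<Rightarrow> nat \<times> nat \<Rightarrow> real" where
  "point f m v = (\<Sum>k<m. if es ! k = v then f k else 0)"

lemma point_nth: "k < m \<Longrightarrow> m \<le> n \<Longrightarrow> point f m (es ! k) = f k"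
proof -
  assume k: "k < m" "m \<le> n"
  have "point f m (es ! k) = (\<Sum>k'<m. if k' = k then f k else 0)"
    unfolding point_def by (rule sum.cong) (use k es_inj in auto)
  then show ?thesis using k by simp
qed

lemma point_other: "(\<And>k. k < m \<Longrightarrow> es ! k \<noteq> v) \<Longrightarrow> point f m v = 0"
  unfolding point_def by (rule sum.neutral) auto

lemma point_cong: "(\<And>k. k < m \<Longrightarrow> f k = g k) \<Longrightarrow> point f m = point g m"
  unfolding point_def by (auto intro!: sum.cong)

definition vals :: "(nat \<Rightarrow> real) \<Rightarrow> nat list \<Rightarrow> (real \<times> real) list" where
  "vals x ks = map (\<lambda>k. (x k, act_prob P (rw k))) ks"

text \<open>The list has to represent \<open>excess\<close> of its column only as a function of
  \<open>t\<close>, so discarded values may be missing. \<open>length ks < L\<close> leaves room for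
  the breakpoint 0.\<close>

definition col_list :: "(nat \<Rightarrow> nat) \<Rightarrow> (nat \<Rightarrow> nat) \<Rightarrow> (nat \<Rightarrow> nat) \<Rightarrow> nat \<Rightarrow> (nat \<Rightarrow> real) \<Rightarrow> nat \<Rightarrow> nat \<Rightarrow> nat list \<Rightarrow> bool" where
  "col_list nx hp cn L x m j ks \<longleftrightarrow> chain nx (hp j) ks \<and> distinct ks \<and> (\<forall>k\<in>set ks. k < m \<and> cl k = j) \<and>
     sorted_wrt (\<lambda>k k'. x k' \<le> x k) ks \<and> (\<forall>t\<ge>0. excess P (point x m) j t = excess_list (vals x ks) t) \<and>
     cn j = length ks \<and> length ks < L \<and> ((\<forall>i<nrows P. act_prob P i = 1) \<longrightarrow> length ks \<le> 1)"

lemma col_listD: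
  assumes "col_list nx hp cn L x m j ks"
  shows "chain nx (hp j) ks" "distinct ks" "\<forall>k\<in>set ks. k < m \<and> cl k = j" "sorted_wrt (\<lambda>k k'. x k' \<le> x k) ks"
    "\<forall>t\<ge>0. excess P (point x m) j t = excess_list (vals x ks) t" "cn j = length ks" "length ks < L"
    "(\<forall>i<nrows P. act_prob P i = 1) \<longrightarrow> length ks \<le> 1"
  by (insert assms[unfolded col_list_def], elim conjE, assumption)+

end

lemma contrib_ub: "contrib P i j (ub P j) = mat P i j * (if j \<in> ints P then of_int \<lfloor>ub P j\<rfloor> else ub P j)"
  by (cases "j \<in> ints P") (simp_all add: contrib_def)

section \<open>From the levels of a row to a greedy step\<close>

locale input_row = input +
  fixes s e i L :: nat and x :: "nat \<Rightarrow> real" and KS :: "nat \<Rightarrow> nat list" and nx hp cn :: "nat \<Rightarrow> nat"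
  assumes se: "s < e" "e \<le> n" and row: "\<And>k. k < n \<Longrightarrow> rw k = i \<longleftrightarrow> s \<le> k \<and> k < e"
    and x: "\<And>k. k < s \<Longrightarrow> 0 \<le> x k" and KS: "\<And>j. col_list nx hp cn L x s j (KS j)" and rhs: "0 < rhs P i"
begin

abbreviation "X \<equiv> point x s"
definition "V k = vals x (KS (cl k))"
definition "bpf k = list_bp L (V k)"
definition "slf k = list_sl L (wt P i (cl k)) (price P (cl k) * act_prob P i) (V k)"
definition "levf k = lev_of (bpf k) (slf k)"

lemma i: "i < nrows P"
  using entry[of s] row[of s] se by simp

lemma rw_i: "k \<in> {s..<e} \<Longrightarrow> rw k = i" "k \<in> {s..<e} \<Longrightarrow> k < n"
  using row[of k] se by auto

lemma cl_bij: "bij_betw (\<lambda>k. cl k) {s..<e} (row_vars P i)"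
  unfolding bij_betw_def
proof
  show "inj_on (\<lambda>k. cl k) {s..<e}"
  proof (rule inj_onI)
    fix k k' assume k: "k \<in> {s..<e}" "k' \<in> {s..<e}" "cl k = cl k'"
    then have "es ! k = es ! k'" using rw_i by (intro prod_eqI) auto
    then show "k = k'" using es_inj[OF rw_i(2)[OF k(1)] rw_i(2)[OF k(2)]] by blast
  qed
  show "(\<lambda>k. cl k) ` {s..<e} = row_vars P i"
  proof
    show "(\<lambda>k. cl k) ` {s..<e} \<subseteq> row_vars P i"
    proof
      fix j assume "j \<in> (\<lambda>k. cl k) ` {s..<e}"
      then obtain k where k: "k \<in> {s..<e}" "j = cl k" by blast
      show "j \<in> row_vars P i" using entry[OF rw_i(2)[OF k(1)]] rw_i(1)[OF k(1)] k(2) by simp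
    qed
    show "row_vars P i \<subseteq> (\<lambda>k. cl k) ` {s..<e}"
    proof
      fix j assume "j \<in> row_vars P i"
      then obtain k where k: "k < n" "es ! k = (i, j)" using entry_exists[OF i] by blast
      then have "k \<in> {s..<e}" using row[OF k(1)] by simp
      then show "j \<in> (\<lambda>k. cl k) ` {s..<e}" using k(2) by force
    qed
  qed
qed

lemma X_row: "X (i, j) = 0"
proof (rule point_other)
  fix k assume "k < s"
  then have "rw k \<noteq> i" using row[of k] se by simp
  then show "es ! k \<noteq> (i, j)" by auto
qed

lemma V_pieces: "k \<in> {s..<e} \<Longrightarrow> pieces L (V k) (wt P i (cl k)) (price P (cl k) * act_prob P i)"
proof
  assume k: "k \<in> {s..<e}"
  have c: "cl k < ncols P" using entry[OF rw_i(2)[OF k]] by blast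
  note D = col_listD[OF KS[of "cl k"]]
  show "length (V k) < L" using D(7) by (simp add: V_def vals_def)
  show "sorted_wrt (\<lambda>x y. fst y \<le> fst x) (V k)" using D(4) by (simp add: V_def vals_def sorted_wrt_map)
  show "0 \<le> wt P i (cl k)" using pcmip_instanceD(6)[OF inst i c] .
  show "0 \<le> price P (cl k) * act_prob P i" using pcmip_instanceD(4)[OF inst c] pcmip_instanceD(2)[OF inst i] by simp
  fix v assume "v \<in> set (V k)"
  then obtain k' where k': "k' \<in> set (KS (cl k))" "v = (x k', act_prob P (rw k'))" by (auto simp: V_def vals_def)
  have "k' < s" using D(3) k'(1) by blast
  then have "rw k' < nrows P" using entry[of k'] se by simp
  then show "0 \<le> fst v \<and> snd v \<in> {0..1}" using x[OF \<open>k' < s\<close>] pcmip_instanceD(2)[OF inst] k'(2) by simp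
qed

lemma sum_row: "(\<Sum>j\<in>row_vars P i. g j) = (\<Sum>k\<in>{s..<e}. g (cl k))"
  by (rule sum.reindex_bij_betw[OF cl_bij, symmetric])

lemma row_machine:
  assumes h: "L \<le> 2 ^ h"
  shows "row_machine s e L bpf levf slf (\<lambda>k. mat P i (cl k)) (\<lambda>k. ub P (cl k)) (\<lambda>k. cl k \<in> ints P) (rhs P i) h"
proof
  fix k d assume k: "k \<in> {s..<e}"
  interpret pieces L "V k" "wt P i (cl k)" "price P (cl k) * act_prob P i" by (rule V_pieces[OF k])
  show "bpf k 0 = 0" unfolding bpf_def by (rule pb_0)
  show "levf k 0 = 0" by (simp add: levf_def)
  show "Suc d < L \<Longrightarrow> bpf k d \<le> bpf k (Suc d)" unfolding bpf_def by (rule pb_mono) simp_all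
  show "Suc d < L \<Longrightarrow> slf k d \<le> slf k (Suc d)" unfolding slf_def by (rule ps_mono) simp
  show "0 \<le> slf k 0" unfolding slf_def by (rule ps_nonneg)
  show "Suc d < L \<Longrightarrow> levf k (Suc d) = levf k d + slf k d * (bpf k (Suc d) - bpf k d)" by (simp add: levf_def)
  have c: "cl k < ncols P" "mat P i (cl k) \<noteq> 0" using entry[OF rw_i(2)[OF k]] rw_i(1)[OF k] by (auto simp: row_vars_def)
  show "0 < mat P i (cl k)" using pcmip_instanceD(5)[OF inst i c(1)] c(2) by simp
  show "0 \<le> ub P (cl k)" using pcmip_instanceD(3)[OF inst c(1)] .
next
  show "0 < L" using col_listD(7)[OF KS] by (rule gr_implies_not_zero[THEN neq0_conv[THEN iffD1]])
  obtain z where z: "z \<in> row_constraint P i" using pcmip_instanceD(7)[OF inst i] by blast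
  \<comment> \<open>No value contributes more than the upper bound does, so the solvability of the
    row gives \<open>feas\<close>.\<close>
  have "rhs P i \<le> (\<Sum>j\<in>row_vars P i. contrib P i j (z j))" using z by (simp add: row_constraint_alt)
  also have "\<dots> \<le> (\<Sum>j\<in>row_vars P i. contrib P i j (ub P j))"
    using pcmip_instanceD(5)[OF inst i] by (intro sum_mono) (auto simp: contrib_def row_vars_def intro!: mult_left_mono floor_mono)
  also have "\<dots> = (\<Sum>k\<in>{s..<e}. contrib P i (cl k) (ub P (cl k)))" by (rule sum_row)
  finally show "rhs P i \<le> (\<Sum>k = s..<e. mat P i (cl k) * (if cl k \<in> ints P then real_of_int \<lfloor>ub P (cl k)\<rfloor> else ub P (cl k)))"
    by (simp add: contrib_ub)
qed (use se rhs h in simp_all)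

end

context pieces
begin

lemma piece_exists:
  assumes "0 \<le> t"
  obtains d where "d < L" "pb d \<le> t" "Suc d < L \<Longrightarrow> t \<le> pb (Suc d)"
proof -
  let ?S = "{d. d < L \<and> pb d \<le> t}"
  have "0 \<in> ?S" using assms pb_0 len by simp
  then have S: "finite ?S" "?S \<noteq> {}" by auto
  have "Max ?S \<in> ?S" by (rule Max_in[OF S])
  moreover have "Suc (Max ?S) \<notin> ?S" using Max_ge[OF S(1)] Suc_n_not_le_n by blast
  ultimately show thesis using that[of "Max ?S"] by auto
qed

end

context input_row
begin

text \<open>Once \<open>cst\<close> is identified with \<open>raise_cost\<close>,
  \<open>good_increase\<close> and the properties of \<open>lvl\<close> become the hypotheses of
  \<open>greedy_step_row\<close>, read along the bijection between entries and columns.\<close>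

lemma row_step:
  assumes rm: "row_machine s e L bpf levf slf (\<lambda>k. mat P i (cl k)) (\<lambda>k. ub P (cl k)) (\<lambda>k. cl k \<in> ints P) (rhs P i) h"
    and good: "row_machine.good_increase s e L bpf levf slf (\<lambda>k. mat P i (cl k)) (\<lambda>k. ub P (cl k)) (\<lambda>k. cl k \<in> ints P) (rhs P i) B"
    and x': "\<And>k. k < s \<Longrightarrow> x' k = x k"
      "\<And>k. k \<in> {s..<e} \<Longrightarrow> x' k = row_levels.lvl L bpf levf slf (\<lambda>k. ub P (cl k)) k B"
  shows "greedy_step (pcmip_covering P) X (point x' e)"
    "(\<lambda>j. point x' e (i, j)) \<in> row_constraint P i"
    "\<And>k. k < e \<Longrightarrow> 0 \<le> x' k"
proof -
  note en = se(2)
  interpret row_machine s e L bpf levf slf "\<lambda>k. mat P i (cl k)" "\<lambda>k. ub P (cl k)" "\<lambda>k. cl k \<in> ints P" "rhs P i" i h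
    by (rule rm)
  have B: "0 \<le> B" "rhs P i \<le> covered B"
    and opt: "\<And>y. \<lbrakk>\<forall>k\<in>{s..<e}. 0 \<le> y k; rhs P i \<le> (\<Sum>k\<in>{s..<e}. mat P i (cl k) * units k (y k))\<rbrakk> \<Longrightarrow> B \<le> (\<Sum>k\<in>{s..<e}. cst k (y k))"
    using good unfolding good_increase_def by blast+
  have cst: "cst k t = raise_cost P X i (cl k) t" if k: "k \<in> {s..<e}" and t: "0 \<le> t" for k t
  proof -
    interpret pieces L "V k" "wt P i (cl k)" "price P (cl k) * act_prob P i" by (rule V_pieces[OF k])
    obtain d where d: "d < L" "pb d \<le> t" "Suc d < L \<Longrightarrow> t \<le> pb (Suc d)" using piece_exists[OF t] by blast
    have "cst k t = tang k d t" by (rule cst_piece[OF k d(1)]) (use d in \<open>simp_all add: bpf_def\<close>)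
    also have "\<dots> = pcost (pb d) + ps d * (t - pb d)"
      unfolding tang_def levf_def unfolding bpf_def slf_def using pl_eq[OF d(1)] by simp
    also have "\<dots> = pcost t" using pcost_piece[OF d(1) order_refl d(2,3)] by simp
    also have "\<dots> = raise_cost P X i (cl k) t"
      unfolding pcost_def raise_cost_def using col_listD(5)[OF KS[of "cl k"]] t by (simp add: V_def)
    finally show ?thesis .
  qed
  have contrib: "contrib P i (cl k) t = mat P i (cl k) * units k t" for k t
    by (simp add: contrib_def units_def)
  define xi where "xi = (\<lambda>j. x' (the_inv_into {s..<e} (\<lambda>k. cl k) j))"
  have inj: "inj_on (\<lambda>k. cl k) {s..<e}" using cl_bij by (rule bij_betw_imp_inj_on)
  have xi: "xi (cl k) = lvl k B" if "k \<in> {s..<e}" for k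
    unfolding xi_def using the_inv_into_f_f[OF inj that] x'(2)[OF that] by simp
  have col: "\<exists>k\<in>{s..<e}. j = cl k" if "j \<in> row_vars P i" for j
    using cl_bij that unfolding bij_betw_def by blast
  have step: "greedy_step (pcmip_covering P) X (\<lambda>v. if v \<in> {i} \<times> row_vars P i then xi (snd v) else X v)"
  proof (rule greedy_step_row[of P i X B xi, OF inst i rhs X_row B(1)])
    fix y assume y: "\<And>j. 0 \<le> y j" "rhs P i \<le> (\<Sum>j\<in>row_vars P i. contrib P i j (y j))"
    have "B \<le> (\<Sum>k\<in>{s..<e}. cst k (y (cl k)))"
      using y(2) by (intro opt) (simp_all add: y(1) sum_row contrib)
    then show "B \<le> (\<Sum>j\<in>row_vars P i. raise_cost P X i j (y j))"
      unfolding sum_row by (simp add: cst y(1))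
  next
    fix j assume "j \<in> row_vars P i"
    then obtain k where k: "k \<in> {s..<e}" "j = cl k" using col by blast
    show "0 \<le> xi j" using lvl_nonneg[OF k(1) B(1)] xi[OF k(1)] k(2) by simp
    show "(\<forall>t\<ge>0. (raise_cost P X i j t \<le> B) = (t \<le> xi j)) \<or> (\<forall>t\<ge>0. raise_cost P X i j t \<le> B) \<and> ub P j \<le> xi j"
    proof (cases "free k")
      case True
      then have "\<forall>t\<ge>0. raise_cost P X i j t \<le> B" using cst[OF k(1)] cst_free[OF k(1) True] B(1) k(2) by simp
      moreover have "xi j = ub P j" using xi[OF k(1)] k(2) True by (simp add: lvl_def)
      ultimately show ?thesis by simp
    next
      case False
      have "raise_cost P X i j t \<le> B \<longleftrightarrow> t \<le> xi j" if "0 \<le> t" for t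
        using lvl_iff[OF k(1) B(1) False, of t] cst[OF k(1) that] xi[OF k(1)] k(2) by simp
      then show ?thesis by blast
    qed
  qed
  have pt: "point x' e = (\<lambda>v. if v \<in> {i} \<times> row_vars P i then xi (snd v) else X v)"
  proof
    fix v
    show "point x' e v = (if v \<in> {i} \<times> row_vars P i then xi (snd v) else X v)"
    proof (cases "v \<in> {i} \<times> row_vars P i")
      case True
      then obtain k where k: "k \<in> {s..<e}" "snd v = cl k" using col by force
      have v: "v = es ! k" using True k rw_i(1)[OF k(1)] by (auto intro: prod_eqI)
      have "point x' e v = x' k" unfolding v by (rule point_nth) (use k en in auto)
      then show ?thesis using True k xi x'(2) by simp
    next
      case False
      have ne: "es ! k \<noteq> v" if "k \<in> {s..<e}" for k
        using False entry[OF rw_i(2)[OF that]] rw_i(1)[OF that] by (metis SigmaI prod.collapse singletonI)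
      have "point x' e v = (\<Sum>k<s. if es ! k = v then x' k else 0)"
        unfolding point_def by (rule sum.mono_neutral_right) (use se ne in auto)
      also have "\<dots> = X v" unfolding point_def by (rule sum.cong) (simp_all add: x'(1))
      finally show ?thesis using False by simp
    qed
  qed
  show "greedy_step (pcmip_covering P) X (point x' e)" using step unfolding pt .
  have x'_i: "point x' e (i, cl k) = lvl k B" if "k \<in> {s..<e}" for k
    unfolding pt using xi[OF that] cl_bij that unfolding bij_betw_def by auto
  show pos: "0 \<le> x' k" if "k < e" for k
  proof (cases "k < s")
    case True
    then show ?thesis using x[OF True] x'(1)[OF True] by simp
  next
    case False
    then have "k \<in> {s..<e}" using that by simp
    then show ?thesis using x'(2) lvl_nonneg B(1) by simp
  qed
  have nonneg: "0 \<le> point x' e v" for v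
    unfolding point_def using pos by (intro sum_nonneg) auto
  show "(\<lambda>j. point x' e (i, j)) \<in> row_constraint P i"
    unfolding row_constraint_alt
  proof (rule CollectI, rule conjI)
    show "\<forall>j<ncols P. 0 \<le> point x' e (i, j)" using nonneg by blast
    have "(\<Sum>j\<in>row_vars P i. contrib P i j (point x' e (i, j))) = covered B"
      unfolding sum_row covered_def by (rule sum.cong) (simp_all add: x'_i contrib)
    then show "rhs P i \<le> (\<Sum>j\<in>row_vars P i. contrib P i j (point x' e (i, j)))" using B(2) by simp
  qed
qed

lemma reach_build_row:
  assumes st: "static \<sigma>" and m: "nmem \<sigma> ''s'' 0 = s" "nmem \<sigma> ''e'' 0 = e" "nmem \<sigma> ''i'' 0 = i" "nmem \<sigma> ''L'' 0 = L"
    and l: "nmem \<sigma> ''next'' = nx" "nmem \<sigma> ''head'' = hp" "rmem \<sigma> ''x'' = x"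
  shows "reach build_row \<sigma> (3 + (e - s) * (10 + L * 10)) (\<lambda>\<tau>. \<forall>k\<in>{s..<e}. \<forall>d<L. rmem \<tau> ''bp'' ((k - s) * L + d) = bpf k d \<and>
       rmem \<tau> ''lev'' ((k - s) * L + d) = levf k d \<and> rmem \<tau> ''sl'' ((k - s) * L + d) = slf k d)"
proof -
  have L: "0 < L" using col_listD(7)[OF KS] by (rule gr_implies_not_zero[THEN neq0_conv[THEN iffD1]])
  let ?I = "\<lambda>k \<tau>. nmem \<tau> ''o'' 0 = (k - s) * L \<and> (\<forall>k'\<in>{s..<k}. \<forall>d<L. rmem \<tau> ''bp'' ((k' - s) * L + d) = bpf k' d \<and>
       rmem \<tau> ''lev'' ((k' - s) * L + d) = levf k' d \<and> rmem \<tau> ''sl'' ((k' - s) * L + d) = slf k' d)"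
  have loop: "reach (For ''k'' (nv ''s'') (nv ''e'') build_entry) (nput ''o'' 0 0 \<sigma>) (2 + (e - s) * (2 + (8 + L * 10))) (?I e)"
  proof (rule reach_For[where I = ?I])
    show "nval (nv ''s'') (nput ''o'' 0 0 \<sigma>) = s" "s \<le> e" using m se by simp_all
    show "nval (nv ''e'') \<tau> = e" if "same (insert ''k'' (nwrites build_entry)) (rwrites build_entry) (nput ''o'' 0 0 \<sigma>) \<tau>" for \<tau>
      using m that by (simp add: same_def)
  next
    fix k \<tau> assume k: "s \<le> k" "k < e" "nmem \<tau> ''k'' 0 = k"
      and sm: "same (insert ''k'' (nwrites build_entry)) (rwrites build_entry) (nput ''o'' 0 0 \<sigma>) \<tau>" and I: "?I k \<tau>"
    have sm': "same {''k'', ''ptr'', ''d'', ''o''} {''pr'', ''sl'', ''bp'', ''lev''} \<sigma> \<tau>" using sm by (auto simp: same_def)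
    note S = same_nmem[OF sm'] same_rmem[OF sm']
    have st': "static \<tau>" by (rule static_same[OF st sm']) (auto simp: scratch_n_def scratch_r_def)
    have kn: "k < n" and ki: "k \<in> {s..<e}" using k se by auto
    have c: "cl k < ncols P" "rw k = i" using entry[OF kn] rw_i(1)[OF ki] by auto
    note D = col_listD[OF KS[of "cl k"]]
    define off where "off = (k - s) * L"
    have o: "nmem \<tau> ''o'' 0 = off" using I by (simp add: off_def)
    have ch: "chain (nmem \<tau> ''next'') (nmem \<tau> ''head'' (nmem \<tau> ''col'' k)) (KS (cl k))"
      using D(1) by (simp add: staticD(3)[OF st kn] S l)
    have vs: "map (\<lambda>k. (rmem \<tau> ''x'' k, rmem \<tau> ''prob'' (nmem \<tau> ''row'' k))) (KS (cl k)) = V k"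
      unfolding V_def vals_def
    proof (rule map_cong[OF refl])
      fix k' assume "k' \<in> set (KS (cl k))"
      then have k': "k' < n" using D(3) se by auto
      then show "(rmem \<tau> ''x'' k', rmem \<tau> ''prob'' (nmem \<tau> ''row'' k')) = (x k', act_prob P (rw k'))"
        using entry[OF k'] by (simp add: S l staticD(2)[OF st k'] staticD(8)[OF st])
    qed
    have w: "rmem \<tau> ''wt'' k = wt P i (cl k)" "rmem \<tau> ''price'' (nmem \<tau> ''col'' k) * rmem \<tau> ''prob'' i = price P (cl k) * act_prob P i"
      using c i by (simp_all add: staticD(6,3)[OF st' kn] staticD(9,8)[OF st'])
    let ?P = "\<lambda>\<rho>. (\<forall>p<off. rmem \<rho> ''bp'' p = rmem \<tau> ''bp'' p \<and> rmem \<rho> ''sl'' p = rmem \<tau> ''sl'' p) \<and>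
      (\<forall>d<L. rmem \<rho> ''bp'' (off + d) = bpf k d \<and> rmem \<rho> ''sl'' (off + d) = slf k d)"
    have m': "nmem \<tau> ''L'' 0 = L" "nmem \<tau> ''i'' 0 = i" by (simp_all add: S m)
    have p: "reach build_pieces \<tau> (4 + L * 7) ?P"
      using reach_build_pieces[OF m'(1) k(3) o m'(2) ch D(7)] unfolding vs w bpf_def slf_def .
    have off_Suc: "(Suc k - s) * L = off + L" unfolding off_def by (rule offset_Suc[OF k(1)])
    have below: "(k' - s) * L + d < off" if "k' \<in> {s..<k}" "d < L" for k' d
    proof -
      have "Suc (k' - s) * L \<le> (k - s) * L" using that(1) by (intro mult_le_mono1) auto
      then show ?thesis using that(2) by (simp add: off_def)
    qed
    have "reach build_entry \<tau> (8 + L * 10) (\<lambda>\<rho>. ?I (Suc k) (nput ''k'' 0 (Suc k) \<rho>))"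
      unfolding build_entry_def
    proof (rule reach_Seq_then[OF reach_same[OF p]])
      fix \<rho> assume "same (nwrites build_pieces) (rwrites build_pieces) \<tau> \<rho> \<and> ?P \<rho>"
      then have s1: "same {''ptr'', ''d''} {''pr'', ''sl'', ''bp''} \<tau> \<rho>"
        and p1: "\<And>p. p < off \<Longrightarrow> rmem \<rho> ''bp'' p = rmem \<tau> ''bp'' p \<and> rmem \<rho> ''sl'' p = rmem \<tau> ''sl'' p"
        and p2: "\<And>d. d < L \<Longrightarrow> rmem \<rho> ''bp'' (off + d) = bpf k d" "\<And>d. d < L \<Longrightarrow> rmem \<rho> ''sl'' (off + d) = slf k d" by simp_all
      have m1: "nmem \<rho> ''L'' 0 = L" "nmem \<rho> ''o'' 0 = off" using m' o by (simp_all add: same_nmem[OF s1])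
      show "reach (build_levels ;; ns ''o'' (NAdd (nv ''o'') (nv ''L''))) \<rho> ((3 + L * 3) + 1) (\<lambda>\<rho>. ?I (Suc k) (nput ''k'' 0 (Suc k) \<rho>))"
      proof (rule reach_Seq_then[OF reach_same[OF reach_build_levels[OF m1 L p2]]])
        fix \<rho>' assume "same (nwrites build_levels) (rwrites build_levels) \<rho> \<rho>' \<and> (\<forall>p<off. rmem \<rho>' ''lev'' p = rmem \<rho> ''lev'' p) \<and>
          (\<forall>d<L. rmem \<rho>' ''lev'' (off + d) = lev_of (bpf k) (slf k) d)"
        then have s2: "same {''d''} {''lev''} \<rho> \<rho>'"
          and q1: "\<And>p. p < off \<Longrightarrow> rmem \<rho>' ''lev'' p = rmem \<rho> ''lev'' p"
          and q2: "\<And>d. d < L \<Longrightarrow> rmem \<rho>' ''lev'' (off + d) = levf k d" by (simp_all add: levf_def)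
        have o2: "nmem \<rho>' ''o'' 0 = off" "nmem \<rho>' ''L'' 0 = L" using m1 by (simp_all add: same_nmem[OF s2])
        have arr: "\<forall>k'\<in>{s..<Suc k}. \<forall>d<L. rmem \<rho>' ''bp'' ((k' - s) * L + d) = bpf k' d \<and>
          rmem \<rho>' ''lev'' ((k' - s) * L + d) = levf k' d \<and> rmem \<rho>' ''sl'' ((k' - s) * L + d) = slf k' d"
        proof (intro ballI allI impI)
          fix k' d assume h: "k' \<in> {s..<Suc k}" "d < L"
          show "rmem \<rho>' ''bp'' ((k' - s) * L + d) = bpf k' d \<and>
            rmem \<rho>' ''lev'' ((k' - s) * L + d) = levf k' d \<and> rmem \<rho>' ''sl'' ((k' - s) * L + d) = slf k' d"
          proof (cases "k' = k")
            case True
            then show ?thesis using p2[OF h(2)] q2[OF h(2)] by (simp add: same_rmem[OF s2] off_def)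
          next
            case False
            then have k': "k' \<in> {s..<k}" using h(1) by auto
            note bl = below[OF k' h(2)]
            show ?thesis using I k' h(2) p1[OF bl] q1[OF bl] by (simp add: same_rmem[OF s2] same_rmem[OF s1])
          qed
        qed
        show "reach (ns ''o'' (NAdd (nv ''o'') (nv ''L''))) \<rho>' 1 (\<lambda>\<rho>. ?I (Suc k) (nput ''k'' 0 (Suc k) \<rho>))"
          by (rule reach_run) (use arr in \<open>simp_all only: nmem_nput rmem_nput run.simps, simp_all add: o2 off_Suc\<close>)
      qed simp_all
    qed simp
    then show "reach build_entry \<tau> (8 + L * 10) (\<lambda>\<rho>. same (nwrites build_entry) (rwrites build_entry) \<tau> \<rho> \<longrightarrow> ?I (Suc k) (nput ''k'' 0 (Suc k) \<rho>))"
      by (rule reach_conseq) simp_all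
  qed simp_all
  show ?thesis unfolding build_row_def
    by (rule reach_Seq_run[where U = "2 + (e - s) * (2 + (8 + L * 10))"])
      (simp, simp, rule reach_conseq[of _ _ "2 + (e - s) * (2 + (8 + L * 10))" "?I e"], use loop in simp_all)
qed

end

subsection \<open>Inserting the values of a solved row\<close>

text \<open>\<open>prev\<close> trails \<open>ptr\<close> to allow a splice, and \<open>cnt\<close>
  is the length of the part in front, needed when the tail is cut.\<close>

definition insert_find :: com where
  "insert_find = (ns ''prev'' (NConst 0) ;; ns ''ptr'' (NGet ''head'' (NGet ''col'' (nv ''k''))) ;; ns ''cnt'' (NConst 0)) ;;
    While (BAnd (NLess (NConst 0) (nv ''ptr'')) (RLess (RGet ''x'' (nv ''k'')) (RGet ''x'' (NSub (nv ''ptr'') (NConst 1)))))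
     (ns ''prev'' (nv ''ptr'') ;; ns ''ptr'' (NGet ''next'' (NSub (nv ''ptr'') (NConst 1))) ;; ns ''cnt'' (NAdd (nv ''cnt'') (NConst 1)))"

text \<open>
  A constraint that is active with probability 1 makes all smaller values of its column irrelevant.
  Such values are dropped, which keeps the lists short when all probabilities are 1.
\<close>

definition insert_link :: com where
  "insert_link = Cond (BAnd (NLess (NConst 0) (nv ''prev'')) (BNot (RLess (RGet ''prob'' (NGet ''row'' (NSub (nv ''prev'') (NConst 1)))) (RConst 1)))) Skip
    (Cond (RLess (RGet ''prob'' (nv ''i'')) (RConst 1))
       (NPut ''next'' (nv ''k'') (nv ''ptr'') ;; NPut ''clen'' (NGet ''col'' (nv ''k'')) (NAdd (NGet ''clen'' (NGet ''col'' (nv ''k''))) (NConst 1)))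
       (NPut ''next'' (nv ''k'') (NConst 0) ;; NPut ''clen'' (NGet ''col'' (nv ''k'')) (NAdd (nv ''cnt'') (NConst 1))) ;;
     Cond (NLess (NConst 0) (nv ''prev'')) (NPut ''next'' (NSub (nv ''prev'') (NConst 1)) (NAdd (nv ''k'') (NConst 1)))
       (NPut ''head'' (NGet ''col'' (nv ''k'')) (NAdd (nv ''k'') (NConst 1))) ;;
     ns ''L'' (NAdd (nv ''L'') (NSub (NAdd (NGet ''clen'' (NGet ''col'' (nv ''k''))) (NConst 1)) (nv ''L''))))"

definition insert_row :: com where
  "insert_row = For ''k'' (nv ''s'') (nv ''e'') (insert_find ;; insert_link)"

lemma nwrites_insert [simp]:
  "nwrites insert_find = {''prev'', ''ptr'', ''cnt''}" "rwrites insert_find = {}"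
  "nwrites insert_link = {''next'', ''clen'', ''head'', ''L''}" "rwrites insert_link = {}"
  "nwrites insert_row = {''prev'', ''ptr'', ''cnt'', ''next'', ''clen'', ''head'', ''L'', ''k''}" "rwrites insert_row = {}"
  by (auto simp: insert_find_def insert_link_def insert_row_def)

lemma takeWhile_dropWhile_split:
  assumes "\<forall>y\<in>set a. Q y" "r = [] \<or> \<not> Q (hd r)"
  shows "takeWhile Q (a @ r) = a" "dropWhile Q (a @ r) = r"
  using assms by (cases r; auto simp: takeWhile_append dropWhile_append)+

lemma excess_cong: "(\<And>i. i < nrows P \<Longrightarrow> X (i, j) = Y (i, j)) \<Longrightarrow> excess P X j t = excess P Y j t"
proof -
  assume h: "\<And>i. i < nrows P \<Longrightarrow> X (i, j) = Y (i, j)"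
  have "xhat P X a j = xhat P Y a j" for a by (intro antisym xhat_mono) (simp_all add: h)
  then show ?thesis by (simp add: excess_def)
qed

context input
begin

lemma point_Suc_neq: "es ! m \<noteq> v \<Longrightarrow> point f (Suc m) v = point f m v"
  by (simp add: point_def)

text \<open>The two running times differ only through this bound on the length of the column
  lists.\<close>

definition D :: nat where
  "D = (if \<forall>i<nrows P. act_prob P i = 1 then 1 else max 1 (Delta_hat P))"

text \<open>The entries of a list are distinct and lie in one column, so they belong to different
  rows.\<close>

lemma col_list_length:
  assumes "col_list nx hp cn L x m j ks" "m \<le> n"
  shows "length ks \<le> D"
proof (cases "\<forall>i<nrows P. act_prob P i = 1")
  case True
  then show ?thesis using col_listD(8)[OF assms(1)] by (simp add: D_def)
next
  case False
  note C = col_listD[OF assms(1)]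
  have "length ks \<le> Delta_hat P" if "ks \<noteq> []"
  proof -
    have kn: "k < n \<and> cl k = j" if "k \<in> set ks" for k using C(3) assms(2) that by auto
    have j: "j < ncols P" using kn[of "hd ks"] entry[of "hd ks"] \<open>ks \<noteq> []\<close> by auto
    have "inj_on (\<lambda>k. rw k) (set ks)"
    proof (rule inj_onI)
      fix k k' assume k: "k \<in> set ks" "k' \<in> set ks" "rw k = rw k'"
      then have "es ! k = es ! k'" using kn by (intro prod_eqI) auto
      then show "k = k'" using es_inj kn k by blast
    qed
    then have "card (set ks) = card ((\<lambda>k. rw k) ` set ks)" by (simp add: card_image)
    also have "\<dots> \<le> card {i. i < nrows P \<and> j \<in> row_vars P i}"
      using kn entry by (intro card_mono) auto
    also have "\<dots> \<le> Delta_hat P" unfolding Delta_hat_def using j by (intro Max_ge) auto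
    finally show ?thesis using C(2) by (simp add: distinct_card)
  qed
  then show ?thesis unfolding D_def using False by (cases "ks = []") auto
qed

text \<open>The counterpart of \<open>insert_pos\<close> for lists of entries.\<close>

definition inserted :: "(nat \<Rightarrow> real) \<Rightarrow> nat \<Rightarrow> nat list \<Rightarrow> nat list" where
  "inserted x k ks = (let a = takeWhile (\<lambda>k'. x k < x k') ks; b = dropWhile (\<lambda>k'. x k < x k') ks in
     if a \<noteq> [] \<and> act_prob P (rw (last a)) = 1 then ks else a @ k # (if act_prob P (rw k) = 1 then [] else b))"

lemma vals_inserted: "vals x (inserted x k ks) = insert_pos (x k) (act_prob P (rw k)) (vals x ks)"
proof -
  have t: "takeWhile (\<lambda>w. x k < fst w) (vals x ks) = vals x (takeWhile (\<lambda>k'. x k < x k') ks)"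
    "dropWhile (\<lambda>w. x k < fst w) (vals x ks) = vals x (dropWhile (\<lambda>k'. x k < x k') ks)"
    unfolding vals_def by (simp_all add: takeWhile_map dropWhile_map o_def)
  have l: "snd (last (vals x a)) = act_prob P (rw (last a))" if "a \<noteq> []" for a
    using that by (simp add: vals_def last_map)
  have e: "vals x a = [] \<longleftrightarrow> a = []" for a by (simp add: vals_def)
  show ?thesis unfolding inserted_def insert_pos_def t Let_def
    by (auto simp: l e) (simp_all add: vals_def)
qed

lemma col_list_other:
  assumes C: "col_list nx hp cn L x k j ks" and k: "k < n" "j \<noteq> cl k"
    and nx: "\<And>k'. k' \<in> set ks \<Longrightarrow> nx' k' = nx k'" and "hp' j = hp j" "cn' j = cn j" "L \<le> L'"
  shows "col_list nx' hp' cn' L' x (Suc k) j ks"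
proof -
  note C' = col_listD[OF C]
  have "excess P (point x (Suc k)) j t = excess P (point x k) j t" for t
  proof (rule excess_cong)
    fix i have "es ! k \<noteq> (i, j)" using k(2) by auto
    then show "point x (Suc k) (i, j) = point x k (i, j)" by (rule point_Suc_neq)
  qed
  moreover have "chain nx' (hp' j) ks" using C'(1) assms(5) chain_cong[of ks nx nx'] nx by simp
  moreover have "\<forall>k'\<in>set ks. k' < Suc k \<and> cl k' = j" using C'(3) by auto
  ultimately show ?thesis unfolding col_list_def using C' assms(6,7) by simp
qed

text \<open>\<open>excess_upd\<close> describes the change of the point,
  \<open>excess_list_insert\<close> that of the list, and both changes are the same.\<close>

lemma col_list_insert:
  assumes C: "col_list nx hp cn L x k (cl k) ks" and k: "k < n" and x: "0 \<le> x k"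
    and nx: "chain nx' (hp' (cl k)) (inserted x k ks)" and cn: "cn' (cl k) = length (inserted x k ks)" "length (inserted x k ks) < L'"
  shows "col_list nx' hp' cn' L' x (Suc k) (cl k) (inserted x k ks)"
proof -
  note C' = col_listD[OF C]
  define a where "a = takeWhile (\<lambda>k'. x k < x k') ks"
  define b where "b = dropWhile (\<lambda>k'. x k < x k') ks"
  have ks: "ks = a @ b" by (simp add: a_def b_def)
  have ins: "inserted x k ks = (if a \<noteq> [] \<and> act_prob P (rw (last a)) = 1 then ks else a @ k # (if act_prob P (rw k) = 1 then [] else b))"
    by (simp add: inserted_def a_def b_def)
  have ax: "\<forall>k'\<in>set a. x k < x k'" unfolding a_def by (meson set_takeWhileD)
  have bx: "\<forall>k'\<in>set b. x k' \<le> x k"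
  proof (cases b)
    case (Cons q bs)
    have "\<not> x k < x q" using hd_dropWhile[of "\<lambda>k'. x k < x k'" ks] Cons unfolding b_def by auto
    moreover have "sorted_wrt (\<lambda>k k'. x k' \<le> x k) (q # bs)" using C'(4) unfolding ks Cons by (simp add: sorted_wrt_append)
    ultimately show ?thesis unfolding Cons by auto
  qed simp
  have r: "rw k < nrows P" using entry[OF k] by simp
  have X0: "point x k (rw k, cl k) = 0"
  proof (rule point_other)
    fix k' assume "k' < k"
    then show "es ! k' \<noteq> (rw k, cl k)" using es_inj[of k' k] k by auto
  qed
  have Y: "point x (Suc k) (rw k, cl k) = x k" "\<And>i'. i' \<noteq> rw k \<Longrightarrow> point x (Suc k) (i', cl k) = point x k (i', cl k)"
  proof -
    show "point x (Suc k) (rw k, cl k) = x k" using point_nth[of k "Suc k" x] k by simp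
    fix i' assume "i' \<noteq> rw k"
    then have "es ! k \<noteq> (i', cl k)" by (metis fst_conv)
    then show "point x (Suc k) (i', cl k) = point x k (i', cl k)" by (rule point_Suc_neq)
  qed
  have srt: "sorted_wrt (\<lambda>x y. fst y \<le> fst x) (vals x ks)" using C'(4) by (simp add: vals_def sorted_wrt_map)
  have "excess P (point x (Suc k)) (cl k) t = excess_list (vals x (inserted x k ks)) t" if t: "0 \<le> t" for t
  proof -
    have "excess P (point x (Suc k)) (cl k) t = excess P (point x k) (cl k) t - act_prob P (rw k) * excess P (point x k) (cl k) (min t (x k))"
      using excess_upd[of P "rw k" "point x k" "cl k" "point x (Suc k)", OF inst r X0 _ Y(2)] x unfolding Y(1) by simp
    also have "\<dots> = excess_list (vals x ks) t - act_prob P (rw k) * excess_list (vals x ks) (min t (x k))"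
      using C'(5) t x by simp
    also have "\<dots> = excess_list (vals x (inserted x k ks)) t"
      unfolding vals_inserted using excess_list_insert[OF srt x t] by simp
    finally show ?thesis .
  qed
  moreover have "distinct (inserted x k ks)" unfolding ins using C'(2,3) by (auto simp: ks)
  moreover have "\<forall>k'\<in>set (inserted x k ks). k' < Suc k \<and> cl k' = cl k"
  proof -
    have "set (inserted x k ks) \<subseteq> insert k (set ks)" unfolding ins by (auto simp: ks)
    then show ?thesis using C'(3) less_SucI by blast
  qed
  moreover have "sorted_wrt (\<lambda>k k'. x k' \<le> x k) (inserted x k ks)"
    unfolding ins using C'(4) ax bx by (auto simp: ks sorted_wrt_append less_imp_le)
  \<comment> \<open>If all probabilities are 1, either the new value is dropped behind the old one
    or it replaces the whole list.\<close>
  moreover have "length (inserted x k ks) \<le> 1" if one: "\<forall>i<nrows P. act_prob P i = 1"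
  proof (cases "a = []")
    case True
    then show ?thesis using one r by (simp add: ins)
  next
    case False
    have "last a < n" using C'(3) False k unfolding ks by (auto dest!: bspec[OF _ UnI1[OF last_in_set]])
    then have "act_prob P (rw (last a)) = 1" using one entry by blast
    then show ?thesis using False C'(8) one by (simp add: ins)
  qed
  ultimately show ?thesis unfolding col_list_def using nx cn by simp
qed

lemma reach_insert_find:
  assumes k: "nmem \<sigma> ''k'' 0 = k" and x: "rmem \<sigma> ''x'' = x"
    and ch: "chain (nmem \<sigma> ''next'') (nmem \<sigma> ''head'' (nmem \<sigma> ''col'' k)) ks"
  shows "reach insert_find \<sigma> (4 + length ks * 4) (\<lambda>\<tau>. \<exists>a b. ks = a @ b \<and> a = takeWhile (\<lambda>k'. x k < x k') ks \<and> b = dropWhile (\<lambda>k'. x k < x k') ks \<and>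
    chain (nmem \<sigma> ''next'') (nmem \<tau> ''ptr'' 0) b \<and> nmem \<tau> ''prev'' 0 = (if a = [] then 0 else Suc (last a)) \<and> nmem \<tau> ''cnt'' 0 = length a)"
proof -
  let ?b = "BAnd (NLess (NConst 0) (nv ''ptr'')) (RLess (RGet ''x'' (nv ''k'')) (RGet ''x'' (NSub (nv ''ptr'') (NConst 1))))"
  let ?c = "ns ''prev'' (nv ''ptr'') ;; ns ''ptr'' (NGet ''next'' (NSub (nv ''ptr'') (NConst 1))) ;; ns ''cnt'' (NAdd (nv ''cnt'') (NConst 1))"
  let ?\<sigma> = "nput ''cnt'' 0 0 (nput ''ptr'' 0 (nmem \<sigma> ''head'' (nmem \<sigma> ''col'' k)) (nput ''prev'' 0 0 \<sigma>))"
  let ?I = "\<lambda>m \<tau>. \<exists>a r. ks = a @ r \<and> m = length r \<and> (\<forall>k'\<in>set a. x k < x k') \<and> chain (nmem \<sigma> ''next'') (nmem \<tau> ''ptr'' 0) r \<and>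
     nmem \<tau> ''prev'' 0 = (if a = [] then 0 else Suc (last a)) \<and> nmem \<tau> ''cnt'' 0 = length a"
  let ?Q = "\<lambda>\<tau>. \<exists>a b. ks = a @ b \<and> a = takeWhile (\<lambda>k'. x k < x k') ks \<and> b = dropWhile (\<lambda>k'. x k < x k') ks \<and>
    chain (nmem \<sigma> ''next'') (nmem \<tau> ''ptr'' 0) b \<and> nmem \<tau> ''prev'' 0 = (if a = [] then 0 else Suc (last a)) \<and> nmem \<tau> ''cnt'' 0 = length a"
  have loop: "reach (While ?b ?c) ?\<sigma> (1 + length ks * (1 + 3)) ?Q"
  proof (rule reach_While[where I = ?I])
    show "?I (length ks) ?\<sigma>" by (rule exI[of _ "[]"], rule exI[of _ ks]) (use ch in simp)
  next
    fix m \<tau> assume I: "?I m \<tau>" and sm: "same (nwrites ?c) (rwrites ?c) ?\<sigma> \<tau>" and b: "bval ?b \<tau>"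
    have sm': "same {''prev'', ''ptr'', ''cnt''} {} \<sigma> \<tau>" using sm by (auto simp: same_def)
    note S = same_nmem[OF sm'] same_rmem[OF sm']
    obtain a r where I': "ks = a @ r" "m = length r" "\<forall>k'\<in>set a. x k < x k'" "chain (nmem \<sigma> ''next'') (nmem \<tau> ''ptr'' 0) r"
      "nmem \<tau> ''prev'' 0 = (if a = [] then 0 else Suc (last a))" "nmem \<tau> ''cnt'' 0 = length a" using I by blast
    have "r \<noteq> []" using I'(4) b by (cases r) auto
    then obtain q r' where r: "r = q # r'" by (cases r) auto
    have p: "nmem \<tau> ''ptr'' 0 = Suc q" "chain (nmem \<sigma> ''next'') (nmem \<sigma> ''next'' q) r'" using I'(4) by (simp_all add: r)
    have xq: "x k < x q" using b p(1) by (simp add: S x k)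
    have "?I (m - 1) (run ?c \<tau>)"
      by (rule exI[of _ "a @ [q]"], rule exI[of _ r']) (use I' xq p in \<open>auto simp: r S\<close>)
    then have "reach ?c \<tau> 3 (?I (m - 1))" by (rule_tac reach_run) simp_all
    then show "0 < m \<and> reach ?c \<tau> 3 (?I (m - 1))" using I'(2) r by simp
  next
    fix m \<tau> assume I: "?I m \<tau>" and sm: "same (nwrites ?c) (rwrites ?c) ?\<sigma> \<tau>" and b: "\<not> bval ?b \<tau>"
    have sm': "same {''prev'', ''ptr'', ''cnt''} {} \<sigma> \<tau>" using sm by (auto simp: same_def)
    note S = same_nmem[OF sm'] same_rmem[OF sm']
    obtain a r where I': "ks = a @ r" "m = length r" "\<forall>k'\<in>set a. x k < x k'" "chain (nmem \<sigma> ''next'') (nmem \<tau> ''ptr'' 0) r"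
      "nmem \<tau> ''prev'' 0 = (if a = [] then 0 else Suc (last a))" "nmem \<tau> ''cnt'' 0 = length a" using I by blast
    have "r = [] \<or> \<not> x k < x (hd r)" using I'(4) b by (cases r) (simp_all add: S x k)
    from takeWhile_dropWhile_split[OF I'(3) this] show "?Q \<tau>"
      using I' by (intro exI[of _ a] exI[of _ r]) simp
  qed
  show ?thesis unfolding insert_find_def
    by (rule reach_Seq_run[where U = "1 + length ks * (1 + 3)"]) (use loop k in simp_all)
qed

lemma reach_insert_entry:
  assumes st: "static \<sigma>" and k: "nmem \<sigma> ''k'' 0 = k" "k < n" "nmem \<sigma> ''i'' 0 = rw k" and x: "rmem \<sigma> ''x'' = x" "0 \<le> x k"
    and KS: "\<And>j. col_list (nmem \<sigma> ''next'') (nmem \<sigma> ''head'') (nmem \<sigma> ''clen'') (nmem \<sigma> ''L'' 0) x k j (KS j)"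
    and L: "nmem \<sigma> ''L'' 0 \<le> D + 1"
  shows "reach (insert_find ;; insert_link) \<sigma> (11 + D * 4) (\<lambda>\<tau>. nmem \<tau> ''L'' 0 \<le> D + 1 \<and>
    (\<forall>j. \<exists>ks. col_list (nmem \<tau> ''next'') (nmem \<tau> ''head'') (nmem \<tau> ''clen'') (nmem \<tau> ''L'' 0) x (Suc k) j ks))"
proof -
  let ?ks = "KS (cl k)"
  note C = col_listD[OF KS[of "cl k"]]
  have len: "length ?ks \<le> D" by (rule col_list_length[OF KS[of "cl k"]]) (use k in simp)
  have ck: "nmem \<sigma> ''col'' k = cl k" by (rule staticD(3)[OF st k(2)])
  let ?Q = "\<lambda>\<tau>. nmem \<tau> ''L'' 0 \<le> D + 1 \<and>
    (\<forall>j. \<exists>ks. col_list (nmem \<tau> ''next'') (nmem \<tau> ''head'') (nmem \<tau> ''clen'') (nmem \<tau> ''L'' 0) x (Suc k) j ks)"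
  have ch: "chain (nmem \<sigma> ''next'') (nmem \<sigma> ''head'' (nmem \<sigma> ''col'' k)) ?ks" using C(1) by (simp add: ck)
  show ?thesis
  proof (rule reach_Seq_then[OF reach_same[OF reach_insert_find[OF k(1) x(1) ch]]])
    fix \<tau>
    assume "same (nwrites insert_find) (rwrites insert_find) \<sigma> \<tau> \<and> (\<exists>a b. ?ks = a @ b \<and> a = takeWhile (\<lambda>k'. x k < x k') ?ks \<and> b = dropWhile (\<lambda>k'. x k < x k') ?ks \<and>
      chain (nmem \<sigma> ''next'') (nmem \<tau> ''ptr'' 0) b \<and> nmem \<tau> ''prev'' 0 = (if a = [] then 0 else Suc (last a)) \<and> nmem \<tau> ''cnt'' 0 = length a)"
    then obtain a b where sm: "same {''prev'', ''ptr'', ''cnt''} {} \<sigma> \<tau>" and ks: "?ks = a @ b" and ab: "a = takeWhile (\<lambda>k'. x k < x k') ?ks" "b = dropWhile (\<lambda>k'. x k < x k') ?ks"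
      and pb: "chain (nmem \<sigma> ''next'') (nmem \<tau> ''ptr'' 0) b" and prev: "nmem \<tau> ''prev'' 0 = (if a = [] then 0 else Suc (last a))"
      and cnt: "nmem \<tau> ''cnt'' 0 = length a" by auto
    note S = same_nmem[OF sm] same_rmem[OF sm]
    have ins: "inserted x k ?ks = (if a \<noteq> [] \<and> act_prob P (rw (last a)) = 1 then ?ks else a @ k # (if act_prob P (rw k) = 1 then [] else b))"
      unfolding inserted_def Let_def using ab by simp
    have prob: "act_prob P (rw q) < 1 \<longleftrightarrow> act_prob P (rw q) \<noteq> 1" if "q < n" for q
      using pcmip_instanceD(2)[OF inst] entry[OF that] by force
    have la: "last a < n" "last a \<noteq> k" "last a \<in> set ?ks" if "a \<noteq> []"
    proof -
      show "last a \<in> set ?ks" using that ks by simp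
      then show "last a < n" "last a \<noteq> k" using C(3) k(2) by auto
    qed
    have pv: "rmem \<sigma> ''prob'' (nmem \<sigma> ''row'' q) = act_prob P (rw q)" if "q < n" for q
      using staticD(2,8)[OF st] entry[OF that] that by simp
    have pi: "rmem \<sigma> ''prob'' (rw k) = act_prob P (rw k)" using staticD(8)[OF st] entry[OF k(2)] by simp
    define skip where "skip \<longleftrightarrow> a \<noteq> [] \<and> act_prob P (rw (last a)) = 1"
    have bskip: "bval (BAnd (NLess (NConst 0) (nv ''prev'')) (BNot (RLess (RGet ''prob'' (NGet ''row'' (NSub (nv ''prev'') (NConst 1)))) (RConst 1)))) \<tau> \<longleftrightarrow> skip"
      using la(1) by (cases "a = []") (simp_all add: skip_def prev S pv prob)
    define nx' where "nx' = (if skip then nmem \<sigma> ''next'' else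
      (let f = (nmem \<sigma> ''next'')(k := if act_prob P (rw k) = 1 then 0 else nmem \<tau> ''ptr'' 0) in if a = [] then f else f(last a := Suc k)))"
    define hp' where "hp' = (if skip \<or> a \<noteq> [] then nmem \<sigma> ''head'' else (nmem \<sigma> ''head'')(cl k := Suc k))"
    define cn' where "cn' = (if skip then nmem \<sigma> ''clen'' else (nmem \<sigma> ''clen'')(cl k := if act_prob P (rw k) = 1 then Suc (length a) else Suc (nmem \<sigma> ''clen'' (cl k))))"
    \<comment> \<open>With truncated subtraction, the second case is the maximum of the old
      \<open>L\<close> and the new list length plus 1.\<close>
    define L' where "L' = (if skip then nmem \<sigma> ''L'' 0 else nmem \<sigma> ''L'' 0 + (Suc (cn' (cl k)) - nmem \<sigma> ''L'' 0))"
    let ?r = "run insert_link \<tau>"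
    have "nmem ?r ''next'' = nx' \<and> nmem ?r ''head'' = hp' \<and> nmem ?r ''clen'' = cn' \<and> nmem ?r ''L'' 0 = L'"
    proof (cases skip)
      case True
      then show "nmem ?r ''next'' = nx' \<and> nmem ?r ''head'' = hp' \<and> nmem ?r ''clen'' = cn' \<and> nmem ?r ''L'' 0 = L'"
        unfolding insert_link_def run.simps bskip by (simp add: S nx'_def hp'_def cn'_def L'_def)
    next
      case False
      then show "nmem ?r ''next'' = nx' \<and> nmem ?r ''head'' = hp' \<and> nmem ?r ''clen'' = cn' \<and> nmem ?r ''L'' 0 = L'"
        unfolding insert_link_def run.simps(5)[of _ Skip] bskip nx'_def hp'_def cn'_def L'_def
        by (cases "a = []"; cases "act_prob P (rw k) = 1") (simp_all add: S k ck pi prob[OF k(2)] prev cnt)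
    qed
    then have r: "nmem ?r ''next'' = nx'" "nmem ?r ''head'' = hp'" "nmem ?r ''clen'' = cn'" "nmem ?r ''L'' 0 = L'" by blast+
    have chain': "chain nx' (hp' (cl k)) (inserted x k ?ks)"
    proof (cases skip)
      case True
      then show ?thesis using C(1) by (simp add: nx'_def hp'_def ins skip_def)
    next
      case False
      let ?q = "if act_prob P (rw k) = 1 then 0 else nmem \<tau> ''ptr'' 0"
      let ?b = "if act_prob P (rw k) = 1 then [] else b"
      let ?f = "(nmem \<sigma> ''next'')(k := ?q)"
      \<comment> \<open>The new cell is not yet in the list, so writing its pointer leaves the old
        chain intact.\<close>
      have kks: "k \<notin> set ?ks" using C(3) by auto
      have "chain (nmem \<sigma> ''next'') ?q ?b" using pb by simp
      then have "chain ?f ?q ?b" using kks ks by (subst chain_cong[where nx' = "nmem \<sigma> ''next''"]) auto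
      then have kb: "chain ?f (Suc k) (k # ?b)" by simp
      have ins': "inserted x k ?ks = a @ k # ?b" using False unfolding ins skip_def by (simp only: if_False)
      show ?thesis
      proof (cases "a = []")
        case True
        then show ?thesis using kb False unfolding ins' by (simp add: nx'_def hp'_def)
      next
        case a: False
        have "chain ?f (nmem \<sigma> ''head'' (cl k)) (a @ b)"
          using C(1) kks unfolding ks by (subst chain_cong[where nx' = "nmem \<sigma> ''next''"]) auto
        moreover have "distinct a" "set a \<inter> set (k # ?b) = {}" using C(2) kks unfolding ks by auto
        ultimately have "chain (?f(last a := Suc k)) (nmem \<sigma> ''head'' (cl k)) (a @ k # ?b)"
          using chain_splice[of ?f _ a b "Suc k" "k # ?b"] a kb by blast
        then show ?thesis using a False unfolding ins' by (simp add: nx'_def hp'_def)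
      qed
    qed
    have cn: "cn' (cl k) = length (inserted x k ?ks)"
      using C(6) ks unfolding ins cn'_def by (auto simp: skip_def)
    have lt: "length (inserted x k ?ks) < L'"
      using C(7) cn unfolding L'_def by (cases skip) (auto simp: ins skip_def)
    have new: "col_list nx' hp' cn' L' x (Suc k) (cl k) (inserted x k ?ks)"
      by (rule col_list_insert[of "nmem \<sigma> ''next''" "nmem \<sigma> ''head''" "nmem \<sigma> ''clen''" "nmem \<sigma> ''L'' 0" x k ?ks nx' hp' cn' L', OF KS k(2) x(2) chain' cn lt])
    have LL: "nmem \<sigma> ''L'' 0 \<le> L'" unfolding L'_def by simp
    have old: "col_list nx' hp' cn' L' x (Suc k) j (KS j)" if j: "j \<noteq> cl k" for j
    proof (rule col_list_other[OF KS k(2) j])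
      fix k' assume k': "k' \<in> set (KS j)"
      then have "k' < k" "cl k' = j" using col_listD(3)[OF KS[of j]] by auto
      moreover have "a \<noteq> [] \<Longrightarrow> cl (last a) = cl k" using la(3) C(3) by blast
      ultimately show "nx' k' = nmem \<sigma> ''next'' k'" using j by (auto simp: nx'_def Let_def)
    qed (use j LL in \<open>auto simp: hp'_def cn'_def\<close>)
    have "length (inserted x k ?ks) \<le> D" by (rule col_list_length[OF new]) (use k in simp)
    then have "L' \<le> D + 1" using L cn unfolding L'_def by auto
    moreover have "\<exists>ks. col_list nx' hp' cn' L' x (Suc k) j ks" for j using new old by (cases "j = cl k") auto
    ultimately have Q: "?Q ?r" unfolding r by blast
    show "reach insert_link \<tau> 7 ?Q"
      by (rule reach_run) (use Q in \<open>simp_all add: insert_link_def\<close>)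
  next
    show "4 + length ?ks * 4 + 7 \<le> 11 + D * 4" using len by simp
  qed
qed

end

subsection \<open>The complete program\<close>

definition find_row :: com where
  "find_row = (ns ''i'' (NGet ''row'' (nv ''s'')) ;; ns ''e'' (nv ''s'')) ;;
    While (BAnd (NLess (nv ''e'') (nv ''len'')) (BNot (NLess (NGet ''row'' (nv ''s'')) (NGet ''row'' (nv ''e'')))))
      (ns ''e'' (NAdd (nv ''e'') (NConst 1)))"

text \<open>A row with non-positive right-hand side is satisfied by the values 0 and takes no greedy
  step.\<close>

definition process_row :: com where
  "process_row = find_row ;;
    Cond (RLess (RConst 0) (RGet ''rhs'' (nv ''i''))) (build_row ;; solve_row ;; insert_row) Skip ;;
    ns ''s'' (nv ''e'')"

definition greedy_program :: com where
  "greedy_program = ns ''L'' (NConst 1) ;; While (NLess (nv ''s'') (nv ''len'')) process_row"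

lemma nwrites_find_row [simp]: "nwrites find_row = {''i'', ''e''}" "rwrites find_row = {}"
  by (auto simp: find_row_def)

text \<open>With \<open>2 ^ h\<close> proportional to D, this bounds the squared logarithm by a
  multiple of D.\<close>

lemma square_le_pow2: "(h + 1)\<^sup>2 \<le> 4 * 2 ^ h" for h :: nat
proof (induction h)
  case (Suc h)
  show ?case
  proof (cases "h < 2")
    case True
    then have "h = 0 \<or> h = 1" by auto
    then show ?thesis by (auto simp: power2_eq_square)
  next
    case False
    then have "2 * 2 \<le> h * h" by (intro mult_le_mono) simp_all
    then have "2 * h + 3 \<le> (h + 1)\<^sup>2" by (simp add: power2_eq_square algebra_simps)
    then show ?thesis using Suc by (simp add: power2_eq_square algebra_simps)
  qed
qed simp

lemma pow2_bracket: "1 \<le> (a :: nat) \<Longrightarrow> \<exists>m. a \<le> 2 ^ m \<and> 2 ^ m \<le> 2 * a"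
proof (induction a rule: dec_induct)
  case base
  show ?case by (rule exI[of _ 0]) simp
next
  case (step a)
  then obtain m where m: "a \<le> 2 ^ m" "2 ^ m \<le> 2 * a" by blast
  show ?case
  proof (cases "Suc a \<le> 2 ^ m")
    case True
    then show ?thesis using m by (intro exI[of _ m]) simp
  next
    case False
    then have "a = 2 ^ m" using m by simp
    then show ?thesis using step(1) by (intro exI[of _ "Suc m"]) simp
  qed
qed

text \<open>Every term is compared with \<open>B\<close>. The critical one is the search, whose
  \<open>m + 2 + h\<close> evaluations of time proportional to \<open>q * (h + 1)\<close> produce a
  square of \<open>h + 1\<close>.\<close>

lemma (in row_machine) solve_time_bound:
  assumes E: "L \<le> E" "2 ^ h \<le> 2 * E" "1 \<le> E"
  shows "solve_time m \<le> 1000 * ((e - s) * (m + 2) * E)"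
proof -
  define q where "q = e - s"
  define B where "B = q * (m + 2) * E"
  have q: "1 \<le> q" using se by (simp add: q_def)
  have hE: "(h + 1) * (h + 1) \<le> 8 * E" using square_le_pow2[of h] E(2) by (simp add: power2_eq_square)
  have mono: "a * c * d \<le> B" if "a \<le> q" "c \<le> m + 2" "d \<le> E" for a c d
    unfolding B_def using that by (intro mult_le_mono)
  have B1: "1 \<le> B" using mono[of 1 1 1] q E(3) by simp
  have Bq: "q \<le> B" using mono[of q 1 1] E(3) by simp
  have BqL: "q * L \<le> B" using mono[of q 1 L] E by simp
  have Bm: "m + 2 \<le> B" using mono[of 1 "m + 2" 1] E q by simp
  have BmqL: "(m + 2) * (q * L) \<le> B" using mono[of q "m + 2" L] E by (simp only: mult.assoc mult.left_commute)
  have Bmq: "(m + 2) * q \<le> B" using mono[of q "m + 2" 1] E by (simp add: mult.commute)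
  have Bh: "(m + 2) * q * ((h + 1) * (h + 1)) \<le> 8 * B"
  proof -
    have "(m + 2) * q * ((h + 1) * (h + 1)) \<le> (m + 2) * q * (8 * E)" using hE by (rule mult_le_mono2)
    then show ?thesis by (simp add: B_def algebra_simps)
  qed
  \<comment> \<open>The constant 9 is at most \<open>9 * q\<close>, and 9 + 13 = 22.\<close>
  have ev: "5 + eval_time \<le> 22 * (q * (h + 1))"
  proof -
    have "5 + eval_time = 9 + q * 13 + q * h * 4" by (simp add: eval_time_def q_def algebra_simps)
    also have "\<dots> \<le> 22 * (q * (h + 1))" using q by (simp add: algebra_simps)
    finally show ?thesis .
  qed
  \<comment> \<open>\<open>m + 2 + h \<le> (m + 2) * (h + 1)\<close> isolates the square of
    \<open>h + 1\<close>, which is at most \<open>8 * E\<close>; 176 is 22 times 8.\<close>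
  have t1: "(m + 2 + h) * (5 + eval_time) \<le> 176 * B"
  proof -
    have "m + 2 + h \<le> (m + 2) * (h + 1)" by (simp add: algebra_simps)
    then have "(m + 2 + h) * (5 + eval_time) \<le> (m + 2) * (h + 1) * (22 * (q * (h + 1)))" using ev by (rule mult_le_mono)
    also have "\<dots> = 22 * ((m + 2) * q * ((h + 1) * (h + 1)))" by (simp only: mult.assoc mult.commute mult.left_commute)
    finally show ?thesis using Bh by simp
  qed
  have ev1: "5 + eval_time \<le> 88 * B"
  proof -
    have "2 * (5 + eval_time) \<le> (m + 2 + h) * (5 + eval_time)" by (rule mult_le_mono1) simp
    then show ?thesis using t1 by simp
  qed
  have ev2: "eval_time \<le> 88 * B" using ev1 by simp
  have t2: "m * (3 + eval_time) \<le> 176 * B"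
  proof -
    have "m * (3 + eval_time) \<le> (m + 2 + h) * (5 + eval_time)" by (rule mult_le_mono) simp_all
    then show ?thesis using t1 by simp
  qed
  have fin: "finish_time \<le> 3 + 12 * q + 5 * (q * L)" by (simp add: finish_time_def q_def algebra_simps)
  have t3: "(m + 2) * (7 + 3 * q * L * 14) = 7 * (m + 2) + 42 * ((m + 2) * (q * L))" by (simp add: algebra_simps)
  have t4: "q * (10 + L * 10) = 10 * q + 10 * (q * L)" by (simp add: algebra_simps)
  \<comment> \<open>The coefficients on the left add up to 829.\<close>
  have gen: "4 + (10 * a + 10 * b) + (2 + (7 * c + 42 * d) + (1 + (88 * B + (1 + (3 + 176 * B +
    (5 + 176 * B + 3 * (88 * B) + 2 * (3 + 12 * a + 5 * b))))))) \<le> 1000 * B"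
    if "1 \<le> B" "a \<le> B" "b \<le> B" "c \<le> B" "d \<le> B" for a b c d B :: nat using that by (simp add: algebra_simps)
  have "solve_time m \<le> 4 + (10 * q + 10 * (q * L)) + (2 + (7 * (m + 2) + 42 * ((m + 2) * (q * L))) + (1 + (88 * B + (1 + (3 + 176 * B +
    (5 + 176 * B + 3 * (88 * B) + 2 * (3 + 12 * q + 5 * (q * L))))))))"
    unfolding solve_time_def q_def[symmetric] t3 t4 by (intro add_le_mono mult_le_mono2 order_refl t1 t2 ev2 fin)
  also have "\<dots> \<le> 1000 * B" by (rule gen[OF B1 Bq BqL Bm BmqL])
  finally show ?thesis by (simp add: B_def q_def)
qed

section \<open>The loop over the rows\<close>

context input
begin

text \<open>The prefix of length \<open>s\<close> ends at a row boundary. Rows without entries are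
  never visited by the loop; the last conjunct counts them as finished from the start.\<close>

definition processed :: "nat \<Rightarrow> memory \<Rightarrow> bool" where
  "processed s \<sigma> \<longleftrightarrow> s \<le> n \<and> (\<forall>k k'. k < s \<longrightarrow> s \<le> k' \<longrightarrow> k' < n \<longrightarrow> rw k < rw k') \<and> static \<sigma> \<and> nmem \<sigma> ''s'' 0 = s \<and>
     (\<forall>k\<ge>s. rmem \<sigma> ''x'' k = 0) \<and> (\<forall>k<s. 0 \<le> rmem \<sigma> ''x'' k) \<and>
     (greedy_step (pcmip_covering P))\<^sup>*\<^sup>* (\<lambda>_. 0) (point (rmem \<sigma> ''x'') s) \<and>
     (\<forall>j. \<exists>ks. col_list (nmem \<sigma> ''next'') (nmem \<sigma> ''head'') (nmem \<sigma> ''clen'') (nmem \<sigma> ''L'' 0) (rmem \<sigma> ''x'') s j ks) \<and>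
     nmem \<sigma> ''L'' 0 \<le> D + 1 \<and>
     (\<forall>i<nrows P. (\<forall>k. s \<le> k \<longrightarrow> k < n \<longrightarrow> rw k \<noteq> i) \<longrightarrow> (\<lambda>j. point (rmem \<sigma> ''x'') s (i, j)) \<in> row_constraint P i)"

lemma processedD:
  assumes "processed s \<sigma>"
  shows "s \<le> n" "\<forall>k k'. k < s \<longrightarrow> s \<le> k' \<longrightarrow> k' < n \<longrightarrow> rw k < rw k'" "static \<sigma>" "nmem \<sigma> ''s'' 0 = s"
     "\<forall>k\<ge>s. rmem \<sigma> ''x'' k = 0" "\<forall>k<s. 0 \<le> rmem \<sigma> ''x'' k"
     "(greedy_step (pcmip_covering P))\<^sup>*\<^sup>* (\<lambda>_. 0) (point (rmem \<sigma> ''x'') s)"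
     "\<forall>j. \<exists>ks. col_list (nmem \<sigma> ''next'') (nmem \<sigma> ''head'') (nmem \<sigma> ''clen'') (nmem \<sigma> ''L'' 0) (rmem \<sigma> ''x'') s j ks"
     "nmem \<sigma> ''L'' 0 \<le> D + 1"
     "\<forall>i<nrows P. (\<forall>k. s \<le> k \<longrightarrow> k < n \<longrightarrow> rw k \<noteq> i) \<longrightarrow> (\<lambda>j. point (rmem \<sigma> ''x'') s (i, j)) \<in> row_constraint P i"
  by (insert assms[unfolded processed_def], elim conjE, assumption)+

lemma reach_find_row:
  assumes pr: "processed s \<sigma>" and s: "s < n"
  shows "\<exists>e. s < e \<and> e \<le> n \<and> (\<forall>k<n. rw k = rw s \<longleftrightarrow> s \<le> k \<and> k < e) \<and>
    reach find_row \<sigma> (3 + (e - s) * 2) (\<lambda>\<tau>. same {''i'', ''e''} {} \<sigma> \<tau> \<and> nmem \<tau> ''i'' 0 = rw s \<and> nmem \<tau> ''e'' 0 = e)"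
proof -
  note C = processedD[OF pr]
  \<comment> \<open>The length \<open>n\<close> serves as a sentinel behind the last row.\<close>
  define e where "e = (LEAST k. s \<le> k \<and> (k = n \<or> rw s < rw k))"
  have ex: "s \<le> n \<and> (n = n \<or> rw s < rw n)" using s by simp
  have e: "s \<le> e" "e = n \<or> rw s < rw e" using LeastI[of "\<lambda>k. s \<le> k \<and> (k = n \<or> rw s < rw k)", OF ex] unfolding e_def by auto
  have en: "e \<le> n" unfolding e_def by (rule Least_le[of "\<lambda>k. s \<le> k \<and> (k = n \<or> rw s < rw k)" n, OF ex])
  have same_row: "rw k = rw s" if "s \<le> k" "k < e" for k
  proof -
    have "\<not> rw s < rw k" using not_less_Least[of k "\<lambda>k. s \<le> k \<and> (k = n \<or> rw s < rw k)"] that unfolding e_def by blast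
    moreover have "rw s \<le> rw k" using rw_mono[of s k] that en by simp
    ultimately show ?thesis by simp
  qed
  have se: "s < e" using e s by (cases "s = e") auto
  have row: "rw k = rw s \<longleftrightarrow> s \<le> k \<and> k < e" if k: "k < n" for k
  proof
    assume eq: "rw k = rw s"
    have "s \<le> k"
    proof (rule ccontr)
      assume "\<not> s \<le> k"
      then have "rw k < rw s" using C(2) s by simp
      then show False using eq by simp
    qed
    moreover have "k < e"
    proof (rule ccontr)
      assume "\<not> k < e"
      then have "rw s < rw e" "rw e \<le> rw k" using e(2) k rw_mono[of e k] by auto
      then show False using eq by simp
    qed
    ultimately show "s \<le> k \<and> k < e" by blast
  qed (use same_row in blast)
  let ?b = "BAnd (NLess (nv ''e'') (nv ''len'')) (BNot (NLess (NGet ''row'' (nv ''s'')) (NGet ''row'' (nv ''e''))))"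
  let ?c = "ns ''e'' (NAdd (nv ''e'') (NConst 1))"
  let ?\<sigma> = "nput ''e'' 0 s (nput ''i'' 0 (rw s) \<sigma>)"
  let ?I = "\<lambda>m \<tau>. m = e - nmem \<tau> ''e'' 0 \<and> s \<le> nmem \<tau> ''e'' 0 \<and> nmem \<tau> ''e'' 0 \<le> e \<and> nmem \<tau> ''i'' 0 = rw s"
  have loop: "reach (While ?b ?c) ?\<sigma> (1 + (e - s) * (1 + 1)) (\<lambda>\<tau>. nmem \<tau> ''i'' 0 = rw s \<and> nmem \<tau> ''e'' 0 = e)"
  proof (rule reach_While[where I = ?I])
    show "?I (e - s) ?\<sigma>" using se by simp
  next
    fix m \<tau> assume I: "?I m \<tau>" and sm: "same (nwrites ?c) (rwrites ?c) ?\<sigma> \<tau>" and b: "bval ?b \<tau>"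
    have sm': "same {''i'', ''e''} {} \<sigma> \<tau>" using sm by (auto simp: same_def)
    note S = same_nmem[OF sm']
    define k where "k = nmem \<tau> ''e'' 0"
    have k: "k < n" "\<not> rw s < rw k" using b staticD(1)[OF C(3)] staticD(2)[OF C(3), of k] staticD(2)[OF C(3) s]
      by (simp_all add: S C(4) k_def)
    have "k < e" using e(2) k I by (cases "k = e") (auto simp: k_def)
    then have m: "0 < m" and Q: "?I (m - 1) (run ?c \<tau>)" using I by (simp_all add: k_def)
    have "reach ?c \<tau> 1 (?I (m - 1))" by (rule reach_run) (use Q in simp_all)
    with m show "0 < m \<and> reach ?c \<tau> 1 (?I (m - 1))" by (rule conjI)
  next
    fix m \<tau> assume I: "?I m \<tau>" and sm: "same (nwrites ?c) (rwrites ?c) ?\<sigma> \<tau>" and b: "\<not> bval ?b \<tau>"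
    have sm': "same {''i'', ''e''} {} \<sigma> \<tau>" using sm by (auto simp: same_def)
    note S = same_nmem[OF sm']
    define k where "k = nmem \<tau> ''e'' 0"
    have k: "\<not> k < n \<or> rw s < rw k" using b staticD(1)[OF C(3)] staticD(2)[OF C(3), of k] staticD(2)[OF C(3) s]
      by (auto simp: S C(4) k_def)
    have "k = e"
    proof (rule ccontr)
      assume "k \<noteq> e"
      then have "k < e" "s \<le> k" using I by (simp_all add: k_def)
      then show False using k same_row[of k] en by simp
    qed
    then show "nmem \<tau> ''i'' 0 = rw s \<and> nmem \<tau> ''e'' 0 = e" using I by (simp add: k_def)
  qed
  have "reach find_row \<sigma> (2 + (1 + (e - s) * (1 + 1))) (\<lambda>\<tau>. nmem \<tau> ''i'' 0 = rw s \<and> nmem \<tau> ''e'' 0 = e)"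
    unfolding find_row_def
  proof (rule reach_Seq_run)
    have "run (ns ''i'' (NGet ''row'' (nv ''s'')) ;; ns ''e'' (nv ''s'')) \<sigma> = ?\<sigma>"
      using C(4) staticD(2)[OF C(3) s] by simp
    then show "reach (While ?b ?c) (run (ns ''i'' (NGet ''row'' (nv ''s'')) ;; ns ''e'' (nv ''s'')) \<sigma>) (1 + (e - s) * (1 + 1))
      (\<lambda>\<tau>. nmem \<tau> ''i'' 0 = rw s \<and> nmem \<tau> ''e'' 0 = e)" using loop by (simp only:)
  qed simp_all
  from reach_same[OF this] have "reach find_row \<sigma> (3 + (e - s) * 2) (\<lambda>\<tau>. same {''i'', ''e''} {} \<sigma> \<tau> \<and> nmem \<tau> ''i'' 0 = rw s \<and> nmem \<tau> ''e'' 0 = e)"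
    by (rule reach_conseq) simp_all
  then show ?thesis using se en row by blast
qed

lemma reach_insert_row:
  assumes st: "static \<sigma>" and se: "s \<le> e" "e \<le> n" and m: "nmem \<sigma> ''s'' 0 = s" "nmem \<sigma> ''e'' 0 = e" "nmem \<sigma> ''i'' 0 = i"
    and row: "\<And>k. s \<le> k \<Longrightarrow> k < e \<Longrightarrow> rw k = i" and x: "rmem \<sigma> ''x'' = x" "\<And>k. k < e \<Longrightarrow> 0 \<le> x k"
    and KS: "\<forall>j. \<exists>ks. col_list (nmem \<sigma> ''next'') (nmem \<sigma> ''head'') (nmem \<sigma> ''clen'') (nmem \<sigma> ''L'' 0) x s j ks"
    and L: "nmem \<sigma> ''L'' 0 \<le> D + 1"
  shows "reach insert_row \<sigma> (2 + (e - s) * (13 + D * 4)) (\<lambda>\<tau>. nmem \<tau> ''L'' 0 \<le> D + 1 \<and>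
    (\<forall>j. \<exists>ks. col_list (nmem \<tau> ''next'') (nmem \<tau> ''head'') (nmem \<tau> ''clen'') (nmem \<tau> ''L'' 0) x e j ks))"
proof -
  let ?I = "\<lambda>k \<tau>. nmem \<tau> ''L'' 0 \<le> D + 1 \<and>
    (\<forall>j. \<exists>ks. col_list (nmem \<tau> ''next'') (nmem \<tau> ''head'') (nmem \<tau> ''clen'') (nmem \<tau> ''L'' 0) x k j ks)"
  let ?c = "insert_find ;; insert_link"
  have "reach insert_row \<sigma> (2 + (e - s) * (2 + (11 + D * 4))) (?I e)"
    unfolding insert_row_def
  proof (rule reach_For[where I = ?I])
    show "nval (nv ''e'') \<tau> = e" if "same (insert ''k'' (nwrites ?c)) (rwrites ?c) \<sigma> \<tau>" for \<tau>
      using m that by (simp add: same_def)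
    show "?I s (nput ''k'' 0 s \<sigma>)" using L KS by simp
  next
    fix k \<tau> assume k: "s \<le> k" "k < e" "nmem \<tau> ''k'' 0 = k"
      and sm: "same (insert ''k'' (nwrites ?c)) (rwrites ?c) \<sigma> \<tau>" and I: "?I k \<tau>"
    have sm': "same {''prev'', ''ptr'', ''cnt'', ''next'', ''clen'', ''head'', ''L'', ''k''} {} \<sigma> \<tau>" using sm by (auto simp: same_def)
    have st': "static \<tau>" by (rule static_same[OF st sm']) (auto simp: scratch_n_def)
    from I obtain KS' where KS': "\<And>j. col_list (nmem \<tau> ''next'') (nmem \<tau> ''head'') (nmem \<tau> ''clen'') (nmem \<tau> ''L'' 0) x k j (KS' j)" by metis
    have i': "nmem \<tau> ''i'' 0 = rw k" using same_nmem[OF sm', of "''i''"] m row[OF k(1,2)] by simp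
    have x': "rmem \<tau> ''x'' = x" using same_rmem[OF sm', of "''x''"] x(1) by simp
    have kn: "k < n" using k se by simp
    have "reach ?c \<tau> (11 + D * 4) (?I (Suc k))"
      by (rule reach_insert_entry[OF st' k(3) kn i' x' x(2)[OF k(2)] KS' conjunct1[OF I]])
    then show "reach ?c \<tau> (11 + D * 4) (\<lambda>\<tau>'. same (nwrites ?c) (rwrites ?c) \<tau> \<tau>' \<longrightarrow> ?I (Suc k) (nput ''k'' 0 (Suc k) \<tau>'))"
      by (rule reach_conseq) simp_all
  qed (use m se in simp_all)
  then show ?thesis by (rule reach_conseq) simp_all
qed

lemma row_card:
  assumes "s < e" "e \<le> n" "\<And>k. k < n \<Longrightarrow> rw k = i \<longleftrightarrow> s \<le> k \<and> k < e"
  shows "e - s \<le> Delta P"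
proof -
  have i: "i < nrows P" using entry[of s] assms(3)[of s] assms(1,2) by simp
  have "inj_on (\<lambda>k. cl k) {s..<e}"
  proof (rule inj_onI)
    fix k k' assume k: "k \<in> {s..<e}" "k' \<in> {s..<e}" "cl k = cl k'"
    have kn: "k < n" "k' < n" using k assms(2) by auto
    have "rw k = i" "rw k' = i" using assms(3)[OF kn(1)] assms(3)[OF kn(2)] k by auto
    then have "es ! k = es ! k'" using k(3) by (intro prod_eqI) simp_all
    then show "k = k'" using es_inj[of k k'] kn by blast
  qed
  then have "e - s = card ((\<lambda>k. cl k) ` {s..<e})" by (simp add: card_image)
  also have "\<dots> \<le> card (row_vars P i)"
  proof (rule card_mono)
    show "(\<lambda>k. cl k) ` {s..<e} \<subseteq> row_vars P i"
    proof
      fix j assume "j \<in> (\<lambda>k. cl k) ` {s..<e}"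
      then obtain k where k: "k \<in> {s..<e}" "j = cl k" by blast
      then have "k < n" "rw k = i" using assms by auto
      then show "j \<in> row_vars P i" using entry[of k] k(2) by auto
    qed
  qed simp
  also have "\<dots> = card (scope (pcmip_covering P) i)" by (simp add: pcmip_covering_def card_cartesian_product)
  also have "\<dots> \<le> Delta P"
    unfolding Delta_def max_scope_def using i by (intro Max_ge) (auto simp: pcmip_covering_def)
  finally show ?thesis .
qed

end

lemma zero_row_constraint:
  assumes "pcmip_instance P" "rhs P i \<le> 0"
  shows "(\<lambda>_. 0) \<in> row_constraint P i"
proof -
  have "min 0 (ub P j) = 0" if "j < ncols P" for j using pcmip_instanceD(3)[OF assms(1) that] by simp
  then show ?thesis using assms(2) by (simp add: row_constraint_def)
qed

text \<open>The left-hand side of the row is 0 at every point, and some point satisfies the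
  row.\<close>

lemma empty_row_rhs:
  assumes "pcmip_instance P" "i < nrows P" "row_vars P i = {}"
  shows "rhs P i \<le> 0"
proof -
  obtain y where y: "y \<in> row_constraint P i" using pcmip_instanceD(7)[OF assms(1,2)] by blast
  have "mat P i j = 0" if "j < ncols P" for j using assms(3) that by (auto simp: row_vars_def)
  then show ?thesis using y by (simp add: row_constraint_def)
qed

context input
begin

lemma point_extend:
  assumes "s \<le> e" "\<And>k. k < s \<Longrightarrow> g k = f k" "\<And>k. s \<le> k \<Longrightarrow> k < e \<Longrightarrow> es ! k \<noteq> v \<or> g k = 0"
  shows "point g e v = point f s v"
  unfolding point_def
proof (rule sum.mono_neutral_cong_right)
  show "\<forall>k\<in>{..<e} - {..<s}. (if es ! k = v then g k else 0) = 0" using assms(3) by auto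
  show "(if es ! k = v then g k else 0) = (if es ! k = v then f k else 0)" if "k \<in> {..<s}" for k
    using assms(2)[of k] that by simp
qed (use assms(1) in auto)

lemma reach_solve_positive:
  assumes st: "static \<sigma>" and m: "nmem \<sigma> ''s'' 0 = s" "nmem \<sigma> ''e'' 0 = e" "nmem \<sigma> ''i'' 0 = i"
    and se: "s < e" "e \<le> n" and row: "\<And>k. k < n \<Longrightarrow> rw k = i \<longleftrightarrow> s \<le> k \<and> k < e"
    and x: "rmem \<sigma> ''x'' = x" "\<And>k. k < s \<Longrightarrow> 0 \<le> x k"
    and KS: "\<forall>j. \<exists>ks. col_list (nmem \<sigma> ''next'') (nmem \<sigma> ''head'') (nmem \<sigma> ''clen'') (nmem \<sigma> ''L'' 0) x s j ks"
    and L: "nmem \<sigma> ''L'' 0 \<le> D + 1" and pos: "0 < rhs P i" and M: "e - s < 2 ^ M"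
  shows "reach (build_row ;; solve_row ;; insert_row) \<sigma> (1060 * ((e - s) * (M + 2) * (D + 1))) (\<lambda>\<tau>. static \<tau> \<and>
     nmem \<tau> ''s'' 0 = s \<and> nmem \<tau> ''e'' 0 = e \<and>
     (\<forall>k. k \<notin> {s..<e} \<longrightarrow> rmem \<tau> ''x'' k = x k) \<and> (\<forall>k<e. 0 \<le> rmem \<tau> ''x'' k) \<and>
     greedy_step (pcmip_covering P) (point x s) (point (rmem \<tau> ''x'') e) \<and>
     (\<lambda>j. point (rmem \<tau> ''x'') e (i, j)) \<in> row_constraint P i \<and>
     (\<forall>j. \<exists>ks. col_list (nmem \<tau> ''next'') (nmem \<tau> ''head'') (nmem \<tau> ''clen'') (nmem \<tau> ''L'' 0) (rmem \<tau> ''x'') e j ks) \<and>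
     nmem \<tau> ''L'' 0 \<le> D + 1)" (is "reach _ _ _ ?Q")
proof -
  define l where "l = nmem \<sigma> ''L'' 0"
  obtain KS' where KS': "\<And>j. col_list (nmem \<sigma> ''next'') (nmem \<sigma> ''head'') (nmem \<sigma> ''clen'') l x s j (KS' j)"
    using KS unfolding l_def by metis
  interpret R: input_row P es s e i l x KS' "nmem \<sigma> ''next''" "nmem \<sigma> ''head''" "nmem \<sigma> ''clen''"
    using se row x(2) KS' pos by unfold_locales
  \<comment> \<open>\<open>h\<close> is chosen for \<open>D + 1\<close> rather than for the current
    \<open>l\<close>, so that \<open>solve_time_bound\<close> applies with
    \<open>E = D + 1\<close>.\<close>
  obtain h where h: "D + 1 \<le> 2 ^ h" "2 ^ h \<le> 2 * (D + 1)" using pow2_bracket[of "D + 1"] by auto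
  have "l \<le> 2 ^ h" using L h(1) by (simp add: l_def)
  note rm = R.row_machine[OF this]
  interpret M: row_machine s e l R.bpf R.levf R.slf "\<lambda>k. mat P i (cl k)" "\<lambda>k. ub P (cl k)" "\<lambda>k. cl k \<in> ints P" "rhs P i" i h
    by (rule rm)
  let ?B = "(e - s) * (M + 2) * (D + 1)"
  let ?T1 = "3 + (e - s) * (10 + l * 10)" and ?T2 = "M.solve_time M" and ?T3 = "2 + (e - s) * (13 + D * 4)"
  have time: "?T1 + (?T2 + ?T3) \<le> 1060 * ?B"
  proof -
    \<comment> \<open>The coefficients add up to 1038: 1000 for solving, 20 for building, 13 for
      inserting and 5 for the constants.\<close>
    have gen: "3 + u + (v + (2 + w)) \<le> 1060 * b" if "v \<le> 1000 * b" "u \<le> 20 * b" "w \<le> 13 * b" "1 \<le> b" for u v w b :: nat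
      using that by simp
    have se': "e - s \<le> (e - s) * (M + 2)" by simp
    show ?thesis
    proof (rule gen)
      show "M.solve_time M \<le> 1000 * ?B" using L h(2) by (intro M.solve_time_bound) (simp_all add: l_def)
      have "(e - s) * (10 + l * 10) \<le> (e - s) * (M + 2) * (20 * (D + 1))" by (rule mult_le_mono[OF se']) (use L l_def in simp)
      then show "(e - s) * (10 + l * 10) \<le> 20 * ?B" by (simp only: mult.left_commute)
      have "(e - s) * (13 + D * 4) \<le> (e - s) * (M + 2) * (13 * (D + 1))" by (rule mult_le_mono[OF se']) simp
      then show "(e - s) * (13 + D * 4) \<le> 13 * ?B" by (simp only: mult.left_commute)
      have "1 * 1 * 1 \<le> ?B" using se by (intro mult_le_mono) simp_all
      then show "1 \<le> ?B" by simp
    qed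
  qed
  have i: "i < nrows P" using entry[of s] row[of s] se by simp
  have rwi: "rw k = i" "k < n" if "k \<in> {s..<e}" for k using row[of k] that se by auto
  show ?thesis
  proof (rule reach_Seq_then[OF reach_same[OF R.reach_build_row[OF st m l_def[symmetric] refl refl x(1)]]])
    fix \<tau>1
    assume A: "same (nwrites build_row) (rwrites build_row) \<sigma> \<tau>1 \<and> (\<forall>k\<in>{s..<e}. \<forall>d<l. rmem \<tau>1 ''bp'' ((k - s) * l + d) = R.bpf k d \<and>
       rmem \<tau>1 ''lev'' ((k - s) * l + d) = R.levf k d \<and> rmem \<tau>1 ''sl'' ((k - s) * l + d) = R.slf k d)"
    have S1: "same {''ptr'', ''d'', ''o'', ''k''} {''pr'', ''sl'', ''bp'', ''lev''} \<sigma> \<tau>1" using A by simp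
    have st1: "static \<tau>1" by (rule static_same[OF st S1]) (auto simp: scratch_n_def scratch_r_def)
    note n1 = same_nmem[OF S1] and r1 = same_rmem[OF S1]
    have ok: "M.row_ok \<tau>1" unfolding M.row_ok_def
    proof (intro conjI ballI)
      show "nmem \<tau>1 ''s'' 0 = s" "nmem \<tau>1 ''e'' 0 = e" "nmem \<tau>1 ''i'' 0 = i" "nmem \<tau>1 ''L'' 0 = l"
        using m by (simp_all add: n1 l_def)
      show "rmem \<tau>1 ''rhs'' i = rhs P i" by (rule staticD(7)[OF st1 i])
      fix k assume k: "k \<in> {s..<e}"
      show "\<forall>d<l. rmem \<tau>1 ''bp'' ((k - s) * l + d) = R.bpf k d \<and>
         rmem \<tau>1 ''lev'' ((k - s) * l + d) = R.levf k d \<and> rmem \<tau>1 ''sl'' ((k - s) * l + d) = R.slf k d" using A k by blast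
      have cl: "cl k < ncols P" using entry[OF rwi(2)[OF k]] by simp
      show "rmem \<tau>1 ''mat'' k = mat P i (cl k)" using staticD(5)[OF st1 rwi(2)[OF k]] rwi(1)[OF k] by simp
      show "rmem \<tau>1 ''ub'' (nmem \<tau>1 ''col'' k) = ub P (cl k)"
        using staticD(3)[OF st1 rwi(2)[OF k]] staticD(10)[OF st1 cl] by simp
      show "0 < nmem \<tau>1 ''int'' (nmem \<tau>1 ''col'' k) \<longleftrightarrow> cl k \<in> ints P"
        using staticD(3)[OF st1 rwi(2)[OF k]] staticD(4)[OF st1 cl] by simp
    qed
    show "reach (solve_row ;; insert_row) \<tau>1 (?T2 + ?T3) ?Q"
    proof (rule reach_Seq_then[OF reach_same[OF M.reach_solve_row[OF ok M]]])
      fix \<tau>2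
      assume B: "same (nwrites solve_row) (rwrites solve_row) \<tau>1 \<tau>2 \<and> (\<exists>B. M.good_increase B \<and>
         (\<forall>k. rmem \<tau>2 ''x'' k = (if k \<in> {s..<e} then M.lvl k B else rmem \<tau>1 ''x'' k)))"
      then obtain B where B': "M.good_increase B" "\<And>k. rmem \<tau>2 ''x'' k = (if k \<in> {s..<e} then M.lvl k B else rmem \<tau>1 ''x'' k)"
        by blast
      have S2: "same {''k'', ''a'', ''c'', ''d'', ''o'', ''y'', ''b'', ''mid'', ''en'', ''p'', ''q'', ''w'', ''lo'', ''hi''}
          {''lv'', ''x'', ''z'', ''r'', ''top'', ''t'', ''m'', ''v'', ''key'', ''tmp''} \<tau>1 \<tau>2" using B by simp
      have st2: "static \<tau>2" by (rule static_same[OF st1 S2]) (auto simp: scratch_n_def scratch_r_def)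
      note n2 = same_nmem[OF S2]
      let ?x = "rmem \<tau>2 ''x''"
      have x1: "rmem \<tau>1 ''x'' = x" using r1[of "''x''"] x(1) by simp
      have xs: "?x k = x k" if "k \<notin> {s..<e}" for k unfolding B'(2) if_not_P[OF that] x1 ..
      have xv: "?x k = M.lvl k B" if "k \<in> {s..<e}" for k using B'(2)[of k] that by simp
      have xs': "?x k = x k" if "k < s" for k using xs[of k] that by simp
      note step = R.row_step[OF rm B'(1), of ?x, OF xs' xv]
      \<comment> \<open>Solving the row has changed \<open>x\<close> only from \<open>s\<close> on,
        whereas the lists contain entries before \<open>s\<close>.\<close>
      have KS2: "\<forall>j. \<exists>ks. col_list (nmem \<tau>2 ''next'') (nmem \<tau>2 ''head'') (nmem \<tau>2 ''clen'') (nmem \<tau>2 ''L'' 0) ?x s j ks"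
      proof
        fix j
        have eq: "nmem \<tau>2 ''next'' = nmem \<sigma> ''next''" "nmem \<tau>2 ''head'' = nmem \<sigma> ''head''" "nmem \<tau>2 ''clen'' = nmem \<sigma> ''clen''"
          "nmem \<tau>2 ''L'' 0 = l" by (simp_all add: n2 n1 l_def)
        have pt: "point ?x s = point x s" by (rule point_cong) (rule xs')
        note C = col_listD[OF KS'[of j]]
        have ks: "?x k = x k" if "k \<in> set (KS' j)" for k using C(3) xs' that by blast
        then have v: "vals ?x (KS' j) = vals x (KS' j)" by (simp add: vals_def)
        have "sorted_wrt (\<lambda>k k'. ?x k' \<le> ?x k) (KS' j)"
          by (rule sorted_wrt_mono_rel[OF _ C(4)]) (simp add: ks)
        then have "col_list (nmem \<sigma> ''next'') (nmem \<sigma> ''head'') (nmem \<sigma> ''clen'') l ?x s j (KS' j)"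
          using C unfolding col_list_def v pt by blast
        then show "\<exists>ks. col_list (nmem \<tau>2 ''next'') (nmem \<tau>2 ''head'') (nmem \<tau>2 ''clen'') (nmem \<tau>2 ''L'' 0) ?x s j ks"
          unfolding eq by blast
      qed
      have m2: "nmem \<tau>2 ''s'' 0 = s" "nmem \<tau>2 ''e'' 0 = e" "nmem \<tau>2 ''i'' 0 = i" and L2: "nmem \<tau>2 ''L'' 0 \<le> D + 1"
        using m L by (simp_all add: n2 n1)
      have rw2: "rw k = i" if "s \<le> k" "k < e" for k using rwi(1)[of k] that by simp
      have ins: "reach insert_row \<tau>2 ?T3 (\<lambda>\<tau>. same (nwrites insert_row) (rwrites insert_row) \<tau>2 \<tau> \<and> nmem \<tau> ''L'' 0 \<le> D + 1 \<and>
          (\<forall>j. \<exists>ks. col_list (nmem \<tau> ''next'') (nmem \<tau> ''head'') (nmem \<tau> ''clen'') (nmem \<tau> ''L'' 0) ?x e j ks))"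
        by (rule reach_same[OF reach_insert_row[OF st2 less_imp_le[OF se(1)] se(2) m2 rw2 refl step(3) KS2 L2]])
      show "reach insert_row \<tau>2 ?T3 ?Q"
      proof (rule reach_conseq[OF ins order_refl])
        fix \<tau>
        assume C: "same (nwrites insert_row) (rwrites insert_row) \<tau>2 \<tau> \<and> nmem \<tau> ''L'' 0 \<le> D + 1 \<and>
          (\<forall>j. \<exists>ks. col_list (nmem \<tau> ''next'') (nmem \<tau> ''head'') (nmem \<tau> ''clen'') (nmem \<tau> ''L'' 0) ?x e j ks)"
        have S3: "same {''prev'', ''ptr'', ''cnt'', ''next'', ''clen'', ''head'', ''L'', ''k''} {} \<tau>2 \<tau>" using C by simp
        have st3: "static \<tau>" by (rule static_same[OF st2 S3]) (auto simp: scratch_n_def)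
        have x3: "rmem \<tau> ''x'' = ?x" using same_rmem[OF S3, of "''x''"] by simp
        have m3: "nmem \<tau> ''s'' 0 = s" "nmem \<tau> ''e'' 0 = e" using m2 by (simp_all add: same_nmem[OF S3])
        show "?Q \<tau>" unfolding x3 by (intro conjI allI impI st3 m3 step xs C[THEN conjunct2, THEN conjunct1] C[THEN conjunct2, THEN conjunct2, rule_format])
      qed
    qed simp
  qed (rule time)
qed

lemma processedI:
  assumes "e \<le> n" "\<forall>k k'. k < e \<longrightarrow> e \<le> k' \<longrightarrow> k' < n \<longrightarrow> rw k < rw k'" "static \<sigma>"
     "\<forall>k\<ge>e. x k = 0" "\<forall>k<e. 0 \<le> x k" "(greedy_step (pcmip_covering P))\<^sup>*\<^sup>* (\<lambda>_. 0) (point x e)"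
     "\<forall>j. \<exists>ks. col_list (nmem \<sigma> ''next'') (nmem \<sigma> ''head'') (nmem \<sigma> ''clen'') (nmem \<sigma> ''L'' 0) x e j ks"
     "nmem \<sigma> ''L'' 0 \<le> D + 1"
     "\<forall>i<nrows P. (\<forall>k. e \<le> k \<longrightarrow> k < n \<longrightarrow> rw k \<noteq> i) \<longrightarrow> (\<lambda>j. point x e (i, j)) \<in> row_constraint P i"
    and x: "rmem \<sigma> ''x'' = x"
  shows "processed e (nput ''s'' 0 e \<sigma>)"
proof -
  let ?\<sigma> = "nput ''s'' 0 e \<sigma>"
  have st: "static ?\<sigma>" by (rule static_same[OF assms(3), of "{''s''}" "{}"]) (simp_all add: same_def scratch_n_def)
  have eq: "nmem ?\<sigma> ''next'' = nmem \<sigma> ''next''" "nmem ?\<sigma> ''head'' = nmem \<sigma> ''head''" "nmem ?\<sigma> ''clen'' = nmem \<sigma> ''clen''"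
    "nmem ?\<sigma> ''L'' = nmem \<sigma> ''L''" "rmem ?\<sigma> ''x'' = x" "nmem ?\<sigma> ''s'' 0 = e" using x by simp_all
  show ?thesis unfolding processed_def eq by (intro conjI assms st refl)
qed

lemma reach_process_row:
  assumes pr: "processed s \<sigma>" and s: "s < n" and M: "Delta P < 2 ^ M"
  shows "\<exists>e. s < e \<and> e \<le> n \<and> reach process_row \<sigma> (1068 * ((e - s) * (M + 2) * (D + 1))) (processed e)"
proof -
  note C = processedD[OF pr]
  define i where "i = rw s"
  obtain e where e: "s < e" "e \<le> n" and row: "\<And>k. k < n \<Longrightarrow> rw k = i \<longleftrightarrow> s \<le> k \<and> k < e"
    and find: "reach find_row \<sigma> (3 + (e - s) * 2) (\<lambda>\<tau>. same {''i'', ''e''} {} \<sigma> \<tau> \<and> nmem \<tau> ''i'' 0 = i \<and> nmem \<tau> ''e'' 0 = e)"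
    using reach_find_row[OF pr s] unfolding i_def by blast
  have i: "i < nrows P" using entry[OF s] by (simp add: i_def)
  have eM: "e - s < 2 ^ M" using row_card[OF e row] M by simp
  let ?B = "(e - s) * (M + 2) * (D + 1)"
  let ?x = "rmem \<sigma> ''x''"
  let ?Q = "\<lambda>\<tau>. nmem \<tau> ''e'' 0 = e \<and> processed e (nput ''s'' 0 e \<tau>)"
  have sep: "\<forall>k k'. k < e \<longrightarrow> e \<le> k' \<longrightarrow> k' < n \<longrightarrow> rw k < rw k'"
  proof (intro allI impI)
    fix k k' assume k: "k < e" "e \<le> k'" "k' < n"
    have ne: "rw k' \<noteq> i" using row[OF k(3)] k(2) by simp
    show "rw k < rw k'"
    proof (cases "k < s")
      case True
      then show ?thesis using C(2) k e(1) by simp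
    next
      case False
      then have "rw k = i" using row[of k] k by simp
      moreover have "rw k \<le> rw k'" using rw_mono[of k k'] k by simp
      ultimately show ?thesis using ne by simp
    qed
  qed
  \<comment> \<open>Apart from row \<open>i\<close>, the rows finished now were finished before, and
    the new entries do not belong to them.\<close>
  have feas: "\<forall>i'<nrows P. (\<forall>k. e \<le> k \<longrightarrow> k < n \<longrightarrow> rw k \<noteq> i') \<longrightarrow> (\<lambda>j. point y e (i', j)) \<in> row_constraint P i'"
    if y: "\<And>k. k < s \<Longrightarrow> y k = ?x k" and yi: "(\<lambda>j. point y e (i, j)) \<in> row_constraint P i" for y
  proof (intro allI impI)
    fix i' assume i': "i' < nrows P" "\<forall>k. e \<le> k \<longrightarrow> k < n \<longrightarrow> rw k \<noteq> i'"
    show "(\<lambda>j. point y e (i', j)) \<in> row_constraint P i'"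
    proof (cases "i' = i")
      case False
      have rwi: "rw k = i" if "s \<le> k" "k < e" for k using row[of k] that e by simp
      have "\<forall>k. s \<le> k \<longrightarrow> k < n \<longrightarrow> rw k \<noteq> i'"
      proof (intro allI impI)
        fix k assume "s \<le> k" "k < n"
        then show "rw k \<noteq> i'" using i'(2) rwi[of k] False by (cases "k < e") auto
      qed
      moreover have "point y e (i', j) = point ?x s (i', j)" for j
      proof (rule point_extend)
        fix k assume "s \<le> k" "k < e"
        then show "es ! k \<noteq> (i', j) \<or> y k = 0" using rwi[of k] False by auto
      qed (use e(1) y in simp_all)
      ultimately show ?thesis using C(10) i'(1) by simp
    qed (use yi in simp)
  qed
  show ?thesis
  proof (intro exI conjI)
    show "reach process_row \<sigma> (1068 * ?B) (processed e)" unfolding process_row_def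
    proof (rule reach_Seq_then[OF find])
      fix \<tau> assume A: "same {''i'', ''e''} {} \<sigma> \<tau> \<and> nmem \<tau> ''i'' 0 = i \<and> nmem \<tau> ''e'' 0 = e"
      have S: "same {''i'', ''e''} {} \<sigma> \<tau>" using A by blast
      have st: "static \<tau>" by (rule static_same[OF C(3) S]) (auto simp: scratch_n_def)
      have m: "nmem \<tau> ''s'' 0 = s" "nmem \<tau> ''e'' 0 = e" "nmem \<tau> ''i'' 0 = i" using A C(4) by (simp_all add: same_nmem[OF S])
      have x: "rmem \<tau> ''x'' = ?x" using same_rmem[OF S, of "''x''"] by simp
      have eq: "nmem \<tau> ''next'' = nmem \<sigma> ''next''" "nmem \<tau> ''head'' = nmem \<sigma> ''head''" "nmem \<tau> ''clen'' = nmem \<sigma> ''clen''"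
         "nmem \<tau> ''L'' = nmem \<sigma> ''L''" by (simp_all add: same_nmem[OF S])
      have rhs: "rmem \<tau> ''rhs'' i = rhs P i" by (rule staticD(7)[OF st i])
      let ?b = "RLess (RConst 0) (RGet ''rhs'' (nv ''i''))"
      have cond: "reach (Cond ?b (build_row ;; solve_row ;; insert_row) Skip) \<tau> (1 + 1060 * ?B) ?Q"
      proof (rule reach_Cond)
        assume "bval ?b \<tau>"
        then have pos: "0 < rhs P i" using rhs m(3) by simp
        have KS: "\<forall>j. \<exists>ks. col_list (nmem \<tau> ''next'') (nmem \<tau> ''head'') (nmem \<tau> ''clen'') (nmem \<tau> ''L'' 0) ?x s j ks"
          using C(8) unfolding eq .
        have L: "nmem \<tau> ''L'' 0 \<le> D + 1" using C(9) unfolding eq .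
        show "reach (build_row ;; solve_row ;; insert_row) \<tau> (1060 * ?B) ?Q"
        proof (rule reach_conseq[OF reach_solve_positive[OF st m e row x C(6)[rule_format] KS L pos eM] order_refl])
          fix \<rho>
          assume Q: "static \<rho> \<and> nmem \<rho> ''s'' 0 = s \<and> nmem \<rho> ''e'' 0 = e \<and>
             (\<forall>k. k \<notin> {s..<e} \<longrightarrow> rmem \<rho> ''x'' k = ?x k) \<and> (\<forall>k<e. 0 \<le> rmem \<rho> ''x'' k) \<and>
             greedy_step (pcmip_covering P) (point ?x s) (point (rmem \<rho> ''x'') e) \<and>
             (\<lambda>j. point (rmem \<rho> ''x'') e (i, j)) \<in> row_constraint P i \<and>
             (\<forall>j. \<exists>ks. col_list (nmem \<rho> ''next'') (nmem \<rho> ''head'') (nmem \<rho> ''clen'') (nmem \<rho> ''L'' 0) (rmem \<rho> ''x'') e j ks) \<and>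
             nmem \<rho> ''L'' 0 \<le> D + 1"
          have R: "static \<rho>" "nmem \<rho> ''e'' 0 = e" "\<forall>k. k \<notin> {s..<e} \<longrightarrow> rmem \<rho> ''x'' k = ?x k" "\<forall>k<e. 0 \<le> rmem \<rho> ''x'' k"
             "greedy_step (pcmip_covering P) (point ?x s) (point (rmem \<rho> ''x'') e)"
             "(\<lambda>j. point (rmem \<rho> ''x'') e (i, j)) \<in> row_constraint P i"
             "\<forall>j. \<exists>ks. col_list (nmem \<rho> ''next'') (nmem \<rho> ''head'') (nmem \<rho> ''clen'') (nmem \<rho> ''L'' 0) (rmem \<rho> ''x'') e j ks"
             "nmem \<rho> ''L'' 0 \<le> D + 1" by (insert Q, elim conjE, assumption)+
          have x0: "\<forall>k\<ge>e. rmem \<rho> ''x'' k = 0" using R(3) C(5) e(1) by simp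
          have xs: "rmem \<rho> ''x'' k = ?x k" if "k < s" for k using R(3)[rule_format, of k] that by simp
          have f: "\<forall>i'<nrows P. (\<forall>k. e \<le> k \<longrightarrow> k < n \<longrightarrow> rw k \<noteq> i') \<longrightarrow> (\<lambda>j. point (rmem \<rho> ''x'') e (i', j)) \<in> row_constraint P i'"
            by (rule feas) (rule xs, assumption, rule R(6))
          have g: "(greedy_step (pcmip_covering P))\<^sup>*\<^sup>* (\<lambda>_. 0) (point (rmem \<rho> ''x'') e)"
            by (rule rtranclp.rtrancl_into_rtrancl[of _ _ "point ?x s", OF C(7) R(5)])
          have "processed e (nput ''s'' 0 e \<rho>)"
            by (rule processedI[of e \<rho> "rmem \<rho> ''x''", OF e(2) sep R(1) x0 R(4) g R(7,8) f refl])
          with R(2) show "?Q \<rho>" by (rule conjI)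
        qed
      next
        assume "\<not> bval ?b \<tau>"
        then have nonpos: "rhs P i \<le> 0" using rhs m(3) by simp
        have x0: "?x k = 0" if "s \<le> k" for k using C(5) that by simp
        \<comment> \<open>A skipped row keeps its values 0, so the point stays the same and no
          greedy step is taken.\<close>
        have pt: "point ?x e = point ?x s"
          by (rule ext, rule point_extend) (use e(1) x0 in simp_all)
        have "point ?x e (i, j) = 0" for j
          unfolding pt
        proof (rule point_other)
          fix k assume "k < s"
          then show "es ! k \<noteq> (i, j)" using row[of k] s by auto
        qed
        then have yi: "(\<lambda>j. point ?x e (i, j)) \<in> row_constraint P i" using zero_row_constraint[OF inst nonpos] by simp
        note f = feas[of ?x, OF refl yi]
        have KS: "\<forall>j. \<exists>ks. col_list (nmem \<sigma> ''next'') (nmem \<sigma> ''head'') (nmem \<sigma> ''clen'') (nmem \<sigma> ''L'' 0) ?x e j ks"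
        proof
          fix j
          obtain ks where "col_list (nmem \<sigma> ''next'') (nmem \<sigma> ''head'') (nmem \<sigma> ''clen'') (nmem \<sigma> ''L'' 0) ?x s j ks" using C(8) by blast
          moreover from this have "\<forall>k\<in>set ks. k < e \<and> cl k = j" using col_listD(3) e(1) less_trans by blast
          ultimately have "col_list (nmem \<sigma> ''next'') (nmem \<sigma> ''head'') (nmem \<sigma> ''clen'') (nmem \<sigma> ''L'' 0) ?x e j ks"
            unfolding col_list_def pt by blast
          then show "\<exists>ks. col_list (nmem \<sigma> ''next'') (nmem \<sigma> ''head'') (nmem \<sigma> ''clen'') (nmem \<sigma> ''L'' 0) ?x e j ks" by blast
        qed
        have g: "(greedy_step (pcmip_covering P))\<^sup>*\<^sup>* (\<lambda>_. 0) (point ?x e)" using C(7) unfolding pt .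
        have xn: "\<forall>k<e. 0 \<le> ?x k"
        proof (intro allI impI)
          fix k show "0 \<le> ?x k" using C(5,6) by (cases "k < s") simp_all
        qed
        have x0': "\<forall>k\<ge>e. ?x k = 0" using x0 e(1) by simp
        have "processed e (nput ''s'' 0 e \<tau>)"
          by (rule processedI[of e \<tau> ?x, OF e(2) sep st x0' xn g KS[folded eq] C(9)[folded eq] f x])
        with m(2) have "?Q \<tau>" by (rule conjI)
        then show "reach Skip \<tau> (1060 * ?B) ?Q"
          by (rule_tac reach_run) (use e(1) in simp_all)
      qed
      show "reach (Cond ?b (build_row ;; solve_row ;; insert_row) Skip ;; ns ''s'' (nv ''e'')) \<tau> (2 + 1060 * ?B) (processed e)"
      proof (rule reach_Seq_then[OF cond])
        fix \<rho> assume "?Q \<rho>"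
        then show "reach (ns ''s'' (nv ''e'')) \<rho> 1 (processed e)" by (rule_tac reach_run) simp_all
      qed simp
    next
      have gen: "3 + u * 2 + (2 + 1060 * b) \<le> 1068 * b" if "u \<le> b" "1 \<le> b" for u b :: nat using that by simp
      have "(e - s) * 1 * 1 \<le> ?B" by (intro mult_le_mono) simp_all
      then have u: "e - s \<le> ?B" by (simp only: mult_1_right)
      then have "1 \<le> ?B" using e(1) by linarith
      with u show "3 + (e - s) * 2 + (2 + 1060 * ?B) \<le> 1068 * ?B" by (rule gen)
    qed
  qed (rule e)+
qed

lemma processed_0: "processed 0 (nput ''L'' 0 1 (input_memory P es))"
proof -
  let ?\<sigma> = "nput ''L'' 0 1 (input_memory P es)"
  have st: "static ?\<sigma>" unfolding static_def by (simp add: same_def scratch_n_def)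
  have pt: "point f 0 = (\<lambda>_. 0)" for f by (rule ext) (simp add: point_def)
  have mem: "nmem ?\<sigma> ''s'' 0 = 0" "nmem ?\<sigma> ''head'' = (\<lambda>_. 0)" "nmem ?\<sigma> ''clen'' = (\<lambda>_. 0)" "nmem ?\<sigma> ''L'' 0 = 1"
    "rmem ?\<sigma> ''x'' = (\<lambda>_. 0)" by (simp_all add: input_memory_def)
  have "col_list nx (\<lambda>_. 0) (\<lambda>_. 0) 1 x 0 j []" for nx x j
    unfolding col_list_def pt by (simp add: vals_def excess_zero_point)
  moreover have "(\<lambda>j. 0) \<in> row_constraint P i" if i: "i < nrows P" "\<forall>k<n. rw k \<noteq> i" for i
  proof -
    have "row_vars P i = {}"
    proof (rule ccontr)
      assume "row_vars P i \<noteq> {}"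
      then obtain j where "j \<in> row_vars P i" by blast
      then have "(i, j) \<in> set es" using sparse i(1) by (simp add: sparse_form_def)
      then obtain k where "k < n" "es ! k = (i, j)" by (auto simp: in_set_conv_nth)
      then show False using i(2) by auto
    qed
    then show ?thesis using zero_row_constraint[OF inst] empty_row_rhs[OF inst i(1)] by simp
  qed
  ultimately show ?thesis unfolding processed_def mem pt using st by auto
qed

lemma reach_greedy_program:
  assumes M: "Delta P < 2 ^ M"
  shows "reach greedy_program (input_memory P es) (2 + n * (1069 * ((M + 2) * (D + 1)))) (processed n)"
proof -
  define W where "W = 1069 * ((M + 2) * (D + 1))"
  let ?\<sigma> = "nput ''L'' 0 1 (input_memory P es)"
  let ?b = "NLess (nv ''s'') (nv ''len'')"
  have loop: "reach (While ?b process_row) ?\<sigma> (1 + n * W) (processed n)"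
  \<comment> \<open>The budget is proportional to the number of entries left, so each row pays for
    itself. Compared with 1068, the factor 1069 also pays for the test of the loop.\<close>
  proof (rule reach_While_budget[where I = "\<lambda>b \<tau>. \<exists>s. processed s \<tau> \<and> b = (n - s) * W"])
    show "\<exists>s. processed s ?\<sigma> \<and> n * W = (n - s) * W" using processed_0 by (intro exI[of _ 0]) simp
  next
    fix k \<tau> assume "\<exists>s. processed s \<tau> \<and> k = (n - s) * W" and b: "bval ?b \<tau>"
    then obtain s where s: "processed s \<tau>" "k = (n - s) * W" by blast
    note C = processedD[OF s(1)]
    have sn: "s < n" using b C(4) staticD(1)[OF C(3)] by simp
    obtain e where e: "s < e" "e \<le> n" "reach process_row \<tau> (1068 * ((e - s) * (M + 2) * (D + 1))) (processed e)"
      using reach_process_row[OF s(1) sn M] by blast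
    have "1 * 1 * 1 \<le> (e - s) * (M + 2) * (D + 1)" using e(1) by (intro mult_le_mono) simp_all
    then have "1 + 1068 * ((e - s) * (M + 2) * (D + 1)) \<le> 1069 * ((e - s) * (M + 2) * (D + 1))" by linarith
    also have "\<dots> = (e - s) * W" unfolding W_def by (simp only: mult.assoc mult.left_commute)
    finally have t: "1 + 1068 * ((e - s) * (M + 2) * (D + 1)) \<le> (e - s) * W" .
    have "n - s = (e - s) + (n - e)" using e by simp
    then have "k = (e - s) * W + (n - e) * W" unfolding s(2) by (simp only: distrib_right)
    then have "1 + 1068 * ((e - s) * (M + 2) * (D + 1)) + (n - e) * W \<le> k" using t by linarith
    moreover have "reach process_row \<tau> (1068 * ((e - s) * (M + 2) * (D + 1))) (\<lambda>\<tau>. \<exists>s. processed s \<tau> \<and> (n - e) * W = (n - s) * W)"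
      by (rule reach_conseq[OF e(3) order_refl]) blast
    ultimately show "\<exists>T k'. 1 + T + k' \<le> k \<and> reach process_row \<tau> T (\<lambda>\<tau>. \<exists>s. processed s \<tau> \<and> k' = (n - s) * W)" by blast
  next
    fix k \<tau> assume "\<exists>s. processed s \<tau> \<and> k = (n - s) * W" and b: "\<not> bval ?b \<tau>"
    then obtain s where s: "processed s \<tau>" by blast
    note C = processedD[OF s]
    have "s = n" using b C(1,4) staticD(1)[OF C(3)] by simp
    then show "processed n \<tau>" using s by simp
  qed
  show ?thesis unfolding greedy_program_def W_def[symmetric]
  proof (rule reach_Seq_run)
    show "reach (While ?b process_row) (run (ns ''L'' (NConst 1)) (input_memory P es)) (1 + n * W) (processed n)" using loop by simp
  qed simp_all
qed

lemma length_es: "n = input_size P"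
proof -
  have "n = card (SIGMA i:{..<nrows P}. row_vars P i)" using sparse distinct_card[of es] by (simp add: sparse_form_def)
  then show ?thesis by (simp add: input_size_def card_SigmaI)
qed

lemma processed_result:
  assumes "processed n \<tau>"
  shows "greedy_result (pcmip_covering P) (point (rmem \<tau> ''x'') n)" "\<forall>k<n. rmem \<tau> ''x'' k = point (rmem \<tau> ''x'') n (es ! k)"
proof -
  note C = processedD[OF assms]
  have "feasible_point (pcmip_covering P) (point (rmem \<tau> ''x'') n)"
    using C(10) by (simp add: feasible_point_def pcmip_covering_def)
  then show "greedy_result (pcmip_covering P) (point (rmem \<tau> ''x'') n)" using C(7) by (simp add: greedy_result_def)
  show "\<forall>k<n. rmem \<tau> ''x'' k = point (rmem \<tau> ''x'') n (es ! k)" by (simp add: point_nth)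
qed

end

lemma Delta_hat_pos:
  assumes "0 < input_size P"
  shows "1 \<le> Delta_hat P"
proof -
  obtain i where i: "i < nrows P" "card (row_vars P i) \<noteq> 0"
    using assms unfolding input_size_def by (metis lessThan_iff neq0_conv sum.neutral)
  then obtain j where j: "j \<in> row_vars P i" by fastforce
  then have jn: "j < ncols P" by (simp add: row_vars_def)
  have "1 \<le> card {i. i < nrows P \<and> j \<in> row_vars P i}"
    using i(1) j card_gt_0_iff[of "{i. i < nrows P \<and> j \<in> row_vars P i}"] by auto
  also have "\<dots> \<le> Delta_hat P" unfolding Delta_hat_def using jn by (intro Max_ge) auto
  finally show ?thesis .
qed

lemma log_Delta_bracket: "\<exists>M. Delta P < 2 ^ M \<and> real (M + 2) \<le> 4 * log_Delta P"
proof (cases "Delta P = 0")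
  case True
  then show ?thesis by (intro exI[of _ 0]) (simp add: log_Delta_def)
next
  case False
  then obtain m where m: "2 ^ m \<le> Delta P" "Delta P < 2 ^ (m + 1)" using ex_power_ivl1[of 2 "Delta P"] by auto
  have "(2::real) powr real m = 2 ^ m" by (simp add: powr_realpow)
  also have "\<dots> \<le> real (Delta P)" using m(1) by (metis of_nat_le_iff of_nat_numeral of_nat_power)
  finally have "real m \<le> log 2 (real (Delta P))" using False by (simp add: le_log_iff)
  \<comment> \<open>Here \<open>M + 2 = m + 3\<close>, where \<open>m\<close> is at most the
    logarithm and 3 is at most \<open>3 * log_Delta P\<close>.\<close>
  then show ?thesis using m(2) by (intro exI[of _ "m + 1"]) (simp add: log_Delta_def)
qed

text \<open>Both parts of the theorem use the same program, with \<open>d\<close> equal to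
  \<open>Delta_hat P\<close> or 1. From \<open>M + 2 \<le> 4 * log_Delta P\<close> and
  \<open>D + 1 \<le> 2 * d\<close> comes the factor 1069 * 8 = 8552, and the additive constant 2
  makes it 8554. The maximum with 1 covers instances without entries.\<close>

lemma runs_greedy_program:
  assumes inst: "pcmip_instance P" and d: "0 < input_size P \<Longrightarrow> (if \<forall>i<nrows P. act_prob P i = 1 then 1 else real (Delta_hat P)) \<le> d"
  shows "runs_greedy greedy_program P (8554 * max 1 (real (input_size P) * d * log_Delta P))"
  unfolding runs_greedy_def
proof (intro allI impI)
  fix es assume sparse: "sparse_form P es"
  interpret input P es using inst sparse by unfold_locales
  obtain M where M: "Delta P < 2 ^ M" "real (M + 2) \<le> 4 * log_Delta P" using log_Delta_bracket by blast
  obtain t \<tau> where t: "exec greedy_program (input_memory P es) t \<tau>" "t \<le> 2 + n * (1069 * ((M + 2) * (D + 1)))" "processed n \<tau>"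
    using reach_greedy_program[OF M(1)] unfolding reach_def by blast
  note r = processed_result[OF t(3)]
  have time: "real t \<le> 8554 * max 1 (real (input_size P) * d * log_Delta P)"
  proof (cases "n = 0")
    case True
    then show ?thesis using t(2) length_es by simp
  next
    case False
    then have N: "0 < input_size P" using length_es by simp
    have d1: "1 \<le> d" and Dd: "real D \<le> d"
      using d[OF N] Delta_hat_pos[OF N] unfolding D_def by (cases "\<forall>i<nrows P. act_prob P i = 1"; simp)+
    then have D: "real (D + 1) \<le> 2 * d" using d1 by simp
    have "real (M + 2) * real (D + 1) \<le> (4 * log_Delta P) * (2 * d)"
      using M(2) D by (intro mult_mono) (simp_all add: log_Delta_def)
    then have "real n * (1069 * (real (M + 2) * real (D + 1))) \<le> real n * (1069 * ((4 * log_Delta P) * (2 * d)))"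
      by (intro mult_left_mono) simp_all
    also have "\<dots> = 8552 * (real (input_size P) * d * log_Delta P)" using length_es by simp
    also have "\<dots> \<le> 8552 * max 1 (real (input_size P) * d * log_Delta P)" by (rule mult_left_mono[OF max.cobounded2]) simp
    finally have "real n * (1069 * (real (M + 2) * real (D + 1))) \<le> 8552 * max 1 (real (input_size P) * d * log_Delta P)" .
    moreover have "1 \<le> max 1 (real (input_size P) * d * log_Delta P)" by (rule max.cobounded1)
    moreover have "real t \<le> real (2 + n * (1069 * ((M + 2) * (D + 1))))" using t(2) by (rule of_nat_mono)
    then have "real t \<le> 2 + real n * (1069 * (real (M + 2) * real (D + 1)))" by (simp only: of_nat_add of_nat_mult of_nat_numeral)
    ultimately show ?thesis by linarith
  qed
  show "\<exists>t \<tau> X. exec greedy_program (input_memory P es) t \<tau> \<and> real t \<le> 8554 * max 1 (real (input_size P) * d * log_Delta P) \<and>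
     greedy_result (pcmip_covering P) X \<and> approx_solution (pcmip_covering P) (real (Delta P)) X \<and>
     (\<forall>k<n. rmem \<tau> ''x'' k = X (es ! k))"
    using t(1) time r greedy_result_approx[OF inst r(1)] by blast
qed

theorem theorem4:
  shows "(\<exists>prog K. \<forall>P. pcmip_instance P \<longrightarrow>
            runs_greedy prog P
              (K * max 1 (real (input_size P) * real (Delta_hat P) * log_Delta P))) \<and>
         (\<exists>prog K. \<forall>P. pcmip_instance P \<and> (\<forall>i<nrows P. act_prob P i = 1) \<longrightarrow>
            runs_greedy prog P (K * max 1 (real (input_size P) * log_Delta P)))"
proof (intro conjI exI allI impI)
  fix P assume P: "pcmip_instance P"
  show "runs_greedy greedy_program P (8554 * max 1 (real (input_size P) * real (Delta_hat P) * log_Delta P))"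
    using runs_greedy_program[of P "real (Delta_hat P)"] P Delta_hat_pos[of P] by simp
next
  fix P assume P: "pcmip_instance P \<and> (\<forall>i<nrows P. act_prob P i = 1)"
  show "runs_greedy greedy_program P (8554 * max 1 (real (input_size P) * log_Delta P))"
    using runs_greedy_program[of P 1] P by simp
qed

end
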